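(* $\overline{V\oplus L}$ is a universal conservative extension of $V\oplus L$.
   Context: Two-sorted arithmetic with basic vocabulary $\mathcal{L}_A^2$. $V^0(2)$ is the theory for $AC^0(2)$, with universal conservative extension $\overline{V^0(2)}$ over the language $\mathcal{L}_{FAC^0(2)}$ (symbols for all $AC^0(2)$ functions). $\mathrm{PowSeq}_2(n,k,X)$ is the string $Y$ encoding the list of $\mathbb{Z}_2$-matrix powers $[I,X,\dots,X^k]$ of the $n\times n$ matrix $X$: $|Y|<\langle k,\langle n,n\rangle\rangle$, only pair-number bits set, $Y^{[0]}$ the identity, $Y^{[i+1]}=\mathrm{Prod}_2(n,X,Y^{[i]})$ for $i<k$, where $\langle x,y\rangle=(x+y)(x+y+1)+2y$, $Y^{[i]}(b)\leftrightarrow b<|Y|\wedge Y(\langle i,b\rangle)$ and $\mathrm{Prod}_2(n,X_1,X_2)(\langle i,j\rangle)\leftrightarrow i<n\wedge j<n\wedge$ the number of $b<n$ with $X_1(\langle i,b\rangle)\wedge X_2(\langle b,j\rangle)$ is odd. $V\oplus L$ is the theory over $\mathcal{L}_A^2$ axiomatized by $V^0(2)$ plus a $\Sigma_1^B(\mathcal{L}_A^2)$ axiom, provably equivalent in $\overline{V^0(2)}$ to the existence of a value of $\mathrm{PowSeq}_2(n,k,X)$. $\mathrm{PowSeq}_2'$ is a function symbol with the quantifier-free defining axiom: $|Y|<\langle k,\langle n,n\rangle\rangle\wedge(b<|Y|\supset(\neg Y(b)\vee \mathrm{Pair}(b)))\wedge Y^{[1]}=X\wedge(i<k\supset Y^{[i+1]}=\mathrm{Prod}_2(n,X,Y^{[i]}))$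 with $Y=\mathrm{PowSeq}_2'(n,k,X)$ and free variables $b,i$. The language $\mathcal{L}_{F\oplus L}$ is the smallest set containing $\mathcal{L}_{FAC^0(2)}\cup\{\mathrm{PowSeq}_2'\}$ and, for each open formula $\varphi(z,\vec x,\vec X)$ over it and each $\mathcal{L}_A^2$-term $t(\vec x,\vec X)$, a string function $F_{\varphi(z),t}$ with defining axiom $F_{\varphi(z),t}(\vec x,\vec X)(z)\leftrightarrow z<t(\vec x,\vec X)\wedge\varphi(z,\vec x,\vec X)$. $\overline{V\oplus L}$ is the universal theory over $\mathcal{L}_{F\oplus L}$ with the axioms of $\overline{V^0(2)}$, the defining axiom of $\mathrm{PowSeq}_2'$, and the defining axioms of all $F_{\varphi(z),t}$. *)

theory Defs
  imports Main
begin

section \<open>Syntax of two-sorted first-order logic\<close>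

text \<open>Variables of both sorts are de Bruijn indices, counted separately for each sort.
  The vocabulary of two-sorted arithmetic (0, 1, +, ., length, both equalities, order, membership)
  is built in; \<open>'f\<close> and \<open>'g\<close> are the types of the additional number-valued and
  string-valued function symbols.\<close>

datatype (nsyms_nt: 'f, ssyms_nt: 'g) nterm =
    NVar nat
  | Zero
  | One
  | Plus "('f, 'g) nterm" "('f, 'g) nterm"  (infixl "\<^bold>+" 65)
  | Times "('f, 'g) nterm" "('f, 'g) nterm"  (infixl "\<^bold>*" 70)
  | Len "('f, 'g) sterm"
  | NFun 'f "('f, 'g) nterm list" "('f, 'g) sterm list"
and (nsyms_st: 'f, ssyms_st: 'g) sterm =
    SVar nat
  | SFun 'g "('f, 'g) nterm list" "('f, 'g) sterm list"

datatype (nsyms: 'f, ssyms: 'g) fm =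
    Falsum
  | EqN "('f, 'g) nterm" "('f, 'g) nterm"  (infix "\<^bold>=\<^sub>1" 50)
  | EqS "('f, 'g) sterm" "('f, 'g) sterm"  (infix "\<^bold>=\<^sub>2" 50)
  | Le "('f, 'g) nterm" "('f, 'g) nterm"  (infix "\<^bold>\<le>" 50)
  | Mem "('f, 'g) nterm" "('f, 'g) sterm"  (infix "\<^bold>\<in>" 50)
  | Imp "('f, 'g) fm" "('f, 'g) fm"  (infixr "\<^bold>\<longrightarrow>" 25)
  | AllN "('f, 'g) fm"
  | AllS "('f, 'g) fm"

primrec subst_nt :: "(nat \<Rightarrow> ('f, 'g) nterm) \<Rightarrow> (nat \<Rightarrow> ('f, 'g) sterm) \<Rightarrow>
      ('f, 'g) nterm \<Rightarrow> ('f, 'g) nterm"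
  and subst_st :: "(nat \<Rightarrow> ('f, 'g) nterm) \<Rightarrow> (nat \<Rightarrow> ('f, 'g) sterm) \<Rightarrow>
      ('f, 'g) sterm \<Rightarrow> ('f, 'g) sterm"
where
  "subst_nt \<sigma> \<tau> (NVar i) = \<sigma> i"
| "subst_nt \<sigma> \<tau> Zero = Zero"
| "subst_nt \<sigma> \<tau> One = One"
| "subst_nt \<sigma> \<tau> (s \<^bold>+ t) = subst_nt \<sigma> \<tau> s \<^bold>+ subst_nt \<sigma> \<tau> t"
| "subst_nt \<sigma> \<tau> (s \<^bold>* t) = subst_nt \<sigma> \<tau> s \<^bold>* subst_nt \<sigma> \<tau> t"
| "subst_nt \<sigma> \<tau> (Len T) = Len (subst_st \<sigma> \<tau> T)"
| "subst_nt \<sigma> \<tau> (NFun f ts Ts) = NFun f (map (subst_nt \<sigma> \<tau>) ts) (map (subst_st \<sigma> \<tau>) Ts)"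
| "subst_st \<sigma> \<tau> (SVar i) = \<tau> i"
| "subst_st \<sigma> \<tau> (SFun g ts Ts) = SFun g (map (subst_nt \<sigma> \<tau>) ts) (map (subst_st \<sigma> \<tau>) Ts)"

text \<open>\<open>upN\<close> makes room for a new number variable 0, \<open>upS\<close> for a new string variable 0.\<close>

definition upN_nt :: "('f, 'g) nterm \<Rightarrow> ('f, 'g) nterm" where
  "upN_nt = subst_nt (\<lambda>i. NVar (Suc i)) SVar"

definition upN_st :: "('f, 'g) sterm \<Rightarrow> ('f, 'g) sterm" where
  "upN_st = subst_st (\<lambda>i. NVar (Suc i)) SVar"

definition upS_nt :: "('f, 'g) nterm \<Rightarrow> ('f, 'g) nterm" where
  "upS_nt = subst_nt NVar (\<lambda>i. SVar (Suc i))"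

definition upS_st :: "('f, 'g) sterm \<Rightarrow> ('f, 'g) sterm" where
  "upS_st = subst_st NVar (\<lambda>i. SVar (Suc i))"

primrec subst :: "(nat \<Rightarrow> ('f, 'g) nterm) \<Rightarrow> (nat \<Rightarrow> ('f, 'g) sterm) \<Rightarrow> ('f, 'g) fm \<Rightarrow> ('f, 'g) fm"
where
  "subst \<sigma> \<tau> Falsum = Falsum"
| "subst \<sigma> \<tau> (s \<^bold>=\<^sub>1 t) = (subst_nt \<sigma> \<tau> s \<^bold>=\<^sub>1 subst_nt \<sigma> \<tau> t)"
| "subst \<sigma> \<tau> (S \<^bold>=\<^sub>2 T) = (subst_st \<sigma> \<tau> S \<^bold>=\<^sub>2 subst_st \<sigma> \<tau> T)"
| "subst \<sigma> \<tau> (s \<^bold>\<le> t) = (subst_nt \<sigma> \<tau> s \<^bold>\<le> subst_nt \<sigma> \<tau> t)"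
| "subst \<sigma> \<tau> (t \<^bold>\<in> T) = (subst_nt \<sigma> \<tau> t \<^bold>\<in> subst_st \<sigma> \<tau> T)"
| "subst \<sigma> \<tau> (\<phi> \<^bold>\<longrightarrow> \<psi>) = (subst \<sigma> \<tau> \<phi> \<^bold>\<longrightarrow> subst \<sigma> \<tau> \<psi>)"
| "subst \<sigma> \<tau> (AllN \<phi>) =
     AllN (subst (case_nat (NVar 0) (\<lambda>i. upN_nt (\<sigma> i))) (\<lambda>i. upN_st (\<tau> i)) \<phi>)"
| "subst \<sigma> \<tau> (AllS \<phi>) =
     AllS (subst (\<lambda>i. upS_nt (\<sigma> i)) (case_nat (SVar 0) (\<lambda>i. upS_st (\<tau> i))) \<phi>)"

definition upN :: "('f, 'g) fm \<Rightarrow> ('f, 'g) fm" where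
  "upN = subst (\<lambda>i. NVar (Suc i)) SVar"

definition upS :: "('f, 'g) fm \<Rightarrow> ('f, 'g) fm" where
  "upS = subst NVar (\<lambda>i. SVar (Suc i))"

definition instN :: "('f, 'g) nterm \<Rightarrow> ('f, 'g) fm \<Rightarrow> ('f, 'g) fm" where
  "instN t = subst (case_nat t NVar) SVar"

definition instS :: "('f, 'g) sterm \<Rightarrow> ('f, 'g) fm \<Rightarrow> ('f, 'g) fm" where
  "instS T = subst NVar (case_nat T SVar)"

primrec fvN_nt :: "('f, 'g) nterm \<Rightarrow> nat set" and fvN_st :: "('f, 'g) sterm \<Rightarrow> nat set" where
  "fvN_nt (NVar i) = {i}"
| "fvN_nt Zero = {}"
| "fvN_nt One = {}"
| "fvN_nt (s \<^bold>+ t) = fvN_nt s \<union> fvN_nt t"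
| "fvN_nt (s \<^bold>* t) = fvN_nt s \<union> fvN_nt t"
| "fvN_nt (Len T) = fvN_st T"
| "fvN_nt (NFun f ts Ts) = \<Union> (set (map fvN_nt ts)) \<union> \<Union> (set (map fvN_st Ts))"
| "fvN_st (SVar i) = {}"
| "fvN_st (SFun g ts Ts) = \<Union> (set (map fvN_nt ts)) \<union> \<Union> (set (map fvN_st Ts))"

primrec fvS_nt :: "('f, 'g) nterm \<Rightarrow> nat set" and fvS_st :: "('f, 'g) sterm \<Rightarrow> nat set" where
  "fvS_nt (NVar i) = {}"
| "fvS_nt Zero = {}"
| "fvS_nt One = {}"
| "fvS_nt (s \<^bold>+ t) = fvS_nt s \<union> fvS_nt t"
| "fvS_nt (s \<^bold>* t) = fvS_nt s \<union> fvS_nt t"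
| "fvS_nt (Len T) = fvS_st T"
| "fvS_nt (NFun f ts Ts) = \<Union> (set (map fvS_nt ts)) \<union> \<Union> (set (map fvS_st Ts))"
| "fvS_st (SVar i) = {i}"
| "fvS_st (SFun g ts Ts) = \<Union> (set (map fvS_nt ts)) \<union> \<Union> (set (map fvS_st Ts))"

primrec fvN :: "('f, 'g) fm \<Rightarrow> nat set" where
  "fvN Falsum = {}"
| "fvN (s \<^bold>=\<^sub>1 t) = fvN_nt s \<union> fvN_nt t"
| "fvN (S \<^bold>=\<^sub>2 T) = fvN_st S \<union> fvN_st T"
| "fvN (s \<^bold>\<le> t) = fvN_nt s \<union> fvN_nt t"
| "fvN (t \<^bold>\<in> T) = fvN_nt t \<union> fvN_st T"
| "fvN (\<phi> \<^bold>\<longrightarrow> \<psi>) = fvN \<phi> \<union> fvN \<psi>"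
| "fvN (AllN \<phi>) = {i. Suc i \<in> fvN \<phi>}"
| "fvN (AllS \<phi>) = fvN \<phi>"

primrec fvS :: "('f, 'g) fm \<Rightarrow> nat set" where
  "fvS Falsum = {}"
| "fvS (s \<^bold>=\<^sub>1 t) = fvS_nt s \<union> fvS_nt t"
| "fvS (S \<^bold>=\<^sub>2 T) = fvS_st S \<union> fvS_st T"
| "fvS (s \<^bold>\<le> t) = fvS_nt s \<union> fvS_nt t"
| "fvS (t \<^bold>\<in> T) = fvS_nt t \<union> fvS_st T"
| "fvS (\<phi> \<^bold>\<longrightarrow> \<psi>) = fvS \<phi> \<union> fvS \<psi>"
| "fvS (AllN \<phi>) = fvS \<phi>"
| "fvS (AllS \<phi>) = {i. Suc i \<in> fvS \<phi>}"

primrec qfree :: "('f, 'g) fm \<Rightarrow> bool" where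
  "qfree Falsum = True"
| "qfree (s \<^bold>=\<^sub>1 t) = True"
| "qfree (S \<^bold>=\<^sub>2 T) = True"
| "qfree (s \<^bold>\<le> t) = True"
| "qfree (t \<^bold>\<in> T) = True"
| "qfree (\<phi> \<^bold>\<longrightarrow> \<psi>) = (qfree \<phi> \<and> qfree \<psi>)"
| "qfree (AllN \<phi>) = False"
| "qfree (AllS \<phi>) = False"

inductive universal :: "('f, 'g) fm \<Rightarrow> bool" where
  "qfree \<phi> \<Longrightarrow> universal \<phi>"
| "universal \<phi> \<Longrightarrow> universal (AllN \<phi>)"
| "universal \<phi> \<Longrightarrow> universal (AllS \<phi>)"

definition Neg :: "('f, 'g) fm \<Rightarrow> ('f, 'g) fm"  ("\<^bold>\<not> _" [40] 40) where
  "(\<^bold>\<not> \<phi>) = (\<phi> \<^bold>\<longrightarrow> Falsum)"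

definition Conj :: "('f, 'g) fm \<Rightarrow> ('f, 'g) fm \<Rightarrow> ('f, 'g) fm"  (infixr "\<^bold>\<and>" 35) where
  "(\<phi> \<^bold>\<and> \<psi>) = (\<^bold>\<not> (\<phi> \<^bold>\<longrightarrow> \<^bold>\<not> \<psi>))"

definition Disj :: "('f, 'g) fm \<Rightarrow> ('f, 'g) fm \<Rightarrow> ('f, 'g) fm"  (infixr "\<^bold>\<or>" 30) where
  "(\<phi> \<^bold>\<or> \<psi>) = (\<^bold>\<not> \<phi> \<^bold>\<longrightarrow> \<psi>)"

definition Iff :: "('f, 'g) fm \<Rightarrow> ('f, 'g) fm \<Rightarrow> ('f, 'g) fm"  (infixr "\<^bold>\<longleftrightarrow>" 25) where
  "(\<phi> \<^bold>\<longleftrightarrow> \<psi>) = ((\<phi> \<^bold>\<longrightarrow> \<psi>) \<^bold>\<and> (\<psi> \<^bold>\<longrightarrow> \<phi>))"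

definition ExN :: "('f, 'g) fm \<Rightarrow> ('f, 'g) fm" where
  "ExN \<phi> = (\<^bold>\<not> AllN (\<^bold>\<not> \<phi>))"

definition ExS :: "('f, 'g) fm \<Rightarrow> ('f, 'g) fm" where
  "ExS \<phi> = (\<^bold>\<not> AllS (\<^bold>\<not> \<phi>))"

definition Lt :: "('f, 'g) nterm \<Rightarrow> ('f, 'g) nterm \<Rightarrow> ('f, 'g) fm"  (infix "\<^bold><" 50) where
  "(s \<^bold>< t) = (s \<^bold>\<le> t \<^bold>\<and> \<^bold>\<not> s \<^bold>=\<^sub>1 t)"

text \<open>Bounded quantifiers. The bound is a term of the surrounding scope, so the bound variable
  cannot occur in it. A bound on a string quantifier bounds the length of the string.\<close>

definition AllLe :: "('f, 'g) nterm \<Rightarrow> ('f, 'g) fm \<Rightarrow> ('f, 'g) fm" where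
  "AllLe t \<phi> = AllN (NVar 0 \<^bold>\<le> upN_nt t \<^bold>\<longrightarrow> \<phi>)"

definition ExLe :: "('f, 'g) nterm \<Rightarrow> ('f, 'g) fm \<Rightarrow> ('f, 'g) fm" where
  "ExLe t \<phi> = ExN (NVar 0 \<^bold>\<le> upN_nt t \<^bold>\<and> \<phi>)"

definition AllLt :: "('f, 'g) nterm \<Rightarrow> ('f, 'g) fm \<Rightarrow> ('f, 'g) fm" where
  "AllLt t \<phi> = AllLe t (NVar 0 \<^bold>< upN_nt t \<^bold>\<longrightarrow> \<phi>)"

definition ExSLe :: "('f, 'g) nterm \<Rightarrow> ('f, 'g) fm \<Rightarrow> ('f, 'g) fm" where
  "ExSLe t \<phi> = ExS (Len (SVar 0) \<^bold>\<le> upS_nt t \<^bold>\<and> \<phi>)"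

inductive Sigma0B :: "('f, 'g) fm \<Rightarrow> bool" where
  "qfree \<phi> \<Longrightarrow> Sigma0B \<phi>"
| "Sigma0B \<phi> \<Longrightarrow> Sigma0B \<psi> \<Longrightarrow> Sigma0B (\<phi> \<^bold>\<longrightarrow> \<psi>)"
| "Sigma0B \<phi> \<Longrightarrow> Sigma0B (AllLe t \<phi>)"
| "Sigma0B \<phi> \<Longrightarrow> Sigma0B (ExLe t \<phi>)"

inductive Sigma1B :: "('f, 'g) fm \<Rightarrow> bool" where
  "Sigma0B \<phi> \<Longrightarrow> Sigma1B \<phi>"
| "Sigma1B \<phi> \<Longrightarrow> Sigma1B (ExSLe t \<phi>)"


section \<open>Function symbols\<close>

text \<open>\<open>CompFun z xs Xs \<phi> t\<close> is the string function symbol $F_{\varphi(z),t}$ of the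
  arguments \<open>xs\<close>, \<open>Xs\<close>; \<open>MinFun z xs Xs \<phi> t\<close> is the number function
  symbol for the least $z < t$ with $\varphi(z)$ (and $t$ if there is none).\<close>

datatype nfun =
    Pd
  | FSE
  | MinFun nat "nat list" "nat list" "(nfun, sfun) fm" "(nfun, sfun) nterm"
and sfun =
    ParityF
  | PowSeqF
  | CompFun nat "nat list" "nat list" "(nfun, sfun) fm" "(nfun, sfun) nterm"

type_synonym num = "(nfun, sfun) nterm"
type_synonym str = "(nfun, sfun) sterm"
type_synonym form = "(nfun, sfun) fm"

text \<open>Arities: numbers of number and of string arguments.\<close>

primrec arity_n :: "nfun \<Rightarrow> nat \<times> nat" where
  "arity_n Pd = (1, 0)"
| "arity_n FSE = (0, 2)"
| "arity_n (MinFun z xs Xs \<phi> t) = (length xs, length Xs)"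

primrec arity_s :: "sfun \<Rightarrow> nat \<times> nat" where
  "arity_s ParityF = (1, 1)"
| "arity_s PowSeqF = (2, 1)"
| "arity_s (CompFun z xs Xs \<phi> t) = (length xs, length Xs)"

primrec wf_nt :: "num \<Rightarrow> bool" and wf_st :: "str \<Rightarrow> bool" where
  "wf_nt (NVar i) = True"
| "wf_nt Zero = True"
| "wf_nt One = True"
| "wf_nt (s \<^bold>+ t) = (wf_nt s \<and> wf_nt t)"
| "wf_nt (s \<^bold>* t) = (wf_nt s \<and> wf_nt t)"
| "wf_nt (Len T) = wf_st T"
| "wf_nt (NFun f ts Ts) =
     ((length ts, length Ts) = arity_n f \<and> list_all id (map wf_nt ts) \<and> list_all id (map wf_st Ts))"
| "wf_st (SVar i) = True"
| "wf_st (SFun g ts Ts) =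
     ((length ts, length Ts) = arity_s g \<and> list_all id (map wf_nt ts) \<and> list_all id (map wf_st Ts))"

primrec wf_fm :: "form \<Rightarrow> bool" where
  "wf_fm Falsum = True"
| "wf_fm (s \<^bold>=\<^sub>1 t) = (wf_nt s \<and> wf_nt t)"
| "wf_fm (S \<^bold>=\<^sub>2 T) = (wf_st S \<and> wf_st T)"
| "wf_fm (s \<^bold>\<le> t) = (wf_nt s \<and> wf_nt t)"
| "wf_fm (t \<^bold>\<in> T) = (wf_nt t \<and> wf_st T)"
| "wf_fm (\<phi> \<^bold>\<longrightarrow> \<psi>) = (wf_fm \<phi> \<and> wf_fm \<psi>)"
| "wf_fm (AllN \<phi>) = wf_fm \<phi>"
| "wf_fm (AllS \<phi>) = wf_fm \<phi>"

text \<open>A language is given by the function symbols it has in addition to the basic vocabulary.\<close>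

type_synonym language = "nfun set \<times> sfun set"

definition L_A2 :: language where "L_A2 = ({}, {})"

definition formulas :: "language \<Rightarrow> form set" where
  "formulas L = {\<phi>. wf_fm \<phi> \<and> nsyms \<phi> \<subseteq> fst L \<and> ssyms \<phi> \<subseteq> snd L}"


section \<open>Theories\<close>

text \<open>A Hilbert calculus for two-sorted classical logic with equality, in which every formula of a
  derivation belongs to the language. The axioms \<open>A\<close> may have free variables; generalization
  applies to all derived formulas, so they are treated as universally closed.\<close>

inductive derives :: "language \<Rightarrow> form set \<Rightarrow> form \<Rightarrow> bool" for L A where
  Axiom: "\<phi> \<in> A \<Longrightarrow> \<phi> \<in> formulas L \<Longrightarrow> derives L A \<phi>"
| MP: "derives L A (\<phi> \<^bold>\<longrightarrow> \<psi>) \<Longrightarrow> derives L A \<phi> \<Longrightarrow> derives L A \<psi>"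
| GenN: "derives L A \<phi> \<Longrightarrow> derives L A (AllN \<phi>)"
| GenS: "derives L A \<phi> \<Longrightarrow> derives L A (AllS \<phi>)"
| K: "(\<phi> \<^bold>\<longrightarrow> \<psi> \<^bold>\<longrightarrow> \<phi>) \<in> formulas L \<Longrightarrow> derives L A (\<phi> \<^bold>\<longrightarrow> \<psi> \<^bold>\<longrightarrow> \<phi>)"
| S: "((\<phi> \<^bold>\<longrightarrow> \<psi> \<^bold>\<longrightarrow> \<chi>) \<^bold>\<longrightarrow> (\<phi> \<^bold>\<longrightarrow> \<psi>) \<^bold>\<longrightarrow> \<phi> \<^bold>\<longrightarrow> \<chi>) \<in> formulas L \<Longrightarrow>
    derives L A ((\<phi> \<^bold>\<longrightarrow> \<psi> \<^bold>\<longrightarrow> \<chi>) \<^bold>\<longrightarrow> (\<phi> \<^bold>\<longrightarrow> \<psi>) \<^bold>\<longrightarrow> \<phi> \<^bold>\<longrightarrow> \<chi>)"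
| DN: "(((\<phi> \<^bold>\<longrightarrow> Falsum) \<^bold>\<longrightarrow> Falsum) \<^bold>\<longrightarrow> \<phi>) \<in> formulas L \<Longrightarrow>
    derives L A (((\<phi> \<^bold>\<longrightarrow> Falsum) \<^bold>\<longrightarrow> Falsum) \<^bold>\<longrightarrow> \<phi>)"
| InstN: "(AllN \<phi> \<^bold>\<longrightarrow> instN t \<phi>) \<in> formulas L \<Longrightarrow>
    derives L A (AllN \<phi> \<^bold>\<longrightarrow> instN t \<phi>)"
| InstS: "(AllS \<phi> \<^bold>\<longrightarrow> instS T \<phi>) \<in> formulas L \<Longrightarrow>
    derives L A (AllS \<phi> \<^bold>\<longrightarrow> instS T \<phi>)"
| DistN: "(AllN (\<phi> \<^bold>\<longrightarrow> \<psi>) \<^bold>\<longrightarrow> AllN \<phi> \<^bold>\<longrightarrow> AllN \<psi>) \<in> formulas L \<Longrightarrow>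
    derives L A (AllN (\<phi> \<^bold>\<longrightarrow> \<psi>) \<^bold>\<longrightarrow> AllN \<phi> \<^bold>\<longrightarrow> AllN \<psi>)"
| DistS: "(AllS (\<phi> \<^bold>\<longrightarrow> \<psi>) \<^bold>\<longrightarrow> AllS \<phi> \<^bold>\<longrightarrow> AllS \<psi>) \<in> formulas L \<Longrightarrow>
    derives L A (AllS (\<phi> \<^bold>\<longrightarrow> \<psi>) \<^bold>\<longrightarrow> AllS \<phi> \<^bold>\<longrightarrow> AllS \<psi>)"
| VacN: "(\<phi> \<^bold>\<longrightarrow> AllN (upN \<phi>)) \<in> formulas L \<Longrightarrow> derives L A (\<phi> \<^bold>\<longrightarrow> AllN (upN \<phi>))"
| VacS: "(\<phi> \<^bold>\<longrightarrow> AllS (upS \<phi>)) \<in> formulas L \<Longrightarrow> derives L A (\<phi> \<^bold>\<longrightarrow> AllS (upS \<phi>))"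
| ReflN: "(t \<^bold>=\<^sub>1 t) \<in> formulas L \<Longrightarrow> derives L A (t \<^bold>=\<^sub>1 t)"
| ReflS: "(T \<^bold>=\<^sub>2 T) \<in> formulas L \<Longrightarrow> derives L A (T \<^bold>=\<^sub>2 T)"
| LeibnizN: "(s \<^bold>=\<^sub>1 t \<^bold>\<longrightarrow> instN s \<phi> \<^bold>\<longrightarrow> instN t \<phi>) \<in> formulas L \<Longrightarrow>
    derives L A (s \<^bold>=\<^sub>1 t \<^bold>\<longrightarrow> instN s \<phi> \<^bold>\<longrightarrow> instN t \<phi>)"
| LeibnizS: "(S \<^bold>=\<^sub>2 T \<^bold>\<longrightarrow> instS S \<phi> \<^bold>\<longrightarrow> instS T \<phi>) \<in> formulas L \<Longrightarrow>
    derives L A (S \<^bold>=\<^sub>2 T \<^bold>\<longrightarrow> instS S \<phi> \<^bold>\<longrightarrow> instS T \<phi>)"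

record axiomatic_theory =
  lang :: language
  axms :: "form set"

definition theorems :: "axiomatic_theory \<Rightarrow> form set" where
  "theorems \<T> = {\<phi>. derives (lang \<T>) (axms \<T>) \<phi>}"

definition universal_theory :: "axiomatic_theory \<Rightarrow> bool" where
  "universal_theory \<T> \<longleftrightarrow>
     (\<exists>A \<subseteq> formulas (lang \<T>). (\<forall>\<phi>\<in>A. universal \<phi>) \<and>
        theorems \<T> = theorems \<lparr>lang = lang \<T>, axms = A\<rparr>)"

definition conservative_extension :: "axiomatic_theory \<Rightarrow> axiomatic_theory \<Rightarrow> bool" where
  "conservative_extension \<T>' \<T> \<longleftrightarrow>
     fst (lang \<T>) \<subseteq> fst (lang \<T>') \<and> snd (lang \<T>) \<subseteq> snd (lang \<T>') \<and>
     theorems \<T> \<subseteq> theorems \<T>' \<and>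
     theorems \<T>' \<inter> formulas (lang \<T>) \<subseteq> theorems \<T>"


section \<open>$V^0(2)$\<close>

abbreviation Xor :: "('f, 'g) fm \<Rightarrow> ('f, 'g) fm \<Rightarrow> ('f, 'g) fm" where
  "Xor \<phi> \<psi> \<equiv> \<^bold>\<not> (\<phi> \<^bold>\<longleftrightarrow> \<psi>)"

abbreviation "x\<^sub>0 \<equiv> NVar 0 :: num"
abbreviation "x\<^sub>1 \<equiv> NVar 1 :: num"
abbreviation "x\<^sub>2 \<equiv> NVar 2 :: num"
abbreviation "x\<^sub>3 \<equiv> NVar 3 :: num"
abbreviation "X\<^sub>0 \<equiv> SVar 0 :: str"
abbreviation "X\<^sub>1 \<equiv> SVar 1 :: str"

text \<open>The open axioms B1--B11, L1, L2 of 2-BASIC.\<close>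

definition basic_open :: "form set" where
  "basic_open = {
     \<^bold>\<not> x\<^sub>0 \<^bold>+ One \<^bold>=\<^sub>1 Zero,
     x\<^sub>0 \<^bold>+ One \<^bold>=\<^sub>1 x\<^sub>1 \<^bold>+ One \<^bold>\<longrightarrow> x\<^sub>0 \<^bold>=\<^sub>1 x\<^sub>1,
     x\<^sub>0 \<^bold>+ Zero \<^bold>=\<^sub>1 x\<^sub>0,
     x\<^sub>0 \<^bold>+ (x\<^sub>1 \<^bold>+ One) \<^bold>=\<^sub>1 (x\<^sub>0 \<^bold>+ x\<^sub>1) \<^bold>+ One,
     x\<^sub>0 \<^bold>* Zero \<^bold>=\<^sub>1 Zero,
     x\<^sub>0 \<^bold>* (x\<^sub>1 \<^bold>+ One) \<^bold>=\<^sub>1 x\<^sub>0 \<^bold>* x\<^sub>1 \<^bold>+ x\<^sub>0,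
     x\<^sub>0 \<^bold>\<le> x\<^sub>1 \<^bold>\<and> x\<^sub>1 \<^bold>\<le> x\<^sub>0 \<^bold>\<longrightarrow> x\<^sub>0 \<^bold>=\<^sub>1 x\<^sub>1,
     x\<^sub>0 \<^bold>\<le> x\<^sub>0 \<^bold>+ x\<^sub>1,
     Zero \<^bold>\<le> x\<^sub>0,
     x\<^sub>0 \<^bold>\<le> x\<^sub>1 \<^bold>\<or> x\<^sub>1 \<^bold>\<le> x\<^sub>0,
     x\<^sub>0 \<^bold>\<le> x\<^sub>1 \<^bold>\<longleftrightarrow> x\<^sub>0 \<^bold>< x\<^sub>1 \<^bold>+ One,
     x\<^sub>1 \<^bold>\<in> X\<^sub>0 \<^bold>\<longrightarrow> x\<^sub>1 \<^bold>< Len X\<^sub>0,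
     x\<^sub>1 \<^bold>+ One \<^bold>=\<^sub>1 Len X\<^sub>0 \<^bold>\<longrightarrow> x\<^sub>1 \<^bold>\<in> X\<^sub>0}"

definition B12 :: form where
  "B12 = (\<^bold>\<not> x\<^sub>0 \<^bold>=\<^sub>1 Zero \<^bold>\<longrightarrow> ExLe x\<^sub>0 (x\<^sub>0 \<^bold>+ One \<^bold>=\<^sub>1 x\<^sub>1))"

definition SE :: form where
  "SE = (Len X\<^sub>0 \<^bold>=\<^sub>1 Len X\<^sub>1 \<^bold>\<and> AllLt (Len X\<^sub>0) (x\<^sub>0 \<^bold>\<in> X\<^sub>0 \<^bold>\<longleftrightarrow> x\<^sub>0 \<^bold>\<in> X\<^sub>1) \<^bold>\<longrightarrow> X\<^sub>0 \<^bold>=\<^sub>2 X\<^sub>1)"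

text \<open>Comprehension: a string of length at most $y$ contains a $z < y$ iff $\varphi(z)$.
  In \<open>\<phi>\<close> the number variable 0 is $z$, the number variable 1 is $y$ (which may occur), and the
  other variables are parameters; the new string variable is not free in \<open>upS \<phi>\<close>.\<close>

definition COMP :: "form \<Rightarrow> form" where
  "COMP \<phi> = ExSLe x\<^sub>0 (AllLt x\<^sub>0 (x\<^sub>0 \<^bold>\<in> X\<^sub>0 \<^bold>\<longleftrightarrow> upS \<phi>))"

text \<open>The string \<open>X\<^sub>0\<close> holds the parities of the initial segments of \<open>X\<^sub>1\<close>.\<close>

definition parity_axiom :: form where
  "parity_axiom = ExSLe (x\<^sub>0 \<^bold>+ One)
     (\<^bold>\<not> Zero \<^bold>\<in> X\<^sub>0 \<^bold>\<and>
      AllLt x\<^sub>0 (x\<^sub>0 \<^bold>+ One \<^bold>\<in> X\<^sub>0 \<^bold>\<longleftrightarrow> Xor (x\<^sub>0 \<^bold>\<in> X\<^sub>1) (x\<^sub>0 \<^bold>\<in> X\<^sub>0)))"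

definition V0_2 :: axiomatic_theory where
  "V0_2 = \<lparr>lang = L_A2,
     axms = basic_open \<union> {B12, SE, parity_axiom} \<union>
       {COMP \<phi> | \<phi>. Sigma0B \<phi> \<and> \<phi> \<in> formulas L_A2}\<rparr>"


section \<open>The universal theory for $AC^0(2)$\<close>

definition defining_data ::
    "nat \<Rightarrow> nat list \<Rightarrow> nat list \<Rightarrow> form \<Rightarrow> num \<Rightarrow> bool" where
  "defining_data z xs Xs \<phi> t \<longleftrightarrow>
     distinct (z # xs) \<and> distinct Xs \<and>
     qfree \<phi> \<and> wf_fm \<phi> \<and> fvN \<phi> \<subseteq> insert z (set xs) \<and> fvS \<phi> \<subseteq> set Xs \<and>
     nsyms_nt t = {} \<and> ssyms_nt t = {} \<and> fvN_nt t \<subseteq> set xs \<and> fvS_nt t \<subseteq> set Xs"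

inductive AC02_n :: "nfun \<Rightarrow> bool" and AC02_s :: "sfun \<Rightarrow> bool" where
  "AC02_n Pd"
| "AC02_n FSE"
| "AC02_s ParityF"
| "defining_data z xs Xs \<phi> t \<Longrightarrow> \<forall>f\<in>nsyms \<phi>. AC02_n f \<Longrightarrow> \<forall>g\<in>ssyms \<phi>. AC02_s g \<Longrightarrow>
   AC02_n (MinFun z xs Xs \<phi> t)"
| "defining_data z xs Xs \<phi> t \<Longrightarrow> \<forall>f\<in>nsyms \<phi>. AC02_n f \<Longrightarrow> \<forall>g\<in>ssyms \<phi>. AC02_s g \<Longrightarrow>
   AC02_s (CompFun z xs Xs \<phi> t)"

definition L_FAC02 :: language where
  "L_FAC02 = ({f. AC02_n f}, {g. AC02_s g})"

definition pd_axioms :: "form set" where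
  "pd_axioms = {NFun Pd [Zero] [] \<^bold>=\<^sub>1 Zero, \<^bold>\<not> x\<^sub>0 \<^bold>=\<^sub>1 Zero \<^bold>\<longrightarrow> NFun Pd [x\<^sub>0] [] \<^bold>+ One \<^bold>=\<^sub>1 x\<^sub>0}"

text \<open>\<open>FSE\<close> is the first position at which \<open>X\<^sub>0\<close> and \<open>X\<^sub>1\<close> differ, or $|X_0|$; it replaces
  the bounded quantifier of the extensionality axiom.\<close>

definition SE_axioms :: "form set" where
  "SE_axioms = (let d = NFun FSE [] [X\<^sub>0, X\<^sub>1] in {
     d \<^bold>\<le> Len X\<^sub>0,
     x\<^sub>0 \<^bold>< d \<^bold>\<longrightarrow> (x\<^sub>0 \<^bold>\<in> X\<^sub>0 \<^bold>\<longleftrightarrow> x\<^sub>0 \<^bold>\<in> X\<^sub>1),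
     d \<^bold>< Len X\<^sub>0 \<^bold>\<longrightarrow> Xor (d \<^bold>\<in> X\<^sub>0) (d \<^bold>\<in> X\<^sub>1),
     Len X\<^sub>0 \<^bold>=\<^sub>1 Len X\<^sub>1 \<^bold>\<and> d \<^bold>=\<^sub>1 Len X\<^sub>0 \<^bold>\<longrightarrow> X\<^sub>0 \<^bold>=\<^sub>2 X\<^sub>1})"

definition ParityF_axiom :: form where
  "ParityF_axiom = (let Z = SFun ParityF [x\<^sub>0] [X\<^sub>0] in
     Len Z \<^bold>\<le> x\<^sub>0 \<^bold>+ One \<^bold>\<and> \<^bold>\<not> Zero \<^bold>\<in> Z \<^bold>\<and>
     (x\<^sub>1 \<^bold>< x\<^sub>0 \<^bold>\<longrightarrow> (x\<^sub>1 \<^bold>+ One \<^bold>\<in> Z \<^bold>\<longleftrightarrow> Xor (x\<^sub>1 \<^bold>\<in> X\<^sub>0) (x\<^sub>1 \<^bold>\<in> Z))))"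

definition MinFun_axiom :: "nat \<Rightarrow> nat list \<Rightarrow> nat list \<Rightarrow> form \<Rightarrow> num \<Rightarrow> form" where
  "MinFun_axiom z xs Xs \<phi> t =
     (let m = NFun (MinFun z xs Xs \<phi> t) (map NVar xs) (map SVar Xs) in
      m \<^bold>\<le> t \<^bold>\<and> (NVar z \<^bold>=\<^sub>1 m \<^bold>\<and> NVar z \<^bold>< t \<^bold>\<longrightarrow> \<phi>) \<^bold>\<and> (NVar z \<^bold>< m \<^bold>\<longrightarrow> \<^bold>\<not> \<phi>))"

definition CompFun_axiom :: "nat \<Rightarrow> nat list \<Rightarrow> nat list \<Rightarrow> form \<Rightarrow> num \<Rightarrow> form" where
  "CompFun_axiom z xs Xs \<phi> t =
     (NVar z \<^bold>\<in> SFun (CompFun z xs Xs \<phi> t) (map NVar xs) (map SVar Xs) \<^bold>\<longleftrightarrow> NVar z \<^bold>< t \<^bold>\<and> \<phi>)"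

definition V0_2_bar :: axiomatic_theory where
  "V0_2_bar = \<lparr>lang = L_FAC02,
     axms = basic_open \<union> pd_axioms \<union> SE_axioms \<union> {ParityF_axiom} \<union>
       {MinFun_axiom z xs Xs \<phi> t | z xs Xs \<phi> t. MinFun z xs Xs \<phi> t \<in> fst L_FAC02} \<union>
       {CompFun_axiom z xs Xs \<phi> t | z xs Xs \<phi> t. CompFun z xs Xs \<phi> t \<in> snd L_FAC02}\<rparr>"


section \<open>Matrix powers over $\mathbb{Z}_2$\<close>

definition pair :: "num \<Rightarrow> num \<Rightarrow> num" where
  "pair s t = (s \<^bold>+ t) \<^bold>* (s \<^bold>+ t \<^bold>+ One) \<^bold>+ (One \<^bold>+ One) \<^bold>* t"

text \<open>\<open>second s u\<close> is the least $y \le u$ with $u = \langle s, y\rangle$ (or $u + 1$), and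
  \<open>left u\<close> is the least $x \le u$ for which such a $y$ exists; hence \<open>is_pair u\<close> is an open
  formula saying that $u$ is a pair number.\<close>

definition second :: "num \<Rightarrow> num \<Rightarrow> num" where
  "second s u = NFun (MinFun 0 [1, 2] [] (x\<^sub>2 \<^bold>=\<^sub>1 pair x\<^sub>1 x\<^sub>0) (x\<^sub>2 \<^bold>+ One)) [s, u] []"

definition left :: "num \<Rightarrow> num" where
  "left u = NFun (MinFun 0 [1] [] (x\<^sub>1 \<^bold>=\<^sub>1 pair x\<^sub>0 (second x\<^sub>0 x\<^sub>1))
     (x\<^sub>1 \<^bold>+ One)) [u] []"

definition right :: "num \<Rightarrow> num" where
  "right u = second (left u) u"

definition is_pair :: "num \<Rightarrow> form" where
  "is_pair u = (u \<^bold>=\<^sub>1 pair (left u) (right u))"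

definition row :: "num \<Rightarrow> str \<Rightarrow> str" where
  "row i Y = SFun (CompFun 0 [1] [0] (pair x\<^sub>1 x\<^sub>0 \<^bold>\<in> X\<^sub>0) (Len X\<^sub>0)) [i] [Y]"

definition identity :: "num \<Rightarrow> str" where
  "identity n = SFun (CompFun 0 [1] []
     (is_pair x\<^sub>0 \<^bold>\<and> left x\<^sub>0 \<^bold>< x\<^sub>1 \<^bold>\<and> left x\<^sub>0 \<^bold>=\<^sub>1 right x\<^sub>0)
     (pair x\<^sub>1 x\<^sub>1)) [n] []"

text \<open>\<open>entry_products n i j X1 X2\<close> is the set of all $b < n$ with
  $X_1(i,b) \wedge X_2(b,j)$; the parity of its size is the bit \<open>n\<close> of its parity string.\<close>

definition entry_products :: "num \<Rightarrow> num \<Rightarrow> num \<Rightarrow> str \<Rightarrow> str \<Rightarrow> str" where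
  "entry_products n i j X1 X2 = SFun (CompFun 0 [1, 2, 3] [0, 1]
     (pair x\<^sub>2 x\<^sub>0 \<^bold>\<in> X\<^sub>0 \<^bold>\<and> pair x\<^sub>0 x\<^sub>3 \<^bold>\<in> X\<^sub>1) x\<^sub>1)
     [n, i, j] [X1, X2]"

definition Prod2 :: "num \<Rightarrow> str \<Rightarrow> str \<Rightarrow> str" where
  "Prod2 n X1 X2 = SFun (CompFun 0 [1] [0, 1]
     (is_pair x\<^sub>0 \<^bold>\<and> left x\<^sub>0 \<^bold>< x\<^sub>1 \<^bold>\<and> right x\<^sub>0 \<^bold>< x\<^sub>1 \<^bold>\<and>
      x\<^sub>1 \<^bold>\<in> SFun ParityF [x\<^sub>1]
        [entry_products x\<^sub>1 (left x\<^sub>0) (right x\<^sub>0) X\<^sub>0 X\<^sub>1])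
     (pair x\<^sub>1 x\<^sub>1)) [n] [X1, X2]"

text \<open>Taken literally, the usual defining formulas are not satisfiable for all arguments:
  for $n = k = 0$ the bound $|Y| < \langle k, \langle n, n\rangle\rangle$ reads $|Y| < 0$, and the
  condition $Y^{[1]} = X$ in the defining axiom of $PowSeq_2'$ (in place of $Y^{[0]} = I$) fails
  for instance when $k \ge 1$ and $X$ has elements that do not encode entries of an $n \times n$
  matrix. \<open>Literal\<close> keeps these formulas; \<open>Corrected\<close> has the bound
  $|Y| \le \langle k, \langle n, n\rangle\rangle$ and the condition $Y^{[0]} = I$, and is otherwise
  the same.\<close>

datatype variant = Literal | Corrected

primrec powseq_bound :: "variant \<Rightarrow> num \<Rightarrow> num \<Rightarrow> str \<Rightarrow> form" where
  "powseq_bound Literal n k Y = (Len Y \<^bold>< pair k (pair n n))"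
| "powseq_bound Corrected n k Y = (Len Y \<^bold>\<le> pair k (pair n n))"

primrec powseq_start :: "variant \<Rightarrow> num \<Rightarrow> str \<Rightarrow> str \<Rightarrow> form" where
  "powseq_start Literal n X Y = (row One Y \<^bold>=\<^sub>2 X)"
| "powseq_start Corrected n X Y = (row Zero Y \<^bold>=\<^sub>2 identity n)"

definition powseq_graph :: "variant \<Rightarrow> num \<Rightarrow> num \<Rightarrow> str \<Rightarrow> str \<Rightarrow> form" where
  "powseq_graph v n k X Y =
     (powseq_bound v n k Y \<^bold>\<and>
      AllLt (Len Y) (x\<^sub>0 \<^bold>\<in> upN_st Y \<^bold>\<longrightarrow> is_pair x\<^sub>0) \<^bold>\<and>
      row Zero Y \<^bold>=\<^sub>2 identity n \<^bold>\<and>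
      AllLt k (row (x\<^sub>0 \<^bold>+ One) (upN_st Y) \<^bold>=\<^sub>2
        Prod2 (upN_nt n) (upN_st X) (row x\<^sub>0 (upN_st Y))))"

text \<open>The formula $\exists Y\,(Y = PowSeq_2(n,k,X))$ for $n, k, X$ the variables
  \<open>x\<^sub>0\<close>, \<open>x\<^sub>1\<close>, \<open>X\<^sub>0\<close>; under the quantifier $X$ becomes \<open>X\<^sub>1\<close>.\<close>

definition powseq_exists :: "variant \<Rightarrow> form" where
  "powseq_exists v = ExS (powseq_graph v x\<^sub>0 x\<^sub>1 X\<^sub>1 X\<^sub>0)"

definition PowSeqF_axiom :: "variant \<Rightarrow> form" where
  "PowSeqF_axiom v =
     (let n = x\<^sub>0; k = x\<^sub>1; b = x\<^sub>2; i = x\<^sub>3; X = X\<^sub>0; Y = SFun PowSeqF [n, k] [X] in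
      powseq_bound v n k Y \<^bold>\<and>
      (b \<^bold>< Len Y \<^bold>\<longrightarrow> \<^bold>\<not> b \<^bold>\<in> Y \<^bold>\<or> is_pair b) \<^bold>\<and>
      powseq_start v n X Y \<^bold>\<and>
      (i \<^bold>< k \<^bold>\<longrightarrow> row (i \<^bold>+ One) Y \<^bold>=\<^sub>2 Prod2 n X (row i Y)))"


section \<open>$V{\oplus}L$ and its universal version\<close>

definition VparityL_axiom :: "variant \<Rightarrow> form \<Rightarrow> bool" where
  "VparityL_axiom v \<psi> \<longleftrightarrow>
     \<psi> \<in> formulas L_A2 \<and> Sigma1B \<psi> \<and> (\<psi> \<^bold>\<longleftrightarrow> powseq_exists v) \<in> theorems V0_2_bar"

definition VparityL :: "form \<Rightarrow> axiomatic_theory" where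
  "VparityL \<psi> = \<lparr>lang = L_A2, axms = axms V0_2 \<union> {\<psi>}\<rparr>"

inductive FparityL_s :: "sfun \<Rightarrow> bool" where
  "g \<in> snd L_FAC02 \<Longrightarrow> FparityL_s g"
| "FparityL_s PowSeqF"
| "defining_data z xs Xs \<phi> t \<Longrightarrow> \<forall>f\<in>nsyms \<phi>. f \<in> fst L_FAC02 \<Longrightarrow> \<forall>g\<in>ssyms \<phi>. FparityL_s g \<Longrightarrow>
   FparityL_s (CompFun z xs Xs \<phi> t)"

definition L_FparityL :: language where
  "L_FparityL = (fst L_FAC02, {g. FparityL_s g})"

definition VparityL_bar :: "variant \<Rightarrow> axiomatic_theory" where
  "VparityL_bar v = \<lparr>lang = L_FparityL,
     axms = axms V0_2_bar \<union> {PowSeqF_axiom v} \<union>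
       {CompFun_axiom z xs Xs \<phi> t | z xs Xs \<phi> t. CompFun z xs Xs \<phi> t \<in> snd L_FparityL}\<rparr>"

end

(* Henkin's completeness theorem for the given calculus turns both inclusions into statements
   about models, where a string is identified with its set of elements because both theories
   prove extensionality.

   Every model of V0(2) + psi expands to one of the universal theory: the sets definable by
   bounded formulas in the closure of the AC0(2) functions are strings, as the parity function
   of a whole family of strings is read off from a single parity function of their
   concatenation.  For PowSeq2 the closure requires the powers of a definable family of matrices
   at once; these are the blocks of the powers of one block-diagonal matrix.  Since the bounded
   formulas are closed under comprehension, the new functions can be added one after the other.

   Conversely, in a model of the universal theory the bounded quantifiers are eliminated with
   the least-number functions, so that comprehension for bounded formulas follows from the
   axioms of the string functions, and the value of PowSeq2 witnesses the axiom of V + parity L.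

   For the literal reading of the axiom of PowSeq2 both theories are inconsistent: the bound on
   the length is 0 for n = k = 0. *)
theory Submission
  imports Defs "HOL-Library.Countable_Set"
begin

section \<open>Substitution\<close>

text \<open>The obstacle is uniformity. The concatenation that codes a family of parities, and the
  block diagonal matrix that codes a family of powers, exist only for indices up to some bound
  \<open>b\<close>, and the coding string changes with \<open>b\<close>. Hence no single bounded
  formula with fixed parameters need define a new function on the whole model. Definability is
  therefore demanded only on each bounded set of arguments, together with bounds on the values
  (\<open>LD\<close>, \<open>NN\<close>, \<open>NS\<close>). Comprehension and induction survive, as
  each instance looks at bounded arguments only, and terms can be nested, since the inner values are
  bounded too. For a function symbol the invariant is closure under families of arguments and not
  mere definability of its graph, because the symbol may be applied to terms that contain the
  comprehension variable of another one. Interpreting strings by sets has its price in the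
  completeness proof: equality in a maximal consistent set must follow from agreement on all terms.
  In both theories this goes through the lengths of the strings, whose predecessors are
  elements.\<close>

lemma subst_comp_term:
  shows "subst_nt \<sigma> \<tau> (subst_nt \<sigma>' \<tau>' t) =
      subst_nt (\<lambda>i. subst_nt \<sigma> \<tau> (\<sigma>' i)) (\<lambda>i. subst_st \<sigma> \<tau> (\<tau>' i)) t"
    and "subst_st \<sigma> \<tau> (subst_st \<sigma>' \<tau>' T) =
      subst_st (\<lambda>i. subst_nt \<sigma> \<tau> (\<sigma>' i)) (\<lambda>i. subst_st \<sigma> \<tau> (\<tau>' i)) T"
  by (induction t and T) auto

lemma subst_id_term [simp]:
  fixes t :: "('f, 'g) nterm" and T :: "('f, 'g) sterm"
  shows "subst_nt NVar SVar t = t" and "subst_st NVar SVar T = T"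
  by (induction t and T) (auto simp: map_idI)

lemma subst_term_cong:
  shows "(\<And>i. i \<in> fvN_nt t \<Longrightarrow> \<sigma> i = \<sigma>' i) \<Longrightarrow> (\<And>i. i \<in> fvS_nt t \<Longrightarrow> \<tau> i = \<tau>' i) \<Longrightarrow>
      subst_nt \<sigma> \<tau> t = subst_nt \<sigma>' \<tau>' t"
    and "(\<And>i. i \<in> fvN_st T \<Longrightarrow> \<sigma> i = \<sigma>' i) \<Longrightarrow> (\<And>i. i \<in> fvS_st T \<Longrightarrow> \<tau> i = \<tau>' i) \<Longrightarrow>
      subst_st \<sigma> \<tau> T = subst_st \<sigma>' \<tau>' T"
proof (induction t and T)
  case (NFun f ts Ts)
  have "map (subst_nt \<sigma> \<tau>) ts = map (subst_nt \<sigma>' \<tau>') ts"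
    "map (subst_st \<sigma> \<tau>) Ts = map (subst_st \<sigma>' \<tau>') Ts"
    by (intro map_cong refl NFun.IH NFun.prems; auto)+
  then show ?case by simp
next
  case (SFun g ts Ts)
  have "map (subst_nt \<sigma> \<tau>) ts = map (subst_nt \<sigma>' \<tau>') ts"
    "map (subst_st \<sigma> \<tau>) Ts = map (subst_st \<sigma>' \<tau>') Ts"
    by (intro map_cong refl SFun.IH SFun.prems; auto)+
  then show ?case by simp
qed auto

text \<open>Names the substitution that acts below a quantifier. With these constants in place of
  the \<open>case_nat\<close> forms of \<open>subst.simps\<close>, the laws of lifting can serve as
  rewrite rules.\<close>

definition liftN :: "(nat \<Rightarrow> ('f, 'g) nterm) \<Rightarrow> nat \<Rightarrow> ('f, 'g) nterm" where
  "liftN \<sigma> = case_nat (NVar 0) (\<lambda>i. upN_nt (\<sigma> i))"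

definition liftS :: "(nat \<Rightarrow> ('f, 'g) sterm) \<Rightarrow> nat \<Rightarrow> ('f, 'g) sterm" where
  "liftS \<tau> = case_nat (SVar 0) (\<lambda>i. upS_st (\<tau> i))"

lemma lift_simps [simp]:
  "liftN \<sigma> 0 = NVar 0" "liftN \<sigma> (Suc i) = upN_nt (\<sigma> i)"
  "liftS \<tau> 0 = SVar 0" "liftS \<tau> (Suc i) = upS_st (\<tau> i)"
  by (auto simp: liftN_def liftS_def)

lemma subst_All [simp]:
  "subst \<sigma> \<tau> (AllN \<phi>) = AllN (subst (liftN \<sigma>) (\<lambda>i. upN_st (\<tau> i)) \<phi>)"
  "subst \<sigma> \<tau> (AllS \<phi>) = AllS (subst (\<lambda>i. upS_nt (\<sigma> i)) (liftS \<tau>) \<phi>)"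
  by (auto simp: liftN_def liftS_def)

declare subst.simps(7,8) [simp del]

lemma subst_lift_up:
  "subst_nt (liftN \<sigma>) (\<lambda>i. upN_st (\<tau> i)) (upN_nt t) = upN_nt (subst_nt \<sigma> \<tau> t)"
  "subst_st (liftN \<sigma>) (\<lambda>i. upN_st (\<tau> i)) (upN_st T) = upN_st (subst_st \<sigma> \<tau> T)"
  "subst_nt (\<lambda>i. upS_nt (\<sigma> i)) (liftS \<tau>) (upS_nt t) = upS_nt (subst_nt \<sigma> \<tau> t)"
  "subst_st (\<lambda>i. upS_nt (\<sigma> i)) (liftS \<tau>) (upS_st T) = upS_st (subst_st \<sigma> \<tau> T)"
  by (auto simp: upN_nt_def upN_st_def upS_nt_def upS_st_def subst_comp_term)

lemma subst_comp:
  "subst \<sigma> \<tau> (subst \<sigma>' \<tau>' \<phi>) =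
     subst (\<lambda>i. subst_nt \<sigma> \<tau> (\<sigma>' i)) (\<lambda>i. subst_st \<sigma> \<tau> (\<tau>' i)) \<phi>"
proof (induction \<phi> arbitrary: \<sigma> \<tau> \<sigma>' \<tau>')
  case (AllN \<phi>)
  have "(\<lambda>i. subst_nt (liftN \<sigma>) (\<lambda>i. upN_st (\<tau> i)) (liftN \<sigma>' i)) = liftN (\<lambda>i. subst_nt \<sigma> \<tau> (\<sigma>' i))"
    by (rule ext, case_tac i) (auto simp: subst_lift_up)
  then show ?case by (simp add: AllN subst_lift_up)
next
  case (AllS \<phi>)
  have "(\<lambda>i. subst_st (\<lambda>i. upS_nt (\<sigma> i)) (liftS \<tau>) (liftS \<tau>' i)) = liftS (\<lambda>i. subst_st \<sigma> \<tau> (\<tau>' i))"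
    by (rule ext, case_tac i) (auto simp: subst_lift_up)
  then show ?case by (simp add: AllS subst_lift_up)
qed (auto simp: subst_comp_term)

lemma lift_Var [simp]:
  "liftN NVar = NVar" "liftS SVar = SVar"
  "upN_st (SVar i) = SVar i" "upS_nt (NVar j) = NVar j"
  "upN_nt (NVar j) = NVar (Suc j)" "upS_st (SVar i) = SVar (Suc i)"
  by (auto simp: liftN_def liftS_def upN_nt_def upN_st_def upS_nt_def upS_st_def fun_eq_iff
      split: nat.split)

lemma subst_id [simp]: "subst NVar SVar \<phi> = \<phi>"
  by (induction \<phi>) auto

text \<open>Substitutions are infinite, while the calculus changes one variable at a time. Together
  with \<open>finite_fv\<close> this lemma cuts every substitution down to a finite initial
  part.\<close>

lemma subst_cong_fv:
  "(\<And>i. i \<in> fvN \<phi> \<Longrightarrow> \<sigma> i = \<sigma>' i) \<Longrightarrow> (\<And>i. i \<in> fvS \<phi> \<Longrightarrow> \<tau> i = \<tau>' i) \<Longrightarrow>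
   subst \<sigma> \<tau> \<phi> = subst \<sigma>' \<tau>' \<phi>"
proof (induction \<phi> arbitrary: \<sigma> \<tau> \<sigma>' \<tau>')
  case (AllN \<phi>)
  have "subst (liftN \<sigma>) (\<lambda>i. upN_st (\<tau> i)) \<phi> = subst (liftN \<sigma>') (\<lambda>i. upN_st (\<tau>' i)) \<phi>"
  proof (rule AllN.IH)
    show "liftN \<sigma> i = liftN \<sigma>' i" if "i \<in> fvN \<phi>" for i
      using AllN.prems(1) that by (cases i) auto
  qed (use AllN.prems in auto)
  then show ?case by simp
next
  case (AllS \<phi>)
  have "subst (\<lambda>i. upS_nt (\<sigma> i)) (liftS \<tau>) \<phi> = subst (\<lambda>i. upS_nt (\<sigma>' i)) (liftS \<tau>') \<phi>"
  proof (rule AllS.IH)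
    show "liftS \<tau> i = liftS \<tau>' i" if "i \<in> fvS \<phi>" for i
      using AllS.prems(2) that by (cases i) auto
  qed (use AllS.prems in auto)
  then show ?case by simp
next
  case (Imp \<phi> \<psi>)
  have "subst \<sigma> \<tau> \<phi> = subst \<sigma>' \<tau>' \<phi>" "subst \<sigma> \<tau> \<psi> = subst \<sigma>' \<tau>' \<psi>"
    by (rule Imp.IH; use Imp.prems in auto)+
  then show ?case by simp
qed (auto intro!: subst_term_cong)

lemma finite_fv_term:
  fixes t :: "('f, 'g) nterm" and T :: "('f, 'g) sterm"
  shows "finite (fvN_nt t) \<and> finite (fvS_nt t)" and "finite (fvN_st T) \<and> finite (fvS_st T)"
  by (induction t and T) auto

lemma finite_fv: "finite (fvN \<phi>)" "finite (fvS \<phi>)"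
proof -
  have vim: "{i. Suc i \<in> A} = Suc -` A" for A by auto
  have "finite (fvN \<phi>) \<and> finite (fvS \<phi>)"
    by (induction \<phi>) (auto simp: finite_fv_term vim intro!: finite_vimageI)
  then show "finite (fvN \<phi>)" "finite (fvS \<phi>)" by auto
qed

lemma subst_derived [simp]:
  "subst \<sigma> \<tau> (\<^bold>\<not> \<phi>) = (\<^bold>\<not> subst \<sigma> \<tau> \<phi>)"
  "subst \<sigma> \<tau> (\<phi> \<^bold>\<and> \<psi>) = (subst \<sigma> \<tau> \<phi> \<^bold>\<and> subst \<sigma> \<tau> \<psi>)"
  "subst \<sigma> \<tau> (\<phi> \<^bold>\<or> \<psi>) = (subst \<sigma> \<tau> \<phi> \<^bold>\<or> subst \<sigma> \<tau> \<psi>)"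
  "subst \<sigma> \<tau> (\<phi> \<^bold>\<longleftrightarrow> \<psi>) = (subst \<sigma> \<tau> \<phi> \<^bold>\<longleftrightarrow> subst \<sigma> \<tau> \<psi>)"
  "subst \<sigma> \<tau> (s \<^bold>< t) = (subst_nt \<sigma> \<tau> s \<^bold>< subst_nt \<sigma> \<tau> t)"
  "subst \<sigma> \<tau> (ExN \<phi>) = ExN (subst (liftN \<sigma>) (\<lambda>i. upN_st (\<tau> i)) \<phi>)"
  "subst \<sigma> \<tau> (AllLe t \<phi>) = AllLe (subst_nt \<sigma> \<tau> t) (subst (liftN \<sigma>) (\<lambda>i. upN_st (\<tau> i)) \<phi>)"
  "subst \<sigma> \<tau> (ExLe t \<phi>) = ExLe (subst_nt \<sigma> \<tau> t) (subst (liftN \<sigma>) (\<lambda>i. upN_st (\<tau> i)) \<phi>)"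
  "subst \<sigma> \<tau> (AllLt t \<phi>) = AllLt (subst_nt \<sigma> \<tau> t) (subst (liftN \<sigma>) (\<lambda>i. upN_st (\<tau> i)) \<phi>)"
  by (auto simp: Neg_def Conj_def Disj_def Iff_def Lt_def ExN_def AllLe_def ExLe_def AllLt_def
      subst_lift_up)

lemma qfree_subst [simp]: "qfree (subst \<sigma> \<tau> \<phi>) = qfree \<phi>"
  by (induction \<phi> arbitrary: \<sigma> \<tau>) auto

lemma Sigma0B_subst: "Sigma0B \<phi> \<Longrightarrow> Sigma0B (subst \<sigma> \<tau> \<phi>)"
  by (induction arbitrary: \<sigma> \<tau> rule: Sigma0B.induct) (auto intro: Sigma0B.intros)

definition nterms :: "language \<Rightarrow> num set" where
  "nterms L = {t. wf_nt t \<and> nsyms_nt t \<subseteq> fst L \<and> ssyms_nt t \<subseteq> snd L}"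

definition sterms :: "language \<Rightarrow> str set" where
  "sterms L = {T. wf_st T \<and> nsyms_st T \<subseteq> fst L \<and> ssyms_st T \<subseteq> snd L}"

lemma terms_simps [simp]:
  "NVar i \<in> nterms L" "Zero \<in> nterms L" "One \<in> nterms L"
  "s \<^bold>+ t \<in> nterms L \<longleftrightarrow> s \<in> nterms L \<and> t \<in> nterms L"
  "s \<^bold>* t \<in> nterms L \<longleftrightarrow> s \<in> nterms L \<and> t \<in> nterms L"
  "Len T \<in> nterms L \<longleftrightarrow> T \<in> sterms L"
  "NFun f ts Ts \<in> nterms L \<longleftrightarrow>
     f \<in> fst L \<and> (length ts, length Ts) = arity_n f \<and> set ts \<subseteq> nterms L \<and> set Ts \<subseteq> sterms L"
  "SVar i \<in> sterms L"
  "SFun g ts Ts \<in> sterms L \<longleftrightarrow>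
     g \<in> snd L \<and> (length ts, length Ts) = arity_s g \<and> set ts \<subseteq> nterms L \<and> set Ts \<subseteq> sterms L"
  by (auto simp: nterms_def sterms_def list_all_iff)

lemma formulas_simps [simp]:
  "Falsum \<in> formulas L"
  "(s \<^bold>=\<^sub>1 t) \<in> formulas L \<longleftrightarrow> s \<in> nterms L \<and> t \<in> nterms L"
  "(S \<^bold>=\<^sub>2 T) \<in> formulas L \<longleftrightarrow> S \<in> sterms L \<and> T \<in> sterms L"
  "(s \<^bold>\<le> t) \<in> formulas L \<longleftrightarrow> s \<in> nterms L \<and> t \<in> nterms L"
  "(t \<^bold>\<in> T) \<in> formulas L \<longleftrightarrow> t \<in> nterms L \<and> T \<in> sterms L"
  "(\<phi> \<^bold>\<longrightarrow> \<psi>) \<in> formulas L \<longleftrightarrow> \<phi> \<in> formulas L \<and> \<psi> \<in> formulas L"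
  "AllN \<phi> \<in> formulas L \<longleftrightarrow> \<phi> \<in> formulas L"
  "AllS \<phi> \<in> formulas L \<longleftrightarrow> \<phi> \<in> formulas L"
  by (auto simp: formulas_def nterms_def sterms_def)

lemma subst_terms:
  assumes "\<And>i. \<sigma> i \<in> nterms L" "\<And>i. \<tau> i \<in> sterms L"
  shows "t \<in> nterms L \<Longrightarrow> subst_nt \<sigma> \<tau> t \<in> nterms L"
    and "T \<in> sterms L \<Longrightarrow> subst_st \<sigma> \<tau> T \<in> sterms L"
  by (induction t and T) (use assms in auto)

lemma up_terms [simp]:
  "upN_nt t \<in> nterms L \<longleftrightarrow> t \<in> nterms L" "upS_nt t \<in> nterms L \<longleftrightarrow> t \<in> nterms L"
  "upN_st T \<in> sterms L \<longleftrightarrow> T \<in> sterms L" "upS_st T \<in> sterms L \<longleftrightarrow> T \<in> sterms L"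
proof -
  show "upN_nt t \<in> nterms L \<longleftrightarrow> t \<in> nterms L" "upS_nt t \<in> nterms L \<longleftrightarrow> t \<in> nterms L"
    "upN_st T \<in> sterms L \<longleftrightarrow> T \<in> sterms L" "upS_st T \<in> sterms L \<longleftrightarrow> T \<in> sterms L"
    unfolding upN_nt_def upS_nt_def upN_st_def upS_st_def
    by (induction t and T) auto
qed

lemma formulas_derived [simp]:
  "(\<^bold>\<not> \<phi>) \<in> formulas L \<longleftrightarrow> \<phi> \<in> formulas L"
  "(\<phi> \<^bold>\<and> \<psi>) \<in> formulas L \<longleftrightarrow> \<phi> \<in> formulas L \<and> \<psi> \<in> formulas L"
  "(\<phi> \<^bold>\<or> \<psi>) \<in> formulas L \<longleftrightarrow> \<phi> \<in> formulas L \<and> \<psi> \<in> formulas L"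
  "(\<phi> \<^bold>\<longleftrightarrow> \<psi>) \<in> formulas L \<longleftrightarrow> \<phi> \<in> formulas L \<and> \<psi> \<in> formulas L"
  "(s \<^bold>< t) \<in> formulas L \<longleftrightarrow> s \<in> nterms L \<and> t \<in> nterms L"
  "ExN \<phi> \<in> formulas L \<longleftrightarrow> \<phi> \<in> formulas L"
  "ExS \<phi> \<in> formulas L \<longleftrightarrow> \<phi> \<in> formulas L"
  "AllLe t \<phi> \<in> formulas L \<longleftrightarrow> t \<in> nterms L \<and> \<phi> \<in> formulas L"
  "ExLe t \<phi> \<in> formulas L \<longleftrightarrow> t \<in> nterms L \<and> \<phi> \<in> formulas L"
  "AllLt t \<phi> \<in> formulas L \<longleftrightarrow> t \<in> nterms L \<and> \<phi> \<in> formulas L"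
  "ExSLe t \<phi> \<in> formulas L \<longleftrightarrow> t \<in> nterms L \<and> \<phi> \<in> formulas L"
  by (auto simp: Neg_def Conj_def Disj_def Iff_def Lt_def ExN_def ExS_def AllLe_def ExLe_def
      AllLt_def ExSLe_def)

lemma subst_formulas:
  assumes "\<phi> \<in> formulas L" "\<And>i. \<sigma> i \<in> nterms L" "\<And>i. \<tau> i \<in> sterms L"
  shows "subst \<sigma> \<tau> \<phi> \<in> formulas L"
  using assms
proof (induction \<phi> arbitrary: \<sigma> \<tau>)
  case (AllN \<phi>)
  have "liftN \<sigma> i \<in> nterms L" for i
    using AllN.prems by (cases i) auto
  then show ?case using AllN by simp
next
  case (AllS \<phi>)
  have "liftS \<tau> i \<in> sterms L" for i
    using AllS.prems by (cases i) auto
  then show ?case using AllS by simp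
qed (auto simp: subst_terms)

lemma inst_formulas:
  "\<phi> \<in> formulas L \<Longrightarrow> t \<in> nterms L \<Longrightarrow> instN t \<phi> \<in> formulas L"
  "\<phi> \<in> formulas L \<Longrightarrow> T \<in> sterms L \<Longrightarrow> instS T \<phi> \<in> formulas L"
  unfolding instN_def instS_def by (rule subst_formulas; auto split: nat.split)+

lemma up_formulas:
  "\<phi> \<in> formulas L \<Longrightarrow> upN \<phi> \<in> formulas L"
  "\<phi> \<in> formulas L \<Longrightarrow> upS \<phi> \<in> formulas L"
  unfolding upN_def upS_def by (rule subst_formulas; auto)+

section \<open>Semantics\<close>

text \<open>Strings are interpreted by sets of numbers, so structures are extensional by
  construction, but the string quantifiers only range over \<open>m_strs\<close>.\<close>

record 'n struct =
  m_zero :: 'n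
  m_one :: 'n
  m_plus :: "'n \<Rightarrow> 'n \<Rightarrow> 'n"
  m_times :: "'n \<Rightarrow> 'n \<Rightarrow> 'n"
  m_le :: "'n \<Rightarrow> 'n \<Rightarrow> bool"
  m_strs :: "'n set set"
  m_len :: "'n set \<Rightarrow> 'n"

type_synonym ('f, 'n) nint = "'f \<Rightarrow> 'n list \<Rightarrow> 'n set list \<Rightarrow> 'n"
type_synonym ('g, 'n) sint = "'g \<Rightarrow> 'n list \<Rightarrow> 'n set list \<Rightarrow> 'n set"

primrec eval_nt :: "'n struct \<Rightarrow> ('f, 'n) nint \<Rightarrow> ('g, 'n) sint \<Rightarrow> (nat \<Rightarrow> 'n) \<Rightarrow> (nat \<Rightarrow> 'n set) \<Rightarrow>
      ('f, 'g) nterm \<Rightarrow> 'n"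
  and eval_st :: "'n struct \<Rightarrow> ('f, 'n) nint \<Rightarrow> ('g, 'n) sint \<Rightarrow> (nat \<Rightarrow> 'n) \<Rightarrow> (nat \<Rightarrow> 'n set) \<Rightarrow>
      ('f, 'g) sterm \<Rightarrow> 'n set"
where
  "eval_nt M I J e E (NVar i) = e i"
| "eval_nt M I J e E Zero = m_zero M"
| "eval_nt M I J e E One = m_one M"
| "eval_nt M I J e E (s \<^bold>+ t) = m_plus M (eval_nt M I J e E s) (eval_nt M I J e E t)"
| "eval_nt M I J e E (s \<^bold>* t) = m_times M (eval_nt M I J e E s) (eval_nt M I J e E t)"
| "eval_nt M I J e E (Len T) = m_len M (eval_st M I J e E T)"
| "eval_nt M I J e E (NFun f ts Ts) = I f (map (eval_nt M I J e E) ts) (map (eval_st M I J e E) Ts)"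
| "eval_st M I J e E (SVar i) = E i"
| "eval_st M I J e E (SFun g ts Ts) = J g (map (eval_nt M I J e E) ts) (map (eval_st M I J e E) Ts)"

primrec sat :: "'n struct \<Rightarrow> ('f, 'n) nint \<Rightarrow> ('g, 'n) sint \<Rightarrow> (nat \<Rightarrow> 'n) \<Rightarrow> (nat \<Rightarrow> 'n set) \<Rightarrow>
      ('f, 'g) fm \<Rightarrow> bool"
where
  "sat M I J e E Falsum = False"
| "sat M I J e E (s \<^bold>=\<^sub>1 t) = (eval_nt M I J e E s = eval_nt M I J e E t)"
| "sat M I J e E (S \<^bold>=\<^sub>2 T) = (eval_st M I J e E S = eval_st M I J e E T)"
| "sat M I J e E (s \<^bold>\<le> t) = m_le M (eval_nt M I J e E s) (eval_nt M I J e E t)"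
| "sat M I J e E (t \<^bold>\<in> T) = (eval_nt M I J e E t \<in> eval_st M I J e E T)"
| "sat M I J e E (\<phi> \<^bold>\<longrightarrow> \<psi>) = (sat M I J e E \<phi> \<longrightarrow> sat M I J e E \<psi>)"
| "sat M I J e E (AllN \<phi>) = (\<forall>a. sat M I J (case_nat a e) E \<phi>)"
| "sat M I J e E (AllS \<phi>) = (\<forall>A\<in>m_strs M. sat M I J e (case_nat A E) \<phi>)"

lemma eval_subst:
  shows "eval_nt M I J e E (subst_nt \<sigma> \<tau> t) =
      eval_nt M I J (\<lambda>i. eval_nt M I J e E (\<sigma> i)) (\<lambda>i. eval_st M I J e E (\<tau> i)) t"
    and "eval_st M I J e E (subst_st \<sigma> \<tau> T) =
      eval_st M I J (\<lambda>i. eval_nt M I J e E (\<sigma> i)) (\<lambda>i. eval_st M I J e E (\<tau> i)) T"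
  by (induction t and T) (auto simp: comp_def cong: map_cong)

lemma eval_up [simp]:
  "eval_nt M I J (case_nat a e) E (upN_nt t) = eval_nt M I J e E t"
  "eval_st M I J (case_nat a e) E (upN_st T) = eval_st M I J e E T"
  "eval_nt M I J e (case_nat A E) (upS_nt t) = eval_nt M I J e E t"
  "eval_st M I J e (case_nat A E) (upS_st T) = eval_st M I J e E T"
  by (auto simp: upN_nt_def upN_st_def upS_nt_def upS_st_def eval_subst)

lemma eval_lift [simp]:
  "(\<lambda>i. eval_nt M I J (case_nat a e) E (liftN \<sigma> i)) = case_nat a (\<lambda>i. eval_nt M I J e E (\<sigma> i))"
  "(\<lambda>i. eval_st M I J e (case_nat A E) (liftS \<tau> i)) = case_nat A (\<lambda>i. eval_st M I J e E (\<tau> i))"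
  by (auto simp: fun_eq_iff split: nat.split)

lemma sat_subst:
  "sat M I J e E (subst \<sigma> \<tau> \<phi>) =
     sat M I J (\<lambda>i. eval_nt M I J e E (\<sigma> i)) (\<lambda>i. eval_st M I J e E (\<tau> i)) \<phi>"
  by (induction \<phi> arbitrary: \<sigma> \<tau> e E) (auto simp: eval_subst)

lemma sat_inst:
  "sat M I J e E (instN t \<phi>) = sat M I J (case_nat (eval_nt M I J e E t) e) E \<phi>"
  "sat M I J e E (instS T \<phi>) = sat M I J e (case_nat (eval_st M I J e E T) E) \<phi>"
proof -
  have "(\<lambda>i. eval_nt M I J e E (case_nat t NVar i)) = case_nat (eval_nt M I J e E t) e"
    "(\<lambda>i. eval_st M I J e E (case_nat T SVar i)) = case_nat (eval_st M I J e E T) E"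
    by (auto simp: fun_eq_iff split: nat.split)
  then show "sat M I J e E (instN t \<phi>) = sat M I J (case_nat (eval_nt M I J e E t) e) E \<phi>"
    "sat M I J e E (instS T \<phi>) = sat M I J e (case_nat (eval_st M I J e E T) E) \<phi>"
    by (simp_all add: instN_def instS_def sat_subst)
qed

lemma sat_up [simp]:
  "sat M I J (case_nat a e) E (upN \<phi>) = sat M I J e E \<phi>"
  "sat M I J e (case_nat A E) (upS \<phi>) = sat M I J e E \<phi>"
  by (simp_all add: upN_def upS_def sat_subst)

lemma sat_derived [simp]:
  "sat M I J e E (\<^bold>\<not> \<phi>) = (\<not> sat M I J e E \<phi>)"
  "sat M I J e E (\<phi> \<^bold>\<and> \<psi>) = (sat M I J e E \<phi> \<and> sat M I J e E \<psi>)"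
  "sat M I J e E (\<phi> \<^bold>\<or> \<psi>) = (sat M I J e E \<phi> \<or> sat M I J e E \<psi>)"
  "sat M I J e E (\<phi> \<^bold>\<longleftrightarrow> \<psi>) = (sat M I J e E \<phi> \<longleftrightarrow> sat M I J e E \<psi>)"
  "sat M I J e E (ExN \<phi>) = (\<exists>a. sat M I J (case_nat a e) E \<phi>)"
  "sat M I J e E (ExS \<phi>) = (\<exists>A\<in>m_strs M. sat M I J e (case_nat A E) \<phi>)"
  "sat M I J e E (s \<^bold>< t) = (m_le M (eval_nt M I J e E s) (eval_nt M I J e E t) \<and>
     eval_nt M I J e E s \<noteq> eval_nt M I J e E t)"
  "sat M I J e E (AllLe t \<phi>) =
     (\<forall>a. m_le M a (eval_nt M I J e E t) \<longrightarrow> sat M I J (case_nat a e) E \<phi>)"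
  "sat M I J e E (ExLe t \<phi>) =
     (\<exists>a. m_le M a (eval_nt M I J e E t) \<and> sat M I J (case_nat a e) E \<phi>)"
  "sat M I J e E (AllLt t \<phi>) =
     (\<forall>a. m_le M a (eval_nt M I J e E t) \<and> a \<noteq> eval_nt M I J e E t \<longrightarrow> sat M I J (case_nat a e) E \<phi>)"
  "sat M I J e E (ExSLe t \<phi>) =
     (\<exists>A\<in>m_strs M. m_le M (m_len M A) (eval_nt M I J e E t) \<and> sat M I J e (case_nat A E) \<phi>)"
  by (auto simp: Neg_def Conj_def Disj_def Iff_def Lt_def ExN_def ExS_def AllLe_def ExLe_def
      AllLt_def ExSLe_def)

lemma eval_cong:
  shows "(\<And>i. i \<in> fvN_nt t \<Longrightarrow> e i = e' i) \<Longrightarrow> (\<And>i. i \<in> fvS_nt t \<Longrightarrow> E i = E' i) \<Longrightarrow>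
      (\<And>f. f \<in> nsyms_nt t \<Longrightarrow> I f = I' f) \<Longrightarrow> (\<And>g. g \<in> ssyms_nt t \<Longrightarrow> J g = J' g) \<Longrightarrow>
      eval_nt M I J e E t = eval_nt M I' J' e' E' t"
    and "(\<And>i. i \<in> fvN_st T \<Longrightarrow> e i = e' i) \<Longrightarrow> (\<And>i. i \<in> fvS_st T \<Longrightarrow> E i = E' i) \<Longrightarrow>
      (\<And>f. f \<in> nsyms_st T \<Longrightarrow> I f = I' f) \<Longrightarrow> (\<And>g. g \<in> ssyms_st T \<Longrightarrow> J g = J' g) \<Longrightarrow>
      eval_st M I J e E T = eval_st M I' J' e' E' T"
proof (induction t and T)
  case (NFun f ts Ts)
  have "map (eval_nt M I J e E) ts = map (eval_nt M I' J' e' E') ts"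
    "map (eval_st M I J e E) Ts = map (eval_st M I' J' e' E') Ts"
    by (intro map_cong refl NFun.IH NFun.prems; auto)+
  then show ?case using NFun.prems(3)[of f] by (simp del: map_eq_conv)
next
  case (SFun g ts Ts)
  have "map (eval_nt M I J e E) ts = map (eval_nt M I' J' e' E') ts"
    "map (eval_st M I J e E) Ts = map (eval_st M I' J' e' E') Ts"
    by (intro map_cong refl SFun.IH SFun.prems; auto)+
  then show ?case using SFun.prems(4)[of g] by (simp del: map_eq_conv)
qed auto

lemma sat_cong:
  "(\<And>i. i \<in> fvN \<phi> \<Longrightarrow> e i = e' i) \<Longrightarrow> (\<And>i. i \<in> fvS \<phi> \<Longrightarrow> E i = E' i) \<Longrightarrow>
   (\<And>f. f \<in> nsyms \<phi> \<Longrightarrow> I f = I' f) \<Longrightarrow> (\<And>g. g \<in> ssyms \<phi> \<Longrightarrow> J g = J' g) \<Longrightarrow>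
   sat M I J e E \<phi> = sat M I' J' e' E' \<phi>"
proof (induction \<phi> arbitrary: e e' E E')
  case (Imp \<phi> \<psi>)
  have "sat M I J e E \<phi> = sat M I' J' e' E' \<phi>" "sat M I J e E \<psi> = sat M I' J' e' E' \<psi>"
    by (rule Imp.IH; use Imp.prems in auto)+
  then show ?case by simp
next
  case (AllN \<phi>)
  have "sat M I J (case_nat a e) E \<phi> = sat M I' J' (case_nat a e') E' \<phi>" for a
    by (rule AllN.IH) (use AllN.prems in \<open>auto split: nat.split\<close>)
  then show ?case by simp
next
  case (AllS \<phi>)
  have "sat M I J e (case_nat a E) \<phi> = sat M I' J' e' (case_nat a E') \<phi>" for a
    by (rule AllS.IH) (use AllS.prems in \<open>auto split: nat.split\<close>)
  then show ?case by simp
next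
  case (EqN s t)
  show ?case unfolding sat.simps
    by (rule arg_cong2[where f = "(=)"]; rule eval_cong; use EqN in auto)
next
  case (EqS S T)
  show ?case unfolding sat.simps
    by (rule arg_cong2[where f = "(=)"]; rule eval_cong; use EqS in auto)
next
  case (Le s t)
  show ?case unfolding sat.simps
    by (rule arg_cong2[where f = "m_le M"]; rule eval_cong; use Le in auto)
next
  case (Mem t T)
  show ?case unfolding sat.simps
    by (rule arg_cong2[where f = "(\<in>)"]; rule eval_cong; use Mem in auto)
qed auto

text \<open>The symbols themselves may be replaced by functions. This is how the formulas inside a
  symbol are evaluated in the recursion that defines \<open>nI\<close> and
  \<open>sI\<close>.\<close>

lemma eval_map:
  shows "eval_nt M I J e E (map_nterm a b t) = eval_nt M (\<lambda>f. I (a f)) (\<lambda>g. J (b g)) e E t"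
    and "eval_st M I J e E (map_sterm a b T) = eval_st M (\<lambda>f. I (a f)) (\<lambda>g. J (b g)) e E T"
  by (induction t and T) (auto simp: comp_def cong: map_cong)

lemma sat_map: "sat M I J e E (map_fm a b \<phi>) = sat M (\<lambda>f. I (a f)) (\<lambda>g. J (b g)) e E \<phi>"
  by (induction \<phi> arbitrary: e E) (auto simp: eval_map)

definition models :: "'n struct \<Rightarrow> ('f, 'n) nint \<Rightarrow> ('g, 'n) sint \<Rightarrow> ('f, 'g) fm set \<Rightarrow> bool" where
  "models M I J \<Phi> \<longleftrightarrow> (\<forall>\<phi>\<in>\<Phi>. \<forall>e E. range E \<subseteq> m_strs M \<longrightarrow> sat M I J e E \<phi>)"

lemma modelsD: "models M I J \<Phi> \<Longrightarrow> \<phi> \<in> \<Phi> \<Longrightarrow> range E \<subseteq> m_strs M \<Longrightarrow> sat M I J e E \<phi>"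
  by (auto simp: models_def)

lemma eval_st_strs:
  "range E \<subseteq> m_strs M \<Longrightarrow> (\<And>g as As. J g as As \<in> m_strs M) \<Longrightarrow> eval_st M I J e E T \<in> m_strs M"
  by (cases T) auto

lemma range_case_nat: "range E \<subseteq> A \<Longrightarrow> B \<in> A \<Longrightarrow> range (case_nat B E) \<subseteq> A"
  by (auto simp: image_subset_iff split: nat.split)

text \<open>All values of \<open>J\<close> have to lie in the range of the string quantifiers: the
  axiom \<open>InstS\<close> instantiates with arbitrary string terms, so every such term must
  denote an element of \<open>m_strs\<close>.\<close>

theorem soundness:
  assumes "derives L A \<phi>" and A: "models M I J (A \<inter> formulas L)"
    and J: "\<And>g as As. J g as As \<in> m_strs M" and E: "range E \<subseteq> m_strs M"
  shows "sat M I J e E \<phi>"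
  using assms(1) E
proof (induction arbitrary: e E rule: derives.induct)
  case (Axiom \<phi>)
  then show ?case using A by (auto simp: models_def)
next
  case (GenS \<phi>)
  have "sat M I J e (case_nat B E) \<phi>" if "B \<in> m_strs M" for B
    using GenS that by (intro GenS.IH range_case_nat)
  then show ?case by simp
next
  case (InstS \<phi> T)
  then show ?case using eval_st_strs[OF InstS.prems J, where I = I and T = T] by (auto simp: sat_inst)
qed (auto simp: sat_inst)

text \<open>Countability lets the Henkin construction treat the formulas one after the
  other.\<close>

instance nterm :: (countable, countable) countable by countable_datatype
instance sterm :: (countable, countable) countable by countable_datatype
instance fm :: (countable, countable) countable by countable_datatype
instance nfun :: countable by countable_datatype
instance sfun :: countable by countable_datatype

section \<open>Completeness\<close>

lemma derives_formulas: "derives L A \<phi> \<Longrightarrow> \<phi> \<in> formulas L"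
  by (induction rule: derives.induct) auto

text \<open>The calculus instantiates only the outermost quantifier, hence variable 0. Each round of
  generalization and instantiation consumes one variable and lowers all others, so \<open>k\<close>
  rounds substitute for the first \<open>k\<close> variables and shift the rest down by
  \<open>k\<close>.\<close>

lemma derives_substN_initial:
  assumes "derives L A \<phi>" "\<And>i. \<sigma> i \<in> nterms L"
  shows "derives L A (subst (\<lambda>i. if i < k then \<sigma> i else NVar (i - k)) SVar \<phi>)"
  using assms
proof (induction k arbitrary: \<phi> \<sigma>)
  case (Suc k)
  \<comment> \<open>The remaining \<open>k\<close> rounds lower the variables of this term by
    \<open>k\<close>, so they are raised by \<open>k\<close> beforehand.\<close>
  define t where "t = subst_nt (\<lambda>i. NVar (i + k)) SVar (\<sigma> 0)"
  have t: "t \<in> nterms L"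
    unfolding t_def by (rule subst_terms) (use Suc.prems in auto)
  have "(AllN \<phi> \<^bold>\<longrightarrow> instN t \<phi>) \<in> formulas L"
    using derives_formulas[OF Suc.prems(1)] t by (auto intro: inst_formulas)
  then have "derives L A (instN t \<phi>)"
    using derives.MP[OF derives.InstN derives.GenN[OF Suc.prems(1)]] by blast
  from Suc.IH[OF this, of "\<lambda>i. \<sigma> (Suc i)"] Suc.prems
  have *: "derives L A
      (subst (\<lambda>i. if i < k then \<sigma> (Suc i) else NVar (i - k)) SVar (instN t \<phi>))" by auto
  have "(\<lambda>i. subst_nt (\<lambda>i. if i < k then \<sigma> (Suc i) else NVar (i - k)) SVar (case_nat t NVar i)) =
      (\<lambda>i. if i < Suc k then \<sigma> i else NVar (i - Suc k))"
    by (auto simp: fun_eq_iff t_def subst_comp_term split: nat.split)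
  then show ?case using * by (simp add: instN_def subst_comp)
qed auto

lemma derives_substS_initial:
  assumes "derives L A \<phi>" "\<And>i. \<tau> i \<in> sterms L"
  shows "derives L A (subst NVar (\<lambda>i. if i < k then \<tau> i else SVar (i - k)) \<phi>)"
  using assms
proof (induction k arbitrary: \<phi> \<tau>)
  case (Suc k)
  define T where "T = subst_st NVar (\<lambda>i. SVar (i + k)) (\<tau> 0)"
  have T: "T \<in> sterms L"
    unfolding T_def by (rule subst_terms) (use Suc.prems in auto)
  have "(AllS \<phi> \<^bold>\<longrightarrow> instS T \<phi>) \<in> formulas L"
    using derives_formulas[OF Suc.prems(1)] T by (auto intro: inst_formulas)
  then have "derives L A (instS T \<phi>)"
    using derives.MP[OF derives.InstS derives.GenS[OF Suc.prems(1)]] by blast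
  from Suc.IH[OF this, of "\<lambda>i. \<tau> (Suc i)"] Suc.prems
  have *: "derives L A
      (subst NVar (\<lambda>i. if i < k then \<tau> (Suc i) else SVar (i - k)) (instS T \<phi>))" by auto
  have "(\<lambda>i. subst_st NVar (\<lambda>i. if i < k then \<tau> (Suc i) else SVar (i - k)) (case_nat T SVar i)) =
      (\<lambda>i. if i < Suc k then \<tau> i else SVar (i - Suc k))"
    by (auto simp: fun_eq_iff T_def subst_comp_term split: nat.split)
  then show ?case using * by (simp add: instS_def subst_comp)
qed auto

lemma derives_subst:
  assumes "derives L A \<phi>" "\<And>i. \<sigma> i \<in> nterms L" "\<And>i. \<tau> i \<in> sterms L"
  shows "derives L A (subst \<sigma> \<tau> \<phi>)"
proof -
  obtain k where k: "\<And>i. i \<in> fvN \<phi> \<Longrightarrow> i < k"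
    using finite_fv(1)[of \<phi>] finite_nat_set_iff_bounded by auto
  obtain m where m: "\<And>i. i \<in> fvS \<phi> \<Longrightarrow> i < m"
    using finite_fv(2)[of \<phi>] finite_nat_set_iff_bounded by auto
  \<comment> \<open>The number variables of \<open>\<tau>\<close> are moved out of the way of the substitution by \<open>\<sigma>\<close>.\<close>
  define \<tau>' where "\<tau>' i = subst_st (\<lambda>i. NVar (i + k)) SVar (\<tau> i)" for i
  have "\<tau>' i \<in> sterms L" for i
    unfolding \<tau>'_def by (rule subst_terms) (use assms in auto)
  from derives_substN_initial[OF derives_substS_initial[OF assms(1) this, of m] assms(2), of k]
  have "derives L A (subst (\<lambda>i. if i < k then \<sigma> i else NVar (i - k))
    (\<lambda>i. subst_st (\<lambda>i. if i < k then \<sigma> i else NVar (i - k)) SVar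
       (if i < m then \<tau>' i else SVar (i - m))) \<phi>)"
    by (simp add: subst_comp)
  also have "subst (\<lambda>i. if i < k then \<sigma> i else NVar (i - k))
    (\<lambda>i. subst_st (\<lambda>i. if i < k then \<sigma> i else NVar (i - k)) SVar
       (if i < m then \<tau>' i else SVar (i - m))) \<phi> = subst \<sigma> \<tau> \<phi>"
    by (rule subst_cong_fv) (auto simp: k m \<tau>'_def subst_comp_term)
  finally show ?thesis .
qed

text \<open>Only modus ponens applies to the hypotheses and never generalization. Therefore the
  deduction theorem holds also for hypotheses with free variables.\<close>

inductive prov :: "language \<Rightarrow> form set \<Rightarrow> form set \<Rightarrow> form \<Rightarrow> bool" for L A \<Gamma> where
  thy: "derives L A \<phi> \<Longrightarrow> prov L A \<Gamma> \<phi>"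
| hyp: "\<phi> \<in> \<Gamma> \<Longrightarrow> \<phi> \<in> formulas L \<Longrightarrow> prov L A \<Gamma> \<phi>"
| modus: "prov L A \<Gamma> (\<phi> \<^bold>\<longrightarrow> \<psi>) \<Longrightarrow> prov L A \<Gamma> \<phi> \<Longrightarrow> prov L A \<Gamma> \<psi>"

lemma prov_formulas: "prov L A \<Gamma> \<phi> \<Longrightarrow> \<phi> \<in> formulas L"
  by (induction rule: prov.induct) (auto simp: derives_formulas)

lemma prov_mono:
  assumes "prov L A \<Gamma> \<phi>" "\<Gamma> \<subseteq> \<Delta>"
  shows "prov L A \<Delta> \<phi>"
  using assms(1)
proof (induction rule: prov.induct)
  case (modus \<phi> \<psi>)
  from modus.IH show ?case by (rule prov.modus)
qed (use assms(2) in \<open>auto intro: prov.thy prov.hyp\<close>)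

lemma prov_empty: "prov L A {} \<phi> \<Longrightarrow> derives L A \<phi>"
proof (induction rule: prov.induct)
  case (modus \<phi> \<psi>)
  from modus.IH show ?case by (rule derives.MP)
qed auto

lemma prov_K: "prov L A \<Gamma> \<phi> \<Longrightarrow> \<chi> \<in> formulas L \<Longrightarrow> prov L A \<Gamma> (\<chi> \<^bold>\<longrightarrow> \<phi>)"
  by (rule prov.modus[OF prov.thy[OF derives.K]]) (auto dest: prov_formulas)

lemma prov_S:
  assumes "prov L A \<Gamma> (\<chi> \<^bold>\<longrightarrow> \<phi> \<^bold>\<longrightarrow> \<psi>)" "prov L A \<Gamma> (\<chi> \<^bold>\<longrightarrow> \<phi>)"
  shows "prov L A \<Gamma> (\<chi> \<^bold>\<longrightarrow> \<psi>)"
proof -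
  have "prov L A \<Gamma> ((\<chi> \<^bold>\<longrightarrow> \<phi> \<^bold>\<longrightarrow> \<psi>) \<^bold>\<longrightarrow> (\<chi> \<^bold>\<longrightarrow> \<phi>) \<^bold>\<longrightarrow> \<chi> \<^bold>\<longrightarrow> \<psi>)"
    using prov_formulas[OF assms(1)] by (intro prov.thy derives.S) auto
  from prov.modus[OF prov.modus[OF this assms(1)] assms(2)] show ?thesis .
qed

lemma prov_deduction:
  assumes "prov L A (insert \<chi> \<Gamma>) \<phi>" "\<chi> \<in> formulas L"
  shows "prov L A \<Gamma> (\<chi> \<^bold>\<longrightarrow> \<phi>)"
  using assms
proof (induction rule: prov.induct)
  case (hyp \<phi>)
  have "prov L A \<Gamma> (\<chi> \<^bold>\<longrightarrow> \<chi>)"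
    by (rule prov_S[where \<phi> = "\<chi> \<^bold>\<longrightarrow> \<chi>"]; rule prov.thy[OF derives.K]) (use hyp in auto)
  then show ?case using hyp by (auto intro: prov_K prov.hyp)
next
  case (modus \<phi> \<psi>)
  from modus.IH(1)[OF modus.prems] modus.IH(2)[OF modus.prems] show ?case by (rule prov_S)
qed (auto intro: prov_K prov.thy)

lemma prov_finite:
  "prov L A \<Gamma> \<phi> \<Longrightarrow> \<exists>\<Delta>. \<Delta> \<subseteq> \<Gamma> \<and> finite \<Delta> \<and> prov L A \<Delta> \<phi>"
proof (induction rule: prov.induct)
  case (thy \<phi>)
  then have "prov L A {} \<phi>" by (rule prov.thy)
  then show ?case by (intro exI[of _ "{}"]) simp
next
  case (hyp \<phi>)
  then have "prov L A {\<phi>} \<phi>" by (intro prov.hyp) auto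
  then show ?case using hyp(1) by (intro exI[of _ "{\<phi>}"]) simp
next
  case (modus \<phi> \<psi>)
  from modus.IH obtain \<Delta> \<Delta>' where *: "\<Delta> \<subseteq> \<Gamma>" "finite \<Delta>" "prov L A \<Delta> (\<phi> \<^bold>\<longrightarrow> \<psi>)"
    "\<Delta>' \<subseteq> \<Gamma>" "finite \<Delta>'" "prov L A \<Delta>' \<phi>" by metis
  have "prov L A (\<Delta> \<union> \<Delta>') \<psi>"
    by (rule prov.modus[OF prov_mono[OF *(3)] prov_mono[OF *(6)]]) auto
  with * show ?case by (intro exI[of _ "\<Delta> \<union> \<Delta>'"]) simp
qed

lemma prov_foldr_Imp:
  "prov L A (set G \<union> \<Gamma>) \<phi> \<Longrightarrow> set G \<subseteq> formulas L \<Longrightarrow> prov L A \<Gamma> (foldr Imp G \<phi>)"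
proof (induction G arbitrary: \<Gamma>)
  case (Cons g G)
  have "prov L A (insert g \<Gamma>) (foldr Imp G \<phi>)"
    using Cons.prems by (intro Cons.IH) auto
  then show ?case using Cons.prems by (auto intro: prov_deduction)
qed auto

lemma prov_notI: "prov L A (insert \<phi> \<Gamma>) Falsum \<Longrightarrow> \<phi> \<in> formulas L \<Longrightarrow> prov L A \<Gamma> (\<^bold>\<not> \<phi>)"
  unfolding Neg_def by (rule prov_deduction)

lemma prov_ccontr:
  assumes "prov L A (insert (\<^bold>\<not> \<phi>) \<Gamma>) Falsum" "\<phi> \<in> formulas L"
  shows "prov L A \<Gamma> \<phi>"
proof -
  have "prov L A \<Gamma> ((\<phi> \<^bold>\<longrightarrow> Falsum) \<^bold>\<longrightarrow> Falsum)"
    using prov_notI[OF assms(1)] assms(2) by (simp add: Neg_def)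
  moreover have "prov L A \<Gamma> (((\<phi> \<^bold>\<longrightarrow> Falsum) \<^bold>\<longrightarrow> Falsum) \<^bold>\<longrightarrow> \<phi>)"
    using assms(2) by (intro prov.thy derives.DN) auto
  ultimately show ?thesis using prov.modus by metis
qed

lemma prov_notE: "prov L A \<Gamma> (\<^bold>\<not> \<phi>) \<Longrightarrow> prov L A \<Gamma> \<phi> \<Longrightarrow> prov L A \<Gamma> Falsum"
  unfolding Neg_def by (rule prov.modus)

lemma subst_foldr_Imp: "subst \<sigma> \<tau> (foldr Imp G \<phi>) = foldr Imp (map (subst \<sigma> \<tau>) G) (subst \<sigma> \<tau> \<phi>)"
  by (induction G) auto

text \<open>The quantifier is distributed over the implications by \<open>DistN\<close>; each
  premise then becomes a vacuous quantification, which \<open>VacN\<close> derives from the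
  hypothesis itself.\<close>

lemma prov_AllN_foldr:
  "prov L A \<Gamma> (AllN (foldr Imp (map upN G) \<chi>)) \<Longrightarrow> set G \<subseteq> \<Gamma> \<Longrightarrow> set G \<subseteq> formulas L \<Longrightarrow>
   prov L A \<Gamma> (AllN \<chi>)"
proof (induction G)
  case (Cons g G)
  let ?r = "foldr Imp (map upN G) \<chi>"
  have f: "AllN (upN g \<^bold>\<longrightarrow> ?r) \<in> formulas L"
    using prov_formulas[OF Cons.prems(1)] by simp
  have "prov L A \<Gamma> (AllN (upN g \<^bold>\<longrightarrow> ?r) \<^bold>\<longrightarrow> AllN (upN g) \<^bold>\<longrightarrow> AllN ?r)"
    using f by (intro prov.thy derives.DistN) auto
  moreover have "prov L A \<Gamma> (g \<^bold>\<longrightarrow> AllN (upN g))"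
    using Cons.prems by (intro prov.thy derives.VacN) (auto intro: up_formulas)
  moreover have "prov L A \<Gamma> g" using Cons.prems by (auto intro: prov.hyp)
  ultimately have "prov L A \<Gamma> (AllN ?r)" using Cons.prems(1) by (auto dest: prov.modus)
  then show ?case using Cons by auto
qed auto

lemma prov_AllS_foldr:
  "prov L A \<Gamma> (AllS (foldr Imp (map upS G) \<chi>)) \<Longrightarrow> set G \<subseteq> \<Gamma> \<Longrightarrow> set G \<subseteq> formulas L \<Longrightarrow>
   prov L A \<Gamma> (AllS \<chi>)"
proof (induction G)
  case (Cons g G)
  let ?r = "foldr Imp (map upS G) \<chi>"
  have f: "AllS (upS g \<^bold>\<longrightarrow> ?r) \<in> formulas L"
    using prov_formulas[OF Cons.prems(1)] by simp
  have "prov L A \<Gamma> (AllS (upS g \<^bold>\<longrightarrow> ?r) \<^bold>\<longrightarrow> AllS (upS g) \<^bold>\<longrightarrow> AllS ?r)"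
    using f by (intro prov.thy derives.DistS) auto
  moreover have "prov L A \<Gamma> (g \<^bold>\<longrightarrow> AllS (upS g))"
    using Cons.prems by (intro prov.thy derives.VacS) (auto intro: up_formulas)
  moreover have "prov L A \<Gamma> g" using Cons.prems by (auto intro: prov.hyp)
  ultimately have "prov L A \<Gamma> (AllS ?r)" using Cons.prems(1) by (auto dest: prov.modus)
  then show ?case using Cons by auto
qed auto

text \<open>A fresh variable acts as a fresh constant. The finitely many hypotheses move into the
  formula, the resulting theorem is renamed and generalized, and the quantifier is pushed back
  through the hypotheses, which do not contain the variable.\<close>

lemma prov_genN:
  assumes "prov L A \<Gamma> (instN (NVar i) \<chi>)" "finite \<Gamma>" "\<Gamma> \<subseteq> formulas L" "\<chi> \<in> formulas L"
    and fresh: "\<And>\<phi>. \<phi> \<in> \<Gamma> \<Longrightarrow> i \<notin> fvN \<phi>" "Suc i \<notin> fvN \<chi>"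
  shows "prov L A \<Gamma> (AllN \<chi>)"
proof -
  obtain G where G: "set G = \<Gamma>" using assms(2) finite_list by blast
  \<comment> \<open>This renaming makes variable \<open>i\<close> the one to be generalized and
    shifts all others up. It undoes the instance of \<open>\<chi>\<close> and turns each hypothesis
    \<open>g\<close> into \<open>upN g\<close>.\<close>
  let ?\<rho> = "\<lambda>j. if j = i then NVar 0 else NVar (Suc j)"
  have "derives L A (foldr Imp G (instN (NVar i) \<chi>))"
    using assms G by (intro prov_empty prov_foldr_Imp) auto
  then have "derives L A (subst ?\<rho> SVar (foldr Imp G (instN (NVar i) \<chi>)))"
    by (rule derives_subst) auto
  also have "subst ?\<rho> SVar (foldr Imp G (instN (NVar i) \<chi>)) = foldr Imp (map upN G) \<chi>"
  proof -
    have "subst ?\<rho> SVar g = upN g" if "g \<in> set G" for g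
      unfolding upN_def using fresh(1)[of g] that G by (intro subst_cong_fv) auto
    moreover have "subst ?\<rho> SVar (instN (NVar i) \<chi>) = subst NVar SVar \<chi>"
      unfolding instN_def subst_comp using fresh(2)
      by (intro subst_cong_fv) (auto split: nat.split)
    ultimately show ?thesis by (simp add: subst_foldr_Imp cong: map_cong)
  qed
  finally have "prov L A \<Gamma> (AllN (foldr Imp (map upN G) \<chi>))"
    by (auto intro: prov.thy derives.GenN)
  then show ?thesis using prov_AllN_foldr G assms(3) by blast
qed

lemma prov_genS:
  assumes "prov L A \<Gamma> (instS (SVar i) \<chi>)" "finite \<Gamma>" "\<Gamma> \<subseteq> formulas L" "\<chi> \<in> formulas L"
    and fresh: "\<And>\<phi>. \<phi> \<in> \<Gamma> \<Longrightarrow> i \<notin> fvS \<phi>" "Suc i \<notin> fvS \<chi>"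
  shows "prov L A \<Gamma> (AllS \<chi>)"
proof -
  obtain G where G: "set G = \<Gamma>" using assms(2) finite_list by blast
  let ?\<rho> = "\<lambda>j. if j = i then SVar 0 else SVar (Suc j)"
  have "derives L A (foldr Imp G (instS (SVar i) \<chi>))"
    using assms G by (intro prov_empty prov_foldr_Imp) auto
  then have "derives L A (subst NVar ?\<rho> (foldr Imp G (instS (SVar i) \<chi>)))"
    by (rule derives_subst) auto
  also have "subst NVar ?\<rho> (foldr Imp G (instS (SVar i) \<chi>)) = foldr Imp (map upS G) \<chi>"
  proof -
    have "subst NVar ?\<rho> g = upS g" if "g \<in> set G" for g
      unfolding upS_def using fresh(1)[of g] that G by (intro subst_cong_fv) auto
    moreover have "subst NVar ?\<rho> (instS (SVar i) \<chi>) = subst NVar SVar \<chi>"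
      unfolding instS_def subst_comp using fresh(2)
      by (intro subst_cong_fv) (auto split: nat.split)
    ultimately show ?thesis by (simp add: subst_foldr_Imp cong: map_cong)
  qed
  finally have "prov L A \<Gamma> (AllS (foldr Imp (map upS G) \<chi>))"
    by (auto intro: prov.thy derives.GenS)
  then show ?thesis using prov_AllS_foldr G assms(3) by blast
qed

definition consistent :: "language \<Rightarrow> form set \<Rightarrow> form set \<Rightarrow> bool" where
  "consistent L A \<Gamma> \<longleftrightarrow> \<Gamma> \<subseteq> formulas L \<and> \<not> prov L A \<Gamma> Falsum"

text \<open>Variables take the place of Henkin constants, so the language never grows: a rejected
  universal formula comes with a variable at which it fails.\<close>

definition decides :: "form set \<Rightarrow> form \<Rightarrow> bool" where
  "decides \<Gamma> \<psi> \<longleftrightarrow> \<psi> \<in> \<Gamma> \<or> (\<^bold>\<not> \<psi>) \<in> \<Gamma> \<and>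
     (\<forall>\<chi>. \<psi> = AllN \<chi> \<longrightarrow> (\<exists>i. (\<^bold>\<not> instN (NVar i) \<chi>) \<in> \<Gamma>)) \<and>
     (\<forall>\<chi>. \<psi> = AllS \<chi> \<longrightarrow> (\<exists>i. (\<^bold>\<not> instS (SVar i) \<chi>) \<in> \<Gamma>))"

lemma decides_mono: "decides \<Gamma> \<psi> \<Longrightarrow> \<Gamma> \<subseteq> \<Delta> \<Longrightarrow> decides \<Delta> \<psi>"
  unfolding decides_def by blast

lemma consistent_extend:
  assumes fin: "finite \<Gamma>" and cons: "consistent L A \<Gamma>" and \<psi>: "\<psi> \<in> formulas L"
  shows "\<exists>\<Delta>. finite \<Delta> \<and> \<Gamma> \<subseteq> \<Delta> \<and> consistent L A \<Delta> \<and> decides \<Delta> \<psi>"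
proof (cases "consistent L A (insert \<psi> \<Gamma>)")
  case True
  then show ?thesis using fin by (intro exI[of _ "insert \<psi> \<Gamma>"]) (auto simp: decides_def)
next
  case False
  then have neg: "prov L A \<Gamma> (\<^bold>\<not> \<psi>)"
    using cons \<psi> prov_notI[of L A \<psi> \<Gamma>] by (auto simp: consistent_def)
  have cons': "consistent L A (insert (\<^bold>\<not> \<psi>) \<Gamma>)"
    using cons \<psi> prov_ccontr[of L A \<psi> \<Gamma>] prov_notE[OF neg] by (auto simp: consistent_def)
  have F: "finite (\<Union> (fvN ` insert \<psi> \<Gamma>) \<union> \<Union> (fvS ` insert \<psi> \<Gamma>))" (is "finite ?F")
    using fin finite_fv by auto
  obtain i where i: "\<And>j. j \<ge> i \<Longrightarrow> j \<notin> ?F"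
    using F finite_nat_set_iff_bounded by (metis not_less)
  \<comment> \<open>If adding the negated instance were inconsistent, the instance would be
    provable; generalizing the fresh variable would then prove \<open>\<psi>\<close> itself, which
    is already refuted.\<close>
  have wit: "consistent L A (insert (\<^bold>\<not> \<xi>) (insert (\<^bold>\<not> \<psi>) \<Gamma>))"
    if gen: "prov L A (insert (\<^bold>\<not> \<psi>) \<Gamma>) \<xi> \<Longrightarrow> prov L A (insert (\<^bold>\<not> \<psi>) \<Gamma>) \<psi>"
      and "\<xi> \<in> formulas L" for \<xi>
  proof (rule ccontr)
    assume "\<not> ?thesis"
    then have "prov L A (insert (\<^bold>\<not> \<psi>) \<Gamma>) \<xi>"
      using cons' that(2) prov_ccontr[of L A \<xi>] by (auto simp: consistent_def)
    from prov_notE[OF prov_mono[OF neg] gen[OF this]]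
    have "prov L A (insert (\<^bold>\<not> \<psi>) \<Gamma>) Falsum" by auto
    then show False using cons' by (simp add: consistent_def)
  qed
  consider (N) \<chi> where "\<psi> = AllN \<chi>" | (S) \<chi> where "\<psi> = AllS \<chi>"
    | (other) "\<And>\<chi>. \<psi> \<noteq> AllN \<chi>" "\<And>\<chi>. \<psi> \<noteq> AllS \<chi>" by blast
  then show ?thesis
  proof cases
    case N
    have "consistent L A (insert (\<^bold>\<not> instN (NVar i) \<chi>) (insert (\<^bold>\<not> \<psi>) \<Gamma>))"
    proof (rule wit)
      assume "prov L A (insert (\<^bold>\<not> \<psi>) \<Gamma>) (instN (NVar i) \<chi>)"
      then show "prov L A (insert (\<^bold>\<not> \<psi>) \<Gamma>) \<psi>"
        unfolding N
        by (rule prov_genN)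
          (use fin \<psi> cons N i[of i] i[of "Suc i"] in
            \<open>auto simp: consistent_def Neg_def\<close>)
    qed (use \<psi> N in \<open>auto intro: inst_formulas\<close>)
    then show ?thesis using fin N
      by (intro exI[of _ "insert (\<^bold>\<not> instN (NVar i) \<chi>) (insert (\<^bold>\<not> \<psi>) \<Gamma>)"])
        (auto simp: decides_def)
  next
    case S
    have "consistent L A (insert (\<^bold>\<not> instS (SVar i) \<chi>) (insert (\<^bold>\<not> \<psi>) \<Gamma>))"
    proof (rule wit)
      assume "prov L A (insert (\<^bold>\<not> \<psi>) \<Gamma>) (instS (SVar i) \<chi>)"
      then show "prov L A (insert (\<^bold>\<not> \<psi>) \<Gamma>) \<psi>"
        unfolding S
        by (rule prov_genS)
          (use fin \<psi> cons S i[of i] i[of "Suc i"] in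
            \<open>auto simp: consistent_def Neg_def\<close>)
    qed (use \<psi> S in \<open>auto intro: inst_formulas\<close>)
    then show ?thesis using fin S
      by (intro exI[of _ "insert (\<^bold>\<not> instS (SVar i) \<chi>) (insert (\<^bold>\<not> \<psi>) \<Gamma>)"])
        (auto simp: decides_def)
  next
    case other
    then show ?thesis using fin cons'
      by (intro exI[of _ "insert (\<^bold>\<not> \<psi>) \<Gamma>"]) (auto simp: decides_def)
  qed
qed

locale henkin =
  fixes L :: language and A \<Gamma> :: "form set"
  assumes cons: "consistent L A \<Gamma>"
    and decides: "\<psi> \<in> formulas L \<Longrightarrow> decides \<Gamma> \<psi>"

lemma henkin_extend:
  assumes "finite \<Gamma>" "consistent L A \<Gamma>"
  obtains \<Delta> where "\<Gamma> \<subseteq> \<Delta>" "henkin L A \<Delta>"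
proof -
  let ?P = "\<lambda>\<Delta>. finite \<Delta> \<and> \<Gamma> \<subseteq> \<Delta> \<and> consistent L A \<Delta>"
  let ?Q = "\<lambda>n \<Delta> \<Delta>'. \<Delta> \<subseteq> \<Delta>' \<and>
    (from_nat n \<in> formulas L \<longrightarrow> decides \<Delta>' (from_nat n))"
  have step: "\<exists>\<Delta>'. ?P \<Delta>' \<and> ?Q n \<Delta> \<Delta>'" if P: "?P \<Delta>" for \<Delta> n
  proof (cases "from_nat n \<in> formulas L")
    case True
    then obtain \<Delta>' where "finite \<Delta>'" "\<Delta> \<subseteq> \<Delta>'" "consistent L A \<Delta>'" "decides \<Delta>' (from_nat n)"
      using consistent_extend[of \<Delta> L A "from_nat n"] P by auto
    then show ?thesis using P by (intro exI[of _ \<Delta>']) auto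
  next
    case False
    then show ?thesis using P by (intro exI[of _ \<Delta>]) auto
  qed
  \<comment> \<open>Stage \<open>n\<close> stays finite, so that fresh variables remain, and the
    next stage settles the formula with code \<open>n\<close>.\<close>
  have "\<exists>f. \<forall>n. ?P (f n) \<and> ?Q n (f n) (f (Suc n))"
    by (rule dependent_nat_choice) (use assms step in auto)
  then obtain f where f: "\<And>n. ?P (f n)" "\<And>n. ?Q n (f n) (f (Suc n))" by auto
  have mono: "f m \<subseteq> f n" if "m \<le> n" for m n
    by (rule lift_Suc_mono_le[OF _ that]) (use f(2) in auto)
  have chain: "\<exists>n. \<Delta> \<subseteq> f n" if "finite \<Delta>" "\<Delta> \<subseteq> (\<Union>n. f n)" for \<Delta>
    using that
  proof (induction)
    case (insert x \<Delta>)
    then obtain n m where "\<Delta> \<subseteq> f n" "x \<in> f m" by auto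
    then have "insert x \<Delta> \<subseteq> f (max m n)" using mono[of n "max m n"] mono[of m "max m n"] by auto
    then show ?case by (rule exI)
  qed simp
  have "\<not> prov L A (\<Union>n. f n) Falsum"
  proof
    assume "prov L A (\<Union>n. f n) Falsum"
    from prov_finite[OF this] obtain \<Delta> where \<Delta>: "\<Delta> \<subseteq> (\<Union>n. f n)" "finite \<Delta>" "prov L A \<Delta> Falsum"
      by auto
    from chain[OF \<Delta>(2,1)] obtain n where "\<Delta> \<subseteq> f n" by auto
    from prov_mono[OF \<Delta>(3) this] show False using f(1)[of n] by (simp add: consistent_def)
  qed
  moreover have "(\<Union>n. f n) \<subseteq> formulas L" using f(1) by (auto simp: consistent_def)
  moreover have "decides (\<Union>n. f n) \<psi>" if "\<psi> \<in> formulas L" for \<psi>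
  proof (rule decides_mono)
    show "decides (f (Suc (to_nat \<psi>))) \<psi>" using f(2)[of "to_nat \<psi>"] that by simp
  qed auto
  ultimately have "henkin L A (\<Union>n. f n)" by unfold_locales (simp_all add: consistent_def)
  moreover have "\<Gamma> \<subseteq> (\<Union>n. f n)" using f(1) by auto
  ultimately show thesis by (rule that[rotated])
qed

context henkin
begin

lemma formulas: "\<phi> \<in> \<Gamma> \<Longrightarrow> \<phi> \<in> formulas L"
  using cons by (auto simp: consistent_def)

lemma provI: "\<phi> \<in> \<Gamma> \<Longrightarrow> prov L A \<Gamma> \<phi>"
  by (auto intro: prov.hyp formulas)

lemma not_both: "prov L A \<Gamma> \<phi> \<Longrightarrow> (\<^bold>\<not> \<phi>) \<notin> \<Gamma>"
  using cons prov_notE[OF provI] by (auto simp: consistent_def)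

lemma mem_prov: "prov L A \<Gamma> \<phi> \<longleftrightarrow> \<phi> \<in> \<Gamma>"
  using decides[OF prov_formulas, of A \<Gamma> \<phi>] not_both provI by (auto simp: decides_def)

lemma mem_thy:
  assumes "derives L A \<phi>" "\<And>i. \<sigma> i \<in> nterms L" "\<And>i. \<tau> i \<in> sterms L"
  shows "subst \<sigma> \<tau> \<phi> \<in> \<Gamma>"
  unfolding mem_prov[symmetric] by (intro prov.thy derives_subst assms)

lemma mem_mp: "(\<phi> \<^bold>\<longrightarrow> \<psi>) \<in> \<Gamma> \<Longrightarrow> \<phi> \<in> \<Gamma> \<Longrightarrow> \<psi> \<in> \<Gamma>"
  unfolding mem_prov[symmetric] by (rule prov.modus)

lemma mem_Falsum: "Falsum \<notin> \<Gamma>"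
  using cons mem_prov by (auto simp: consistent_def)

lemma mem_Neg: "\<phi> \<in> formulas L \<Longrightarrow> (\<^bold>\<not> \<phi>) \<in> \<Gamma> \<longleftrightarrow> \<phi> \<notin> \<Gamma>"
  using decides[of \<phi>] not_both[OF provI] by (auto simp: decides_def)

lemma mem_Imp:
  assumes "\<phi> \<in> formulas L" "\<psi> \<in> formulas L"
  shows "(\<phi> \<^bold>\<longrightarrow> \<psi>) \<in> \<Gamma> \<longleftrightarrow> (\<phi> \<in> \<Gamma> \<longrightarrow> \<psi> \<in> \<Gamma>)"
proof
  assume *: "\<phi> \<in> \<Gamma> \<longrightarrow> \<psi> \<in> \<Gamma>"
  show "(\<phi> \<^bold>\<longrightarrow> \<psi>) \<in> \<Gamma>"
  proof (cases "\<phi> \<in> \<Gamma>")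
    case True
    then have "prov L A \<Gamma> \<psi>" using * provI by simp
    from prov_K[OF this assms(1)] show ?thesis by (simp add: mem_prov)
  next
    case False
    then have "(\<^bold>\<not> \<phi>) \<in> \<Gamma>" using mem_Neg assms by simp
    from prov_mono[OF provI[OF this] subset_insertI]
    have "prov L A (insert \<phi> \<Gamma>) Falsum"
      by (rule prov_notE) (intro prov.hyp insertI1 assms(1))
    then have "prov L A (insert (\<^bold>\<not> \<psi>) (insert \<phi> \<Gamma>)) Falsum"
      by (rule prov_mono) auto
    from prov_deduction[OF prov_ccontr[OF this assms(2)] assms(1)] show ?thesis
      by (simp add: mem_prov)
  qed
qed (use mem_mp in blast)

lemma mem_derived:
  "\<phi> \<in> formulas L \<Longrightarrow> \<psi> \<in> formulas L \<Longrightarrow> (\<phi> \<^bold>\<and> \<psi>) \<in> \<Gamma> \<longleftrightarrow> \<phi> \<in> \<Gamma> \<and> \<psi> \<in> \<Gamma>"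
  "\<phi> \<in> formulas L \<Longrightarrow> \<psi> \<in> formulas L \<Longrightarrow> (\<phi> \<^bold>\<or> \<psi>) \<in> \<Gamma> \<longleftrightarrow> \<phi> \<in> \<Gamma> \<or> \<psi> \<in> \<Gamma>"
  "\<phi> \<in> formulas L \<Longrightarrow> \<psi> \<in> formulas L \<Longrightarrow> (\<phi> \<^bold>\<longleftrightarrow> \<psi>) \<in> \<Gamma> \<longleftrightarrow> (\<phi> \<in> \<Gamma> \<longleftrightarrow> \<psi> \<in> \<Gamma>)"
  "s \<in> nterms L \<Longrightarrow> t \<in> nterms L \<Longrightarrow> (s \<^bold>< t) \<in> \<Gamma> \<longleftrightarrow> (s \<^bold>\<le> t) \<in> \<Gamma> \<and> (s \<^bold>=\<^sub>1 t) \<notin> \<Gamma>"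
  by (auto simp: Conj_def Disj_def Iff_def Lt_def mem_Neg mem_Imp)

lemma mem_AllN:
  assumes "AllN \<chi> \<in> formulas L"
  shows "AllN \<chi> \<in> \<Gamma> \<longleftrightarrow> (\<forall>t\<in>nterms L. instN t \<chi> \<in> \<Gamma>)"
proof
  assume *: "AllN \<chi> \<in> \<Gamma>"
  have "(AllN \<chi> \<^bold>\<longrightarrow> instN t \<chi>) \<in> \<Gamma>" if "t \<in> nterms L" for t
    using that assms mem_prov prov.thy[OF derives.InstN[of \<chi> t L A]] by (auto intro: inst_formulas)
  then show "\<forall>t\<in>nterms L. instN t \<chi> \<in> \<Gamma>" using * mem_mp by blast
next
  assume *: "\<forall>t\<in>nterms L. instN t \<chi> \<in> \<Gamma>"
  have "(\<^bold>\<not> instN (NVar i) \<chi>) \<notin> \<Gamma>" for i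
    using * not_both[OF provI] by auto
  then show "AllN \<chi> \<in> \<Gamma>" using decides[OF assms] by (auto simp: decides_def)
qed

lemma mem_AllS:
  assumes "AllS \<chi> \<in> formulas L"
  shows "AllS \<chi> \<in> \<Gamma> \<longleftrightarrow> (\<forall>T\<in>sterms L. instS T \<chi> \<in> \<Gamma>)"
proof
  assume *: "AllS \<chi> \<in> \<Gamma>"
  have "(AllS \<chi> \<^bold>\<longrightarrow> instS T \<chi>) \<in> \<Gamma>" if "T \<in> sterms L" for T
    using that assms mem_prov prov.thy[OF derives.InstS[of \<chi> T L A]] by (auto intro: inst_formulas)
  then show "\<forall>T\<in>sterms L. instS T \<chi> \<in> \<Gamma>" using * mem_mp by blast
next
  assume *: "\<forall>T\<in>sterms L. instS T \<chi> \<in> \<Gamma>"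
  have "(\<^bold>\<not> instS (SVar i) \<chi>) \<notin> \<Gamma>" for i
    using * not_both[OF provI] by auto
  then show "AllS \<chi> \<in> \<Gamma>" using decides[OF assms] by (auto simp: decides_def)
qed

definition eqN :: "num \<Rightarrow> num \<Rightarrow> bool" where
  "eqN s t \<longleftrightarrow> s \<in> nterms L \<and> t \<in> nterms L \<and> (s \<^bold>=\<^sub>1 t) \<in> \<Gamma>"

definition eqS :: "str \<Rightarrow> str \<Rightarrow> bool" where
  "eqS S T \<longleftrightarrow> S \<in> sterms L \<and> T \<in> sterms L \<and> (S \<^bold>=\<^sub>2 T) \<in> \<Gamma>"

lemma eq_refl: "t \<in> nterms L \<Longrightarrow> eqN t t" "T \<in> sterms L \<Longrightarrow> eqS T T"
  using mem_prov prov.thy[OF derives.ReflN[of t L A]] prov.thy[OF derives.ReflS[of T L A]]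
  by (auto simp: eqN_def eqS_def)

lemma leibnizN:
  assumes "eqN s t" "\<phi> \<in> formulas L" "instN s \<phi> \<in> \<Gamma>"
  shows "instN t \<phi> \<in> \<Gamma>"
proof -
  have "(s \<^bold>=\<^sub>1 t \<^bold>\<longrightarrow> instN s \<phi> \<^bold>\<longrightarrow> instN t \<phi>) \<in> \<Gamma>"
    using assms mem_prov prov.thy[OF derives.LeibnizN[of s t \<phi> L A]]
    by (auto simp: eqN_def intro: inst_formulas)
  then show ?thesis using assms mem_mp unfolding eqN_def by blast
qed

lemma leibnizS:
  assumes "eqS S T" "\<phi> \<in> formulas L" "instS S \<phi> \<in> \<Gamma>"
  shows "instS T \<phi> \<in> \<Gamma>"
proof -
  have "(S \<^bold>=\<^sub>2 T \<^bold>\<longrightarrow> instS S \<phi> \<^bold>\<longrightarrow> instS T \<phi>) \<in> \<Gamma>"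
    using assms mem_prov prov.thy[OF derives.LeibnizS[of S T \<phi> L A]]
    by (auto simp: eqS_def intro: inst_formulas)
  then show ?thesis using assms mem_mp unfolding eqS_def by blast
qed

lemma inst_up_term:
  "subst_nt (case_nat s NVar) SVar (upN_nt t) = t" "subst_st (case_nat s NVar) SVar (upN_st T) = T"
  "subst_nt NVar (case_nat S SVar) (upS_nt t) = t" "subst_st NVar (case_nat S SVar) (upS_st T) = T"
  by (auto simp: upN_nt_def upN_st_def upS_nt_def upS_st_def subst_comp_term)

lemma eq_sym: "eqN s t \<Longrightarrow> eqN t s" "eqS S T \<Longrightarrow> eqS T S"
proof -
  show "eqN t s" if *: "eqN s t"
    using leibnizN[OF *, of "NVar 0 \<^bold>=\<^sub>1 upN_nt s"] * eq_refl(1)[of s]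
    by (auto simp: eqN_def instN_def inst_up_term)
  show "eqS T S" if *: "eqS S T"
    using leibnizS[OF *, of "SVar 0 \<^bold>=\<^sub>2 upS_st S"] * eq_refl(2)[of S]
    by (auto simp: eqS_def instS_def inst_up_term)
qed

text \<open>A Leibniz axiom exchanges the term for a single variable. Induction on \<open>k\<close>
  exchanges the first \<open>k\<close> of them, which is enough because only finitely many are
  free.\<close>

lemma mem_substN_cong_initial:
  assumes "\<And>i. eqN (\<sigma> i) (\<sigma>' i)" "\<And>i. \<tau> i \<in> sterms L" "\<phi> \<in> formulas L"
    and "subst \<sigma> \<tau> \<phi> \<in> \<Gamma>"
  shows "subst (\<lambda>i. if i < k then \<sigma>' i else \<sigma> i) \<tau> \<phi> \<in> \<Gamma>"
proof (induction k)
  case (Suc k)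
  let ?\<sigma> = "\<lambda>i. if i < k then \<sigma>' i else \<sigma> i"
  \<comment> \<open>The formula with a hole: place \<open>k\<close> becomes the new variable 0, and
    both neighbouring substitutions are instances of it.\<close>
  define \<psi> where "\<psi> = subst (\<lambda>i. if i = k then NVar 0 else upN_nt (?\<sigma> i)) (\<lambda>i. upN_st (\<tau> i)) \<phi>"
  have inst: "instN t \<psi> = subst (?\<sigma>(k := t)) \<tau> \<phi>" for t
    unfolding instN_def \<psi>_def subst_comp
    by (rule subst_cong_fv) (auto simp: inst_up_term)
  have "\<psi> \<in> formulas L"
    unfolding \<psi>_def using assms(1,2)
    by (intro subst_formulas[OF assms(3)]) (auto simp: eqN_def)
  moreover have "?\<sigma>(k := \<sigma> k) = ?\<sigma>" by auto
  ultimately have "subst (?\<sigma>(k := \<sigma>' k)) \<tau> \<phi> \<in> \<Gamma>"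
    using leibnizN[OF assms(1)[of k], of \<psi>] Suc by (simp add: inst)
  moreover have "?\<sigma>(k := \<sigma>' k) = (\<lambda>i. if i < Suc k then \<sigma>' i else \<sigma> i)" by auto
  ultimately show ?case by simp
qed (use assms in simp)

lemma mem_substS_cong_initial:
  assumes "\<And>i. eqS (\<tau> i) (\<tau>' i)" "\<And>i. \<sigma> i \<in> nterms L" "\<phi> \<in> formulas L"
    and "subst \<sigma> \<tau> \<phi> \<in> \<Gamma>"
  shows "subst \<sigma> (\<lambda>i. if i < k then \<tau>' i else \<tau> i) \<phi> \<in> \<Gamma>"
proof (induction k)
  case (Suc k)
  let ?\<tau> = "\<lambda>i. if i < k then \<tau>' i else \<tau> i"
  define \<psi> where "\<psi> = subst (\<lambda>i. upS_nt (\<sigma> i)) (\<lambda>i. if i = k then SVar 0 else upS_st (?\<tau> i)) \<phi>"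
  have inst: "instS T \<psi> = subst \<sigma> (?\<tau>(k := T)) \<phi>" for T
    unfolding instS_def \<psi>_def subst_comp
    by (rule subst_cong_fv) (auto simp: inst_up_term)
  have "\<psi> \<in> formulas L"
    unfolding \<psi>_def using assms(1,2)
    by (intro subst_formulas[OF assms(3)]) (auto simp: eqS_def)
  moreover have "?\<tau>(k := \<tau> k) = ?\<tau>" by auto
  ultimately have "subst \<sigma> (?\<tau>(k := \<tau>' k)) \<phi> \<in> \<Gamma>"
    using leibnizS[OF assms(1)[of k], of \<psi>] Suc by (simp add: inst)
  moreover have "?\<tau>(k := \<tau>' k) = (\<lambda>i. if i < Suc k then \<tau>' i else \<tau> i)" by auto
  ultimately show ?case by simp
qed (use assms in simp)

lemma mem_subst_cong:
  assumes "\<And>i. eqN (\<sigma> i) (\<sigma>' i)" "\<And>i. eqS (\<tau> i) (\<tau>' i)" "\<phi> \<in> formulas L"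
    and "subst \<sigma> \<tau> \<phi> \<in> \<Gamma>"
  shows "subst \<sigma>' \<tau>' \<phi> \<in> \<Gamma>"
proof -
  obtain k where k: "\<And>i. i \<in> fvN \<phi> \<Longrightarrow> i < k"
    using finite_fv(1)[of \<phi>] finite_nat_set_iff_bounded by auto
  obtain m where m: "\<And>i. i \<in> fvS \<phi> \<Longrightarrow> i < m"
    using finite_fv(2)[of \<phi>] finite_nat_set_iff_bounded by auto
  have "subst (\<lambda>i. if i < k then \<sigma>' i else \<sigma> i) \<tau> \<phi> \<in> \<Gamma>"
    by (rule mem_substN_cong_initial) (use assms in \<open>auto simp: eqS_def\<close>)
  also have "subst (\<lambda>i. if i < k then \<sigma>' i else \<sigma> i) \<tau> \<phi> = subst \<sigma>' \<tau> \<phi>"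
    by (rule subst_cong_fv) (auto simp: k)
  finally have "subst \<sigma>' (\<lambda>i. if i < m then \<tau>' i else \<tau> i) \<phi> \<in> \<Gamma>"
    by (intro mem_substS_cong_initial) (use assms in \<open>auto simp: eqN_def\<close>)
  also have "subst \<sigma>' (\<lambda>i. if i < m then \<tau>' i else \<tau> i) \<phi> = subst \<sigma>' \<tau>' \<phi>"
    by (rule subst_cong_fv) (auto simp: m)
  finally show ?thesis .
qed

lemma mem_subst_cong_iff:
  assumes "\<And>i. eqN (\<sigma> i) (\<sigma>' i)" "\<And>i. eqS (\<tau> i) (\<tau>' i)" "\<phi> \<in> formulas L"
  shows "subst \<sigma> \<tau> \<phi> \<in> \<Gamma> \<longleftrightarrow> subst \<sigma>' \<tau>' \<phi> \<in> \<Gamma>"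
  using mem_subst_cong[OF assms] mem_subst_cong[OF eq_sym(1)[OF assms(1)] eq_sym(2)[OF assms(2)] assms(3)]
  by auto

lemma subst_term_congE:
  assumes "\<And>i. eqN (\<sigma> i) (\<sigma>' i)" "\<And>i. eqS (\<tau> i) (\<tau>' i)"
  shows "t \<in> nterms L \<Longrightarrow> eqN (subst_nt \<sigma> \<tau> t) (subst_nt \<sigma>' \<tau>' t)"
    and "T \<in> sterms L \<Longrightarrow> eqS (subst_st \<sigma> \<tau> T) (subst_st \<sigma>' \<tau>' T)"
proof -
  \<comment> \<open>Even variables of the formula \<open>t[even] = t[odd]\<close> are kept, odd ones are replaced.\<close>
  let ?se = "subst_nt (\<lambda>i. NVar (2 * i)) (\<lambda>i. SVar (2 * i))"
    and ?so = "subst_nt (\<lambda>i. NVar (2 * i + 1)) (\<lambda>i. SVar (2 * i + 1))"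
    and ?Se = "subst_st (\<lambda>i. NVar (2 * i)) (\<lambda>i. SVar (2 * i))"
    and ?So = "subst_st (\<lambda>i. NVar (2 * i + 1)) (\<lambda>i. SVar (2 * i + 1))"
  let ?m = "\<lambda>f g i. if even i then f (i div 2) else g (i div 2)"
  have terms: "\<And>i. \<sigma> i \<in> nterms L" "\<And>i. \<tau> i \<in> sterms L" "\<And>i. \<sigma>' i \<in> nterms L" "\<And>i. \<tau>' i \<in> sterms L"
    using assms by (auto simp: eqN_def eqS_def)
  have e: "\<And>i. eqN (?m \<sigma> \<sigma> i) (?m \<sigma> \<sigma>' i)" "\<And>i. eqS (?m \<tau> \<tau> i) (?m \<tau> \<tau>' i)"
    using assms terms eq_refl by auto
  show "eqN (subst_nt \<sigma> \<tau> t) (subst_nt \<sigma>' \<tau>' t)" if "t \<in> nterms L"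
  proof -
    have "(?se t \<^bold>=\<^sub>1 ?so t) \<in> formulas L" using that by (auto intro!: subst_terms)
    from mem_subst_cong[of "?m \<sigma> \<sigma>" "?m \<sigma> \<sigma>'" "?m \<tau> \<tau>" "?m \<tau> \<tau>'", OF e this] eq_refl(1)[OF subst_terms(1)[of \<sigma> L \<tau>, OF terms(1,2) that]]
    show ?thesis using that terms by (auto simp: eqN_def subst_comp_term intro!: subst_terms)
  qed
  show "eqS (subst_st \<sigma> \<tau> T) (subst_st \<sigma>' \<tau>' T)" if "T \<in> sterms L"
  proof -
    have "(?Se T \<^bold>=\<^sub>2 ?So T) \<in> formulas L" using that by (auto intro!: subst_terms)
    from mem_subst_cong[of "?m \<sigma> \<sigma>" "?m \<sigma> \<sigma>'" "?m \<tau> \<tau>" "?m \<tau> \<tau>'", OF e this] eq_refl(2)[OF subst_terms(2)[of \<sigma> L \<tau>, OF terms(1,2) that]]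
    show ?thesis using that terms by (auto simp: eqS_def subst_comp_term intro!: subst_terms)
  qed
qed

lemma eq_trans: "eqN r s \<Longrightarrow> eqN s t \<Longrightarrow> eqN r t" "eqS R S \<Longrightarrow> eqS S T \<Longrightarrow> eqS R T"
proof -
  show "eqN r t" if *: "eqN r s" "eqN s t"
    using leibnizN[OF *(2), of "upN_nt r \<^bold>=\<^sub>1 NVar 0"] *
    by (auto simp: eqN_def instN_def inst_up_term)
  show "eqS R T" if *: "eqS R S" "eqS S T"
    using leibnizS[OF *(2), of "upS_st R \<^bold>=\<^sub>2 SVar 0"] *
    by (auto simp: eqS_def instS_def inst_up_term)
qed

text \<open>An application is a substitution instance of its symbol applied to distinct variables,
  so congruence under substitution yields congruence in all arguments at once.\<close>

lemma Fun_cong: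
  assumes "list_all2 eqN ts ts'" "list_all2 eqS Ts Ts'"
  shows "NFun f ts Ts \<in> nterms L \<Longrightarrow> eqN (NFun f ts Ts) (NFun f ts' Ts')"
    and "SFun g ts Ts \<in> sterms L \<Longrightarrow> eqS (SFun g ts Ts) (SFun g ts' Ts')"
proof -
  \<comment> \<open>An argument list is extended to a total substitution; the default beyond its end
    never shows, as the term has only the first variables.\<close>
  define get where "get ts i = (if i < length ts then ts ! i else Zero)" for ts :: "num list" and i
  define getS where "getS Ts i = (if i < length Ts then Ts ! i else SVar 0)"
    for Ts :: "str list" and i
  have len: "length ts' = length ts" "length Ts' = length Ts"
    using assms by (auto dest: list_all2_lengthD)
  have m: "map (subst_nt (get xs) \<tau>) (map NVar [0..<length xs]) = xs"
    "map (subst_st \<sigma> (getS Xs)) (map SVar [0..<length Xs]) = Xs" for xs Xs \<tau> \<sigma>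
    by (auto intro!: nth_equalityI simp: get_def getS_def)
  have e: "\<And>i. eqN (get ts i) (get ts' i)" "\<And>i. eqS (getS Ts i) (getS Ts' i)"
    using assms by (auto simp: get_def getS_def list_all2_conv_all_nth eq_refl)
  show "eqN (NFun f ts Ts) (NFun f ts' Ts')" if "NFun f ts Ts \<in> nterms L"
    using subst_term_congE(1)[of "get ts" "get ts'" "getS Ts" "getS Ts'", OF e,
        of "NFun f (map NVar [0..<length ts]) (map SVar [0..<length Ts])"]
      that m(1)[of ts] m(2)[of _ Ts] m(1)[of ts'] m(2)[of _ Ts']
    by (auto simp: len image_subset_iff simp del: map_map)
  show "eqS (SFun g ts Ts) (SFun g ts' Ts')" if "SFun g ts Ts \<in> sterms L"
    using subst_term_congE(2)[of "get ts" "get ts'" "getS Ts" "getS Ts'", OF e,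
        of "SFun g (map NVar [0..<length ts]) (map SVar [0..<length Ts])"]
      that m(1)[of ts] m(2)[of _ Ts] m(1)[of ts'] m(2)[of _ Ts']
    by (auto simp: len image_subset_iff simp del: map_map)
qed

lemma mem_axiom:
  assumes "\<phi> \<in> A" "\<phi> \<in> formulas L" "\<And>i. \<sigma> i \<in> nterms L" "\<And>i. \<tau> i \<in> sterms L"
  shows "subst \<sigma> \<tau> \<phi> \<in> \<Gamma>"
  by (rule mem_thy[OF derives.Axiom]) (use assms in auto)

text \<open>If every variable differed from \<open>t\<close>, then \<open>t\<close> would differ
  from itself. As some variable thus equals each term, the classes of terms can be represented by
  variable indices.\<close>

lemma ex_NVar:
  assumes "t \<in> nterms L"
  shows "\<exists>i. eqN (NVar i) t"
proof -
  let ?\<chi> = "\<^bold>\<not> (NVar 0 \<^bold>=\<^sub>1 upN_nt t)"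
  have \<chi>: "?\<chi> \<in> formulas L" using assms by simp
  have inst: "instN s ?\<chi> = (\<^bold>\<not> (s \<^bold>=\<^sub>1 t))" for s
    by (simp add: instN_def inst_up_term)
  have "AllN ?\<chi> \<notin> \<Gamma>"
  proof
    assume "AllN ?\<chi> \<in> \<Gamma>"
    then have "(\<^bold>\<not> (t \<^bold>=\<^sub>1 t)) \<in> \<Gamma>" using mem_AllN[of ?\<chi>] assms \<chi> by (simp add: inst)
    then show False using eq_refl(1)[OF assms] mem_Neg assms by (simp add: eqN_def)
  qed
  then obtain i where "(\<^bold>\<not> \<^bold>\<not> (NVar i \<^bold>=\<^sub>1 t)) \<in> \<Gamma>"
    using decides[of "AllN ?\<chi>"] \<chi> by (auto simp: decides_def inst)
  then show ?thesis using assms by (auto simp: mem_Neg eqN_def)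
qed

end

text \<open>The axioms of 2-BASIC make the numerals pairwise distinct, so that the number sort of the
  term model can be taken to be the whole type of natural numbers.\<close>

primrec numeral_tm :: "nat \<Rightarrow> num" where
  "numeral_tm 0 = Zero"
| "numeral_tm (Suc n) = numeral_tm n \<^bold>+ One"

lemma numeral_tm_terms [simp]: "numeral_tm n \<in> nterms L"
  by (induction n) auto

text \<open>The assumption \<open>ext\<close> makes it sound to interpret a string term by the set
  of its elements. It is stated for the maximal consistent set, since the two theories reach it from
  different axioms.\<close>

locale arith_henkin = henkin +
  assumes basic: "basic_open \<subseteq> A"
    and ext: "S \<in> sterms L \<Longrightarrow> T \<in> sterms L \<Longrightarrow>
      (\<And>t. t \<in> nterms L \<Longrightarrow> (t \<^bold>\<in> S) \<in> \<Gamma> \<longleftrightarrow> (t \<^bold>\<in> T) \<in> \<Gamma>) \<Longrightarrow> (S \<^bold>=\<^sub>2 T) \<in> \<Gamma>"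
begin

lemma basic_mem:
  assumes "\<phi> \<in> basic_open" "\<phi> \<in> formulas L" "s \<in> nterms L" "t \<in> nterms L" "T \<in> sterms L"
  shows "subst (case_nat s (\<lambda>_. t)) (\<lambda>_. T) \<phi> \<in> \<Gamma>"
  by (rule mem_axiom) (use assms basic in \<open>auto split: nat.split\<close>)

lemma numeral_tm_eqD: "eqN (numeral_tm m) (numeral_tm n) \<Longrightarrow> m = n"
proof (induction m arbitrary: n)
  case 0
  then show ?case
  proof (cases n)
    case (Suc k)
    have "(\<^bold>\<not> (numeral_tm k \<^bold>+ One \<^bold>=\<^sub>1 Zero)) \<in> \<Gamma>"
      using basic_mem[of "\<^bold>\<not> x\<^sub>0 \<^bold>+ One \<^bold>=\<^sub>1 Zero" "numeral_tm k" Zero "SVar 0"]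
      by (simp add: basic_open_def)
    then show ?thesis using 0 Suc eq_sym(1) mem_Neg by (auto simp: eqN_def)
  qed simp
next
  case (Suc m)
  show ?case
  proof (cases n)
    case 0
    have "(\<^bold>\<not> (numeral_tm m \<^bold>+ One \<^bold>=\<^sub>1 Zero)) \<in> \<Gamma>"
      using basic_mem[of "\<^bold>\<not> x\<^sub>0 \<^bold>+ One \<^bold>=\<^sub>1 Zero" "numeral_tm m" Zero "SVar 0"]
      by (simp add: basic_open_def)
    then show ?thesis using 0 Suc mem_Neg by (auto simp: eqN_def)
  next
    case (Suc k)
    have "(numeral_tm m \<^bold>+ One \<^bold>=\<^sub>1 numeral_tm k \<^bold>+ One \<^bold>\<longrightarrow> numeral_tm m \<^bold>=\<^sub>1 numeral_tm k) \<in> \<Gamma>"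
      using basic_mem[of "x\<^sub>0 \<^bold>+ One \<^bold>=\<^sub>1 x\<^sub>1 \<^bold>+ One \<^bold>\<longrightarrow> x\<^sub>0 \<^bold>=\<^sub>1 x\<^sub>1" "numeral_tm m" "numeral_tm k" "SVar 0"]
      by (simp add: basic_open_def)
    then show ?thesis using Suc Suc.prems Suc.IH mem_mp by (auto simp: eqN_def)
  qed
qed

text \<open>Least representatives turn the classes of terms into a set of natural numbers, which
  \<open>to_nat_on\<close> enumerates without gaps once the set is infinite.\<close>

definition rep_var :: "num \<Rightarrow> nat" where
  "rep_var t = (LEAST i. eqN (NVar i) t)"

lemma rep_var: "t \<in> nterms L \<Longrightarrow> eqN (NVar (rep_var t)) t"
  unfolding rep_var_def using ex_NVar by (metis LeastI_ex)

lemma rep_var_eq: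
  assumes "s \<in> nterms L" "t \<in> nterms L"
  shows "rep_var s = rep_var t \<longleftrightarrow> eqN s t"
proof
  assume "eqN s t"
  then have "(\<lambda>i. eqN (NVar i) s) = (\<lambda>i. eqN (NVar i) t)"
    by (auto intro: eq_trans(1)[OF _ \<open>eqN s t\<close>] eq_trans(1)[OF _ eq_sym(1)[OF \<open>eqN s t\<close>]])
  then show "rep_var s = rep_var t" by (simp add: rep_var_def)
next
  assume "rep_var s = rep_var t"
  then show "eqN s t"
    using eq_trans(1)[OF eq_sym(1)[OF rep_var[OF assms(1)]]] rep_var[OF assms(2)] by simp
qed

lemma infinite_rep_vars: "infinite (rep_var ` nterms L)"
proof -
  have "inj (\<lambda>n. rep_var (numeral_tm n))"
    by (auto simp: inj_def rep_var_eq dest: numeral_tm_eqD)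
  then have "infinite (range (\<lambda>n. rep_var (numeral_tm n)))" by (simp add: finite_image_iff)
  then show ?thesis by (rule infinite_super[rotated]) auto
qed

definition valN :: "num \<Rightarrow> nat" where
  "valN t = to_nat_on (rep_var ` nterms L) (rep_var t)"

definition repN :: "nat \<Rightarrow> num" where
  "repN a = (SOME t. t \<in> nterms L \<and> valN t = a)"

lemma valN_eq: "s \<in> nterms L \<Longrightarrow> t \<in> nterms L \<Longrightarrow> valN s = valN t \<longleftrightarrow> eqN s t"
  unfolding valN_def using rep_var_eq by (subst to_nat_on_inj) auto

lemma repN: "repN a \<in> nterms L" "valN (repN a) = a"
proof -
  have "bij_betw (to_nat_on (rep_var ` nterms L)) (rep_var ` nterms L) UNIV"
    using infinite_rep_vars by (intro to_nat_on_infinite) auto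
  then have "a \<in> to_nat_on (rep_var ` nterms L) ` rep_var ` nterms L"
    by (auto simp: bij_betw_def)
  then have "\<exists>t. t \<in> nterms L \<and> valN t = a" by (auto simp: valN_def)
  from someI_ex[OF this] show "repN a \<in> nterms L" "valN (repN a) = a" by (auto simp: repN_def)
qed

lemma repN_valN: "t \<in> nterms L \<Longrightarrow> eqN (repN (valN t)) t"
  using valN_eq repN by metis

definition valS :: "str \<Rightarrow> nat set" where
  "valS T = {a. (repN a \<^bold>\<in> T) \<in> \<Gamma>}"

definition repS :: "nat set \<Rightarrow> str" where
  "repS X = (SOME T. T \<in> sterms L \<and> valS T = X)"

lemma mem_valS:
  assumes "t \<in> nterms L" "T \<in> sterms L"
  shows "valN t \<in> valS T \<longleftrightarrow> (t \<^bold>\<in> T) \<in> \<Gamma>"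
proof -
  have "subst (case_nat (repN (valN t)) NVar) (case_nat T SVar) (x\<^sub>0 \<^bold>\<in> X\<^sub>0) \<in> \<Gamma> \<longleftrightarrow>
      subst (case_nat t NVar) (case_nat T SVar) (x\<^sub>0 \<^bold>\<in> X\<^sub>0) \<in> \<Gamma>"
    by (rule mem_subst_cong_iff) (use assms repN_valN in \<open>auto simp: eq_refl split: nat.split\<close>)
  then show ?thesis by (simp add: valS_def)
qed

lemma valS_eq:
  assumes "S \<in> sterms L" "T \<in> sterms L"
  shows "valS S = valS T \<longleftrightarrow> eqS S T"
proof
  assume "valS S = valS T"
  then show "eqS S T" using ext[OF assms] mem_valS assms by (auto simp: eqS_def)
next
  assume *: "eqS S T"
  have "subst (\<lambda>_. repN a) (\<lambda>_. S) (x\<^sub>0 \<^bold>\<in> X\<^sub>0) \<in> \<Gamma> \<longleftrightarrow>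
      subst (\<lambda>_. repN a) (\<lambda>_. T) (x\<^sub>0 \<^bold>\<in> X\<^sub>0) \<in> \<Gamma>" for a
    by (rule mem_subst_cong_iff) (use * repN in \<open>auto simp: eq_refl\<close>)
  then show "valS S = valS T" by (simp add: valS_def)
qed

lemma repS: "X \<in> valS ` sterms L \<Longrightarrow> repS X \<in> sterms L \<and> valS (repS X) = X"
  unfolding repS_def by (rule someI_ex) auto

lemma repS_valS: "T \<in> sterms L \<Longrightarrow> eqS (repS (valS T)) T"
  using valS_eq repS by blast

definition term_struct :: "nat struct" where
  "term_struct = \<lparr>m_zero = valN Zero, m_one = valN One,
     m_plus = (\<lambda>a b. valN (repN a \<^bold>+ repN b)), m_times = (\<lambda>a b. valN (repN a \<^bold>* repN b)),
     m_le = (\<lambda>a b. (repN a \<^bold>\<le> repN b) \<in> \<Gamma>), m_strs = valS ` sterms L,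
     m_len = (\<lambda>X. valN (Len (repS X)))\<rparr>"

definition term_nint :: "(nfun, nat) nint" where
  "term_nint f as Xs = valN (NFun f (map repN as) (map repS Xs))"

text \<open>Applications that are not terms of the language get the value of a string variable, so
  that every value is a string of the structure.\<close>

definition term_sint :: "(sfun, nat) sint" where
  "term_sint g as Xs = (let T = SFun g (map repN as) (map repS Xs) in
     if T \<in> sterms L then valS T else valS (SVar 0))"

lemma term_sint_strs: "term_sint g as Xs \<in> m_strs term_struct"
  by (auto simp: term_sint_def term_struct_def Let_def)

lemma eval_term_struct:
  assumes "range E \<subseteq> m_strs term_struct"
  shows "t \<in> nterms L \<Longrightarrow> eval_nt term_struct term_nint term_sint e E t =
      valN (subst_nt (\<lambda>i. repN (e i)) (\<lambda>i. repS (E i)) t)"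
    and "T \<in> sterms L \<Longrightarrow> eval_st term_struct term_nint term_sint e E T =
      valS (subst_st (\<lambda>i. repN (e i)) (\<lambda>i. repS (E i)) T)"
proof -
  let ?s = "subst_nt (\<lambda>i. repN (e i)) (\<lambda>i. repS (E i))"
  let ?S = "subst_st (\<lambda>i. repN (e i)) (\<lambda>i. repS (E i))"
  have E: "repS (E i) \<in> sterms L" "valS (repS (E i)) = E i" for i
    using repS[of "E i"] assms by (auto simp: term_struct_def)
  have st: "?s t \<in> nterms L" if "t \<in> nterms L" for t
    using that by (intro subst_terms) (auto simp: repN E)
  have St: "?S T \<in> sterms L" if "T \<in> sterms L" for T
    using that by (intro subst_terms) (auto simp: repN E)
  have bin: "eqN (subst_nt (case_nat (repN (valN a)) (\<lambda>_. repN (valN b))) SVar t)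
      (subst_nt (case_nat a (\<lambda>_. b)) SVar t)"
    if "a \<in> nterms L" "b \<in> nterms L" "t \<in> nterms L" for a b t
    by (rule subst_term_congE) (use that in \<open>auto simp: repN_valN eq_refl split: nat.split\<close>)
  have lists: "list_all2 eqN (map repN (map (\<lambda>t. valN (?s t)) ts)) (map ?s ts)"
    if "set ts \<subseteq> nterms L" for ts
    using that by (induction ts) (auto simp: repN_valN st)
  have listsS: "list_all2 eqS (map repS (map (\<lambda>T. valS (?S T)) Ts)) (map ?S Ts)"
    if "set Ts \<subseteq> sterms L" for Ts
    using that by (induction Ts) (auto simp: repS_valS St)
  have ts: "set (map repN as) \<subseteq> nterms L" for as by (auto simp: repN)
  have Ts: "set (map repS (map (\<lambda>T. valS (?S T)) Ts)) \<subseteq> sterms L" if "set Ts \<subseteq> sterms L" for Ts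
    using that St repS by auto
  show "t \<in> nterms L \<Longrightarrow> eval_nt term_struct term_nint term_sint e E t = valN (?s t)"
    and "T \<in> sterms L \<Longrightarrow> eval_st term_struct term_nint term_sint e E T = valS (?S T)"
  proof (induction t and T)
    case (Plus s t)
    then show ?case
      using bin[of "?s s" "?s t" "x\<^sub>0 \<^bold>+ x\<^sub>1"] by (simp add: term_struct_def st valN_eq repN)
  next
    case (Times s t)
    then show ?case
      using bin[of "?s s" "?s t" "x\<^sub>0 \<^bold>* x\<^sub>1"] by (simp add: term_struct_def st valN_eq repN)
  next
    case (Len T)
    have "eqN (subst_nt NVar (\<lambda>_. repS (valS (?S T))) (Len X\<^sub>0)) (subst_nt NVar (\<lambda>_. ?S T) (Len X\<^sub>0))"
      by (rule subst_term_congE) (use Len in \<open>auto simp: repS_valS eq_refl St\<close>)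
    then have "valN (Len (repS (valS (?S T)))) = valN (Len (?S T))"
      using Len St repS by (subst valN_eq) auto
    then show ?case using Len by (simp add: term_struct_def)
  next
    case (NFun f ts Ts)
    have ev: "map (eval_nt term_struct term_nint term_sint e E) ts = map (\<lambda>t. valN (?s t)) ts"
      "map (eval_st term_struct term_nint term_sint e E) Ts = map (\<lambda>T. valS (?S T)) Ts"
      using NFun by auto
    let ?t = "NFun f (map repN (map (\<lambda>t. valN (?s t)) ts)) (map repS (map (\<lambda>T. valS (?S T)) Ts))"
    have t: "?t \<in> nterms L" using NFun.prems ts Ts by (auto simp del: map_map set_map)
    have "eqN ?t (NFun f (map ?s ts) (map ?S Ts))"
      by (rule Fun_cong(1)[OF lists listsS t]) (use NFun.prems in auto)
    then have "valN ?t = valN (NFun f (map ?s ts) (map ?S Ts))"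
      by (simp add: valN_eq eqN_def del: map_map terms_simps)
    then show ?case unfolding eval_nt.simps ev by (simp add: term_nint_def)
  next
    case (SFun g ts Ts)
    have ev: "map (eval_nt term_struct term_nint term_sint e E) ts = map (\<lambda>t. valN (?s t)) ts"
      "map (eval_st term_struct term_nint term_sint e E) Ts = map (\<lambda>T. valS (?S T)) Ts"
      using SFun by auto
    let ?t = "SFun g (map repN (map (\<lambda>t. valN (?s t)) ts)) (map repS (map (\<lambda>T. valS (?S T)) Ts))"
    have t: "?t \<in> sterms L" using SFun.prems ts Ts by (auto simp del: map_map set_map)
    have "eqS ?t (SFun g (map ?s ts) (map ?S Ts))"
      by (rule Fun_cong(2)[OF lists listsS t]) (use SFun.prems in auto)
    then have "valS ?t = valS (SFun g (map ?s ts) (map ?S Ts))"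
      by (simp add: valS_eq eqS_def del: map_map terms_simps)
    moreover have "term_sint g (map (\<lambda>t. valN (?s t)) ts) (map (\<lambda>T. valS (?S T)) Ts) = valS ?t"
      using t by (simp add: term_sint_def del: map_map terms_simps)
    ultimately show ?case by (simp only: eval_st.simps ev subst_st.simps)
  qed (auto simp: term_struct_def repN E)
qed

text \<open>The truth lemma. Membership in \<open>\<Gamma>\<close> speaks about all terms while a
  structure has only classes, so in the quantifier cases congruence must lead from the chosen
  representatives to arbitrary terms.\<close>

lemma sat_term_struct:
  assumes "\<phi> \<in> formulas L" "range E \<subseteq> m_strs term_struct"
  shows "sat term_struct term_nint term_sint e E \<phi> \<longleftrightarrow>
      subst (\<lambda>i. repN (e i)) (\<lambda>i. repS (E i)) \<phi> \<in> \<Gamma>"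
  using assms
proof (induction \<phi> arbitrary: e E)
  have S: "repS (E i) \<in> sterms L" if "range E \<subseteq> m_strs term_struct" for E i
    using repS[of "E i"] that by (auto simp: term_struct_def)
  have st: "subst_nt (\<lambda>i. repN (e i)) (\<lambda>i. repS (E i)) t \<in> nterms L"
    "subst_st (\<lambda>i. repN (e i)) (\<lambda>i. repS (E i)) T \<in> sterms L"
    if "range E \<subseteq> m_strs term_struct" "t \<in> nterms L" "T \<in> sterms L" for e E t T
    using that S[OF that(1)] by (auto intro!: subst_terms simp: repN)
  note [simp] = st[OF _ _ terms_simps(8)] st[OF _ terms_simps(1)]
  {
    case Falsum
    then show ?case by (simp add: mem_Falsum)
  next
    case (EqN s t)
    then show ?case by (simp add: eval_term_struct valN_eq eqN_def)
  next
    case (EqS S T)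
    then show ?case by (simp add: eval_term_struct valS_eq eqS_def)
  next
    case (Le s t)
    let ?s = "subst_nt (\<lambda>i. repN (e i)) (\<lambda>i. repS (E i))"
    have "subst (case_nat (repN (valN (?s s))) (\<lambda>_. repN (valN (?s t)))) SVar (x\<^sub>0 \<^bold>\<le> x\<^sub>1) \<in> \<Gamma> \<longleftrightarrow>
        subst (case_nat (?s s) (\<lambda>_. ?s t)) SVar (x\<^sub>0 \<^bold>\<le> x\<^sub>1) \<in> \<Gamma>"
      by (rule mem_subst_cong_iff) (use Le in \<open>auto simp: repN_valN eq_refl split: nat.split\<close>)
    then show ?case using Le by (simp add: eval_term_struct) (simp add: term_struct_def)
  next
    case (Mem t T)
    then show ?case by (simp add: eval_term_struct mem_valS)
  next
    case (Imp \<phi> \<psi>)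
    have "subst (\<lambda>i. repN (e i)) (\<lambda>i. repS (E i)) \<phi> \<in> formulas L"
      "subst (\<lambda>i. repN (e i)) (\<lambda>i. repS (E i)) \<psi> \<in> formulas L"
      using Imp.prems S[OF Imp.prems(2)] by (auto intro!: subst_formulas simp: repN)
    then show ?case using Imp by (simp add: mem_Imp)
  next
    case (AllN \<chi>)
    let ?\<chi> = "subst (liftN (\<lambda>i. repN (e i))) (\<lambda>i. upN_st (repS (E i))) \<chi>"
    have "AllN ?\<chi> = subst (\<lambda>i. repN (e i)) (\<lambda>i. repS (E i)) (AllN \<chi>)" by simp
    also have "\<dots> \<in> formulas L"
      using AllN.prems S[OF AllN.prems(2)] by (intro subst_formulas) (auto simp: repN)
    finally have "AllN ?\<chi> \<in> formulas L" .
    note m = mem_AllN[OF this]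
    have inst: "instN t ?\<chi> = subst (case_nat t (\<lambda>i. repN (e i))) (\<lambda>i. repS (E i)) \<chi>" for t
      unfolding instN_def subst_comp
      by (rule subst_cong_fv) (auto simp: inst_up_term split: nat.split)
    have "sat term_struct term_nint term_sint (case_nat a e) E \<chi> \<longleftrightarrow> instN (repN a) ?\<chi> \<in> \<Gamma>" for a
    proof -
      have "(\<lambda>i. repN (case_nat a e i)) = case_nat (repN a) (\<lambda>i. repN (e i))"
        by (auto split: nat.split)
      then show ?thesis using AllN.IH[of E "case_nat a e"] AllN.prems by (simp add: inst)
    qed
    note inst_sat = this
    \<comment> \<open>A term and the representative of its class are equal in
      \<open>\<Gamma>\<close>, so both instances belong to it or neither does.\<close>
    have inst_rep: "instN t ?\<chi> \<in> \<Gamma> \<longleftrightarrow> instN (repN (valN t)) ?\<chi> \<in> \<Gamma>" if "t \<in> nterms L" for t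
      unfolding inst
      by (rule mem_subst_cong_iff[of "case_nat t (\<lambda>i. repN (e i))"
            "case_nat (repN (valN t)) (\<lambda>i. repN (e i))" "\<lambda>i. repS (E i)" "\<lambda>i. repS (E i)"])
        (use that AllN.prems S[OF AllN.prems(2)] in \<open>auto simp: eq_sym(1)[OF repN_valN] eq_refl repN split: nat.split\<close>)
    have "(\<forall>a. instN (repN a) ?\<chi> \<in> \<Gamma>) \<longleftrightarrow> (\<forall>t\<in>nterms L. instN t ?\<chi> \<in> \<Gamma>)"
    proof (intro iffI ballI allI)
      fix t assume "\<forall>a. instN (repN a) ?\<chi> \<in> \<Gamma>" "t \<in> nterms L"
      then show "instN t ?\<chi> \<in> \<Gamma>" by (subst inst_rep) simp_all
    next
      fix a assume "\<forall>t\<in>nterms L. instN t ?\<chi> \<in> \<Gamma>"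
      then show "instN (repN a) ?\<chi> \<in> \<Gamma>" using repN(1) by simp
    qed
    then show ?case unfolding sat.simps subst_All m inst_sat .
  next
    case (AllS \<chi>)
    let ?\<chi> = "subst (\<lambda>i. upS_nt (repN (e i))) (liftS (\<lambda>i. repS (E i))) \<chi>"
    have "AllS ?\<chi> = subst (\<lambda>i. repN (e i)) (\<lambda>i. repS (E i)) (AllS \<chi>)" by simp
    also have "\<dots> \<in> formulas L"
      using AllS.prems S[OF AllS.prems(2)] by (intro subst_formulas) (auto simp: repN)
    finally have "AllS ?\<chi> \<in> formulas L" .
    note m = mem_AllS[OF this]
    have inst: "instS T ?\<chi> = subst (\<lambda>i. repN (e i)) (case_nat T (\<lambda>i. repS (E i))) \<chi>" for T
      unfolding instS_def subst_comp
      by (rule subst_cong_fv) (auto simp: inst_up_term split: nat.split)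
    have "sat term_struct term_nint term_sint e (case_nat X E) \<chi> \<longleftrightarrow> instS (repS X) ?\<chi> \<in> \<Gamma>"
      if "X \<in> m_strs term_struct" for X
    proof -
      have "(\<lambda>i. repS (case_nat X E i)) = case_nat (repS X) (\<lambda>i. repS (E i))"
        by (auto split: nat.split)
      then show ?thesis using AllS.IH[of "case_nat X E" e] AllS.prems range_case_nat[OF _ that]
        by (simp add: inst)
    qed
    note inst_sat = this
    have inst_rep: "instS T ?\<chi> \<in> \<Gamma> \<longleftrightarrow> instS (repS (valS T)) ?\<chi> \<in> \<Gamma>" if "T \<in> sterms L" for T
      unfolding inst
      by (rule mem_subst_cong_iff[of "\<lambda>i. repN (e i)" "\<lambda>i. repN (e i)"
            "case_nat T (\<lambda>i. repS (E i))" "case_nat (repS (valS T)) (\<lambda>i. repS (E i))"])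
        (use that AllS.prems S[OF AllS.prems(2)] in \<open>auto simp: eq_sym(2)[OF repS_valS] eq_refl repN split: nat.split\<close>)
    have strs: "m_strs term_struct = valS ` sterms L" by (simp add: term_struct_def)
    have "(\<forall>X\<in>m_strs term_struct. instS (repS X) ?\<chi> \<in> \<Gamma>) \<longleftrightarrow>
        (\<forall>T\<in>sterms L. instS T ?\<chi> \<in> \<Gamma>)"
    proof (intro iffI ballI)
      fix T assume "\<forall>X\<in>m_strs term_struct. instS (repS X) ?\<chi> \<in> \<Gamma>" "T \<in> sterms L"
      then show "instS T ?\<chi> \<in> \<Gamma>" by (subst inst_rep) (simp_all add: strs)
    next
      fix X assume "\<forall>T\<in>sterms L. instS T ?\<chi> \<in> \<Gamma>" "X \<in> m_strs term_struct"
      then show "instS (repS X) ?\<chi> \<in> \<Gamma>" using repS[of X] by (simp add: strs)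
    qed
    then show ?case unfolding sat.simps subst_All m using inst_sat by simp
  }
qed

end

text \<open>The countermodel lives on the type \<open>nat\<close>, whatever the language.
  Nonderivability is assumed, the negation is extended to a Henkin set, and variables denote their
  own classes in the falsifying environment.\<close>

theorem completeness:
  assumes \<phi>: "\<phi> \<in> formulas L" "\<not> derives L A \<phi>" and basic: "basic_open \<subseteq> A"
    and ext: "\<And>\<Gamma> S T. henkin L A \<Gamma> \<Longrightarrow> S \<in> sterms L \<Longrightarrow> T \<in> sterms L \<Longrightarrow>
      (\<And>t. t \<in> nterms L \<Longrightarrow> (t \<^bold>\<in> S) \<in> \<Gamma> \<longleftrightarrow> (t \<^bold>\<in> T) \<in> \<Gamma>) \<Longrightarrow> (S \<^bold>=\<^sub>2 T) \<in> \<Gamma>"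
  obtains M :: "nat struct" and I J e E where "\<And>g as Xs. J g as Xs \<in> m_strs M"
    "models M I J (A \<inter> formulas L)" "range E \<subseteq> m_strs M" "\<not> sat M I J e E \<phi>"
proof -
  have "consistent L A {\<^bold>\<not> \<phi>}"
    using \<phi> prov_ccontr[of L A \<phi> "{}"] prov_empty[of L A \<phi>] by (auto simp: consistent_def)
  then obtain \<Gamma> where \<Gamma>: "{\<^bold>\<not> \<phi>} \<subseteq> \<Gamma>" "henkin L A \<Gamma>" by (rule henkin_extend[rotated]) auto
  interpret henkin L A \<Gamma> by (rule \<Gamma>(2))
  interpret arith_henkin L A \<Gamma>
    by unfold_locales (use basic ext[OF \<Gamma>(2)] in auto)
  have "models term_struct term_nint term_sint (A \<inter> formulas L)"
    unfolding models_def
  proof (intro ballI allI impI)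
    fix \<psi> and e :: "nat \<Rightarrow> nat" and E :: "nat \<Rightarrow> nat set"
    assume "\<psi> \<in> A \<inter> formulas L" and E: "range E \<subseteq> m_strs term_struct"
    then have "subst (\<lambda>i. repN (e i)) (\<lambda>i. repS (E i)) \<psi> \<in> \<Gamma>"
      using repS by (intro mem_axiom) (auto simp: repN term_struct_def)
    then show "sat term_struct term_nint term_sint e E \<psi>"
      using \<open>\<psi> \<in> A \<inter> formulas L\<close> E by (simp add: sat_term_struct)
  qed
  moreover have "\<not> sat term_struct term_nint term_sint (\<lambda>i. valN (NVar i)) (\<lambda>i. valS (SVar i)) \<phi>"
  proof -
    have "subst (\<lambda>i. repN (valN (NVar i))) (\<lambda>i. repS (valS (SVar i))) \<phi> \<in> \<Gamma> \<longleftrightarrow>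
        subst NVar SVar \<phi> \<in> \<Gamma>"
      by (rule mem_subst_cong_iff) (auto simp: repN_valN repS_valS \<phi>)
    moreover have "\<phi> \<notin> \<Gamma>" using \<Gamma>(1) mem_Neg \<phi> by auto
    ultimately show ?thesis using \<phi> by (subst sat_term_struct) (auto simp: term_struct_def)
  qed
  ultimately show thesis
    by (intro that[of term_sint term_struct term_nint "\<lambda>i. valS (SVar i)"] term_sint_strs)
      (auto simp: term_struct_def)
qed

section \<open>Models of $V^0(2)$\<close>

text \<open>Interleaving leaves infinitely many places for arguments and for parameters, so neither
  number has to be fixed in advance.\<close>

definition mix :: "(nat \<Rightarrow> 'a) \<Rightarrow> (nat \<Rightarrow> 'a) \<Rightarrow> nat \<Rightarrow> 'a" where
  "mix e c i = (if even i then e (i div 2) else c (i div 2))"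

lemma mix_simps [simp]:
  "mix e c 0 = e 0" "mix e c (2 * i) = e i" "mix e c (Suc (2 * i)) = c i" "mix e c (Suc 0) = c 0"
  "mix e c (2 + 2 * i) = e (Suc i)" "mix e c (Suc (Suc (2 * i))) = e (Suc i)"
  by (auto simp: mix_def)

lemma range_mix: "range E \<subseteq> A \<Longrightarrow> range F \<subseteq> A \<Longrightarrow> range (mix E F) \<subseteq> A"
  by (auto simp: mix_def)

lemma wf_no_syms:
  fixes t :: num and T :: str
  shows "nsyms_nt t = {} \<Longrightarrow> ssyms_nt t = {} \<Longrightarrow> wf_nt t"
    and "nsyms_st T = {} \<Longrightarrow> ssyms_st T = {} \<Longrightarrow> wf_st T"
  by (induction t and T) auto

text \<open>A nonempty \<open>m_strs\<close> supplies an environment for the string variables;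
  without one, \<open>models\<close> would hold vacuously and say nothing about the numbers.\<close>

locale v0 =
  fixes M :: "'n struct" and I\<^sub>0 :: "(nfun, 'n) nint" and J\<^sub>0 :: "(sfun, 'n) sint"
  assumes V0: "models M I\<^sub>0 J\<^sub>0 (axms V0_2)" and strs_ne: "m_strs M \<noteq> {}"
begin

abbreviation zero ("\<zero>") where "\<zero> \<equiv> m_zero M"
abbreviation one ("\<one>") where "\<one> \<equiv> m_one M"
abbreviation add (infixl "\<oplus>" 65) where "x \<oplus> y \<equiv> m_plus M x y"
abbreviation mul (infixl "\<otimes>" 70) where "x \<otimes> y \<equiv> m_times M x y"
abbreviation le (infix "\<sqsubseteq>" 50) where "x \<sqsubseteq> y \<equiv> m_le M x y"
abbreviation strs ("\<S>") where "\<S> \<equiv> m_strs M"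
abbreviation len where "len X \<equiv> m_len M X"

definition lt (infix "\<sqsubset>" 50) where "x \<sqsubset> y \<longleftrightarrow> x \<sqsubseteq> y \<and> x \<noteq> y"

abbreviation sat\<^sub>0 where "sat\<^sub>0 e E \<phi> \<equiv> sat M I\<^sub>0 J\<^sub>0 e E \<phi>"
abbreviation ev\<^sub>0 where "ev\<^sub>0 e E t \<equiv> eval_nt M I\<^sub>0 J\<^sub>0 e E t"

lemma basic_sat:
  assumes "\<phi> \<in> basic_open" "X \<in> \<S>"
  shows "sat\<^sub>0 (case_nat x (\<lambda>_. y)) (\<lambda>_. X) \<phi>"
  using modelsD[OF V0, of \<phi> "\<lambda>_. X"] assms by (auto simp: V0_2_def)

lemma basic_num:
  assumes "\<phi> \<in> basic_open"
  shows "\<exists>E. sat\<^sub>0 (case_nat x (\<lambda>_. y)) E \<phi>"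
  using basic_sat[OF assms] strs_ne by auto

lemma B1: "x \<oplus> \<one> \<noteq> \<zero>"
  using basic_num[of "\<^bold>\<not> x\<^sub>0 \<^bold>+ One \<^bold>=\<^sub>1 Zero"] by (simp add: basic_open_def)
lemma B2: "x \<oplus> \<one> = y \<oplus> \<one> \<Longrightarrow> x = y"
  using basic_num[of "x\<^sub>0 \<^bold>+ One \<^bold>=\<^sub>1 x\<^sub>1 \<^bold>+ One \<^bold>\<longrightarrow> x\<^sub>0 \<^bold>=\<^sub>1 x\<^sub>1" x y] by (simp add: basic_open_def)
lemma B3: "x \<oplus> \<zero> = x"
  using basic_num[of "x\<^sub>0 \<^bold>+ Zero \<^bold>=\<^sub>1 x\<^sub>0" x] by (simp add: basic_open_def)
lemma B4: "x \<oplus> (y \<oplus> \<one>) = (x \<oplus> y) \<oplus> \<one>"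
  using basic_num[of "x\<^sub>0 \<^bold>+ (x\<^sub>1 \<^bold>+ One) \<^bold>=\<^sub>1 (x\<^sub>0 \<^bold>+ x\<^sub>1) \<^bold>+ One" x y] by (simp add: basic_open_def)
lemma B5: "x \<otimes> \<zero> = \<zero>"
  using basic_num[of "x\<^sub>0 \<^bold>* Zero \<^bold>=\<^sub>1 Zero" x] by (simp add: basic_open_def)
lemma B6: "x \<otimes> (y \<oplus> \<one>) = x \<otimes> y \<oplus> x"
  using basic_num[of "x\<^sub>0 \<^bold>* (x\<^sub>1 \<^bold>+ One) \<^bold>=\<^sub>1 x\<^sub>0 \<^bold>* x\<^sub>1 \<^bold>+ x\<^sub>0" x y] by (simp add: basic_open_def)
lemma B7: "x \<sqsubseteq> y \<Longrightarrow> y \<sqsubseteq> x \<Longrightarrow> x = y"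
  using basic_num[of "x\<^sub>0 \<^bold>\<le> x\<^sub>1 \<^bold>\<and> x\<^sub>1 \<^bold>\<le> x\<^sub>0 \<^bold>\<longrightarrow> x\<^sub>0 \<^bold>=\<^sub>1 x\<^sub>1" x y] by (simp add: basic_open_def)
lemma B8: "x \<sqsubseteq> x \<oplus> y"
  using basic_num[of "x\<^sub>0 \<^bold>\<le> x\<^sub>0 \<^bold>+ x\<^sub>1" x y] by (simp add: basic_open_def)
lemma B9: "\<zero> \<sqsubseteq> x"
  using basic_num[of "Zero \<^bold>\<le> x\<^sub>0" x] by (simp add: basic_open_def)
lemma B10: "x \<sqsubseteq> y \<or> y \<sqsubseteq> x"
  using basic_num[of "x\<^sub>0 \<^bold>\<le> x\<^sub>1 \<^bold>\<or> x\<^sub>1 \<^bold>\<le> x\<^sub>0" x y] by (simp add: basic_open_def)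
lemma B11: "x \<sqsubseteq> y \<longleftrightarrow> x \<sqsubset> y \<oplus> \<one>"
  using basic_num[of "x\<^sub>0 \<^bold>\<le> x\<^sub>1 \<^bold>\<longleftrightarrow> x\<^sub>0 \<^bold>< x\<^sub>1 \<^bold>+ One" x y] by (simp add: basic_open_def lt_def)
lemma L1: "X \<in> \<S> \<Longrightarrow> x \<in> X \<Longrightarrow> x \<sqsubset> len X"
  using basic_sat[of "x\<^sub>1 \<^bold>\<in> X\<^sub>0 \<^bold>\<longrightarrow> x\<^sub>1 \<^bold>< Len X\<^sub>0" X x x] by (simp add: basic_open_def lt_def)
lemma L2: "X \<in> \<S> \<Longrightarrow> x \<oplus> \<one> = len X \<Longrightarrow> x \<in> X"
  using basic_sat[of "x\<^sub>1 \<^bold>+ One \<^bold>=\<^sub>1 Len X\<^sub>0 \<^bold>\<longrightarrow> x\<^sub>1 \<^bold>\<in> X\<^sub>0" X x x] by (simp add: basic_open_def)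

lemma pred: "x \<noteq> \<zero> \<Longrightarrow> \<exists>y. y \<sqsubseteq> x \<and> y \<oplus> \<one> = x"
proof -
  assume x: "x \<noteq> \<zero>"
  obtain X where "X \<in> \<S>" using strs_ne by auto
  then have "sat\<^sub>0 (\<lambda>_. x) (\<lambda>_. X) B12"
    using modelsD[OF V0, of B12 "\<lambda>_. X"] by (auto simp: V0_2_def)
  then show ?thesis using x by (simp add: B12_def)
qed

subsection \<open>Definable predicates and induction\<close>

text \<open>\<open>DT\<close> and \<open>DP\<close> describe the polynomials and the $\Sigma^B_0$ predicates of an environment,
  with parameters from the model: the argument occupies the even and the parameters the
  odd variables of the defining term or formula.\<close>

definition DT :: "((nat \<Rightarrow> 'n) \<Rightarrow> 'n) \<Rightarrow> bool" where
  "DT t \<longleftrightarrow> (\<exists>u\<in>nterms L_A2. \<exists>c. \<forall>e E. t e = ev\<^sub>0 (mix e c) E u)"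

definition DP :: "((nat \<Rightarrow> 'n) \<Rightarrow> bool) \<Rightarrow> bool" where
  "DP P \<longleftrightarrow> (\<exists>\<phi>\<in>formulas L_A2. Sigma0B \<phi> \<and>
     (\<exists>c E. range E \<subseteq> \<S> \<and> (\<forall>e. P e \<longleftrightarrow> sat\<^sub>0 (mix e c) E \<phi>)))"

text \<open>Parameter \<open>j\<close> sits at index \<open>2 * j + 1\<close>. It moves to
  \<open>4 * j + 1\<close> or \<open>4 * j + 3\<close>, so two formulas can share the parameter
  sequence \<open>mix c d\<close>.\<close>

definition ren :: "bool \<Rightarrow> nat \<Rightarrow> nat" where
  "ren b i = (if even i then i else 4 * (i div 2) + (if b then 1 else 3))"

lemma ren_mix:
  "mix e (mix c d) (ren True i) = mix e c i" "mix e (mix c d) (ren False i) = mix e d i"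
proof -
  have "4 * (i div 2) + 3 = Suc (2 * Suc (2 * (i div 2)))" "4 * (i div 2) + 1 = Suc (2 * (2 * (i div 2)))"
    by auto
  then show "mix e (mix c d) (ren True i) = mix e c i" "mix e (mix c d) (ren False i) = mix e d i"
    unfolding ren_def by (auto simp only: mix_simps split: if_splits) (auto simp: mix_def)
qed

lemma DT2E:
  assumes "DT s" "DT t"
  obtains u v c where "u \<in> nterms L_A2" "v \<in> nterms L_A2"
    "\<And>e E. s e = ev\<^sub>0 (mix e c) E u" "\<And>e E. t e = ev\<^sub>0 (mix e c) E v"
proof -
  obtain u c v d where uv: "u \<in> nterms L_A2" "\<And>e E. s e = ev\<^sub>0 (mix e c) E u"
    "v \<in> nterms L_A2" "\<And>e E. t e = ev\<^sub>0 (mix e d) E v"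
    using assms unfolding DT_def by blast
  show thesis
    by (rule that[of "subst_nt (\<lambda>i. NVar (ren True i)) SVar u"
          "subst_nt (\<lambda>i. NVar (ren False i)) SVar v" "mix c d"])
      (auto simp: eval_subst ren_mix uv intro!: subst_terms)
qed

lemma DT_var: "DT (\<lambda>e. e i)"
  unfolding DT_def by (intro bexI[of _ "NVar (2 * i)"] exI[of _ "\<lambda>_. \<zero>"]) auto

lemma DT_const: "DT (\<lambda>e. a)"
  unfolding DT_def by (intro bexI[of _ "NVar 1"] exI[of _ "\<lambda>_. a"]) auto

lemma DT_add: assumes "DT s" "DT t" shows "DT (\<lambda>e. s e \<oplus> t e)"
proof (rule DT2E[OF assms])
  fix u v c assume *: "u \<in> nterms L_A2" "v \<in> nterms L_A2"
    "\<And>e E. s e = ev\<^sub>0 (mix e c) E u" "\<And>e E. t e = ev\<^sub>0 (mix e c) E v"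
  show ?thesis unfolding DT_def using *(1,2)
    by (intro bexI[of _ "u \<^bold>+ v"] exI[of _ c] allI) (simp_all add: *(3,4)[symmetric])
qed

lemma DT_mul: assumes "DT s" "DT t" shows "DT (\<lambda>e. s e \<otimes> t e)"
proof (rule DT2E[OF assms])
  fix u v c assume *: "u \<in> nterms L_A2" "v \<in> nterms L_A2"
    "\<And>e E. s e = ev\<^sub>0 (mix e c) E u" "\<And>e E. t e = ev\<^sub>0 (mix e c) E v"
  show ?thesis unfolding DT_def using *(1,2)
    by (intro bexI[of _ "u \<^bold>* v"] exI[of _ c] allI) (simp_all add: *(3,4)[symmetric])
qed

lemmas DT_intros = DT_var DT_const DT_add DT_mul

lemma DP_eq: assumes "DT s" "DT t" shows "DP (\<lambda>e. s e = t e)"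
proof (rule DT2E[OF assms])
  fix u v c assume *: "u \<in> nterms L_A2" "v \<in> nterms L_A2"
    "\<And>e E. s e = ev\<^sub>0 (mix e c) E u" "\<And>e E. t e = ev\<^sub>0 (mix e c) E v"
  obtain X where "X \<in> \<S>" using strs_ne by auto
  then show ?thesis unfolding DP_def using *(1,2)
    by (intro bexI[of _ "u \<^bold>=\<^sub>1 v"] conjI exI[of _ c] exI[of _ "\<lambda>_. X"])
      (auto intro: Sigma0B.intros(1) simp: *(3,4)[symmetric])
qed

lemma DP_le: assumes "DT s" "DT t" shows "DP (\<lambda>e. s e \<sqsubseteq> t e)"
proof (rule DT2E[OF assms])
  fix u v c assume *: "u \<in> nterms L_A2" "v \<in> nterms L_A2"
    "\<And>e E. s e = ev\<^sub>0 (mix e c) E u" "\<And>e E. t e = ev\<^sub>0 (mix e c) E v"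
  obtain X where "X \<in> \<S>" using strs_ne by auto
  then show ?thesis unfolding DP_def using *(1,2)
    by (intro bexI[of _ "u \<^bold>\<le> v"] conjI exI[of _ c] exI[of _ "\<lambda>_. X"])
      (auto intro: Sigma0B.intros(1) simp: *(3,4)[symmetric])
qed

lemma DP_mem: assumes "DT t" "X \<in> \<S>" shows "DP (\<lambda>e. t e \<in> X)"
proof -
  obtain u c where *: "u \<in> nterms L_A2" "\<And>e E. t e = ev\<^sub>0 (mix e c) E u"
    using assms(1) unfolding DT_def by blast
  show ?thesis unfolding DP_def using *(1) assms(2)
    by (intro bexI[of _ "u \<^bold>\<in> SVar 0"] conjI exI[of _ c] exI[of _ "\<lambda>_. X"])
      (auto intro: Sigma0B.intros(1) simp: *(2)[symmetric])
qed

lemma DPE: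
  assumes "DP P"
  obtains \<phi> c E where "\<phi> \<in> formulas L_A2" "Sigma0B \<phi>" "range E \<subseteq> \<S>"
    "\<And>e. P e \<longleftrightarrow> sat\<^sub>0 (mix e c) E \<phi>"
proof -
  obtain \<phi> where \<phi>: "\<phi> \<in> formulas L_A2" "Sigma0B \<phi> \<and>
     (\<exists>c E. range E \<subseteq> \<S> \<and> (\<forall>e. P e \<longleftrightarrow> sat\<^sub>0 (mix e c) E \<phi>))"
    using assms unfolding DP_def by (elim bexE)
  then obtain c E where "range E \<subseteq> \<S>" "\<forall>e. P e \<longleftrightarrow> sat\<^sub>0 (mix e c) E \<phi>" by (elim conjE exE)
  with \<phi> show thesis by (intro that[of \<phi> E c]) simp_all
qed

lemma DP2E:
  assumes "DP P" "DP Q"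
  obtains \<phi> \<psi> c E where "\<phi> \<in> formulas L_A2" "\<psi> \<in> formulas L_A2" "Sigma0B \<phi>" "Sigma0B \<psi>"
    "range E \<subseteq> \<S>" "\<And>e. P e \<longleftrightarrow> sat\<^sub>0 (mix e c) E \<phi>" "\<And>e. Q e \<longleftrightarrow> sat\<^sub>0 (mix e c) E \<psi>"
proof -
  obtain \<phi> c E where \<phi>: "\<phi> \<in> formulas L_A2" "Sigma0B \<phi>" "range E \<subseteq> \<S>"
    "\<And>e. P e \<longleftrightarrow> sat\<^sub>0 (mix e c) E \<phi>" by (rule DPE[OF assms(1)]) (rule that; assumption)
  obtain \<psi> d F where \<psi>: "\<psi> \<in> formulas L_A2" "Sigma0B \<psi>" "range F \<subseteq> \<S>"
    "\<And>e. Q e \<longleftrightarrow> sat\<^sub>0 (mix e d) F \<psi>" by (rule DPE[OF assms(2)]) (rule that; assumption)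
  show thesis
    by (rule that[of "subst (\<lambda>i. NVar (ren True i)) (\<lambda>i. SVar (2 * i)) \<phi>"
          "subst (\<lambda>i. NVar (ren False i)) (\<lambda>i. SVar (2 * i + 1)) \<psi>" "mix E F" "mix c d"])
      (use \<phi>(1-3) \<psi>(1-3) in \<open>auto simp: \<phi>(4) \<psi>(4) sat_subst ren_mix range_mix
        intro!: subst_formulas Sigma0B_subst\<close>)
qed

lemma DP_imp: assumes "DP P" "DP Q" shows "DP (\<lambda>e. P e \<longrightarrow> Q e)"
proof (rule DP2E[OF assms])
  fix \<phi> \<psi> c E assume *: "\<phi> \<in> formulas L_A2" "\<psi> \<in> formulas L_A2" "Sigma0B \<phi>" "Sigma0B \<psi>"
    "range E \<subseteq> \<S>" "\<And>e. P e \<longleftrightarrow> sat\<^sub>0 (mix e c) E \<phi>" "\<And>e. Q e \<longleftrightarrow> sat\<^sub>0 (mix e c) E \<psi>"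
  show ?thesis unfolding DP_def
    by (intro bexI[of _ "\<phi> \<^bold>\<longrightarrow> \<psi>"] conjI exI[of _ c] exI[of _ E])
      (use *(1-5) in \<open>auto simp: *(6,7) intro: Sigma0B.intros(2)\<close>)
qed

lemma DP_False: "DP (\<lambda>e. False)"
proof -
  obtain X where "X \<in> \<S>" using strs_ne by auto
  then show ?thesis unfolding DP_def
    by (intro bexI[of _ Falsum] conjI exI[of _ "\<lambda>_. \<zero>"] exI[of _ "\<lambda>_. X"])
      (auto intro: Sigma0B.intros(1))
qed

lemma DP_all:
  assumes "DT t" "DP (\<lambda>e. P (e 0) (\<lambda>i. e (Suc i)))"
  shows "DP (\<lambda>e. \<forall>x. x \<sqsubseteq> t e \<longrightarrow> P x e)"
proof -
  obtain u c where u: "u \<in> nterms L_A2" "\<And>e E. t e = ev\<^sub>0 (mix e c) E u"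
    using assms(1) unfolding DT_def by blast
  obtain \<phi> d E where \<phi>: "\<phi> \<in> formulas L_A2" "Sigma0B \<phi>" "range E \<subseteq> \<S>"
    "\<And>e. P (e 0) (\<lambda>i. e (Suc i)) \<longleftrightarrow> sat\<^sub>0 (mix e d) E \<phi>"
    by (rule DPE[OF assms(2)]) (rule that; assumption)
  \<comment> \<open>For the environment \<open>case_nat x e\<close> the formula
    \<open>\<phi>\<close> expects the bound variable at index 0 and the old variable
    \<open>j\<close> at \<open>2 * j + 2\<close>. Below the quantifier the latter sits at
    \<open>2 * j + 1\<close>, one above its old place \<open>2 * j\<close>. The parameters join
    those of the bound by \<open>ren False\<close> and are then raised by one.\<close>
  define r where "r i = (case i of 0 \<Rightarrow> 0 | Suc j \<Rightarrow> if even i then Suc (i - 2) else Suc (ren False i))" for i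
  define \<psi> where "\<psi> = AllLe (subst_nt (\<lambda>i. NVar (ren True i)) SVar u) (subst (\<lambda>i. NVar (r i)) SVar \<phi>)"
  have "(\<lambda>i. case_nat x (mix e (mix c d)) (r i)) = mix (case_nat x e) d" for x e
  proof
    fix i
    consider "i = 0" | j where "i = 2 * Suc j" | j where "i = Suc (2 * j)"
    proof (cases "even i")
      case True
      then obtain k where "i = 2 * k" by blast
      then show ?thesis using that by (cases k) auto
    next
      case False
      then show ?thesis using that by (auto elim!: oddE)
    qed
    then show "case_nat x (mix e (mix c d)) (r i) = mix (case_nat x e) d i"
      by cases (auto simp: r_def ren_mix simp del: mix_simps(4))
  qed
  moreover have "P x e \<longleftrightarrow> sat\<^sub>0 (mix (case_nat x e) d) E \<phi>" for x e
    using \<phi>(4)[of "case_nat x e"] by simp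
  ultimately have "(\<forall>x. x \<sqsubseteq> t e \<longrightarrow> P x e) \<longleftrightarrow> sat\<^sub>0 (mix e (mix c d)) E \<psi>" for e
    by (simp add: \<psi>_def eval_subst ren_mix u(2)[symmetric] sat_subst)
  moreover have "\<psi> \<in> formulas L_A2" "Sigma0B \<psi>"
    using u \<phi> by (auto simp: \<psi>_def intro!: subst_terms subst_formulas Sigma0B.intros(3) Sigma0B_subst)
  ultimately show ?thesis unfolding DP_def using \<phi>(3)
    by (intro bexI[of _ \<psi>] conjI exI[of _ "mix c d"] exI[of _ E]) simp_all
qed

lemma DP_not: "DP P \<Longrightarrow> DP (\<lambda>e. \<not> P e)"
  using DP_imp[OF _ DP_False] by simp

lemma DP_and: "DP P \<Longrightarrow> DP Q \<Longrightarrow> DP (\<lambda>e. P e \<and> Q e)"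
  using DP_not[OF DP_imp[OF _ DP_not]] by simp

lemma DP_iff: "DP P \<Longrightarrow> DP Q \<Longrightarrow> DP (\<lambda>e. P e = Q e)"
  using DP_and[OF DP_imp[of P Q] DP_imp[of Q P]] by (simp add: iff_conv_conj_imp[symmetric])

lemma DP_True: "DP (\<lambda>e. True)"
  using DP_not[OF DP_False] by simp

lemma DP_ex:
  assumes "DT t" "DP (\<lambda>e. P (e 0) (\<lambda>i. e (Suc i)))"
  shows "DP (\<lambda>e. \<exists>x. x \<sqsubseteq> t e \<and> P x e)"
  using DP_not[OF DP_all[OF assms(1) DP_not[OF assms(2)]]] by simp

lemma DP_lt: "DT s \<Longrightarrow> DT t \<Longrightarrow> DP (\<lambda>e. s e \<sqsubset> t e)"
  unfolding lt_def by (intro DP_and DP_not DP_le DP_eq)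

lemmas DP_intros = DT_intros DP_eq DP_le DP_lt DP_imp DP_not DP_and DP_iff
  DP_all DP_ex DP_mem

lemma weak_comprehension:
  assumes "DP (\<lambda>e. P (e 0))"
  obtains X where "X \<in> \<S>" "len X \<sqsubseteq> b" "\<And>z. z \<sqsubset> b \<Longrightarrow> z \<in> X \<longleftrightarrow> P z"
proof -
  obtain \<phi> c E where \<phi>: "\<phi> \<in> formulas L_A2" "Sigma0B \<phi>" "range E \<subseteq> \<S>"
    "\<And>e. P (e 0) \<longleftrightarrow> sat\<^sub>0 (mix e c) E \<phi>"
    by (rule DPE[OF assms]) (rule that; assumption)
  \<comment> \<open>In \<open>COMP\<close> variable 0 is the element and variable 1 the bound, so
    the parameters start at 2. Every argument place reads the element, as the predicate depends on
    \<open>e 0\<close> only.\<close>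
  define r where "r i = (if even i then 0 else Suc (Suc (i div 2)))" for i :: nat
  define \<psi> where "\<psi> = subst (\<lambda>i. NVar (r i)) SVar \<phi>"
  have "\<psi> \<in> formulas L_A2" "Sigma0B \<psi>"
    unfolding \<psi>_def using \<phi> by (auto intro: subst_formulas Sigma0B_subst)
  then have "COMP \<psi> \<in> axms V0_2" by (auto simp: V0_2_def)
  from modelsD[OF V0 this \<phi>(3), of "case_nat b c"]
  obtain X where X: "X \<in> \<S>" "len X \<sqsubseteq> b"
    "\<And>z. z \<sqsubset> b \<Longrightarrow> z \<in> X \<longleftrightarrow> sat\<^sub>0 (case_nat z (case_nat b c)) E \<psi>"
    by (auto simp: COMP_def lt_def)
  have "(\<lambda>i. case_nat z (case_nat b c) (r i)) = mix (\<lambda>_. z) c" for z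
    by (auto simp: r_def mix_def)
  then have "sat\<^sub>0 (case_nat z (case_nat b c)) E \<psi> \<longleftrightarrow> P z" for z
    using \<phi>(4)[of "\<lambda>_. z"] by (simp add: \<psi>_def sat_subst)
  then show thesis using X that by blast
qed

text \<open>All further arithmetic rests on induction, so only the axioms themselves are at hand.
  The string \<open>Y\<close> collects the numbers up to which \<open>P\<close> holds throughout; by
  L2 the predecessor \<open>w\<close> of its length is an element. The step puts
  \<open>w \<oplus> \<one>\<close> into \<open>Y\<close>, although that is the length of
  \<open>Y\<close>, against L1.\<close>

lemma induct:
  assumes D: "DP (\<lambda>e. P (e 0))" and 0: "P \<zero>" and step: "\<And>x. P x \<Longrightarrow> P (x \<oplus> \<one>)"
  shows "P x"
proof (rule ccontr)
  assume notP: "\<not> P x"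
  have refl: "y \<sqsubseteq> y" for y using B10 by blast
  have "DP (\<lambda>e. \<forall>i. i \<sqsubseteq> e 0 \<longrightarrow> P i)" by (intro DP_all DT_var D)
  then obtain Y where Y: "Y \<in> \<S>" "len Y \<sqsubseteq> x \<oplus> \<one>" "\<And>z. z \<sqsubset> x \<oplus> \<one> \<Longrightarrow> z \<in> Y \<longleftrightarrow> (\<forall>i. i \<sqsubseteq> z \<longrightarrow> P i)"
    by (rule weak_comprehension) blast
  have "\<zero> \<sqsubset> x \<oplus> \<one>" using B11 B9 by blast
  then have "\<zero> \<in> Y" using Y(3) 0 B7[OF _ B9] by auto
  then have "len Y \<noteq> \<zero>" using L1[OF Y(1), of \<zero>] by (auto simp: lt_def)
  then obtain w where w: "w \<oplus> \<one> = len Y" using pred by blast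
  then have wY: "w \<in> Y" using L2 Y(1) by blast
  have wx: "w \<sqsubseteq> x"
  proof (cases "w = x")
    case False
    then have "w \<oplus> \<one> \<sqsubset> x \<oplus> \<one>" using Y(2) B2[of w x] by (auto simp: lt_def w)
    then have "w \<oplus> \<one> \<sqsubseteq> x" by (simp add: B11)
    then show ?thesis using B10[of w x] B11[of x w] B7[of x "w \<oplus> \<one>"] by (auto simp: lt_def)
  qed (use refl in simp)
  then have P: "\<forall>i. i \<sqsubseteq> w \<longrightarrow> P i" using Y(3)[of w] wY by (simp add: B11)
  then have "w \<noteq> x" using refl notP by auto
  then have "w \<oplus> \<one> \<sqsubseteq> x"
    using wx B10[of "w \<oplus> \<one>" x] B11[of x w] B7[of x w] refl by (auto simp: lt_def)
  then have "w \<oplus> \<one> \<sqsubset> x \<oplus> \<one>" by (simp add: B11)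
  moreover have "P i" if "i \<sqsubseteq> w \<oplus> \<one>" for i
  proof (cases "i = w \<oplus> \<one>")
    case False
    then have "i \<sqsubseteq> w" using that B11[of i w] by (simp add: lt_def)
    then show ?thesis using P by simp
  qed (use step P refl in blast)
  ultimately have "w \<oplus> \<one> \<in> Y" using Y(3)[of "w \<oplus> \<one>"] by simp
  then show False using L1[OF Y(1), of "w \<oplus> \<one>"] w by (simp add: lt_def)
qed

end

section \<open>Arithmetic of the number sort\<close>

context v0
begin

lemma add_assoc: "x \<oplus> y \<oplus> z = x \<oplus> (y \<oplus> z)"
proof (rule induct[of "\<lambda>z. x \<oplus> y \<oplus> z = x \<oplus> (y \<oplus> z)"])
  show "DP (\<lambda>e. x \<oplus> y \<oplus> e 0 = x \<oplus> (y \<oplus> e 0))" by (intro DP_intros)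
qed (simp_all add: B3 B4)

lemma zero_add: "\<zero> \<oplus> x = x"
proof (rule induct[of "\<lambda>x. \<zero> \<oplus> x = x"])
  show "DP (\<lambda>e. \<zero> \<oplus> e 0 = e 0)" by (intro DP_intros)
qed (simp_all add: B3 B4)

lemma add_one_left: "x \<oplus> \<one> \<oplus> y = x \<oplus> y \<oplus> \<one>"
proof (rule induct[of "\<lambda>y. x \<oplus> \<one> \<oplus> y = x \<oplus> y \<oplus> \<one>"])
  show "DP (\<lambda>e. x \<oplus> \<one> \<oplus> e 0 = x \<oplus> e 0 \<oplus> \<one>)" by (intro DP_intros)
qed (simp_all add: B3 B4)

lemma add_commute: "x \<oplus> y = y \<oplus> x"
proof (rule induct[of "\<lambda>y. x \<oplus> y = y \<oplus> x"])
  show "DP (\<lambda>e. x \<oplus> e 0 = e 0 \<oplus> x)" by (intro DP_intros)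
  show "x \<oplus> (y \<oplus> \<one>) = y \<oplus> \<one> \<oplus> x" if "x \<oplus> y = y \<oplus> x" for y
    unfolding add_one_left B4 that ..
qed (simp add: B3 zero_add)

lemma zero_mul: "\<zero> \<otimes> x = \<zero>"
proof (rule induct[of "\<lambda>x. \<zero> \<otimes> x = \<zero>"])
  show "DP (\<lambda>e. \<zero> \<otimes> e 0 = \<zero>)" by (intro DP_intros)
qed (simp_all add: B3 B5 B6)

lemma add_left_commute: "x \<oplus> (y \<oplus> z) = y \<oplus> (x \<oplus> z)"
  by (simp add: add_assoc[symmetric] add_commute[of x y])

lemma mul_one_left: "(x \<oplus> \<one>) \<otimes> y = x \<otimes> y \<oplus> y"
proof (rule induct[of "\<lambda>y. (x \<oplus> \<one>) \<otimes> y = x \<otimes> y \<oplus> y"])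
  show "DP (\<lambda>e. (x \<oplus> \<one>) \<otimes> e 0 = x \<otimes> e 0 \<oplus> e 0)" by (intro DP_intros)
  show "(x \<oplus> \<one>) \<otimes> (y \<oplus> \<one>) = x \<otimes> (y \<oplus> \<one>) \<oplus> (y \<oplus> \<one>)"
    if "(x \<oplus> \<one>) \<otimes> y = x \<otimes> y \<oplus> y" for y
    unfolding B6 that by (simp add: add_assoc) (simp add: add_left_commute add_commute)
qed (simp_all add: B3 B5)

lemma mul_commute: "x \<otimes> y = y \<otimes> x"
proof (rule induct[of "\<lambda>y. x \<otimes> y = y \<otimes> x"])
  show "DP (\<lambda>e. x \<otimes> e 0 = e 0 \<otimes> x)" by (intro DP_intros)
qed (simp_all add: B5 B6 zero_mul mul_one_left)

lemma distrib_right: "(x \<oplus> y) \<otimes> z = x \<otimes> z \<oplus> y \<otimes> z"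
proof (rule induct[of "\<lambda>z. (x \<oplus> y) \<otimes> z = x \<otimes> z \<oplus> y \<otimes> z"])
  show "DP (\<lambda>e. (x \<oplus> y) \<otimes> e 0 = x \<otimes> e 0 \<oplus> y \<otimes> e 0)" by (intro DP_intros)
  show "(x \<oplus> y) \<otimes> (z \<oplus> \<one>) = x \<otimes> (z \<oplus> \<one>) \<oplus> y \<otimes> (z \<oplus> \<one>)"
    if "(x \<oplus> y) \<otimes> z = x \<otimes> z \<oplus> y \<otimes> z" for z
    unfolding B6 that by (simp add: add_assoc) (simp add: add_left_commute)
qed (simp_all add: B3 B5)

lemma distrib_left: "z \<otimes> (x \<oplus> y) = z \<otimes> x \<oplus> z \<otimes> y"
  using distrib_right[of x y z] by (simp only: mul_commute[of z])

lemma mul_assoc: "x \<otimes> y \<otimes> z = x \<otimes> (y \<otimes> z)"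
proof (rule induct[of "\<lambda>z. x \<otimes> y \<otimes> z = x \<otimes> (y \<otimes> z)"])
  show "DP (\<lambda>e. x \<otimes> y \<otimes> e 0 = x \<otimes> (y \<otimes> e 0))" by (intro DP_intros)
  show "x \<otimes> y \<otimes> (z \<oplus> \<one>) = x \<otimes> (y \<otimes> (z \<oplus> \<one>))" if "x \<otimes> y \<otimes> z = x \<otimes> (y \<otimes> z)" for z
    by (subst B6, subst that, subst B6, subst distrib_left) (rule refl)
qed (simp_all add: B5)

lemma add_right_cancel: "x \<oplus> z = y \<oplus> z \<Longrightarrow> x = y"
proof -
  have "x \<oplus> z = y \<oplus> z \<longrightarrow> x = y"
  proof (rule induct[of "\<lambda>z. x \<oplus> z = y \<oplus> z \<longrightarrow> x = y"])
    show "DP (\<lambda>e. x \<oplus> e 0 = y \<oplus> e 0 \<longrightarrow> x = y)" by (intro DP_intros)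
  qed (auto simp: B3 B4 dest: B2)
  then show "x \<oplus> z = y \<oplus> z \<Longrightarrow> x = y" by simp
qed

lemma one_mul: "\<one> \<otimes> x = x"
  using mul_one_left[of \<zero> x] by (simp add: zero_add zero_mul)

lemma le_iff_add: "x \<sqsubseteq> y \<longleftrightarrow> (\<exists>z. y = x \<oplus> z)"
proof
  \<comment> \<open>The difference is bounded by \<open>y\<close>, which keeps the induction formula
    bounded.\<close>
  have "x \<sqsubseteq> y \<longrightarrow> (\<exists>z. z \<sqsubseteq> y \<and> y = x \<oplus> z)"
  proof (rule induct[of "\<lambda>y. x \<sqsubseteq> y \<longrightarrow> (\<exists>z. z \<sqsubseteq> y \<and> y = x \<oplus> z)"])
    show "DP (\<lambda>e. x \<sqsubseteq> e 0 \<longrightarrow> (\<exists>z. z \<sqsubseteq> e 0 \<and> e 0 = x \<oplus> z))" by (intro DP_intros)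
    show "x \<sqsubseteq> \<zero> \<longrightarrow> (\<exists>z. z \<sqsubseteq> \<zero> \<and> \<zero> = x \<oplus> z)"
    proof
      assume "x \<sqsubseteq> \<zero>"
      then have "x = \<zero>" using B9 by (rule B7)
      then show "\<exists>z. z \<sqsubseteq> \<zero> \<and> \<zero> = x \<oplus> z" by (intro exI[of _ \<zero>]) (simp add: B3 B9)
    qed
    show "x \<sqsubseteq> y \<oplus> \<one> \<longrightarrow> (\<exists>z. z \<sqsubseteq> y \<oplus> \<one> \<and> y \<oplus> \<one> = x \<oplus> z)"
      if IH: "x \<sqsubseteq> y \<longrightarrow> (\<exists>z. z \<sqsubseteq> y \<and> y = x \<oplus> z)" for y
    proof
      assume xy: "x \<sqsubseteq> y \<oplus> \<one>"
      show "\<exists>z. z \<sqsubseteq> y \<oplus> \<one> \<and> y \<oplus> \<one> = x \<oplus> z"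
      proof (cases "x = y \<oplus> \<one>")
        case True
        then show ?thesis by (intro exI[of _ \<zero>]) (simp add: B3 B9)
      next
        case False
        then have "x \<sqsubset> y \<oplus> \<one>" using xy by (simp add: lt_def)
        then have "x \<sqsubseteq> y" by (simp only: B11)
        with IH obtain z where "y = x \<oplus> z" by blast
        then have "y \<oplus> \<one> = x \<oplus> (z \<oplus> \<one>)" by (simp add: B4)
        moreover have "z \<oplus> \<one> \<sqsubseteq> x \<oplus> (z \<oplus> \<one>)"
          by (subst add_commute[of x]) (rule B8)
        ultimately show ?thesis by (intro exI[of _ "z \<oplus> \<one>"]) simp
      qed
    qed
  qed
  then show "x \<sqsubseteq> y \<Longrightarrow> \<exists>z. y = x \<oplus> z" by auto
qed (auto simp: B8)

lemma le_trans: "x \<sqsubseteq> y \<Longrightarrow> y \<sqsubseteq> z \<Longrightarrow> x \<sqsubseteq> z"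
  by (auto simp: le_iff_add add_assoc)

lemma one_le: "x \<noteq> \<zero> \<Longrightarrow> \<exists>y. x = y \<oplus> \<one>"
  using pred[of x] by auto

lemma lt_iff_add: "x \<sqsubset> y \<longleftrightarrow> (\<exists>z. y = x \<oplus> (z \<oplus> \<one>))"
proof
  assume "x \<sqsubset> y"
  then obtain z where z: "y = x \<oplus> z" "x \<noteq> y" by (auto simp: lt_def le_iff_add)
  then have "z \<noteq> \<zero>" by (auto simp: B3)
  then show "\<exists>z. y = x \<oplus> (z \<oplus> \<one>)" using one_le[of z] z by auto
next
  assume "\<exists>z. y = x \<oplus> (z \<oplus> \<one>)"
  then obtain z where z: "y = x \<oplus> (z \<oplus> \<one>)" by auto
  have "x \<noteq> y"
  proof
    assume "x = y"
    then have "(z \<oplus> \<one>) \<oplus> x = \<zero> \<oplus> x" using z by (simp add: add_commute[of _ x] B3)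
    from add_right_cancel[OF this] show False by (simp add: B1)
  qed
  then show "x \<sqsubset> y" using z by (auto simp: lt_def B8)
qed

definition monus (infixl "\<ominus>" 65) where
  "x \<ominus> y = (if y \<sqsubseteq> x then THE z. x = y \<oplus> z else \<zero>)"

lemma monus_add: "(y \<oplus> z) \<ominus> y = z"
proof -
  have "(THE w. y \<oplus> z = y \<oplus> w) = z"
    by (rule the_equality) (auto simp: add_commute[of y] dest: add_right_cancel)
  then show ?thesis by (simp add: monus_def B8)
qed

lemma monus_zero: "\<not> y \<sqsubseteq> x \<Longrightarrow> x \<ominus> y = \<zero>"
  by (simp add: monus_def)

text \<open>With this instance the library of ordered semirings applies to the numbers of the model.
  The class asks for truncated subtraction besides the signature; \<open>\<ominus>\<close> provides
  it.\<close>

lemma semidom: "class.linordered_semidom (\<oplus>) (\<ominus>) (\<sqsubseteq>) (\<sqsubset>) \<zero> (\<otimes>) \<one>"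
proof -
  have mono: "z \<oplus> x \<sqsubseteq> z \<oplus> y" if "x \<sqsubseteq> y" for x y z
    using that by (auto simp: le_iff_add add_assoc)
  have mono': "x \<sqsubseteq> y" if "z \<oplus> x \<sqsubseteq> z \<oplus> y" for x y z
  proof -
    obtain w where w: "z \<oplus> y = z \<oplus> x \<oplus> w" using \<open>z \<oplus> x \<sqsubseteq> z \<oplus> y\<close> by (auto simp: le_iff_add)
    have "y \<oplus> z = z \<oplus> y" by (rule add_commute)
    also have "\<dots> = z \<oplus> (x \<oplus> w)" unfolding w by (rule add_assoc)
    also have "\<dots> = (x \<oplus> w) \<oplus> z" by (rule add_commute)
    finally have "y \<oplus> z = (x \<oplus> w) \<oplus> z" .
    then have "y = x \<oplus> w" by (rule add_right_cancel)
    then show ?thesis by (simp add: B8)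
  qed
  have pos: "\<zero> \<sqsubset> x \<longleftrightarrow> x \<noteq> \<zero>" for x by (auto simp: lt_def B9)
  have mul_ne: "x \<otimes> y \<noteq> \<zero>" if "x \<noteq> \<zero>" "y \<noteq> \<zero>" for x y
  proof -
    obtain a b where "x = a \<oplus> \<one>" "y = b \<oplus> \<one>"
      using one_le[OF \<open>x \<noteq> \<zero>\<close>] one_le[OF \<open>y \<noteq> \<zero>\<close>] by auto
    then have "x \<otimes> y = ((a \<oplus> \<one>) \<otimes> b \<oplus> a) \<oplus> \<one>" by (simp only: B6 B4)
    then show ?thesis by (simp only: B1 not_False_eq_True)
  qed
  show ?thesis
  proof unfold_locales
    fix a b c
    show "a \<oplus> b \<ominus> a = b" by (rule monus_add)
    show "a \<ominus> b \<ominus> c = a \<ominus> (b \<oplus> c)"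
    proof (cases "b \<sqsubseteq> a")
      case True
      then obtain w where w: "a = b \<oplus> w" by (auto simp: le_iff_add)
      show ?thesis
      proof (cases "c \<sqsubseteq> w")
        case True
        then obtain u where "w = c \<oplus> u" by (auto simp: le_iff_add)
        then show ?thesis using w monus_add[of b w] monus_add[of c u] monus_add[of "b \<oplus> c" u]
          by (simp add: add_assoc)
      next
        case False
        then have "\<not> b \<oplus> c \<sqsubseteq> a" using mono'[of b c w] w by auto
        then show ?thesis using w False by (simp add: monus_add monus_zero)
      qed
    next
      case False
      then have "\<not> b \<oplus> c \<sqsubseteq> a" using le_trans[OF B8, of b c a] by auto
      moreover have "\<zero> \<ominus> c = \<zero>"
        using B7[OF _ B9, of c] monus_add[of \<zero> \<zero>] by (cases "c \<sqsubseteq> \<zero>") (auto simp: monus_zero B3)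
      ultimately show ?thesis using False by (simp add: monus_zero)
    qed
    show "a \<otimes> (b \<ominus> c) = a \<otimes> b \<ominus> a \<otimes> c"
    proof (cases "c \<sqsubseteq> b")
      case True
      then obtain w where w: "b = c \<oplus> w" by (auto simp: le_iff_add)
      have "a \<otimes> b = a \<otimes> c \<oplus> a \<otimes> w" using w by (simp add: distrib_left)
      then show ?thesis using w by (simp add: monus_add)
    next
      case False
      then obtain w where w: "c = b \<oplus> w" using B10[of b c] by (auto simp: le_iff_add)
      have ac: "a \<otimes> c = a \<otimes> b \<oplus> a \<otimes> w" using w by (simp add: distrib_left)
      show ?thesis
      proof (cases "a \<otimes> c \<sqsubseteq> a \<otimes> b")
        case True
        then have "a \<otimes> b = a \<otimes> c" using B7 B8 unfolding ac by blast
        then show ?thesis using False monus_add[of "a \<otimes> c" \<zero>] by (simp add: monus_zero B3 B5)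
      next
        case n: False
        then show ?thesis using False by (simp add: monus_zero B5)
      qed
    qed
    show "a \<sqsubset> b \<longleftrightarrow> a \<sqsubseteq> b \<and> \<not> b \<sqsubseteq> a" using B7 B10 by (auto simp: lt_def)
    show "a \<sqsubseteq> a" using B10 by blast
    show "a \<sqsubseteq> b \<or> b \<sqsubseteq> a" by (rule B10)
    show "a \<sqsubset> b \<Longrightarrow> \<zero> \<sqsubset> c \<Longrightarrow> c \<otimes> a \<sqsubset> c \<otimes> b"
    proof -
      assume ab: "a \<sqsubset> b" and c: "\<zero> \<sqsubset> c"
      then obtain w where w: "b = a \<oplus> (w \<oplus> \<one>)" by (auto simp: lt_iff_add)
      have "c \<otimes> (w \<oplus> \<one>) \<noteq> \<zero>" using c mul_ne[of c] by (simp add: B1 pos)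
      then obtain u where "c \<otimes> (w \<oplus> \<one>) = u \<oplus> \<one>" using one_le[of "c \<otimes> (w \<oplus> \<one>)"] by blast
      moreover have "c \<otimes> b = c \<otimes> a \<oplus> c \<otimes> (w \<oplus> \<one>)" using w by (simp add: distrib_left)
      ultimately show "c \<otimes> a \<sqsubset> c \<otimes> b" by (auto simp: lt_iff_add)
    qed
    show "b \<sqsubseteq> a \<Longrightarrow> a \<ominus> b \<oplus> b = a"
    proof -
      assume "b \<sqsubseteq> a"
      then obtain w where "a = b \<oplus> w" by (auto simp: le_iff_add)
      then show "a \<ominus> b \<oplus> b = a" by (simp add: monus_add add_commute)
    qed
    show "\<zero> \<sqsubset> \<one>" using B1[of \<zero>] by (simp add: pos zero_add)
    show "\<zero> \<noteq> \<one>" using B1[of \<zero>] by (simp add: zero_add)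
    show "a \<oplus> b \<oplus> c = a \<oplus> (b \<oplus> c)" by (rule add_assoc)
    show "a \<oplus> b = b \<oplus> a" by (rule add_commute)
    show "\<zero> \<oplus> a = a" by (rule zero_add)
    show "a \<otimes> b \<otimes> c = a \<otimes> (b \<otimes> c)" by (rule mul_assoc)
    show "a \<otimes> b = b \<otimes> a" by (rule mul_commute)
    show "\<one> \<otimes> a = a" by (rule one_mul)
    show "(a \<oplus> b) \<otimes> c = a \<otimes> c \<oplus> b \<otimes> c" by (rule distrib_right)
    show "a \<otimes> (b \<oplus> c) = a \<otimes> b \<oplus> a \<otimes> c" by (rule distrib_left)
    show "\<zero> \<otimes> a = \<zero>" by (rule zero_mul)
    show "a \<otimes> \<zero> = \<zero>" by (rule B5)
    show "a \<sqsubseteq> b \<Longrightarrow> b \<sqsubseteq> c \<Longrightarrow> a \<sqsubseteq> c" by (rule le_trans)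
    show "a \<sqsubseteq> b \<Longrightarrow> b \<sqsubseteq> a \<Longrightarrow> a = b" by (rule B7)
    show "a \<sqsubseteq> b \<Longrightarrow> c \<oplus> a \<sqsubseteq> c \<oplus> b" by (rule mono)
    show "a \<noteq> \<zero> \<Longrightarrow> b \<noteq> \<zero> \<Longrightarrow> a \<otimes> b \<noteq> \<zero>" by (rule mul_ne)
  qed
qed

sublocale num: linordered_semidom "(\<oplus>)" "(\<ominus>)" "(\<sqsubseteq>)" "(\<sqsubset>)" "\<zero>" "(\<otimes>)" "\<one>"
  by (rule semidom)

lemma lt_Suc: "x \<sqsubset> y \<oplus> \<one> \<longleftrightarrow> x \<sqsubseteq> y"
  by (rule B11[symmetric])

lemma Suc_le: "x \<oplus> \<one> \<sqsubseteq> y \<longleftrightarrow> x \<sqsubset> y"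
  using lt_Suc[of y x] num.not_less by metis

lemma nat_cases: obtains "x = \<zero>" | y where "x = y \<oplus> \<one>"
  using one_le[of x] by blast

lemma comprehension:
  assumes "DP (\<lambda>e. P (e 0))"
  shows "{z. z \<sqsubset> b \<and> P z} \<in> \<S>"
proof -
  obtain X where X: "X \<in> \<S>" "len X \<sqsubseteq> b" "\<And>z. z \<sqsubset> b \<Longrightarrow> z \<in> X \<longleftrightarrow> P z"
    by (rule weak_comprehension[OF assms, of b]) (rule that; assumption)
  have "X = {z. z \<sqsubset> b \<and> P z}"
    using X(3) num.less_le_trans[OF L1[OF X(1)] X(2)] by blast
  then show ?thesis using X(1) by simp
qed

text \<open>By L1 and L2 a nonzero length is the successor of the largest element.\<close>

lemma len_le_iff: "X \<in> \<S> \<Longrightarrow> len X \<sqsubseteq> b \<longleftrightarrow> (\<forall>x\<in>X. x \<sqsubset> b)"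
proof
  assume X: "X \<in> \<S>" and *: "\<forall>x\<in>X. x \<sqsubset> b"
  show "len X \<sqsubseteq> b"
  proof (cases "len X" rule: nat_cases)
    case (2 y)
    then have "y \<in> X" using L2[OF X] by simp
    then show ?thesis using * 2 Suc_le by simp
  qed (simp add: B9)
qed (use L1 num.less_le_trans in blast)

lemma empty_strs: "{} \<in> \<S>"
  using comprehension[OF DP_False, of \<zero>] by simp

text \<open>Without a least element, induction on \<open>z\<close> shows that no number up to
  \<open>z\<close> belongs to \<open>X\<close>.\<close>

lemma minimum:
  assumes "X \<in> \<S>" "x \<in> X"
  obtains m where "m \<in> X" "\<And>y. y \<in> X \<Longrightarrow> m \<sqsubseteq> y"
proof (rule ccontr)
  assume neg: "\<not> thesis"
  have "\<forall>y. y \<sqsubseteq> z \<longrightarrow> y \<notin> X" for z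
  proof (rule induct[of "\<lambda>z. \<forall>y. y \<sqsubseteq> z \<longrightarrow> y \<notin> X"])
    show "DP (\<lambda>e. \<forall>y. y \<sqsubseteq> e 0 \<longrightarrow> y \<notin> X)" by (intro DP_intros assms)
    show "\<forall>y. y \<sqsubseteq> \<zero> \<longrightarrow> y \<notin> X" using neg that B7[OF _ B9] B9 by blast
    show "\<forall>y. y \<sqsubseteq> z \<oplus> \<one> \<longrightarrow> y \<notin> X" if IH: "\<forall>y. y \<sqsubseteq> z \<longrightarrow> y \<notin> X" for z
    proof (intro allI impI notI)
      fix y assume y: "y \<sqsubseteq> z \<oplus> \<one>" "y \<in> X"
      then have "\<not> y \<sqsubseteq> z" using IH by blast
      then have "y = z \<oplus> \<one>" using y(1) lt_Suc[of y z] num.le_less by blast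
      moreover have "z \<oplus> \<one> \<sqsubseteq> w" if "w \<in> X" for w
      proof -
        have "\<not> w \<sqsubseteq> z" using IH that by blast
        then show ?thesis by (simp add: Suc_le num.not_le)
      qed
      ultimately show False using neg y(2) \<open>\<And>m. m \<in> X \<Longrightarrow> (\<And>y. y \<in> X \<Longrightarrow> m \<sqsubseteq> y) \<Longrightarrow> thesis\<close> by blast
    qed
  qed
  then show False using assms(2) num.order_refl by blast
qed

lemma DP_ren: "DP P \<Longrightarrow> DP (\<lambda>e. P (\<lambda>i. e (\<rho> i)))"
proof (erule DPE)
  fix \<phi> c E assume *: "\<phi> \<in> formulas L_A2" "Sigma0B \<phi>" "range E \<subseteq> \<S>"
    "\<And>e. P e \<longleftrightarrow> sat\<^sub>0 (mix e c) E \<phi>"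
  let ?r = "\<lambda>i. if even i then 2 * \<rho> (i div 2) else i"
  have "(\<lambda>i. mix e c (?r i)) = mix (\<lambda>i. e (\<rho> i)) c" for e :: "nat \<Rightarrow> 'n"
    by (auto simp: mix_def)
  then have "P (\<lambda>i. e (\<rho> i)) \<longleftrightarrow> sat\<^sub>0 (mix e c) E (subst (\<lambda>i. NVar (?r i)) SVar \<phi>)" for e
    by (simp add: *(4) sat_subst)
  then show ?thesis unfolding DP_def using *(1-3)
    by (intro bexI[of _ "subst (\<lambda>i. NVar (?r i)) SVar \<phi>"] conjI exI[of _ c] exI[of _ E])
      (auto intro!: Sigma0B_subst subst_formulas)
qed

end

context v0
begin

subsection \<open>Bounded definability\<close>

text \<open>A predicate of an environment is in \<open>LD\<close> if on each bounded set of environments it agrees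
  with a $\Sigma^B_0$ predicate, whose parameters may depend on the bound. \<open>LN\<close>, \<open>NN\<close>
  and \<open>NS\<close> contain the functions with a graph in \<open>LD\<close> that are bounded on bounded sets.\<close>

definition LD :: "((nat \<Rightarrow> 'n) \<Rightarrow> bool) \<Rightarrow> bool" where
  "LD P \<longleftrightarrow> (\<forall>b. \<exists>Q. DP Q \<and> (\<forall>e. (\<forall>i. e i \<sqsubseteq> b) \<longrightarrow> P e = Q e))"

definition LN :: "((nat \<Rightarrow> 'n) \<Rightarrow> 'n) \<Rightarrow> bool" where
  "LN t \<longleftrightarrow> (\<forall>b. \<exists>m. \<forall>e. (\<forall>i. e i \<sqsubseteq> b) \<longrightarrow> t e \<sqsubseteq> m) \<and> LD (\<lambda>e. e 0 = t (\<lambda>i. e (Suc i)))"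

definition NN :: "('n \<Rightarrow> 'n) \<Rightarrow> bool" where
  "NN u \<longleftrightarrow> LN (\<lambda>e. u (e 0))"

definition NS :: "('n \<Rightarrow> 'n set) \<Rightarrow> bool" where
  "NS U \<longleftrightarrow> (\<forall>z. U z \<in> \<S>) \<and> (\<forall>b. \<exists>m. \<forall>z. z \<sqsubseteq> b \<longrightarrow> len (U z) \<sqsubseteq> m) \<and> LD (\<lambda>e. e 0 \<in> U (e 1))"

text \<open>Allows a different definition for each bound, with parameters built from that bound.
  Parity and matrix powers enter in this way.\<close>

lemma LD_local:
  assumes "\<And>b. \<exists>Q. LD Q \<and> (\<forall>e. (\<forall>i. e i \<sqsubseteq> b) \<longrightarrow> P e = Q e)"
  shows "LD P"
  unfolding LD_def
proof
  fix b
  obtain Q where Q: "LD Q" "\<forall>e. (\<forall>i. e i \<sqsubseteq> b) \<longrightarrow> P e = Q e"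
    using assms[of b] by (elim exE conjE)
  obtain R where "DP R" "\<forall>e. (\<forall>i. e i \<sqsubseteq> b) \<longrightarrow> Q e = R e"
    using spec[OF Q(1)[unfolded LD_def], of b] by (elim exE conjE)
  then show "\<exists>R. DP R \<and> (\<forall>e. (\<forall>i. e i \<sqsubseteq> b) \<longrightarrow> P e = R e)" using Q(2) by (intro exI[of _ R]) simp
qed

lemma LD_DP: "DP P \<Longrightarrow> LD P"
  unfolding LD_def by (intro allI exI[of _ P]) simp

lemma LDE:
  assumes "LD P"
  obtains Q where "DP Q" "\<forall>e. (\<forall>i. e i \<sqsubseteq> b) \<longrightarrow> P e = Q e"
  using spec[OF assms[unfolded LD_def], of b] by (elim exE conjE) (rule that; assumption)

lemma LD_imp:
  assumes "LD P" "LD Q"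
  shows "LD (\<lambda>e. P e \<longrightarrow> Q e)"
  unfolding LD_def
proof
  fix b
  obtain P' where P: "DP P'" "\<forall>e. (\<forall>i. e i \<sqsubseteq> b) \<longrightarrow> P e = P' e"
    by (rule LDE[OF assms(1), of b]) (rule that; assumption)
  obtain Q' where Q: "DP Q'" "\<forall>e. (\<forall>i. e i \<sqsubseteq> b) \<longrightarrow> Q e = Q' e"
    by (rule LDE[OF assms(2), of b]) (rule that; assumption)
  show "\<exists>R. DP R \<and> (\<forall>e. (\<forall>i. e i \<sqsubseteq> b) \<longrightarrow> (P e \<longrightarrow> Q e) = R e)"
    by (intro exI[of _ "\<lambda>e. P' e \<longrightarrow> Q' e"] conjI DP_imp P(1) Q(1)) (simp add: P(2) Q(2))
qed

lemma LD_const: "LD (\<lambda>e. p)"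
  using DP_True DP_False by (cases p) (auto intro: LD_DP)

lemma LD_not: "LD P \<Longrightarrow> LD (\<lambda>e. \<not> P e)"
  using LD_imp[OF _ LD_const[of False]] by simp

lemma LD_or: "LD P \<Longrightarrow> LD Q \<Longrightarrow> LD (\<lambda>e. P e \<or> Q e)"
  using LD_imp[OF LD_not] by (simp add: disj_imp)

lemma LD_and: "LD P \<Longrightarrow> LD Q \<Longrightarrow> LD (\<lambda>e. P e \<and> Q e)"
  using LD_not[OF LD_imp[OF _ LD_not]] by simp

lemma LD_iff: "LD P \<Longrightarrow> LD Q \<Longrightarrow> LD (\<lambda>e. P e = Q e)"
  using LD_and[OF LD_imp[of P Q] LD_imp[of Q P]] by (simp add: iff_conv_conj_imp[symmetric])

lemma LD_ren:
  assumes "LD P"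
  shows "LD (\<lambda>e. P (\<lambda>i. e (\<rho> i)))"
  unfolding LD_def
proof
  fix b
  obtain Q where Q: "DP Q" "\<forall>e. (\<forall>i. e i \<sqsubseteq> b) \<longrightarrow> P e = Q e" by (rule LDE[OF assms, of b]) (rule that; assumption)
  show "\<exists>Q. DP Q \<and> (\<forall>e. (\<forall>i. e i \<sqsubseteq> b) \<longrightarrow> P (\<lambda>i. e (\<rho> i)) = Q e)"
    by (intro exI[of _ "\<lambda>e. Q (\<lambda>i. e (\<rho> i))"] conjI DP_ren[OF Q(1), of \<rho>])
      (simp add: Q(2))
qed

lemma LN_bound:
  assumes "LN t"
  obtains m where "\<forall>e. (\<forall>i. e i \<sqsubseteq> b) \<longrightarrow> t e \<sqsubseteq> m"
  using spec[OF conjunct1[OF assms[unfolded LN_def]], of b] by (elim exE) (rule that)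

lemma LN_ren: "LN t \<Longrightarrow> LN (\<lambda>e. t (\<lambda>i. e (\<rho> i)))"
proof -
  assume t: "LN t"
  have "LD (\<lambda>e. e 0 = t (\<lambda>i. e (Suc i)))" using t by (simp add: LN_def)
  from LD_ren[OF this, of "\<lambda>i. case i of 0 \<Rightarrow> 0 | Suc i \<Rightarrow> Suc (\<rho> i)"]
  have "LD (\<lambda>e. e 0 = t (\<lambda>i. e (Suc (\<rho> i))))" by simp
  moreover have "\<exists>m. \<forall>e. (\<forall>i. e i \<sqsubseteq> b) \<longrightarrow> t (\<lambda>i. e (\<rho> i)) \<sqsubseteq> m" for b
  proof -
    obtain m where "\<forall>e. (\<forall>i. e i \<sqsubseteq> b) \<longrightarrow> t e \<sqsubseteq> m" by (rule LN_bound[OF t, of b])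
    then show ?thesis by (intro exI[of _ m]) simp
  qed
  ultimately show ?thesis by (simp add: LN_def)
qed

lemma case_nat_eta: "case_nat (e 0) (\<lambda>i. e (Suc i)) = e"
  by (auto split: nat.split)

lemma LD_all_const:
  assumes "LD (\<lambda>e. P (e 0) (\<lambda>i. e (Suc i)))"
  shows "LD (\<lambda>e. \<forall>x. x \<sqsubseteq> m \<longrightarrow> P x e)"
  unfolding LD_def
proof
  fix b
  define B where "B = b \<oplus> m"
  have B: "b \<sqsubseteq> B" "m \<sqsubseteq> B" unfolding B_def by (rule B8, subst add_commute, rule B8)
  obtain Q where Q: "DP Q" "\<forall>e. (\<forall>i. e i \<sqsubseteq> B) \<longrightarrow> P (e 0) (\<lambda>i. e (Suc i)) = Q e"
    by (rule LDE[OF assms, of B]) (rule that; assumption)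
  have "DP (\<lambda>e. \<forall>x. x \<sqsubseteq> m \<longrightarrow> Q (case_nat x e))"
    by (intro DP_all DT_const) (simp add: case_nat_eta Q(1))
  moreover have "P x e = Q (case_nat x e)" if "\<forall>i. e i \<sqsubseteq> b" "x \<sqsubseteq> m" for e x
  proof -
    have "\<forall>i. case_nat x e i \<sqsubseteq> B"
      using num.order_trans[OF spec[OF that(1)] B(1)] num.order_trans[OF that(2) B(2)]
      by (simp split: nat.split)
    from mp[OF spec[OF Q(2)] this] show ?thesis by simp
  qed
  ultimately show "\<exists>Q. DP Q \<and> (\<forall>e. (\<forall>i. e i \<sqsubseteq> b) \<longrightarrow> (\<forall>x. x \<sqsubseteq> m \<longrightarrow> P x e) = Q e)"
    by (intro exI[of _ "\<lambda>e. \<forall>x. x \<sqsubseteq> m \<longrightarrow> Q (case_nat x e)"]) simp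
qed

lemma LD_ex_const:
  "LD (\<lambda>e. P (e 0) (\<lambda>i. e (Suc i))) \<Longrightarrow> LD (\<lambda>e. \<exists>x. x \<sqsubseteq> m \<and> P x e)"
  using LD_not[OF LD_all_const[OF LD_not]] by simp

text \<open>The term is replaced by a quantified variable for its value. Its bound on bounded
  environments makes the quantifier bounded, by a constant that may depend on the environment
  bound.\<close>

lemma LD_subst:
  assumes t: "LN t" and P: "LD (\<lambda>e. P (e 0) (\<lambda>i. e (Suc i)))"
  shows "LD (\<lambda>e. P (t e) e)"
proof (rule LD_local)
  fix b
  obtain m where m: "\<forall>e. (\<forall>i. e i \<sqsubseteq> b) \<longrightarrow> t e \<sqsubseteq> m" by (rule LN_bound[OF t, of b])
  have "LD (\<lambda>e. \<exists>y. y \<sqsubseteq> m \<and> (y = t e \<and> P y e))"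
    by (intro LD_ex_const LD_and P conjunct2[OF t[unfolded LN_def]])
  then show "\<exists>Q. LD Q \<and> (\<forall>e. (\<forall>i. e i \<sqsubseteq> b) \<longrightarrow> P (t e) e = Q e)"
    using m by (intro exI[of _ "\<lambda>e. \<exists>y. y \<sqsubseteq> m \<and> (y = t e \<and> P y e)"]) simp
qed

lemma LN_var: "LN (\<lambda>e. e i)"
  unfolding LN_def
proof
  show "\<forall>b. \<exists>m. \<forall>e. (\<forall>i. e i \<sqsubseteq> b) \<longrightarrow> e i \<sqsubseteq> m" by blast
  show "LD (\<lambda>e. e 0 = e (Suc i))" by (intro LD_DP DP_intros)
qed

lemma LN_const: "LN (\<lambda>e. a)"
  unfolding LN_def by (intro conjI allI exI[of _ a] LD_DP DP_intros) simp

lemma LN_Suc: "LN t \<Longrightarrow> LN (\<lambda>e. t (\<lambda>i. e (Suc i)))"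
  by (rule LN_ren[of t Suc])

lemma LD_rel2:
  assumes "LN s" "LN t" "DP (\<lambda>e. R (e 0) (e 1))"
  shows "LD (\<lambda>e. R (s e) (t e))"
proof (rule LD_subst[OF assms(1), of "\<lambda>x e. R x (t e)"],
    rule LD_subst[OF LN_Suc[OF assms(2)], of "\<lambda>y e. R (e 0) y"])
  show "LD (\<lambda>e. R (e (Suc 0)) (e 0))"
    using LD_DP[OF DP_ren[OF assms(3), of "\<lambda>i. case i of 0 \<Rightarrow> 1 | _ \<Rightarrow> 0"]] by simp
qed

lemma LD_eq: "LN s \<Longrightarrow> LN t \<Longrightarrow> LD (\<lambda>e. s e = t e)"
  by (rule LD_rel2[where R = "(=)"], assumption, assumption, intro DP_intros)

lemma LD_le: "LN s \<Longrightarrow> LN t \<Longrightarrow> LD (\<lambda>e. s e \<sqsubseteq> t e)"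
  by (rule LD_rel2[where R = "(\<sqsubseteq>)"], assumption, assumption, intro DP_intros)

lemma LD_lt: "LN s \<Longrightarrow> LN t \<Longrightarrow> LD (\<lambda>e. s e \<sqsubset> t e)"
  by (rule LD_rel2[where R = "(\<sqsubset>)"], assumption, assumption, intro DP_intros)

lemma LD_mem: "LN s \<Longrightarrow> X \<in> \<S> \<Longrightarrow> LD (\<lambda>e. s e \<in> X)"
  by (rule LD_subst[of s "\<lambda>x e. x \<in> X"]) (auto intro!: LD_DP DP_intros)

lemma LD_rel_rel:
  assumes "LN s" "LN t" "LD (\<lambda>e. R (e 0) (e 1))"
  shows "LD (\<lambda>e. R (s e) (t e))"
proof (rule LD_subst[OF assms(1), of "\<lambda>x e. R x (t e)"],
    rule LD_subst[OF LN_Suc[OF assms(2)], of "\<lambda>y e. R (e 0) y"])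
  show "LD (\<lambda>e. R (e (Suc 0)) (e 0))"
    using LD_ren[OF assms(3), of "\<lambda>i. case i of 0 \<Rightarrow> 1 | _ \<Rightarrow> 0"] by simp
qed

lemma LD_memS: "NS U \<Longrightarrow> LN s \<Longrightarrow> LN t \<Longrightarrow> LD (\<lambda>e. s e \<in> U (t e))"
  by (rule LD_rel_rel[where R = "\<lambda>x z. x \<in> U z"]) (simp_all add: NS_def)

lemma LD_all:
  assumes "LN t" "LD (\<lambda>e. P (e 0) (\<lambda>i. e (Suc i)))"
  shows "LD (\<lambda>e. \<forall>x. x \<sqsubseteq> t e \<longrightarrow> P x e)"
proof (rule LD_local)
  fix b
  obtain m where m: "\<forall>e. (\<forall>i. e i \<sqsubseteq> b) \<longrightarrow> t e \<sqsubseteq> m" by (rule LN_bound[OF assms(1), of b])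
  have "LD (\<lambda>e. \<forall>x. x \<sqsubseteq> m \<longrightarrow> x \<sqsubseteq> t e \<longrightarrow> P x e)"
    by (intro LD_all_const LD_imp LD_le LN_var LN_Suc[OF assms(1)] assms(2))
  moreover have "(\<forall>x. x \<sqsubseteq> t e \<longrightarrow> P x e) = (\<forall>x. x \<sqsubseteq> m \<longrightarrow> x \<sqsubseteq> t e \<longrightarrow> P x e)"
    if "\<forall>i. e i \<sqsubseteq> b" for e
    using num.order_trans[OF _ mp[OF spec[OF m] that]] by auto
  ultimately show "\<exists>Q. LD Q \<and> (\<forall>e. (\<forall>i. e i \<sqsubseteq> b) \<longrightarrow> (\<forall>x. x \<sqsubseteq> t e \<longrightarrow> P x e) = Q e)"
    by (intro exI[of _ "\<lambda>e. \<forall>x. x \<sqsubseteq> m \<longrightarrow> x \<sqsubseteq> t e \<longrightarrow> P x e"]) simp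
qed

lemma LD_ex:
  "LN t \<Longrightarrow> LD (\<lambda>e. P (e 0) (\<lambda>i. e (Suc i))) \<Longrightarrow> LD (\<lambda>e. \<exists>x. x \<sqsubseteq> t e \<and> P x e)"
  using LD_not[OF LD_all[OF _ LD_not]] by simp

lemma LD_all_lt:
  assumes "LN t" "LD (\<lambda>e. P (e 0) (\<lambda>i. e (Suc i)))"
  shows "LD (\<lambda>e. \<forall>x. x \<sqsubset> t e \<longrightarrow> P x e)"
proof -
  have "LD (\<lambda>e. \<forall>x. x \<sqsubseteq> t e \<longrightarrow> x \<sqsubset> t e \<longrightarrow> P x e)"
    by (intro LD_all LD_imp LD_lt LN_var LN_Suc[OF assms(1)] assms)
  moreover have "(\<forall>x. x \<sqsubseteq> t e \<longrightarrow> x \<sqsubset> t e \<longrightarrow> P x e) = (\<forall>x. x \<sqsubset> t e \<longrightarrow> P x e)" for e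
    by (auto simp: lt_def)
  ultimately show ?thesis by simp
qed

lemma LD_ex_lt:
  "LN t \<Longrightarrow> LD (\<lambda>e. P (e 0) (\<lambda>i. e (Suc i))) \<Longrightarrow> LD (\<lambda>e. \<exists>x. x \<sqsubset> t e \<and> P x e)"
  using LD_not[OF LD_all_lt[OF _ LD_not]] by simp

text \<open>Monotonicity carries bounds on the arguments over to the value; the graph results from
  substituting the two terms one after the other.\<close>

lemma LN_rel2:
  assumes "LN s" "LN t" "DT (\<lambda>e. f (e 0) (e 1))"
    and mono: "\<And>a b c d. a \<sqsubseteq> c \<Longrightarrow> b \<sqsubseteq> d \<Longrightarrow> f a b \<sqsubseteq> f c d"
  shows "LN (\<lambda>e. f (s e) (t e))"
  unfolding LN_def
proof
  show "\<forall>b. \<exists>m. \<forall>e. (\<forall>i. e i \<sqsubseteq> b) \<longrightarrow> f (s e) (t e) \<sqsubseteq> m"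
  proof
    fix b
    obtain k where "\<forall>e. (\<forall>i. e i \<sqsubseteq> b) \<longrightarrow> s e \<sqsubseteq> k" by (rule LN_bound[OF assms(1), of b])
    moreover obtain m where "\<forall>e. (\<forall>i. e i \<sqsubseteq> b) \<longrightarrow> t e \<sqsubseteq> m" by (rule LN_bound[OF assms(2), of b])
    ultimately show "\<exists>m. \<forall>e. (\<forall>i. e i \<sqsubseteq> b) \<longrightarrow> f (s e) (t e) \<sqsubseteq> m"
      by (intro exI[of _ "f k m"]) (simp add: mono)
  qed
  show "LD (\<lambda>e. e 0 = f (s (\<lambda>i. e (Suc i))) (t (\<lambda>i. e (Suc i))))"
  proof (rule LD_subst[OF LN_Suc[OF assms(1)], of "\<lambda>x e. e 0 = f x (t (\<lambda>i. e (Suc i)))"],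
      rule LD_subst[OF LN_ren[OF assms(2), of "\<lambda>i. Suc (Suc i)"], of "\<lambda>y e. e (Suc 0) = f (e 0) y"])
    have "DP (\<lambda>e. e 2 = f (e 0) (e 1))" by (intro DP_eq DT_var assms(3))
    from LD_DP[OF DP_ren[OF this, of "\<lambda>i. case i of 0 \<Rightarrow> 1 | Suc 0 \<Rightarrow> 0 | _ \<Rightarrow> 2"]]
    show "LD (\<lambda>e. e (Suc (Suc 0)) = f (e (Suc 0)) (e 0))" by (simp add: numeral_2_eq_2)
  qed
qed

lemma LN_add: "LN s \<Longrightarrow> LN t \<Longrightarrow> LN (\<lambda>e. s e \<oplus> t e)"
  by (rule LN_rel2[where f = "(\<oplus>)"]) (simp_all add: DT_add DT_var num.add_mono)

lemma LN_mul: "LN s \<Longrightarrow> LN t \<Longrightarrow> LN (\<lambda>e. s e \<otimes> t e)"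
  by (rule LN_rel2[where f = "(\<otimes>)"]) (simp_all add: DT_mul DT_var num.mult_mono B9)

lemmas LD_intros = LD_const LD_imp LD_not LD_or LD_and LD_iff LD_eq LD_le LD_lt LD_mem
  LD_all LD_ex LD_all_lt LD_ex_lt LN_var LN_const LN_add LN_mul

lemma NN_I:
  assumes "\<And>b. \<exists>m. \<forall>z. z \<sqsubseteq> b \<longrightarrow> u z \<sqsubseteq> m" "LD (\<lambda>e. e 0 = u (e 1))"
  shows "NN u"
  unfolding NN_def LN_def
proof
  show "\<forall>b. \<exists>m. \<forall>e. (\<forall>i. e i \<sqsubseteq> b) \<longrightarrow> u (e 0) \<sqsubseteq> m" using assms(1) by meson
qed (use assms(2) in simp)

lemma NN_bound:
  assumes "NN u"
  shows "\<exists>m. \<forall>z. z \<sqsubseteq> b \<longrightarrow> u z \<sqsubseteq> m"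
proof -
  obtain m where m: "\<forall>e :: nat \<Rightarrow> 'n. (\<forall>i. e i \<sqsubseteq> b) \<longrightarrow> u (e 0) \<sqsubseteq> m"
    by (rule LN_bound[OF assms[unfolded NN_def], of b]) (rule that, assumption)
  have "u z \<sqsubseteq> m" if "z \<sqsubseteq> b" for z using spec[OF m, of "\<lambda>_. z"] that by simp
  then show ?thesis by blast
qed

lemma LN_comp:
  assumes "NN u" "LN t"
  shows "LN (\<lambda>e. u (t e))"
  unfolding LN_def
proof
  show "\<forall>b. \<exists>m. \<forall>e. (\<forall>i. e i \<sqsubseteq> b) \<longrightarrow> u (t e) \<sqsubseteq> m"
  proof
    fix b
    obtain k where k: "\<forall>e. (\<forall>i. e i \<sqsubseteq> b) \<longrightarrow> t e \<sqsubseteq> k" by (rule LN_bound[OF assms(2), of b])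
    obtain m where "\<forall>z. z \<sqsubseteq> k \<longrightarrow> u z \<sqsubseteq> m" using NN_bound[OF assms(1)] by blast
    with k show "\<exists>m. \<forall>e. (\<forall>i. e i \<sqsubseteq> b) \<longrightarrow> u (t e) \<sqsubseteq> m" by (intro exI[of _ m]) simp
  qed
  show "LD (\<lambda>e. e 0 = u (t (\<lambda>i. e (Suc i))))"
    by (rule LD_rel_rel[where R = "\<lambda>x y. x = u y", OF LN_var LN_Suc[OF assms(2)]])
      (use assms(1) in \<open>simp add: NN_def LN_def\<close>)
qed

lemma NN_comp: "NN u \<Longrightarrow> NN v \<Longrightarrow> NN (\<lambda>z. u (v z))"
  using LN_comp[of u "\<lambda>e. v (e 0)"] by (simp add: NN_def)

lemma NS_I:
  assumes "\<And>z. U z \<in> \<S>" "\<And>b. \<exists>m. \<forall>z. z \<sqsubseteq> b \<longrightarrow> len (U z) \<sqsubseteq> m" "LD (\<lambda>e. e 0 \<in> U (e 1))"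
  shows "NS U"
  using assms by (simp add: NS_def)

lemma NS_strs: "NS U \<Longrightarrow> U z \<in> \<S>"
  by (simp add: NS_def)

lemma NS_comp:
  assumes "NS U" "NN u"
  shows "NS (\<lambda>z. U (u z))"
proof (rule NS_I)
  fix b
  obtain k where k: "\<forall>z. z \<sqsubseteq> b \<longrightarrow> u z \<sqsubseteq> k" using NN_bound[OF assms(2)] by blast
  obtain m where "\<forall>z. z \<sqsubseteq> k \<longrightarrow> len (U z) \<sqsubseteq> m" using assms(1) unfolding NS_def by blast
  with k show "\<exists>m. \<forall>z. z \<sqsubseteq> b \<longrightarrow> len (U (u z)) \<sqsubseteq> m" by (intro exI[of _ m]) simp
  show "LD (\<lambda>e. e 0 \<in> U (u (e 1)))"
    by (rule LD_memS[OF assms(1) LN_var LN_comp[OF assms(2) LN_var]])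
qed (use assms in \<open>simp add: NS_strs\<close>)

lemma NS_const: "X \<in> \<S> \<Longrightarrow> NS (\<lambda>_. X)"
  by (rule NS_I) (auto intro: LD_mem LN_var)

lemma NN_const: "NN (\<lambda>_. a)"
  unfolding NN_def by (rule LN_const)

lemma NN_id: "NN (\<lambda>z. z)"
  unfolding NN_def by (rule LN_var)

text \<open>A length exceeds all elements and its predecessor, if any, is an element. Given a bound
  on the lengths, both conditions quantify over bounded numbers only.\<close>

lemma NN_len:
  assumes "NS U"
  shows "NN (\<lambda>z. len (U z))"
proof (rule NN_I)
  show bd: "\<exists>m. \<forall>z. z \<sqsubseteq> b \<longrightarrow> len (U z) \<sqsubseteq> m" for b using assms by (simp add: NS_def)
  have len: "l = len (U z) \<longleftrightarrow> (\<forall>x. x \<sqsubset> m \<longrightarrow> x \<in> U z \<longrightarrow> x \<sqsubset> l) \<and>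
      (\<forall>y. y \<sqsubset> l \<longrightarrow> l = y \<oplus> \<one> \<longrightarrow> y \<in> U z)" (is "_ \<longleftrightarrow> ?R") if "len (U z) \<sqsubseteq> m" for l z m
  proof
    assume *: ?R
    have U: "U z \<in> \<S>" by (rule NS_strs[OF assms])
    have "\<forall>x\<in>U z. x \<sqsubset> l" using * L1[OF U] num.less_le_trans[OF _ that] by blast
    then have le: "len (U z) \<sqsubseteq> l" using len_le_iff[OF U] by blast
    show "l = len (U z)"
    proof (cases l rule: nat_cases)
      case 1
      then show ?thesis using B7[OF _ B9, of "len (U z)"] le by simp
    next
      case (2 y)
      have "y \<sqsubset> y \<oplus> \<one>" by (simp add: lt_Suc)
      then have "y \<in> U z" using * 2 by blast
      then have "l \<sqsubseteq> len (U z)" using L1[OF U] 2 Suc_le by blast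
      then show ?thesis using le by (rule B7)
    qed
  next
    assume "l = len (U z)"
    then show ?R using L1[OF NS_strs[OF assms]] L2[OF NS_strs[OF assms]] by auto
  qed
  show "LD (\<lambda>e. e 0 = len (U (e 1)))"
  proof (rule LD_local)
    fix b
    obtain m where "\<forall>z. z \<sqsubseteq> b \<longrightarrow> len (U z) \<sqsubseteq> m" using bd by blast
    then have "\<forall>e :: nat \<Rightarrow> 'n. (\<forall>i. e i \<sqsubseteq> b) \<longrightarrow> (e 0 = len (U (e 1))) =
      ((\<forall>x. x \<sqsubset> m \<longrightarrow> x \<in> U (e 1) \<longrightarrow> x \<sqsubset> e 0) \<and>
       (\<forall>y. y \<sqsubset> e 0 \<longrightarrow> e 0 = y \<oplus> \<one> \<longrightarrow> y \<in> U (e 1)))" using len by simp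
    moreover have "LD (\<lambda>e. (\<forall>x. x \<sqsubset> m \<longrightarrow> x \<in> U (e 1) \<longrightarrow> x \<sqsubset> e 0) \<and>
       (\<forall>y. y \<sqsubset> e 0 \<longrightarrow> e 0 = y \<oplus> \<one> \<longrightarrow> y \<in> U (e 1)))"
      by (intro LD_intros LD_memS[OF assms])
    ultimately show "\<exists>Q. LD Q \<and> (\<forall>e. (\<forall>i. e i \<sqsubseteq> b) \<longrightarrow> (e 0 = len (U (e 1))) = Q e)"
      by blast
  qed
qed

text \<open>All candidates lie below \<open>b\<close>, so the definition belonging to that bound
  decides them. This is why definability on bounded sets is enough for comprehension.\<close>

lemma comprehension_LD:
  assumes "LD (\<lambda>e. P (e 0))"
  shows "{z. z \<sqsubset> b \<and> P z} \<in> \<S>"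
proof -
  obtain Q where Q: "DP Q" "\<forall>e. (\<forall>i. e i \<sqsubseteq> b) \<longrightarrow> P (e 0) = Q e"
    by (rule LDE[OF assms, of b]) (rule that; assumption)
  have "{z. z \<sqsubset> b \<and> Q (\<lambda>_. z)} \<in> \<S>" by (rule comprehension) (rule DP_ren[OF Q(1), of "\<lambda>_. 0"])
  also have "{z. z \<sqsubset> b \<and> Q (\<lambda>_. z)} = {z. z \<sqsubset> b \<and> P z}"
  proof -
    have "Q (\<lambda>_. z) = P z" if "z \<sqsubset> b" for z
      using spec[OF Q(2), of "\<lambda>_. z"] num.less_imp_le[OF that] by simp
    then show ?thesis by auto
  qed
  finally show ?thesis .
qed

text \<open>Up to \<open>x\<close> the predicate coincides with membership in a string, for which
  ordinary induction is available.\<close>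

lemma induct_LD:
  assumes "LD (\<lambda>e. P (e 0))" "P \<zero>" "\<And>y. P y \<Longrightarrow> P (y \<oplus> \<one>)"
  shows "P x"
proof -
  define X where "X = {z. z \<sqsubset> x \<oplus> \<one> \<and> P z}"
  have X: "X \<in> \<S>" unfolding X_def by (rule comprehension_LD[OF assms(1)])
  have "x' \<sqsubseteq> x \<longrightarrow> x' \<in> X" for x'
  proof (rule induct[of "\<lambda>x'. x' \<sqsubseteq> x \<longrightarrow> x' \<in> X"])
    show "DP (\<lambda>e. e 0 \<sqsubseteq> x \<longrightarrow> e 0 \<in> X)" by (intro DP_intros X)
    show "y \<oplus> \<one> \<sqsubseteq> x \<longrightarrow> y \<oplus> \<one> \<in> X" if "y \<sqsubseteq> x \<longrightarrow> y \<in> X" for y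
      using that assms(3)[of y] by (auto simp: X_def lt_Suc Suc_le dest: num.less_imp_le)
  qed (auto simp: X_def lt_Suc assms(2))
  then show ?thesis by (auto simp: X_def)
qed

lemma NS_comprehension:
  assumes "NN t" "LD (\<lambda>e. P (e 1) (e 0))"
  shows "NS (\<lambda>z. {c. c \<sqsubset> t z \<and> P z c})"
proof (rule NS_I)
  show strs: "{c. c \<sqsubset> t z \<and> P z c} \<in> \<S>" for z
    by (rule comprehension_LD, rule LD_rel_rel[where R = "\<lambda>c z. P z c", OF LN_var LN_const])
      (rule assms(2))
  show "\<exists>m. \<forall>z. z \<sqsubseteq> b \<longrightarrow> len {c. c \<sqsubset> t z \<and> P z c} \<sqsubseteq> m" for b
  proof -
    obtain m where m: "\<forall>z. z \<sqsubseteq> b \<longrightarrow> t z \<sqsubseteq> m" using NN_bound[OF assms(1)] by blast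
    have "len {c. c \<sqsubset> t z \<and> P z c} \<sqsubseteq> t z" for z using len_le_iff[OF strs] by auto
    then show ?thesis using m num.order_trans by (intro exI[of _ m]) blast
  qed
  have "LD (\<lambda>e. e 0 \<sqsubset> t (e 1) \<and> P (e 1) (e 0))"
    by (intro LD_and LD_lt LN_var LN_comp[OF assms(1)] assms(2))
  then show "LD (\<lambda>e. e 0 \<in> {c. c \<sqsubset> t (e 1) \<and> P (e 1) c})" by simp
qed

end

section \<open>The standard interpretation of the function symbols\<close>

definition bmin :: "'n struct \<Rightarrow> ('n \<Rightarrow> bool) \<Rightarrow> 'n \<Rightarrow> 'n" where
  "bmin M P b = (let Q = (\<lambda>v. m_le M v b \<and> v \<noteq> b \<and> P v \<and> (\<forall>w. m_le M w v \<and> w \<noteq> v \<longrightarrow> \<not> P w)) in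
     if \<exists>v. Q v then SOME v. Q v else b)"

text \<open>Replacing nonstrings by the empty string makes every function value a string, also for
  arguments that never occur; \<open>soundness\<close> asks for this.\<close>

definition clip :: "'n struct \<Rightarrow> 'n set \<Rightarrow> 'n set" where
  "clip M X = (if X \<in> m_strs M then X else {})"

definition lookup :: "'a \<Rightarrow> nat list \<Rightarrow> 'a list \<Rightarrow> nat \<Rightarrow> 'a" where
  "lookup d xs as i = (case map_of (zip xs as) i of Some a \<Rightarrow> a | None \<Rightarrow> d)"

definition m_pair :: "'n struct \<Rightarrow> 'n \<Rightarrow> 'n \<Rightarrow> 'n" where
  "m_pair M x y = (let s = m_plus M x y in
     m_plus M (m_times M s (m_plus M s (m_one M))) (m_times M (m_plus M (m_one M) (m_one M)) y))"

definition parity_spec :: "'n struct \<Rightarrow> 'n \<Rightarrow> 'n set \<Rightarrow> 'n set \<Rightarrow> bool" where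
  "parity_spec M n X Z \<longleftrightarrow> Z \<in> m_strs M \<and> m_le M (m_len M Z) (m_plus M n (m_one M)) \<and>
     m_zero M \<notin> Z \<and> (\<forall>i. m_le M i n \<and> i \<noteq> n \<longrightarrow> (m_plus M i (m_one M) \<in> Z) = ((i \<in> X) \<noteq> (i \<in> Z)))"

definition parity_str :: "'n struct \<Rightarrow> 'n \<Rightarrow> 'n set \<Rightarrow> 'n set" where
  "parity_str M n X = clip M (SOME Z. parity_spec M n X Z)"

definition row_set :: "'n struct \<Rightarrow> 'n \<Rightarrow> 'n set \<Rightarrow> 'n set" where
  "row_set M i Y = {c. m_pair M i c \<in> Y}"

definition identity_set :: "'n struct \<Rightarrow> 'n \<Rightarrow> 'n set" where
  "identity_set M n = {m_pair M i i |i. m_le M i n \<and> i \<noteq> n}"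

definition prod_set :: "'n struct \<Rightarrow> 'n \<Rightarrow> 'n set \<Rightarrow> 'n set \<Rightarrow> 'n set" where
  "prod_set M n X1 X2 = {m_pair M i j |i j. m_le M i n \<and> i \<noteq> n \<and> m_le M j n \<and> j \<noteq> n \<and>
     n \<in> parity_str M n {b. m_le M b n \<and> b \<noteq> n \<and> m_pair M i b \<in> X1 \<and> m_pair M b j \<in> X2}}"

definition powseq_spec :: "'n struct \<Rightarrow> 'n \<Rightarrow> 'n \<Rightarrow> 'n set \<Rightarrow> 'n set \<Rightarrow> bool" where
  "powseq_spec M n k X Y \<longleftrightarrow> Y \<in> m_strs M \<and> m_le M (m_len M Y) (m_pair M k (m_pair M n n)) \<and>
     (\<forall>p\<in>Y. \<exists>i c. p = m_pair M i c) \<and> row_set M (m_zero M) Y = identity_set M n \<and>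
     (\<forall>i. m_le M i k \<and> i \<noteq> k \<longrightarrow> row_set M (m_plus M i (m_one M)) Y = prod_set M n X (row_set M i Y))"

text \<open>The graph of the power sequence does not determine the rows beyond row \<open>k\<close>; they are
  chosen to be empty.\<close>

definition powseq_str :: "'n struct \<Rightarrow> 'n \<Rightarrow> 'n \<Rightarrow> 'n set \<Rightarrow> 'n set" where
  "powseq_str M n k X = clip M
     {m_pair M i c |i c. m_le M i k \<and> m_pair M i c \<in> (SOME Y. powseq_spec M n k X Y)}"

text \<open>The recursion descends through the formulas and terms stored inside a symbol. The maps
  put the interpretations in the place of the inner symbols, which are then evaluated with the
  identity as interpretation.\<close>

primrec nI :: "'n struct \<Rightarrow> nfun \<Rightarrow> 'n list \<Rightarrow> 'n set list \<Rightarrow> 'n"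
  and sI :: "'n struct \<Rightarrow> sfun \<Rightarrow> 'n list \<Rightarrow> 'n set list \<Rightarrow> 'n set"
where
  "nI M Pd = (\<lambda>as As. SOME y. if hd as = m_zero M then y = m_zero M else m_plus M y (m_one M) = hd as)"
| "nI M FSE = (\<lambda>as As. bmin M (\<lambda>i. (i \<in> As ! 0) \<noteq> (i \<in> As ! 1)) (m_len M (As ! 0)))"
| "nI M (MinFun z xs Xs \<phi> t) = (\<lambda>as As. bmin M
     (\<lambda>v. sat M (\<lambda>f. f) (\<lambda>g. g) ((lookup (m_zero M) xs as)(z := v)) (lookup {} Xs As) (map_fm (nI M) (sI M) \<phi>))
     (eval_nt M (\<lambda>f. f) (\<lambda>g. g) (lookup (m_zero M) xs as) (lookup {} Xs As) (map_nterm (nI M) (sI M) t)))"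
| "sI M ParityF = (\<lambda>as As. parity_str M (hd as) (hd As))"
| "sI M PowSeqF = (\<lambda>as As. powseq_str M (as ! 0) (as ! 1) (As ! 0))"
| "sI M (CompFun z xs Xs \<phi> t) = (\<lambda>as As. clip M {v.
     (let b = eval_nt M (\<lambda>f. f) (\<lambda>g. g) (lookup (m_zero M) xs as) (lookup {} Xs As) (map_nterm (nI M) (sI M) t)
      in m_le M v b \<and> v \<noteq> b) \<and>
     sat M (\<lambda>f. f) (\<lambda>g. g) ((lookup (m_zero M) xs as)(z := v)) (lookup {} Xs As) (map_fm (nI M) (sI M) \<phi>)})"

lemma lookup_map: "x \<in> set xs \<Longrightarrow> lookup d xs (map f xs) x = f x"
  by (simp add: lookup_def map_of_zip_map)

lemma sat_L_A2: "\<phi> \<in> formulas L_A2 \<Longrightarrow> sat M I J e E \<phi> = sat M I' J' e E \<phi>"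
  by (rule sat_cong) (auto simp: formulas_def L_A2_def)

text \<open>By \<open>defining_data\<close> the free variables occur among the listed ones, so the
  artificial environment built by \<open>lookup\<close> may be exchanged for the surrounding
  one.\<close>

lemma sI_MinFun:
  assumes "defining_data z xs Xs \<phi> t"
  shows "nI M (MinFun z xs Xs \<phi> t) (map e xs) (map E Xs) =
      bmin M (\<lambda>v. sat M (nI M) (sI M) (e(z := v)) E \<phi>) (eval_nt M (nI M) (sI M) e E t)" (is ?N)
    and "sI M (CompFun z xs Xs \<phi> t) (map e xs) (map E Xs) =
      clip M {v. (let b = eval_nt M (nI M) (sI M) e E t in m_le M v b \<and> v \<noteq> b) \<and>
        sat M (nI M) (sI M) (e(z := v)) E \<phi>}" (is ?S)
proof -
  have "eval_nt M (nI M) (sI M) (lookup (m_zero M) xs (map e xs)) (lookup {} Xs (map E Xs)) t =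
      eval_nt M (nI M) (sI M) e E t"
    by (rule eval_cong) (use assms in \<open>auto simp: defining_data_def lookup_map\<close>)
  moreover have "sat M (nI M) (sI M) ((lookup (m_zero M) xs (map e xs))(z := v)) (lookup {} Xs (map E Xs)) \<phi> =
      sat M (nI M) (sI M) (e(z := v)) E \<phi>" for v
    by (rule sat_cong) (use assms in \<open>auto simp: defining_data_def lookup_map\<close>)
  ultimately show ?N ?S by (simp_all add: eval_map sat_map)
qed

context v0
begin

abbreviation "ev \<equiv> eval_nt M (nI M) (sI M)"
abbreviation "evS \<equiv> eval_st M (nI M) (sI M)"
abbreviation "holds \<equiv> sat M (nI M) (sI M)"

lemma clip_strs: "clip M X \<in> \<S>"
  by (simp add: clip_def empty_strs)

lemma sI_strs: "sI M g as As \<in> \<S>"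
  by (cases g) (simp_all add: clip_strs parity_str_def powseq_str_def)

subsection \<open>Pairing\<close>

abbreviation pr where "pr x y \<equiv> m_pair M x y"

lemma pr_eq: "pr x y = (x \<oplus> y) \<otimes> (x \<oplus> y \<oplus> \<one>) \<oplus> (\<one> \<oplus> \<one>) \<otimes> y"
  by (simp add: m_pair_def Let_def)

lemma mul_le_self: "a \<sqsubseteq> a \<otimes> (a \<oplus> \<one>)"
  by (subst distrib_left, subst add_commute) (simp add: B9)

lemma le_pr1: "x \<sqsubseteq> pr x y" and le_pr2: "y \<sqsubseteq> pr x y"
proof -
  have "x \<oplus> y \<sqsubseteq> pr x y"
    unfolding pr_eq by (rule le_trans[OF mul_le_self B8])
  moreover have "y \<sqsubseteq> x \<oplus> y" by (subst add_commute) (rule B8)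
  ultimately show "x \<sqsubseteq> pr x y" "y \<sqsubseteq> pr x y" using B8[of x y] le_trans by blast+
qed

lemma pr_mono: "x \<sqsubseteq> x' \<Longrightarrow> y \<sqsubseteq> y' \<Longrightarrow> pr x y \<sqsubseteq> pr x' y'"
  unfolding pr_eq by (intro num.add_mono num.mult_mono) (simp_all add: B9)

text \<open>With \<open>s = x \<oplus> y\<close>, a pair number is at most
  \<open>s(s+1) + 2s\<close>, hence below \<open>(s+1)(s+2)\<close>, which is the least pair number
  with the next sum. So the sum is determined, and then the second component.\<close>

lemma pr_inj: "pr x y = pr x' y' \<longleftrightarrow> x = x' \<and> y = y'"
proof
  have key: "pr x y \<sqsubset> pr x' y'" if "x \<oplus> y \<sqsubset> x' \<oplus> y'" for x y x' y'
  proof -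
    let ?s = "x \<oplus> y"
    have "(\<one> \<oplus> \<one>) \<otimes> y \<sqsubseteq> (\<one> \<oplus> \<one>) \<otimes> ?s"
      by (intro num.mult_mono) (simp_all add: B9)
    then have "pr x y \<sqsubseteq> ?s \<otimes> (?s \<oplus> \<one>) \<oplus> (\<one> \<oplus> \<one>) \<otimes> ?s"
      unfolding pr_eq by (intro num.add_mono) simp_all
    also have "\<dots> \<sqsubset> (?s \<oplus> \<one>) \<otimes> (?s \<oplus> \<one> \<oplus> \<one>)"
    proof -
      have "(?s \<oplus> \<one>) \<otimes> (?s \<oplus> \<one> \<oplus> \<one>) = (?s \<otimes> (?s \<oplus> \<one>) \<oplus> (\<one> \<oplus> \<one>) \<otimes> ?s) \<oplus> (\<one> \<oplus> \<one>)"
        by (simp add: algebra_simps)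
      also have "\<dots> = (?s \<otimes> (?s \<oplus> \<one>) \<oplus> (\<one> \<oplus> \<one>) \<otimes> ?s) \<oplus> \<one> \<oplus> \<one>" by (simp only: add_assoc)
      finally have "(?s \<oplus> \<one>) \<otimes> (?s \<oplus> \<one> \<oplus> \<one>) = (?s \<otimes> (?s \<oplus> \<one>) \<oplus> (\<one> \<oplus> \<one>) \<otimes> ?s) \<oplus> \<one> \<oplus> \<one>" .
      then show ?thesis using B8 lt_Suc by simp
    qed
    also have "\<dots> \<sqsubseteq> (x' \<oplus> y') \<otimes> (x' \<oplus> y' \<oplus> \<one>)"
    proof -
      have "?s \<oplus> \<one> \<sqsubseteq> x' \<oplus> y'" using that by (simp only: Suc_le)
      from num.mult_mono[OF this num.add_right_mono[OF this] B9 B9] show ?thesis .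
    qed
    also have "\<dots> \<sqsubseteq> pr x' y'" unfolding pr_eq by (rule B8)
    finally show ?thesis .
  qed
  assume eq: "pr x y = pr x' y'"
  then have s: "x \<oplus> y = x' \<oplus> y'"
    using key[of x y x' y'] key[of x' y' x y] num.less_linear[of "x \<oplus> y" "x' \<oplus> y'"] by auto
  have "(\<one> \<oplus> \<one>) \<otimes> y = (\<one> \<oplus> \<one>) \<otimes> y'" using eq unfolding pr_eq s by simp
  moreover have "\<zero> \<sqsubset> \<one> \<oplus> \<one>" unfolding lt_Suc by (rule B9)
  ultimately have "y \<sqsubseteq> y'" "y' \<sqsubseteq> y"
    using num.mult_left_le_imp_le[of "\<one> \<oplus> \<one>" y y'] num.mult_left_le_imp_le[of "\<one> \<oplus> \<one>" y' y]
    by (simp_all only: num.order_refl simp_thms)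
  then have "y = y'" by (rule B7)
  then show "x = x' \<and> y = y'" using s by simp
qed simp

text \<open>Projections for coding two arguments into one index. The default zero keeps each
  projection below its argument.\<close>

definition lft where "lft p = (if \<exists>x y. p = pr x y then THE x. \<exists>y. p = pr x y else \<zero>)"
definition rgt where "rgt p = (if \<exists>x y. p = pr x y then THE y. \<exists>x. p = pr x y else \<zero>)"

lemma lft_pr [simp]: "lft (pr x y) = x" and rgt_pr [simp]: "rgt (pr x y) = y"
  by (auto simp: lft_def rgt_def pr_inj)

lemma LN_pr: "LN s \<Longrightarrow> LN t \<Longrightarrow> LN (\<lambda>e. pr (s e) (t e))"
  unfolding pr_eq by (intro LN_add LN_mul LN_const)

lemma NN_lft: "NN lft"
proof (rule NN_I)
  have graph: "c = lft z \<longleftrightarrow> (\<exists>y. y \<sqsubseteq> z \<and> z = pr c y) \<or>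
      (c = \<zero> \<and> \<not> (\<exists>x. x \<sqsubseteq> z \<and> (\<exists>y. y \<sqsubseteq> z \<and> z = pr x y)))" for c z
  proof (cases "\<exists>x y. z = pr x y")
    case True
    then obtain x y where "z = pr x y" by blast
    then show ?thesis using le_pr1[of x y] le_pr2[of y x] by (auto simp: pr_inj)
  qed (auto simp: lft_def)
  show "LD (\<lambda>e. e 0 = lft (e 1))" unfolding graph by (intro LD_intros LN_pr)
  show "\<exists>m. \<forall>z. z \<sqsubseteq> b \<longrightarrow> lft z \<sqsubseteq> m" for b
  proof (intro exI allI impI)
    fix z assume "z \<sqsubseteq> b"
    have "lft z \<sqsubseteq> z" using le_pr1 by (cases "\<exists>x y. z = pr x y") (auto simp: lft_def[of z] B9 pr_inj)
    then show "lft z \<sqsubseteq> b" using \<open>z \<sqsubseteq> b\<close> by (rule le_trans)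
  qed
qed

lemma NN_rgt: "NN rgt"
proof (rule NN_I)
  have graph: "c = rgt z \<longleftrightarrow> (\<exists>y. y \<sqsubseteq> z \<and> z = pr y c) \<or>
      (c = \<zero> \<and> \<not> (\<exists>x. x \<sqsubseteq> z \<and> (\<exists>y. y \<sqsubseteq> z \<and> z = pr x y)))" for c z
  proof (cases "\<exists>x y. z = pr x y")
    case True
    then obtain x y where "z = pr x y" by blast
    then show ?thesis using le_pr1[of x y] le_pr2[of y x] by (auto simp: pr_inj)
  qed (auto simp: rgt_def)
  show "LD (\<lambda>e. e 0 = rgt (e 1))" unfolding graph by (intro LD_intros LN_pr)
  show "\<exists>m. \<forall>z. z \<sqsubseteq> b \<longrightarrow> rgt z \<sqsubseteq> m" for b
  proof (intro exI allI impI)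
    fix z assume "z \<sqsubseteq> b"
    have "rgt z \<sqsubseteq> z" using le_pr2 by (cases "\<exists>x y. z = pr x y") (auto simp: rgt_def[of z] B9 pr_inj)
    then show "rgt z \<sqsubseteq> b" using \<open>z \<sqsubseteq> b\<close> by (rule le_trans)
  qed
qed

subsection \<open>Bounded minimization and parity\<close>

lemma bmin_unfold: "bmin M P b = (let Q = (\<lambda>v. v \<sqsubset> b \<and> P v \<and> (\<forall>w. w \<sqsubset> v \<longrightarrow> \<not> P w)) in
     if \<exists>v. Q v then SOME v. Q v else b)"
  by (simp add: bmin_def lt_def conj_assoc)

text \<open>A least witness exists because the witnesses form a string; for an arbitrary subset of
  the model this could fail. The right-hand side is the bounded graph used for definability.\<close>

lemma bmin_iff:
  assumes "{v. v \<sqsubset> b \<and> P v} \<in> \<S>"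
  shows "c = bmin M P b \<longleftrightarrow> c \<sqsubset> b \<and> P c \<and> (\<forall>w. w \<sqsubset> c \<longrightarrow> \<not> P w) \<or> c = b \<and> (\<forall>w. w \<sqsubset> b \<longrightarrow> \<not> P w)"
proof (cases "\<exists>v. v \<sqsubset> b \<and> P v")
  case True
  then obtain v where v: "v \<in> {v. v \<sqsubset> b \<and> P v}" by blast
  obtain m where m: "m \<in> {v. v \<sqsubset> b \<and> P v}" "\<And>y. y \<in> {v. v \<sqsubset> b \<and> P v} \<Longrightarrow> m \<sqsubseteq> y"
    by (rule minimum[OF assms v]) blast
  define Q where "Q = (\<lambda>v. v \<sqsubset> b \<and> P v \<and> (\<forall>w. w \<sqsubset> v \<longrightarrow> \<not> P w))"
  have "\<not> P w" if "w \<sqsubset> m" for w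
    using m(1) m(2)[of w] num.less_trans[OF that] num.not_le that by auto
  then have Qm: "Q m" using m(1) by (simp add: Q_def)
  have Qu: "v = m" if "Q v" for v
    using that Qm num.less_linear[of v m] by (auto simp: Q_def)
  have "(SOME v. Q v) = m" by (rule some_equality[of Q, OF Qm Qu])
  moreover have "\<exists>v. Q v" using Qm by blast
  ultimately have bm: "bmin M P b = m" unfolding bmin_unfold Q_def[symmetric] Let_def by simp
  show ?thesis unfolding bm
  proof
    assume "c = m"
    then show "c \<sqsubset> b \<and> P c \<and> (\<forall>w. w \<sqsubset> c \<longrightarrow> \<not> P w) \<or> c = b \<and> (\<forall>w. w \<sqsubset> b \<longrightarrow> \<not> P w)"
      using Qm by (simp add: Q_def)
  next
    assume "c \<sqsubset> b \<and> P c \<and> (\<forall>w. w \<sqsubset> c \<longrightarrow> \<not> P w) \<or> c = b \<and> (\<forall>w. w \<sqsubset> b \<longrightarrow> \<not> P w)"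
    moreover have "\<not> (\<forall>w. w \<sqsubset> b \<longrightarrow> \<not> P w)" using True by blast
    ultimately have "Q c" by (simp add: Q_def)
    then show "c = m" by (rule Qu)
  qed
next
  case False
  then have "bmin M P b = b" unfolding bmin_unfold Let_def by (subst if_not_P) auto
  then show ?thesis using False by auto
qed

lemma bmin_props:
  assumes "{v. v \<sqsubset> b \<and> P v} \<in> \<S>"
  shows "bmin M P b \<sqsubseteq> b" "bmin M P b \<sqsubset> b \<Longrightarrow> P (bmin M P b)" "w \<sqsubset> bmin M P b \<Longrightarrow> \<not> P w"
  using bmin_iff[OF assms, THEN iffD1, OF refl] num.less_imp_le by auto

lemma NN_bmin:
  assumes "NN t" "LD (\<lambda>e. P (e 1) (e 0))"
  shows "NN (\<lambda>z. bmin M (P z) (t z))"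
proof (rule NN_I)
  have strs: "{v. v \<sqsubset> t z \<and> P z v} \<in> \<S>" for z
    using NS_strs[OF NS_comprehension[OF assms]] by auto
  show "\<exists>m. \<forall>z. z \<sqsubseteq> b \<longrightarrow> bmin M (P z) (t z) \<sqsubseteq> m" for b
    using NN_bound[OF assms(1), of b] le_trans[OF bmin_props(1)[OF strs]] by blast
  have P: "LD (\<lambda>e. P (f e) (g e))" if "LN f" "LN g" for f g
    by (rule LD_rel_rel[where R = "\<lambda>c z. P z c"]) (use that assms(2) in auto)
  show "LD (\<lambda>e. e 0 = bmin M (P (e 1)) (t (e 1)))"
    unfolding bmin_iff[OF strs] by (intro LD_intros P LN_comp[OF assms(1)])
qed

lemma parity_exists:
  assumes "X \<in> \<S>"
  shows "parity_spec M n X (parity_str M n X)"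
proof -
  have "parity_axiom \<in> axms V0_2" by (simp add: V0_2_def)
  from modelsD[OF V0 this, of "\<lambda>_. X" "\<lambda>_. n"] assms
  have "\<exists>Z. parity_spec M n X Z" by (auto simp: parity_axiom_def parity_spec_def)
  then have "parity_spec M n X (SOME Z. parity_spec M n X Z)" by (rule someI_ex)
  then show ?thesis by (simp add: parity_str_def clip_def parity_spec_def)
qed

lemma parity_str:
  assumes "X \<in> \<S>"
  shows "parity_str M n X \<in> \<S>" "len (parity_str M n X) \<sqsubseteq> n \<oplus> \<one>" "\<zero> \<notin> parity_str M n X"
    "i \<sqsubset> n \<Longrightarrow> i \<oplus> \<one> \<in> parity_str M n X \<longleftrightarrow> (i \<in> X) \<noteq> (i \<in> parity_str M n X)"
  using parity_exists[OF assms, of n] by (auto simp: parity_spec_def lt_def)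

lemma parity_bound: "X \<in> \<S> \<Longrightarrow> c \<in> parity_str M n X \<Longrightarrow> c \<sqsubseteq> n"
  using L1[OF parity_str(1)] num.less_le_trans[OF _ parity_str(2)] lt_Suc by blast

text \<open>All strings \<open>U z\<close> for \<open>z \<le> b\<close> are concatenated, and their parities are differences of
  parities of initial segments of the concatenation.\<close>

lemma block_less: "z \<sqsubset> z' \<Longrightarrow> c \<sqsubset> N \<Longrightarrow> z \<otimes> N \<oplus> c \<sqsubset> z' \<otimes> N \<oplus> c'"
proof -
  assume "z \<sqsubset> z'" "c \<sqsubset> N"
  then have "z \<otimes> N \<oplus> c \<sqsubset> z \<otimes> N \<oplus> N" by simp
  also have "\<dots> = (z \<oplus> \<one>) \<otimes> N" by (simp add: mul_one_left)
  also have "\<dots> \<sqsubseteq> z' \<otimes> N" using \<open>z \<sqsubset> z'\<close> by (intro num.mult_mono) (simp_all add: Suc_le B9)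
  also have "\<dots> \<sqsubseteq> z' \<otimes> N \<oplus> c'" by (rule B8)
  finally show ?thesis .
qed

lemma block_inj: "c \<sqsubset> N \<Longrightarrow> c' \<sqsubset> N \<Longrightarrow> z \<otimes> N \<oplus> c = z' \<otimes> N \<oplus> c' \<longleftrightarrow> z = z' \<and> c = c'"
  using block_less[of z z' c N c'] block_less[of z' z c' N c] num.less_linear[of z z'] by auto

lemma NS_parity:
  assumes "NN u" "NS U"
  shows "NS (\<lambda>z. parity_str M (u z) (U z))"
proof (rule NS_I)
  have U: "U z \<in> \<S>" for z by (rule NS_strs[OF assms(2)])
  show "parity_str M (u z) (U z) \<in> \<S>" for z by (rule parity_str(1)[OF U])
  show "\<exists>m. \<forall>z. z \<sqsubseteq> b \<longrightarrow> len (parity_str M (u z) (U z)) \<sqsubseteq> m" for b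
  proof -
    obtain m where "\<forall>z. z \<sqsubseteq> b \<longrightarrow> u z \<sqsubseteq> m" using NN_bound[OF assms(1)] by blast
    then have "\<forall>z. z \<sqsubseteq> b \<longrightarrow> len (parity_str M (u z) (U z)) \<sqsubseteq> m \<oplus> \<one>"
      using le_trans[OF parity_str(2)[OF U]] num.add_right_mono by blast
    then show ?thesis by blast
  qed
  show "LD (\<lambda>e. e 0 \<in> parity_str M (u (e 1)) (U (e 1)))"
  proof (rule LD_local)
    fix b
    obtain m where m: "\<forall>z. z \<sqsubseteq> b \<longrightarrow> u z \<sqsubseteq> m" using NN_bound[OF assms(1)] by blast
    \<comment> \<open>The common block length exceeds every \<open>u z\<close> with
      \<open>z \<sqsubseteq> b\<close>, so all positions of block \<open>z\<close> that matter stay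
      inside the block.\<close>
    define N where "N = m \<oplus> \<one>"
    define W where "W = {w. w \<sqsubset> (b \<oplus> \<one>) \<otimes> N \<and> (\<exists>z. z \<sqsubseteq> b \<and> (\<exists>c. c \<sqsubset> N \<and> w = z \<otimes> N \<oplus> c \<and> c \<in> U z))}"
    have W: "W \<in> \<S>" unfolding W_def
      by (rule comprehension_LD) (intro LD_intros LD_memS[OF assms(2)])
    have bnd: "z \<otimes> N \<oplus> c \<sqsubset> (b \<oplus> \<one>) \<otimes> N" if "z \<sqsubseteq> b" "c \<sqsubset> N" for z c
      using block_less[of z "b \<oplus> \<one>" c N \<zero>] that by (simp add: lt_Suc B3)
    have memW: "z \<otimes> N \<oplus> c \<in> W \<longleftrightarrow> c \<in> U z" if "z \<sqsubseteq> b" "c \<sqsubset> N" for z c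
    proof
      assume "z \<otimes> N \<oplus> c \<in> W"
      then obtain z' c' where "c' \<sqsubset> N" "z \<otimes> N \<oplus> c = z' \<otimes> N \<oplus> c'" "c' \<in> U z'"
        unfolding W_def by blast
      then show "c \<in> U z" using block_inj[OF that(2)] by auto
    next
      assume "c \<in> U z"
      then show "z \<otimes> N \<oplus> c \<in> W" unfolding W_def using that bnd by blast
    qed
    define P where "P = parity_str M ((b \<oplus> \<one>) \<otimes> N) W"
    have P: "P \<in> \<S>" unfolding P_def by (rule parity_str(1)[OF W])
    have main: "c \<sqsubseteq> u z \<longrightarrow> (c \<in> parity_str M (u z) (U z) \<longleftrightarrow> (z \<otimes> N \<oplus> c \<in> P) \<noteq> (z \<otimes> N \<in> P))"
      if z: "z \<sqsubseteq> b" for z c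
    proof (rule induct[of "\<lambda>c. c \<sqsubseteq> u z \<longrightarrow>
        (c \<in> parity_str M (u z) (U z) \<longleftrightarrow> (z \<otimes> N \<oplus> c \<in> P) \<noteq> (z \<otimes> N \<in> P))"])
      show "DP (\<lambda>e. e 0 \<sqsubseteq> u z \<longrightarrow>
          (e 0 \<in> parity_str M (u z) (U z) \<longleftrightarrow> (z \<otimes> N \<oplus> e 0 \<in> P) \<noteq> (z \<otimes> N \<in> P)))"
        by (intro DP_intros P parity_str(1)[OF U])
      fix c assume IH: "c \<sqsubseteq> u z \<longrightarrow>
        (c \<in> parity_str M (u z) (U z) \<longleftrightarrow> (z \<otimes> N \<oplus> c \<in> P) \<noteq> (z \<otimes> N \<in> P))"
      show "c \<oplus> \<one> \<sqsubseteq> u z \<longrightarrow>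
        (c \<oplus> \<one> \<in> parity_str M (u z) (U z) \<longleftrightarrow> (z \<otimes> N \<oplus> (c \<oplus> \<one>) \<in> P) \<noteq> (z \<otimes> N \<in> P))"
      proof
        assume "c \<oplus> \<one> \<sqsubseteq> u z"
        then have c: "c \<sqsubset> u z" by (simp add: Suc_le)
        have "u z \<sqsubseteq> m" using m z by blast
        then have cN: "c \<sqsubset> N" unfolding N_def lt_Suc
          using num.less_le_trans[OF c] num.less_imp_le by blast
        have "z \<otimes> N \<oplus> (c \<oplus> \<one>) \<in> P \<longleftrightarrow> (z \<otimes> N \<oplus> c \<in> W) \<noteq> (z \<otimes> N \<oplus> c \<in> P)"
          unfolding add_assoc[symmetric] P_def by (rule parity_str(4)[OF W bnd[OF z cN]])
        then show "c \<oplus> \<one> \<in> parity_str M (u z) (U z) \<longleftrightarrow>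
            (z \<otimes> N \<oplus> (c \<oplus> \<one>) \<in> P) \<noteq> (z \<otimes> N \<in> P)"
          using parity_str(4)[OF U c] memW[OF z cN] IH num.less_imp_le[OF c] by auto
      qed
    qed (simp add: parity_str(3)[OF U])
    \<comment> \<open>Beyond \<open>u z\<close> the prefix parities of the concatenation go on
      changing, whereas the parity string has no elements there; hence the first conjunct.\<close>
    have "\<forall>e :: nat \<Rightarrow> 'n. (\<forall>i. e i \<sqsubseteq> b) \<longrightarrow> (e 0 \<in> parity_str M (u (e 1)) (U (e 1))) =
        (e 0 \<sqsubseteq> u (e 1) \<and> ((e 1 \<otimes> N \<oplus> e 0 \<in> P) \<noteq> (e 1 \<otimes> N \<in> P)))"
      using main parity_bound[OF U] by blast
    moreover have "LD (\<lambda>e. e 0 \<sqsubseteq> u (e 1) \<and> ((e 1 \<otimes> N \<oplus> e 0 \<in> P) \<noteq> (e 1 \<otimes> N \<in> P)))"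
      by (intro LD_intros P LN_comp[OF assms(1)])
    ultimately show "\<exists>Q. LD Q \<and> (\<forall>e :: nat \<Rightarrow> 'n. (\<forall>i. e i \<sqsubseteq> b) \<longrightarrow>
        (e 0 \<in> parity_str M (u (e 1)) (U (e 1))) = Q e)"
      by (intro exI[of _ "\<lambda>e. e 0 \<sqsubseteq> u (e 1) \<and> ((e 1 \<otimes> N \<oplus> e 0 \<in> P) \<noteq> (e 1 \<otimes> N \<in> P))"]) simp
  qed
qed

subsection \<open>Closure under the function symbols\<close>

text \<open>Arguments are families indexed by a number, as they arise when the symbol is applied to
  terms containing a comprehension variable. Unlike a definable graph, this condition handles string
  arguments, for which no quantifier is available in \<open>LD\<close>.\<close>

definition goodN :: "nfun \<Rightarrow> bool" where
  "goodN f \<longleftrightarrow> (\<forall>us Us. (length us, length Us) = arity_n f \<longrightarrow> (\<forall>u\<in>set us. NN u) \<longrightarrow>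
     (\<forall>U\<in>set Us. NS U) \<longrightarrow> NN (\<lambda>z. nI M f (map (\<lambda>u. u z) us) (map (\<lambda>U. U z) Us)))"

definition goodS :: "sfun \<Rightarrow> bool" where
  "goodS g \<longleftrightarrow> (\<forall>us Us. (length us, length Us) = arity_s g \<longrightarrow> (\<forall>u\<in>set us. NN u) \<longrightarrow>
     (\<forall>U\<in>set Us. NS U) \<longrightarrow> NS (\<lambda>z. sI M g (map (\<lambda>u. u z) us) (map (\<lambda>U. U z) Us)))"

lemma NN_eval:
  assumes "\<And>i. NN (e i)" "\<And>i. NS (E i)"
  shows "wf_nt t \<Longrightarrow> (\<And>f. f \<in> nsyms_nt t \<Longrightarrow> goodN f) \<Longrightarrow> (\<And>g. g \<in> ssyms_nt t \<Longrightarrow> goodS g) \<Longrightarrow>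
      NN (\<lambda>z. ev (\<lambda>i. e i z) (\<lambda>i. E i z) t)"
    and "wf_st T \<Longrightarrow> (\<And>f. f \<in> nsyms_st T \<Longrightarrow> goodN f) \<Longrightarrow> (\<And>g. g \<in> ssyms_st T \<Longrightarrow> goodS g) \<Longrightarrow>
      NS (\<lambda>z. evS (\<lambda>i. e i z) (\<lambda>i. E i z) T)"
proof (induction t and T)
  case (Plus s t)
  have "NN (\<lambda>z. ev (\<lambda>i. e i z) (\<lambda>i. E i z) s)" "NN (\<lambda>z. ev (\<lambda>i. e i z) (\<lambda>i. E i z) t)"
    by (rule Plus.IH; use Plus.prems in auto)+
  then show ?case unfolding NN_def by (simp add: LN_add)
next
  case (Times s t)
  have "NN (\<lambda>z. ev (\<lambda>i. e i z) (\<lambda>i. E i z) s)" "NN (\<lambda>z. ev (\<lambda>i. e i z) (\<lambda>i. E i z) t)"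
    by (rule Times.IH; use Times.prems in auto)+
  then show ?case unfolding NN_def by (simp add: LN_mul)
next
  case (Len T)
  have "NS (\<lambda>z. evS (\<lambda>i. e i z) (\<lambda>i. E i z) T)" by (rule Len.IH; use Len.prems in auto)
  then show ?case by (simp add: NN_len)
next
  case (NFun f ts Ts)
  let ?us = "map (\<lambda>t z. ev (\<lambda>i. e i z) (\<lambda>i. E i z) t) ts"
  let ?Us = "map (\<lambda>T z. evS (\<lambda>i. e i z) (\<lambda>i. E i z) T) Ts"
  have us: "\<forall>u\<in>set ?us. NN u"
  proof
    fix u assume "u \<in> set ?us"
    then obtain t where t: "t \<in> set ts" "u = (\<lambda>z. ev (\<lambda>i. e i z) (\<lambda>i. E i z) t)" by auto
    have "wf_nt t" using NFun.prems(1) t(1) by (simp add: list_all_iff)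
    then show "NN u" unfolding t(2)
      by (rule NFun.IH(1)[OF t(1) _ NFun.prems(2) NFun.prems(3)]) (use t(1) in auto)
  qed
  have Us: "\<forall>U\<in>set ?Us. NS U"
  proof
    fix U assume "U \<in> set ?Us"
    then obtain T where T: "T \<in> set Ts" "U = (\<lambda>z. evS (\<lambda>i. e i z) (\<lambda>i. E i z) T)" by auto
    have "wf_st T" using NFun.prems(1) T(1) by (simp add: list_all_iff)
    then show "NS U" unfolding T(2)
      by (rule NFun.IH(2)[OF T(1) _ NFun.prems(2) NFun.prems(3)]) (use T(1) in auto)
  qed
  have "goodN f" using NFun.prems(2) by simp
  moreover have "(length ?us, length ?Us) = arity_n f" using NFun.prems(1) by simp
  ultimately have "NN (\<lambda>z. nI M f (map (\<lambda>u. u z) ?us) (map (\<lambda>U. U z) ?Us))"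
    using us Us unfolding goodN_def by blast
  then show ?case by (simp add: comp_def)
next
  case (SFun g ts Ts)
  let ?us = "map (\<lambda>t z. ev (\<lambda>i. e i z) (\<lambda>i. E i z) t) ts"
  let ?Us = "map (\<lambda>T z. evS (\<lambda>i. e i z) (\<lambda>i. E i z) T) Ts"
  have us: "\<forall>u\<in>set ?us. NN u"
  proof
    fix u assume "u \<in> set ?us"
    then obtain t where t: "t \<in> set ts" "u = (\<lambda>z. ev (\<lambda>i. e i z) (\<lambda>i. E i z) t)" by auto
    have "wf_nt t" using SFun.prems(1) t(1) by (simp add: list_all_iff)
    then show "NN u" unfolding t(2)
      by (rule SFun.IH(1)[OF t(1) _ SFun.prems(2) SFun.prems(3)]) (use t(1) in auto)
  qed
  have Us: "\<forall>U\<in>set ?Us. NS U"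
  proof
    fix U assume "U \<in> set ?Us"
    then obtain T where T: "T \<in> set Ts" "U = (\<lambda>z. evS (\<lambda>i. e i z) (\<lambda>i. E i z) T)" by auto
    have "wf_st T" using SFun.prems(1) T(1) by (simp add: list_all_iff)
    then show "NS U" unfolding T(2)
      by (rule SFun.IH(2)[OF T(1) _ SFun.prems(2) SFun.prems(3)]) (use T(1) in auto)
  qed
  have "goodS g" using SFun.prems(3) by simp
  moreover have "(length ?us, length ?Us) = arity_s g" using SFun.prems(1) by simp
  ultimately have "NS (\<lambda>z. sI M g (map (\<lambda>u. u z) ?us) (map (\<lambda>U. U z) ?Us))"
    using us Us unfolding goodS_def by blast
  then show ?case by (simp add: comp_def)
qed (use assms NN_const in simp_all)

text \<open>Strings are sets, so equality compares elements, and the sum of the two lengths bounds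
  the elements of both.\<close>

lemma LD_eqS:
  assumes "NS U" "NS V"
  shows "LD (\<lambda>e. U (e 0) = V (e 0))"
proof -
  have "U z = V z \<longleftrightarrow> (\<forall>x. x \<sqsubset> len (U z) \<oplus> len (V z) \<longrightarrow> (x \<in> U z \<longleftrightarrow> x \<in> V z))" for z
  proof
    assume *: "\<forall>x. x \<sqsubset> len (U z) \<oplus> len (V z) \<longrightarrow> (x \<in> U z \<longleftrightarrow> x \<in> V z)"
    have "x \<sqsubset> len (U z) \<oplus> len (V z)" if "x \<in> U z" for x
      by (rule num.less_le_trans[OF L1[OF NS_strs[OF assms(1)] that] B8])
    moreover have "x \<sqsubset> len (U z) \<oplus> len (V z)" if "x \<in> V z" for x
      by (subst add_commute) (rule num.less_le_trans[OF L1[OF NS_strs[OF assms(2)] that] B8])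
    ultimately show "U z = V z" using * by blast
  qed simp
  moreover have "LD (\<lambda>e. \<forall>x. x \<sqsubset> len (U (e 0)) \<oplus> len (V (e 0)) \<longrightarrow> (x \<in> U (e 0) \<longleftrightarrow> x \<in> V (e 0)))"
    by (intro LD_intros LD_memS[OF assms(1)] LD_memS[OF assms(2)]
        LN_comp[OF NN_len[OF assms(1)]] LN_comp[OF NN_len[OF assms(2)]])
  ultimately show ?thesis by simp
qed

lemma LD_holds:
  assumes "\<And>i. NN (e i)" "\<And>i. NS (E i)"
  shows "qfree \<phi> \<Longrightarrow> wf_fm \<phi> \<Longrightarrow> (\<And>f. f \<in> nsyms \<phi> \<Longrightarrow> goodN f) \<Longrightarrow>
      (\<And>g. g \<in> ssyms \<phi> \<Longrightarrow> goodS g) \<Longrightarrow> LD (\<lambda>e'. holds (\<lambda>i. e i (e' 0)) (\<lambda>i. E i (e' 0)) \<phi>)"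
proof (induction \<phi>)
  case Falsum
  then show ?case by (simp add: LD_const)
next
  case (EqN s t)
  have "NN (\<lambda>z. ev (\<lambda>i. e i z) (\<lambda>i. E i z) s)" "NN (\<lambda>z. ev (\<lambda>i. e i z) (\<lambda>i. E i z) t)"
    by (rule NN_eval(1)[OF assms]; use EqN.prems in auto)+
  then show ?case unfolding NN_def by (simp add: LD_eq)
next
  case (EqS S T)
  have "NS (\<lambda>z. evS (\<lambda>i. e i z) (\<lambda>i. E i z) S)" "NS (\<lambda>z. evS (\<lambda>i. e i z) (\<lambda>i. E i z) T)"
    by (rule NN_eval(2)[OF assms]; use EqS.prems in auto)+
  from LD_eqS[OF this] show ?case by simp
next
  case (Le s t)
  have "NN (\<lambda>z. ev (\<lambda>i. e i z) (\<lambda>i. E i z) s)" "NN (\<lambda>z. ev (\<lambda>i. e i z) (\<lambda>i. E i z) t)"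
    by (rule NN_eval(1)[OF assms]; use Le.prems in auto)+
  then show ?case unfolding NN_def by (simp add: LD_le)
next
  case (Mem t T)
  have "NN (\<lambda>z. ev (\<lambda>i. e i z) (\<lambda>i. E i z) t)"
    by (rule NN_eval(1)[OF assms]; use Mem.prems in auto)
  moreover have "NS (\<lambda>z. evS (\<lambda>i. e i z) (\<lambda>i. E i z) T)"
    by (rule NN_eval(2)[OF assms]; use Mem.prems in auto)
  ultimately show ?case
    using LD_memS[OF _ _ LN_var, of "\<lambda>z. evS (\<lambda>i. e i z) (\<lambda>i. E i z) T"
        "\<lambda>e'. ev (\<lambda>i. e i (e' 0)) (\<lambda>i. E i (e' 0)) t" 0] unfolding NN_def by simp
next
  case (Imp \<phi> \<psi>)
  have "LD (\<lambda>e'. holds (\<lambda>i. e i (e' 0)) (\<lambda>i. E i (e' 0)) \<phi>)"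
    "LD (\<lambda>e'. holds (\<lambda>i. e i (e' 0)) (\<lambda>i. E i (e' 0)) \<psi>)"
    by (rule Imp.IH; use Imp.prems in auto)+
  then show ?case by (simp add: LD_imp)
qed simp_all

lemma lookup_map_fun:
  "lookup d xs (map (\<lambda>u. u z) us) i = (case map_of (zip xs us) i of Some u \<Rightarrow> u z | None \<Rightarrow> d)"
proof -
  have "map_of (zip xs (map (\<lambda>u. u z) us)) = map_option (\<lambda>u. u z) \<circ> map_of (zip xs us)"
    by (simp add: zip_map2 map_of_map[symmetric])
  then show ?thesis by (simp add: lookup_def split: option.split)
qed

lemma NN_lookup:
  assumes "\<forall>u\<in>set us. NN u" "NN w"
  shows "NN (\<lambda>z. lookup a xs (map (\<lambda>u. u (w z)) us) i)"
proof (cases "map_of (zip xs us) i")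
  case (Some u)
  then have "NN u" using assms(1) by (auto dest!: map_of_SomeD set_zip_rightD)
  then show ?thesis using Some assms(2) by (simp add: lookup_map_fun NN_comp)
qed (simp add: lookup_map_fun NN_const)

lemma NS_lookup:
  assumes "\<forall>U\<in>set Us. NS U" "NN w"
  shows "NS (\<lambda>z. lookup {} Xs (map (\<lambda>U. U (w z)) Us) i)"
proof (cases "map_of (zip Xs Us) i")
  case (Some U)
  then have "NS U" using assms(1) by (auto dest!: map_of_SomeD set_zip_rightD)
  then show ?thesis using Some assms(2) by (simp add: lookup_map_fun NS_comp)
qed (simp add: lookup_map_fun NS_const empty_strs)

text \<open>The formula inside the symbol depends on the index of the family and on the candidate
  value. \<open>LD_holds\<close> admits one index, so the two are coded as a pair.\<close>

lemma good_MinFun: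
  assumes D: "defining_data z xs Xs \<phi> t" and g: "\<And>f. f \<in> nsyms \<phi> \<Longrightarrow> goodN f" "\<And>g. g \<in> ssyms \<phi> \<Longrightarrow> goodS g"
    and wf: "wf_nt t"
  shows "goodN (MinFun z xs Xs \<phi> t)" "goodS (CompFun z xs Xs \<phi> t)"
proof -
  have "NN (\<lambda>v. nI M (MinFun z xs Xs \<phi> t) (map (\<lambda>u. u v) us) (map (\<lambda>U. U v) Us)) \<and>
      NS (\<lambda>v. sI M (CompFun z xs Xs \<phi> t) (map (\<lambda>u. u v) us) (map (\<lambda>U. U v) Us))"
    if us: "\<forall>u\<in>set us. NN u" "\<forall>U\<in>set Us. NS U" for us Us
  proof -
    define b where "b v = ev (lookup \<zero> xs (map (\<lambda>u. u v) us)) (lookup {} Xs (map (\<lambda>U. U v) Us)) t" for v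
    define P where "P v c = holds ((lookup \<zero> xs (map (\<lambda>u. u v) us))(z := c))
        (lookup {} Xs (map (\<lambda>U. U v) Us)) \<phi>" for v c
    have "NN b" unfolding b_def
      using NN_eval(1)[of "\<lambda>i v. lookup \<zero> xs (map (\<lambda>u. u v) us) i"
          "\<lambda>i v. lookup {} Xs (map (\<lambda>U. U v) Us) i" t]
        NN_lookup[OF us(1) NN_id] NS_lookup[OF us(2) NN_id] D wf by (simp add: defining_data_def)
    \<comment> \<open>The first component of \<open>p\<close> selects the member of the family, the
      second one is the value of the comprehension variable.\<close>
    have e: "NN (\<lambda>p. ((lookup \<zero> xs (map (\<lambda>u. u (lft p)) us))(z := rgt p)) i)" for i
      using NN_lookup[OF us(1) NN_lft] NN_rgt by (cases "i = z") simp_all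
    have "LD (\<lambda>e'. P (lft (e' 0)) (rgt (e' 0)))" unfolding P_def
      using LD_holds[of "\<lambda>i p. ((lookup \<zero> xs (map (\<lambda>u. u (lft p)) us))(z := rgt p)) i"
          "\<lambda>i p. lookup {} Xs (map (\<lambda>U. U (lft p)) Us) i" \<phi>, OF e NS_lookup[OF us(2) NN_lft]] D g
      by (simp add: defining_data_def del: fun_upd_apply)
    from LD_subst[of "\<lambda>e. pr (e 1) (e 0)" "\<lambda>x e. P (lft x) (rgt x)", OF LN_pr[OF LN_var LN_var] this]
    have "LD (\<lambda>e. P (e 1) (e 0))" by simp
    from NN_bmin[OF \<open>NN b\<close> this] NS_comprehension[OF \<open>NN b\<close> this]
    have "NN (\<lambda>v. bmin M (P v) (b v))" "NS (\<lambda>v. {c. c \<sqsubset> b v \<and> P v c})" .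
    moreover have "clip M {c. c \<sqsubset> b v \<and> P v c} = {c. c \<sqsubset> b v \<and> P v c}" for v
      using NS_strs[OF \<open>NS (\<lambda>v. {c. c \<sqsubset> b v \<and> P v c})\<close>] by (simp add: clip_def)
    ultimately show ?thesis
      by (simp add: eval_map sat_map b_def[symmetric] P_def[symmetric] lt_def Let_def)
  qed
  then show "goodN (MinFun z xs Xs \<phi> t)" "goodS (CompFun z xs Xs \<phi> t)"
    by (auto simp: goodN_def goodS_def simp del: nI.simps sI.simps)
qed

end

section \<open>The symbols of AC0(2) and the axioms of their universal theory\<close>

context v0
begin

lemma goodN_Pd: "goodN Pd"
  unfolding goodN_def
proof (intro allI impI)
  fix us :: "('n \<Rightarrow> 'n) list" and Us :: "('n \<Rightarrow> 'n set) list"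
  assume len: "(length us, length Us) = arity_n Pd" and us: "\<forall>u\<in>set us. NN u"
  obtain u where u: "us = [u]" "Us = []" using len by (cases us) auto
  then have "NN u" using us by simp
  define pd where "pd x = nI M Pd [x] []" for x
  have ex: "\<exists>y. if x = \<zero> then y = \<zero> else y \<oplus> \<one> = x" for x
    by (cases x rule: nat_cases) (auto simp: B1)
  have pd: "if x = \<zero> then pd x = \<zero> else pd x \<oplus> \<one> = x" for x
    unfolding pd_def nI.simps list.sel by (rule someI_ex[OF ex])
  have pd_iff: "c = pd x \<longleftrightarrow> (x = \<zero> \<and> c = \<zero>) \<or> c \<oplus> \<one> = x" for c x
  proof
    assume "(x = \<zero> \<and> c = \<zero>) \<or> c \<oplus> \<one> = x"
    then show "c = pd x" using pd[of x] B1[of c] B2[of c "pd x"] by (cases "x = \<zero>") auto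
  qed (use pd[of x] in \<open>cases "x = \<zero>"; simp\<close>)
  have "NN pd"
  proof (rule NN_I)
    have "pd z \<sqsubseteq> z" for z using pd[of z] B8[of "pd z" \<one>] B9 by (cases "z = \<zero>") auto
    then show "\<exists>m. \<forall>z. z \<sqsubseteq> b \<longrightarrow> pd z \<sqsubseteq> m" for b using le_trans by blast
    show "LD (\<lambda>e. e 0 = pd (e 1))" unfolding pd_iff by (intro LD_intros)
  qed
  from NN_comp[OF this \<open>NN u\<close>] show "NN (\<lambda>z. nI M Pd (map (\<lambda>u. u z) us) (map (\<lambda>U. U z) Us))"
    by (simp only: u pd_def list.map)
qed

lemma goodN_FSE: "goodN FSE"
  unfolding goodN_def
proof (intro allI impI)
  fix us :: "('n \<Rightarrow> 'n) list" and Us :: "('n \<Rightarrow> 'n set) list"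
  assume len: "(length us, length Us) = arity_n FSE" and Us: "\<forall>U\<in>set Us. NS U"
  obtain U V where U: "Us = [U, V]" using len by (auto simp: numeral_2_eq_2 length_Suc_conv)
  then have UV: "NS U" "NS V" using Us by auto
  have "LD (\<lambda>e. (e 0 \<in> U (e 1)) \<noteq> (e 0 \<in> V (e 1)))"
    by (intro LD_intros LD_memS[OF UV(1)] LD_memS[OF UV(2)])
  from NN_bmin[OF NN_len[OF UV(1)], of "\<lambda>z i. (i \<in> U z) \<noteq> (i \<in> V z)", OF this]
  show "NN (\<lambda>z. nI M FSE (map (\<lambda>u. u z) us) (map (\<lambda>U. U z) Us))"
    by (simp add: U)
qed

lemma goodS_ParityF: "goodS ParityF"
  unfolding goodS_def
proof (intro allI impI)
  fix us :: "('n \<Rightarrow> 'n) list" and Us :: "('n \<Rightarrow> 'n set) list"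
  assume len: "(length us, length Us) = arity_s ParityF" and us: "\<forall>u\<in>set us. NN u" "\<forall>U\<in>set Us. NS U"
  obtain u U where "us = [u]" "Us = [U]" using len by (auto simp: length_Suc_conv)
  then show "NS (\<lambda>z. sI M ParityF (map (\<lambda>u. u z) us) (map (\<lambda>U. U z) Us))"
    using us NS_parity by simp
qed

lemma good_AC02:
  shows "AC02_n f \<Longrightarrow> goodN f" and "AC02_s g \<Longrightarrow> goodS g"
proof (induction rule: AC02_n_AC02_s.inducts)
  case (4 z xs Xs \<phi> t)
  then show ?case by (intro good_MinFun) (auto simp: defining_data_def wf_no_syms)
next
  case (5 z xs Xs \<phi> t)
  then show ?case by (intro good_MinFun) (auto simp: defining_data_def wf_no_syms)
qed (rule goodN_Pd goodN_FSE goodS_ParityF)+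

text \<open>Serves both kinds of symbols: \<open>clip\<close> leaves a comprehension unchanged, and
  a bounded search has a least solution.\<close>

lemma defined_strs:
  assumes "defining_data z xs Xs \<phi> t" "\<forall>f\<in>nsyms \<phi>. goodN f" "\<forall>g\<in>ssyms \<phi>. goodS g" "range E \<subseteq> \<S>"
  shows "{v. v \<sqsubset> b \<and> holds (e(z := v)) E \<phi>} \<in> \<S>"
proof (rule comprehension_LD)
  have "NN (\<lambda>v. (e(z := v)) i)" for i by (cases "i = z") (simp_all add: NN_id NN_const)
  moreover have "NS (\<lambda>v. E i)" for i using assms(4) by (intro NS_const) auto
  ultimately show "LD (\<lambda>e'. holds (e(z := e' 0)) E \<phi>)"
    using LD_holds[of "\<lambda>i v. (e(z := v)) i" "\<lambda>i v. E i" \<phi>] assms(1-3)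
    by (simp add: defining_data_def del: fun_upd_apply)
qed

lemma CompFun_value:
  assumes "defining_data z xs Xs \<phi> t" "\<forall>f\<in>nsyms \<phi>. goodN f" "\<forall>g\<in>ssyms \<phi>. goodS g" "range E \<subseteq> \<S>"
  shows "sI M (CompFun z xs Xs \<phi> t) (map e xs) (map E Xs) =
    {v. v \<sqsubset> ev e E t \<and> holds (e(z := v)) E \<phi>}"
  unfolding sI_MinFun(2)[OF assms(1)] using defined_strs[OF assms, of "ev e E t" e]
  by (simp add: clip_def lt_def Let_def)

lemma CompFun_axiom_holds:
  assumes "defining_data z xs Xs \<phi> t" "\<forall>f\<in>nsyms \<phi>. goodN f" "\<forall>g\<in>ssyms \<phi>. goodS g" "range E \<subseteq> \<S>"
  shows "holds e E (CompFun_axiom z xs Xs \<phi> t)"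
  using CompFun_value[OF assms, of e] by (simp add: CompFun_axiom_def comp_def lt_def[symmetric])

lemma MinFun_axiom_holds:
  assumes "defining_data z xs Xs \<phi> t" "\<forall>f\<in>nsyms \<phi>. goodN f" "\<forall>g\<in>ssyms \<phi>. goodS g" "range E \<subseteq> \<S>"
  shows "holds e E (MinFun_axiom z xs Xs \<phi> t)"
proof -
  note b = bmin_props[OF defined_strs[OF assms, of "ev e E t" e]]
  let ?b = "bmin M (\<lambda>v. holds (e(z := v)) E \<phi>) (ev e E t)"
  have m: "nI M (MinFun z xs Xs \<phi> t) (map e xs) (map E Xs) = ?b"
    by (rule sI_MinFun(1)[OF assms(1)])
  have "holds e E \<phi>" if "e z = ?b" "?b \<sqsubset> ev e E t"
    using b(2)[OF that(2)] unfolding that(1)[symmetric] by simp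
  moreover have "\<not> holds e E \<phi>" if "e z \<sqsubset> ?b"
    using b(3)[OF that] by simp
  ultimately show ?thesis
    using b(1) m by (auto simp: MinFun_axiom_def Let_def comp_def lt_def[symmetric] simp del: nI.simps)
qed

lemma basic_open_holds: "\<phi> \<in> basic_open \<Longrightarrow> range E \<subseteq> \<S> \<Longrightarrow> holds e E \<phi>"
proof -
  assume \<phi>: "\<phi> \<in> basic_open" "range E \<subseteq> \<S>"
  have "\<phi> \<in> formulas L_A2" using \<phi>(1) by (auto simp: basic_open_def)
  moreover have "\<phi> \<in> axms V0_2" using \<phi>(1) by (simp add: V0_2_def)
  ultimately show ?thesis
    using sat_L_A2[of \<phi> M "nI M" "sI M" e E I\<^sub>0 J\<^sub>0] modelsD[OF V0 _ \<phi>(2)] by simp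
qed

lemma bar_axioms:
  assumes "\<phi> \<in> axms V0_2_bar" "range E \<subseteq> \<S>"
  shows "holds e E \<phi>"
proof -
  have ES: "E i \<in> \<S>" for i using assms(2) by auto
  consider "\<phi> \<in> basic_open" | "\<phi> \<in> pd_axioms" | "\<phi> \<in> SE_axioms" | "\<phi> = ParityF_axiom"
    | (Min) z xs Xs \<chi> t where "\<phi> = MinFun_axiom z xs Xs \<chi> t" "AC02_n (MinFun z xs Xs \<chi> t)"
    | (Comp) z xs Xs \<chi> t where "\<phi> = CompFun_axiom z xs Xs \<chi> t" "AC02_s (CompFun z xs Xs \<chi> t)"
    using assms(1) by (auto simp: V0_2_bar_def L_FAC02_def)
  then show ?thesis
  proof cases
    case 1
    then show ?thesis using assms by (intro basic_open_holds)
  next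
    case 2
    have pd: "\<exists>y. if x = \<zero> then y = \<zero> else y \<oplus> \<one> = x" for x
      by (cases x rule: nat_cases) (auto simp: B1)
    have "if x = \<zero> then nI M Pd [x] [] = \<zero> else nI M Pd [x] [] \<oplus> \<one> = x" for x
      unfolding nI.simps list.sel by (rule someI_ex[OF pd])
    then show ?thesis using 2 by (auto simp: pd_axioms_def split: if_splits simp del: nI.simps)
  next
    case 3
    have "{i. i \<sqsubset> len (E 0) \<and> ((i \<in> E 0) \<noteq> (i \<in> E 1))} \<in> \<S>"
      by (rule comprehension) (intro DP_intros ES)
    note b = bmin_props[OF this]
    have "E 0 = E 1" if "len (E 0) = len (E 1)" "bmin M (\<lambda>i. (i \<in> E 0) \<noteq> (i \<in> E 1)) (len (E 0)) = len (E 0)"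
      using b(3) L1[OF ES[of 0]] L1[OF ES[of 1]] that by auto
    then show ?thesis using 3 b by (auto simp: SE_axioms_def Let_def lt_def[symmetric])
  next
    case 4
    then show ?thesis using parity_str(1-3)[OF ES[of 0], of "e 0"] parity_str(4)[OF ES[of 0], of "e 1" "e 0"]
      by (simp add: ParityF_axiom_def Let_def lt_def[symmetric])
  next
    case Min
    then show ?thesis using good_AC02 assms(2)
      by (auto elim!: AC02_n.cases intro!: MinFun_axiom_holds)
  next
    case Comp
    then show ?thesis using good_AC02 assms(2)
      by (auto elim!: AC02_s.cases intro!: CompFun_axiom_holds)
  qed
qed

subsection \<open>Powers of block diagonal matrices\<close>

lemma row_set: "row_set M i Y = {c. pr i c \<in> Y}"
  by (simp add: row_set_def)

lemma identity_set: "identity_set M n = {pr i i |i. i \<sqsubset> n}"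
  by (simp add: identity_set_def lt_def)

lemma prod_set: "prod_set M n X1 X2 = {pr i j |i j. i \<sqsubset> n \<and> j \<sqsubset> n \<and>
    n \<in> parity_str M n {b. b \<sqsubset> n \<and> pr i b \<in> X1 \<and> pr b j \<in> X2}}"
  by (simp add: prod_set_def lt_def conj_assoc)

lemma powseq_spec: "powseq_spec M n k X Y \<longleftrightarrow> Y \<in> \<S> \<and> len Y \<sqsubseteq> pr k (pr n n) \<and>
    (\<forall>p\<in>Y. \<exists>i c. p = pr i c) \<and> row_set M \<zero> Y = identity_set M n \<and>
    (\<forall>i. i \<sqsubset> k \<longrightarrow> row_set M (i \<oplus> \<one>) Y = prod_set M n X (row_set M i Y))"
  by (simp add: powseq_spec_def lt_def)

text \<open>Truncation keeps the specification, because its recursion mentions rows up to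
  \<open>k\<close> only and a subset does not get longer. The rows beyond \<open>k\<close> are
  removed by bounded comprehension.\<close>

lemma powseq_str:
  assumes "\<exists>Y. powseq_spec M n k X Y"
  shows "powseq_spec M n k X (powseq_str M n k X)" "pr m c \<in> powseq_str M n k X \<Longrightarrow> m \<sqsubseteq> k"
proof -
  define Y where "Y = (SOME Y. powseq_spec M n k X Y)"
  have Y: "powseq_spec M n k X Y" unfolding Y_def by (rule someI_ex[OF assms])
  then have YS: "Y \<in> \<S>" by (simp add: powseq_spec)
  define Z where "Z = {pr m c |m c. m \<sqsubseteq> k \<and> pr m c \<in> Y}"
  have "{p. p \<sqsubset> len Y \<and> (p \<in> Y \<and> (\<exists>m. m \<sqsubseteq> k \<and> (\<exists>c. c \<sqsubseteq> p \<and> p = pr m c)))} \<in> \<S>"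
    by (rule comprehension_LD) (intro LD_intros LN_pr YS)
  also have "{p. p \<sqsubset> len Y \<and> (p \<in> Y \<and> (\<exists>m. m \<sqsubseteq> k \<and> (\<exists>c. c \<sqsubseteq> p \<and> p = pr m c)))} = Z"
    unfolding Z_def using L1[OF YS] le_pr2 by blast
  finally have ZS: "Z \<in> \<S>" .
  have Zp: "powseq_str M n k X = Z"
    using ZS by (simp add: powseq_str_def clip_def Z_def Y_def)
  have rowZ: "row_set M m Z = row_set M m Y" if "m \<sqsubseteq> k" for m
    using that by (auto simp: row_set Z_def pr_inj)
  have "Z \<subseteq> Y" by (auto simp: Z_def)
  then have "len Z \<sqsubseteq> len Y" using len_le_iff[OF ZS] L1[OF YS] by blast
  then have "len Z \<sqsubseteq> pr k (pr n n)" using Y le_trans by (auto simp: powseq_spec)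
  moreover have "\<forall>p\<in>Z. \<exists>i c. p = pr i c" by (auto simp: Z_def)
  moreover have "row_set M (i \<oplus> \<one>) Z = prod_set M n X (row_set M i Z)" if "i \<sqsubset> k" for i
    using rowZ[of i] rowZ[of "i \<oplus> \<one>"] that Y num.less_imp_le by (simp add: powseq_spec Suc_le)
  moreover have "row_set M \<zero> Z = identity_set M n" using rowZ[OF B9] Y by (simp add: powseq_spec)
  ultimately show "powseq_spec M n k X (powseq_str M n k X)"
    unfolding Zp powseq_spec using ZS by blast
  show "pr m c \<in> powseq_str M n k X \<Longrightarrow> m \<sqsubseteq> k"
    unfolding Zp by (auto simp: Z_def pr_inj)
qed

text \<open>The last fact leaves no elements besides the matrix entries of the rows up to
  \<open>k\<close>. With the recursion this determines the string completely, so equal entries may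
  be copied from another power sequence.\<close>

lemma powseq_entries:
  assumes "\<exists>Y. powseq_spec M n k X Y"
  defines "Y \<equiv> powseq_str M n k X"
  shows "Y \<in> \<S>" "len Y \<sqsubseteq> pr k (pr n n)"
    and "pr \<zero> (pr i j) \<in> Y \<longleftrightarrow> i \<sqsubset> n \<and> i = j"
    and "m \<sqsubset> k \<Longrightarrow> pr (m \<oplus> \<one>) (pr i j) \<in> Y \<longleftrightarrow> i \<sqsubset> n \<and> j \<sqsubset> n \<and>
      n \<in> parity_str M n {b. b \<sqsubset> n \<and> pr i b \<in> X \<and> pr m (pr b j) \<in> Y}"
    and "p \<in> Y \<Longrightarrow> \<exists>m i j. m \<sqsubseteq> k \<and> i \<sqsubset> n \<and> j \<sqsubset> n \<and> p = pr m (pr i j)"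
proof -
  note P = powseq_str[OF assms(1), folded Y_def]
  note S = P(1)[unfolded powseq_spec]
  show "Y \<in> \<S>" "len Y \<sqsubseteq> pr k (pr n n)" using S by auto
  have zero: "pr \<zero> q \<in> Y \<longleftrightarrow> (\<exists>i. i \<sqsubset> n \<and> q = pr i i)" for q
  proof -
    have "row_set M \<zero> Y = identity_set M n" using S by blast
    then have "q \<in> row_set M \<zero> Y \<longleftrightarrow> q \<in> identity_set M n" by simp
    then show ?thesis by (auto simp: row_set identity_set)
  qed
  then show "pr \<zero> (pr i j) \<in> Y \<longleftrightarrow> i \<sqsubset> n \<and> i = j" by (auto simp: pr_inj)
  have step: "pr (m \<oplus> \<one>) q \<in> Y \<longleftrightarrow> (\<exists>i j. q = pr i j \<and> i \<sqsubset> n \<and> j \<sqsubset> n \<and>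
      n \<in> parity_str M n {b. b \<sqsubset> n \<and> pr i b \<in> X \<and> pr m (pr b j) \<in> Y})" if "m \<sqsubset> k" for m q
  proof -
    have "row_set M (m \<oplus> \<one>) Y = prod_set M n X (row_set M m Y)" using S that by blast
    then have "q \<in> row_set M (m \<oplus> \<one>) Y \<longleftrightarrow> q \<in> prod_set M n X (row_set M m Y)" by simp
    then show ?thesis by (simp add: row_set prod_set)
  qed
  show "pr (m \<oplus> \<one>) (pr i j) \<in> Y \<longleftrightarrow> i \<sqsubset> n \<and> j \<sqsubset> n \<and>
      n \<in> parity_str M n {b. b \<sqsubset> n \<and> pr i b \<in> X \<and> pr m (pr b j) \<in> Y}" if "m \<sqsubset> k"
    unfolding step[OF that] by (auto simp: pr_inj)
  show "\<exists>m i j. m \<sqsubseteq> k \<and> i \<sqsubset> n \<and> j \<sqsubset> n \<and> p = pr m (pr i j)" if pY: "p \<in> Y"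
  proof -
    obtain m q where p: "p = pr m q" using S pY by blast
    then have m: "m \<sqsubseteq> k" using P(2) pY by blast
    show ?thesis
    proof (cases m rule: nat_cases)
      case 1
      then show ?thesis using zero[of q] pY p m by blast
    next
      case (2 m')
      then have "m' \<sqsubset> k" using m by (simp add: Suc_le)
      then show ?thesis using step[of m' q] pY p m 2 by blast
    qed
  qed
qed

text \<open>The prefix parities of \<open>C\<close> vanish up to \<open>a\<close>, then repeat those
  of \<open>A\<close>, and stay constant after the copy. Each stretch is an induction. For a block
  diagonal matrix, \<open>C\<close> holds the products contributing to an entry, all inside one
  block.\<close>

lemma parity_shift:
  assumes A: "A \<in> \<S>" "\<And>l. l \<in> A \<Longrightarrow> l \<sqsubset> n" and C: "C \<in> \<S>" "C = {a \<oplus> l |l. l \<in> A}"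
    and le: "a \<oplus> n \<sqsubseteq> b"
  shows "b \<in> parity_str M b C \<longleftrightarrow> n \<in> parity_str M n A"
proof -
  let ?P = "parity_str M b C" and ?Q = "parity_str M n A"
  note PS = parity_str(1)[OF C(1), of b] and QS = parity_str(1)[OF A(1), of n]
  have before: "c \<sqsubseteq> a \<longrightarrow> c \<notin> ?P" for c
  proof (rule induct[of "\<lambda>c. c \<sqsubseteq> a \<longrightarrow> c \<notin> ?P"])
    show "DP (\<lambda>e. e 0 \<sqsubseteq> a \<longrightarrow> e 0 \<notin> ?P)" by (intro DP_intros PS)
    show "\<zero> \<sqsubseteq> a \<longrightarrow> \<zero> \<notin> ?P" using parity_str(3)[OF C(1)] by simp
    fix c assume IH: "c \<sqsubseteq> a \<longrightarrow> c \<notin> ?P"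
    show "c \<oplus> \<one> \<sqsubseteq> a \<longrightarrow> c \<oplus> \<one> \<notin> ?P"
    proof
      assume "c \<oplus> \<one> \<sqsubseteq> a"
      then have c: "c \<sqsubset> a" by (simp only: Suc_le)
      then have "c \<sqsubset> b" using num.less_le_trans[OF num.less_le_trans[OF c B8] le] by blast
      moreover have "c \<notin> C" using c num.less_le_trans[OF c B8] C(2) by (auto dest: num.less_imp_neq)
      ultimately show "c \<oplus> \<one> \<notin> ?P" using parity_str(4)[OF C(1)] IH num.less_imp_le[OF c] by blast
    qed
  qed
  have inside: "l \<sqsubseteq> n \<longrightarrow> (a \<oplus> l \<in> ?P \<longleftrightarrow> l \<in> ?Q)" for l
  proof (rule induct[of "\<lambda>l. l \<sqsubseteq> n \<longrightarrow> (a \<oplus> l \<in> ?P \<longleftrightarrow> l \<in> ?Q)"])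
    show "DP (\<lambda>e. e 0 \<sqsubseteq> n \<longrightarrow> (a \<oplus> e 0 \<in> ?P \<longleftrightarrow> e 0 \<in> ?Q))" by (intro DP_intros PS QS)
    show "\<zero> \<sqsubseteq> n \<longrightarrow> (a \<oplus> \<zero> \<in> ?P \<longleftrightarrow> \<zero> \<in> ?Q)"
      using before[of a] parity_str(3)[OF A(1)] by (simp add: B3)
    fix l assume IH: "l \<sqsubseteq> n \<longrightarrow> (a \<oplus> l \<in> ?P \<longleftrightarrow> l \<in> ?Q)"
    show "l \<oplus> \<one> \<sqsubseteq> n \<longrightarrow> (a \<oplus> (l \<oplus> \<one>) \<in> ?P \<longleftrightarrow> l \<oplus> \<one> \<in> ?Q)"
    proof
      assume "l \<oplus> \<one> \<sqsubseteq> n"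
      then have l: "l \<sqsubset> n" by (simp only: Suc_le)
      then have "a \<oplus> l \<sqsubset> b" using num.less_le_trans[OF num.add_strict_left_mono[OF l] le] by blast
      from parity_str(4)[OF C(1) this] parity_str(4)[OF A(1) l]
      have "a \<oplus> (l \<oplus> \<one>) \<in> ?P \<longleftrightarrow> (a \<oplus> l \<in> C) \<noteq> (a \<oplus> l \<in> ?P)" "l \<oplus> \<one> \<in> ?Q \<longleftrightarrow> (l \<in> A) \<noteq> (l \<in> ?Q)"
        by (simp_all only: add_assoc)
      moreover have "a \<oplus> l \<in> C \<longleftrightarrow> l \<in> A" unfolding C(2) by auto
      ultimately show "a \<oplus> (l \<oplus> \<one>) \<in> ?P \<longleftrightarrow> l \<oplus> \<one> \<in> ?Q" using IH num.less_imp_le[OF l] by blast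
    qed
  qed
  have after: "a \<oplus> n \<oplus> d \<sqsubseteq> b \<longrightarrow> (a \<oplus> n \<oplus> d \<in> ?P \<longleftrightarrow> a \<oplus> n \<in> ?P)" for d
  proof (rule induct[of "\<lambda>d. a \<oplus> n \<oplus> d \<sqsubseteq> b \<longrightarrow> (a \<oplus> n \<oplus> d \<in> ?P \<longleftrightarrow> a \<oplus> n \<in> ?P)"])
    show "DP (\<lambda>e. a \<oplus> n \<oplus> e 0 \<sqsubseteq> b \<longrightarrow> (a \<oplus> n \<oplus> e 0 \<in> ?P \<longleftrightarrow> a \<oplus> n \<in> ?P))"
      by (intro DP_intros PS)
    fix d assume IH: "a \<oplus> n \<oplus> d \<sqsubseteq> b \<longrightarrow> (a \<oplus> n \<oplus> d \<in> ?P \<longleftrightarrow> a \<oplus> n \<in> ?P)"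
    show "a \<oplus> n \<oplus> (d \<oplus> \<one>) \<sqsubseteq> b \<longrightarrow> (a \<oplus> n \<oplus> (d \<oplus> \<one>) \<in> ?P \<longleftrightarrow> a \<oplus> n \<in> ?P)"
    proof
      assume "a \<oplus> n \<oplus> (d \<oplus> \<one>) \<sqsubseteq> b"
      then have d: "a \<oplus> n \<oplus> d \<sqsubset> b" by (simp only: Suc_le add_assoc[of "a \<oplus> n", symmetric])
      have "a \<oplus> n \<oplus> d \<notin> C"
      proof
        assume "a \<oplus> n \<oplus> d \<in> C"
        then obtain l where "a \<oplus> n \<oplus> d = a \<oplus> l" "l \<in> A" unfolding C(2) by blast
        then show False using num.less_le_trans[OF num.add_strict_left_mono[OF A(2)] B8, of l a d]
          by (auto dest: num.less_imp_neq)
      qed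
      then show "a \<oplus> n \<oplus> (d \<oplus> \<one>) \<in> ?P \<longleftrightarrow> a \<oplus> n \<in> ?P"
        using parity_str(4)[OF C(1) d] IH num.less_imp_le[OF d] by (simp only: add_assoc) blast
    qed
  qed (simp add: B3)
  obtain d where "b = a \<oplus> n \<oplus> d" using le by (auto simp: le_iff_add)
  then show ?thesis using after[of d] inside[of n] by simp
qed

text \<open>The matrices \<open>X z\<close> for \<open>z \<le> b\<close>, padded to a common size, are the blocks of a block
  diagonal matrix, whose powers contain the powers of all of them.\<close>

lemma NS_powseq:
  assumes ex: "\<And>n k X. X \<in> \<S> \<Longrightarrow> \<exists>Y. powseq_spec M n k X Y"
    and n: "NN n" and k: "NN k" and X: "NS X"
  shows "NS (\<lambda>z. powseq_str M (n z) (k z) (X z))"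
proof (rule NS_I)
  have XS: "X z \<in> \<S>" for z by (rule NS_strs[OF X])
  note Y = powseq_entries[OF ex[OF XS]]
  show "powseq_str M (n z) (k z) (X z) \<in> \<S>" for z by (rule Y(1))
  show "\<exists>m. \<forall>z. z \<sqsubseteq> b \<longrightarrow> len (powseq_str M (n z) (k z) (X z)) \<sqsubseteq> m" for b
  proof -
    obtain N where N: "\<forall>z. z \<sqsubseteq> b \<longrightarrow> n z \<sqsubseteq> N" using NN_bound[OF n] by blast
    obtain K where K: "\<forall>z. z \<sqsubseteq> b \<longrightarrow> k z \<sqsubseteq> K" using NN_bound[OF k] by blast
    show ?thesis
    proof (intro exI allI impI)
      fix z assume "z \<sqsubseteq> b"
      then show "len (powseq_str M (n z) (k z) (X z)) \<sqsubseteq> pr K (pr N N)"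
        using N K by (intro le_trans[OF Y(2)] pr_mono) auto
    qed
  qed
  show "LD (\<lambda>e. e 0 \<in> powseq_str M (n (e 1)) (k (e 1)) (X (e 1)))"
  proof (rule LD_local)
    fix b
    obtain N' where N': "\<forall>z. z \<sqsubseteq> b \<longrightarrow> n z \<sqsubseteq> N'" using NN_bound[OF n] by blast
    obtain K where K: "\<forall>z. z \<sqsubseteq> b \<longrightarrow> k z \<sqsubseteq> K" using NN_bound[OF k] by blast
    \<comment> \<open>The common block size exceeds all dimensions \<open>n z\<close>, so entries of
      different blocks get different indices; \<open>B\<close> is the dimension of the whole
      matrix.\<close>
    define N where "N = N' \<oplus> \<one>"
    define B where "B = (b \<oplus> \<one>) \<otimes> N"
    have nN: "i \<sqsubset> N" if "z \<sqsubseteq> b" "i \<sqsubset> n z" for z i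
      unfolding N_def lt_Suc using num.less_imp_le[OF num.less_le_trans[OF that(2)]] N' that(1) by blast
    have bnd: "z \<otimes> N \<oplus> i \<sqsubset> B" if "z \<sqsubseteq> b" "i \<sqsubset> n z" for z i
      using block_less[of z "b \<oplus> \<one>" i N \<zero>] nN[OF that] that(1) by (simp add: B_def lt_Suc B3)
    define X' where "X' = {p. p \<sqsubset> pr B B \<oplus> \<one> \<and> (\<exists>z. z \<sqsubseteq> b \<and> (\<exists>i. i \<sqsubset> n z \<and> (\<exists>j. j \<sqsubset> n z \<and>
      p = pr (z \<otimes> N \<oplus> i) (z \<otimes> N \<oplus> j) \<and> pr i j \<in> X z)))}"
    have X'S: "X' \<in> \<S>" unfolding X'_def
      by (rule comprehension_LD) (intro LD_intros LN_pr LN_comp[OF n] LD_memS[OF X])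
    define Y' where "Y' = powseq_str M B K X'"
    note Y' = powseq_entries[where n = B and k = K, OF ex[OF X'S], folded Y'_def]
    \<comment> \<open>A row of the large matrix that starts in block \<open>z\<close> has nonzero
      entries in that block only. The product multiplies by \<open>X'\<close> from the left, so this
      settles which summands survive.\<close>
    have memX': "pr (z \<otimes> N \<oplus> i) t \<in> X' \<longleftrightarrow> (\<exists>j. j \<sqsubset> n z \<and> t = z \<otimes> N \<oplus> j \<and> pr i j \<in> X z)"
      if z: "z \<sqsubseteq> b" and i: "i \<sqsubset> n z" for z i t
    proof
      assume "pr (z \<otimes> N \<oplus> i) t \<in> X'"
      then obtain z' i' j where *: "z' \<sqsubseteq> b" "i' \<sqsubset> n z'" "j \<sqsubset> n z'"
        "pr (z \<otimes> N \<oplus> i) t = pr (z' \<otimes> N \<oplus> i') (z' \<otimes> N \<oplus> j)" "pr i' j \<in> X z'"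
        unfolding X'_def by blast
      then have "z \<otimes> N \<oplus> i = z' \<otimes> N \<oplus> i'" "t = z' \<otimes> N \<oplus> j" by (auto simp: pr_inj)
      then have "z = z' \<and> i = i'" using block_inj[OF nN[OF z i] nN[OF *(1,2)]] by blast
      then show "\<exists>j. j \<sqsubset> n z \<and> t = z \<otimes> N \<oplus> j \<and> pr i j \<in> X z" using * \<open>t = z' \<otimes> N \<oplus> j\<close> by blast
    next
      assume "\<exists>j. j \<sqsubset> n z \<and> t = z \<otimes> N \<oplus> j \<and> pr i j \<in> X z"
      then obtain j where j: "j \<sqsubset> n z" "t = z \<otimes> N \<oplus> j" "pr i j \<in> X z" by blast
      have "pr (z \<otimes> N \<oplus> i) t \<sqsubset> pr B B \<oplus> \<one>"
        unfolding lt_Suc j(2) using bnd[OF z i] bnd[OF z j(1)] by (intro pr_mono num.less_imp_le)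
      then show "pr (z \<otimes> N \<oplus> i) t \<in> X'" unfolding X'_def using z i j by blast
    qed
    have main: "m \<sqsubseteq> k z \<longrightarrow> (\<forall>i. i \<sqsubset> n z \<longrightarrow> (\<forall>j. j \<sqsubset> n z \<longrightarrow>
        (pr m (pr (z \<otimes> N \<oplus> i) (z \<otimes> N \<oplus> j)) \<in> Y' \<longleftrightarrow>
          pr m (pr i j) \<in> powseq_str M (n z) (k z) (X z))))" if z: "z \<sqsubseteq> b" for z m
    proof (rule induct_LD[of "\<lambda>m. m \<sqsubseteq> k z \<longrightarrow> (\<forall>i. i \<sqsubset> n z \<longrightarrow> (\<forall>j. j \<sqsubset> n z \<longrightarrow>
        (pr m (pr (z \<otimes> N \<oplus> i) (z \<otimes> N \<oplus> j)) \<in> Y' \<longleftrightarrow>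
          pr m (pr i j) \<in> powseq_str M (n z) (k z) (X z))))"])
      show "LD (\<lambda>e. e 0 \<sqsubseteq> k z \<longrightarrow> (\<forall>i. i \<sqsubset> n z \<longrightarrow> (\<forall>j. j \<sqsubset> n z \<longrightarrow>
        (pr (e 0) (pr (z \<otimes> N \<oplus> i) (z \<otimes> N \<oplus> j)) \<in> Y' \<longleftrightarrow>
          pr (e 0) (pr i j) \<in> powseq_str M (n z) (k z) (X z)))))"
        by (intro LD_intros LN_pr Y'(1) Y(1))
      show "\<zero> \<sqsubseteq> k z \<longrightarrow> (\<forall>i. i \<sqsubset> n z \<longrightarrow> (\<forall>j. j \<sqsubset> n z \<longrightarrow>
        (pr \<zero> (pr (z \<otimes> N \<oplus> i) (z \<otimes> N \<oplus> j)) \<in> Y' \<longleftrightarrow>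
          pr \<zero> (pr i j) \<in> powseq_str M (n z) (k z) (X z))))"
        unfolding Y(3) Y'(3) using bnd[OF z] by auto
      fix m assume IH: "m \<sqsubseteq> k z \<longrightarrow> (\<forall>i. i \<sqsubset> n z \<longrightarrow> (\<forall>j. j \<sqsubset> n z \<longrightarrow>
        (pr m (pr (z \<otimes> N \<oplus> i) (z \<otimes> N \<oplus> j)) \<in> Y' \<longleftrightarrow>
          pr m (pr i j) \<in> powseq_str M (n z) (k z) (X z))))"
      show "m \<oplus> \<one> \<sqsubseteq> k z \<longrightarrow> (\<forall>i. i \<sqsubset> n z \<longrightarrow> (\<forall>j. j \<sqsubset> n z \<longrightarrow>
        (pr (m \<oplus> \<one>) (pr (z \<otimes> N \<oplus> i) (z \<otimes> N \<oplus> j)) \<in> Y' \<longleftrightarrow>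
          pr (m \<oplus> \<one>) (pr i j) \<in> powseq_str M (n z) (k z) (X z))))"
      proof (intro impI allI)
        fix i j assume "m \<oplus> \<one> \<sqsubseteq> k z" and i: "i \<sqsubset> n z" and j: "j \<sqsubset> n z"
        then have m: "m \<sqsubset> k z" by (simp only: Suc_le)
        have mK: "m \<sqsubset> K" using num.less_le_trans[OF m] K z by blast
        define C where "C = {t. t \<sqsubset> B \<and> pr (z \<otimes> N \<oplus> i) t \<in> X' \<and> pr m (pr t (z \<otimes> N \<oplus> j)) \<in> Y'}"
        define A where "A = {l. l \<sqsubset> n z \<and> pr i l \<in> X z \<and>
          pr m (pr l j) \<in> powseq_str M (n z) (k z) (X z)}"
        have "B \<in> parity_str M B C \<longleftrightarrow> n z \<in> parity_str M (n z) A"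
        proof (rule parity_shift)
          show "C \<in> \<S>" unfolding C_def
            by (rule comprehension_LD) (intro LD_intros LN_pr X'S Y'(1))
          show "A \<in> \<S>" unfolding A_def
            by (rule comprehension_LD) (intro LD_intros LN_pr XS Y(1))
          show "l \<sqsubset> n z" if "l \<in> A" for l using that by (simp add: A_def)
          have IH': "pr m (pr (z \<otimes> N \<oplus> l) (z \<otimes> N \<oplus> j)) \<in> Y' \<longleftrightarrow>
              pr m (pr l j) \<in> powseq_str M (n z) (k z) (X z)" if "l \<sqsubset> n z" for l
            using IH num.less_imp_le[OF m] that j by blast
          show "C = {z \<otimes> N \<oplus> l |l. l \<in> A}"
          proof (intro set_eqI iffI)
            fix t assume "t \<in> C"
            then obtain l where "l \<sqsubset> n z" "t = z \<otimes> N \<oplus> l" "pr i l \<in> X z"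
              "pr m (pr t (z \<otimes> N \<oplus> j)) \<in> Y'" unfolding C_def memX'[OF z i] by blast
            then show "t \<in> {z \<otimes> N \<oplus> l |l. l \<in> A}" unfolding A_def using IH' by blast
          next
            fix t assume "t \<in> {z \<otimes> N \<oplus> l |l. l \<in> A}"
            then obtain l where l: "t = z \<otimes> N \<oplus> l" "l \<sqsubset> n z" "pr i l \<in> X z"
              "pr m (pr l j) \<in> powseq_str M (n z) (k z) (X z)" unfolding A_def by blast
            then show "t \<in> C" unfolding C_def memX'[OF z i] using IH' bnd[OF z] by blast
          qed
          \<comment> \<open>The block ends within the large matrix, as \<open>parity_shift\<close>
            requires.\<close>
          have "n z \<sqsubseteq> N" unfolding N_def using le_trans[OF _ B8] N' z by blast
          then have "z \<otimes> N \<oplus> n z \<sqsubseteq> z \<otimes> N \<oplus> N" by (rule num.add_left_mono)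
          also have "\<dots> = (z \<oplus> \<one>) \<otimes> N" by (simp add: mul_one_left)
          also have "\<dots> \<sqsubseteq> B" unfolding B_def
            using z by (intro num.mult_mono num.add_right_mono num.order_refl B9)
          finally show "z \<otimes> N \<oplus> n z \<sqsubseteq> B" .
        qed
        then show "pr (m \<oplus> \<one>) (pr (z \<otimes> N \<oplus> i) (z \<otimes> N \<oplus> j)) \<in> Y' \<longleftrightarrow>
          pr (m \<oplus> \<one>) (pr i j) \<in> powseq_str M (n z) (k z) (X z)"
          unfolding Y(4)[OF m] Y'(4)[OF mK] C_def A_def using bnd[OF z] i j by blast
      qed
    qed
    \<comment> \<open>Membership is read off from the single string \<open>Y'\<close>. The bounds
      \<open>k z\<close> and \<open>n z\<close> cut out the rows and entries belonging to
      \<open>z\<close>, since \<open>Y'\<close> continues up to the common exponent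
      \<open>K\<close>.\<close>
    let ?Q = "\<lambda>c z. \<exists>m. m \<sqsubseteq> k z \<and> (\<exists>i. i \<sqsubset> n z \<and> (\<exists>j. j \<sqsubset> n z \<and>
      c = pr m (pr i j) \<and> pr m (pr (z \<otimes> N \<oplus> i) (z \<otimes> N \<oplus> j)) \<in> Y'))"
    have "c \<in> powseq_str M (n z) (k z) (X z) \<longleftrightarrow> ?Q c z" if "z \<sqsubseteq> b" for c z
    proof
      assume "c \<in> powseq_str M (n z) (k z) (X z)"
      from Y(5)[OF this] this show "?Q c z" using main[OF that] by blast
    qed (use main[OF that] in blast)
    then have "\<forall>e :: nat \<Rightarrow> 'n. (\<forall>i. e i \<sqsubseteq> b) \<longrightarrow>
      (e 0 \<in> powseq_str M (n (e 1)) (k (e 1)) (X (e 1))) = ?Q (e 0) (e 1)" by simp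
    moreover have "LD (\<lambda>e. ?Q (e 0) (e 1))"
      by (intro LD_intros LN_pr LN_comp[OF n] LN_comp[OF k] Y'(1))
    ultimately show "\<exists>Q. LD Q \<and> (\<forall>e :: nat \<Rightarrow> 'n. (\<forall>i. e i \<sqsubseteq> b) \<longrightarrow>
      (e 0 \<in> powseq_str M (n (e 1)) (k (e 1)) (X (e 1))) = Q e)"
      by (intro exI[of _ "\<lambda>e. ?Q (e 0) (e 1)"]) simp
  qed
qed

lemma good_FparityL:
  assumes "\<And>n k X. X \<in> \<S> \<Longrightarrow> \<exists>Y. powseq_spec M n k X Y"
  shows "FparityL_s g \<Longrightarrow> goodS g"
proof (induction rule: FparityL_s.induct)
  case 2
  show ?case unfolding goodS_def
  proof (intro allI impI)
    fix us :: "('n \<Rightarrow> 'n) list" and Us :: "('n \<Rightarrow> 'n set) list"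
    assume len: "(length us, length Us) = arity_s PowSeqF"
      and us: "\<forall>u\<in>set us. NN u" "\<forall>U\<in>set Us. NS U"
    obtain n k X where "us = [n, k]" "Us = [X]"
      using len by (auto simp: numeral_2_eq_2 length_Suc_conv)
    then show "NS (\<lambda>z. sI M PowSeqF (map (\<lambda>u. u z) us) (map (\<lambda>U. U z) Us))"
      using us NS_powseq[OF assms] by simp
  qed
next
  case (3 z xs Xs \<phi> t)
  then show ?case
    using good_AC02 by (intro good_MinFun) (auto simp: defining_data_def wf_no_syms L_FAC02_def)
qed (auto simp: L_FAC02_def good_AC02)

end

subsection \<open>The expansion of a model\<close>

lemma eval_pair [simp]: "eval_nt M I J e E (pair s t) = m_pair M (eval_nt M I J e E s) (eval_nt M I J e E t)"
  by (simp add: pair_def m_pair_def Let_def)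

lemma map_lookup: "distinct xs \<Longrightarrow> length xs = length as \<Longrightarrow> map (lookup d xs as) xs = as"
  by (auto intro!: nth_equalityI simp: lookup_def map_of_zip_nth)

lemmas open_defs = defining_data_def pair_def Conj_def Neg_def Lt_def

text \<open>This and the next five lemmas check that the auxiliary symbols of the power sequence
  obey the side conditions of the language, which gives access to their values and axioms.\<close>

lemma AC02_second: "AC02_n (MinFun 0 [1, 2] [] (x\<^sub>2 \<^bold>=\<^sub>1 pair x\<^sub>1 x\<^sub>0) (x\<^sub>2 \<^bold>+ One))"
  by (rule AC02_n_AC02_s.intros) (auto simp: open_defs)

lemma AC02_left: "AC02_n (MinFun 0 [1] [] (x\<^sub>1 \<^bold>=\<^sub>1 pair x\<^sub>0 (second x\<^sub>0 x\<^sub>1)) (x\<^sub>1 \<^bold>+ One))"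
  by (rule AC02_n_AC02_s.intros) (use AC02_second in \<open>auto simp: open_defs second_def\<close>)

lemma AC02_row: "AC02_s (CompFun 0 [1] [0] (pair x\<^sub>1 x\<^sub>0 \<^bold>\<in> X\<^sub>0) (Len X\<^sub>0))"
  by (rule AC02_n_AC02_s.intros) (auto simp: open_defs)

lemma AC02_identity: "AC02_s (CompFun 0 [1] []
    (is_pair x\<^sub>0 \<^bold>\<and> left x\<^sub>0 \<^bold>< x\<^sub>1 \<^bold>\<and> left x\<^sub>0 \<^bold>=\<^sub>1 right x\<^sub>0) (pair x\<^sub>1 x\<^sub>1))"
  by (rule AC02_n_AC02_s.intros)
    (use AC02_second AC02_left in \<open>auto simp: open_defs is_pair_def left_def right_def second_def\<close>)

lemma AC02_entry_products: "AC02_s (CompFun 0 [1, 2, 3] [0, 1]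
    (pair x\<^sub>2 x\<^sub>0 \<^bold>\<in> X\<^sub>0 \<^bold>\<and> pair x\<^sub>0 x\<^sub>3 \<^bold>\<in> X\<^sub>1) x\<^sub>1)"
  by (rule AC02_n_AC02_s.intros) (auto simp: open_defs)

lemma AC02_Prod2: "AC02_s (CompFun 0 [1] [0, 1]
    (is_pair x\<^sub>0 \<^bold>\<and> left x\<^sub>0 \<^bold>< x\<^sub>1 \<^bold>\<and> right x\<^sub>0 \<^bold>< x\<^sub>1 \<^bold>\<and>
     x\<^sub>1 \<^bold>\<in> SFun ParityF [x\<^sub>1] [entry_products x\<^sub>1 (left x\<^sub>0) (right x\<^sub>0) X\<^sub>0 X\<^sub>1])
    (pair x\<^sub>1 x\<^sub>1))"
  by (rule AC02_n_AC02_s.intros)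
    (use AC02_second AC02_left AC02_entry_products AC02_n_AC02_s.intros(3) in
      \<open>auto simp: open_defs is_pair_def left_def right_def second_def entry_products_def\<close>)

context v0
begin

text \<open>The variant of \<open>CompFun_value\<close> for lists of argument values, as they come
  from evaluating an application; \<open>map_lookup\<close> recovers the lists from the
  environment.\<close>

lemma CompFun_apply:
  assumes AC: "AC02_s (CompFun z xs Xs \<phi> t)"
    and "length as = length xs" "length As = length Xs" "set As \<subseteq> \<S>"
  shows "sI M (CompFun z xs Xs \<phi> t) as As = {v. v \<sqsubset> ev (lookup \<zero> xs as) (lookup {} Xs As) t \<and>
    holds ((lookup \<zero> xs as)(z := v)) (lookup {} Xs As) \<phi>}"
proof -
  have D: "defining_data z xs Xs \<phi> t" "\<forall>f\<in>nsyms \<phi>. goodN f" "\<forall>g\<in>ssyms \<phi>. goodS g"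
    using AC good_AC02 by (auto elim: AC02_s.cases)
  have "lookup {} Xs As i \<in> \<S>" for i
    using assms(4) by (auto simp: lookup_def empty_strs split: option.split dest!: map_of_SomeD set_zip_rightD)
  then have "range (lookup {} Xs As) \<subseteq> \<S>" by auto
  from CompFun_value[OF D this, of "lookup \<zero> xs as"] show ?thesis
    using map_lookup[of xs as \<zero>] map_lookup[of Xs As "{}"] assms(2,3) D(1)
    by (simp add: defining_data_def del: sI.simps)
qed

text \<open>The values of the symbols \<open>second\<close> and \<open>left\<close>. They agree with
  the projections on pair numbers, but a failed search returns \<open>p \<oplus> \<one>\<close> and
  not zero.\<close>

definition sec where "sec a p = bmin M (\<lambda>v. p = pr a v) (p \<oplus> \<one>)"
definition lf where "lf p = bmin M (\<lambda>v. p = pr v (sec v p)) (p \<oplus> \<one>)"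

lemma sec_pr: "sec x (pr x y) = y"
proof -
  have "{v. v \<sqsubset> pr x y \<oplus> \<one> \<and> pr x y = pr x v} \<in> \<S>"
    by (rule comprehension_LD) (intro LD_intros LN_pr)
  from bmin_iff[OF this, of y] show ?thesis
    unfolding sec_def using le_pr2[of y x] by (auto simp: pr_inj lt_Suc)
qed

lemma lf_pr: "lf (pr x y) = x"
proof -
  have "pr x y = pr v (sec v (pr x y)) \<longleftrightarrow> v = x" for v
    using sec_pr[of x y] by (auto simp: pr_inj)
  then have "lf (pr x y) = bmin M (\<lambda>v. v = x) (pr x y \<oplus> \<one>)" by (simp add: lf_def)
  moreover have "{v. v \<sqsubset> pr x y \<oplus> \<one> \<and> v = x} \<in> \<S>"
    by (rule comprehension) (intro DP_intros)
  from bmin_iff[OF this, of x] have "x = bmin M (\<lambda>v. v = x) (pr x y \<oplus> \<one>)"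
    using le_pr1[of x y] by (auto simp: lt_Suc)
  ultimately show ?thesis by simp
qed

lemma ev_second: "ev e E (second s u) = sec (ev e E s) (ev e E u)"
  by (simp add: second_def sec_def eval_map sat_map lookup_def)

lemma ev_left: "ev e E (left u) = lf (ev e E u)"
  by (simp add: left_def lf_def eval_map sat_map lookup_def ev_second)

lemma ev_right: "ev e E (right u) = sec (lf (ev e E u)) (ev e E u)"
  by (simp add: right_def ev_second ev_left)

lemma holds_is_pair: "holds e E (is_pair u) \<longleftrightarrow> (\<exists>x y. ev e E u = pr x y)"
  by (auto simp: is_pair_def ev_left ev_right lf_pr sec_pr)

text \<open>The bound in the symbol \<open>row\<close> loses no element: an element \<open>c\<close>
  of row \<open>i\<close> satisfies \<open>c \<sqsubseteq> pr i c\<close>, and the latter is below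
  the length.\<close>

lemma evS_row:
  assumes "evS e E Y \<in> \<S>"
  shows "evS e E (row i Y) = row_set M (ev e E i) (evS e E Y)"
  using CompFun_apply[OF AC02_row, of "[ev e E i]" "[evS e E Y]"] assms
    num.le_less_trans[OF le_pr2 L1[OF assms]]
  by (auto simp: row_def row_set lookup_def simp del: sI.simps)

text \<open>Justifies the bound \<open>pair n n\<close> in the symbols for the identity matrix and
  the product.\<close>

lemma pr_strict: "i \<sqsubset> n \<Longrightarrow> j \<sqsubset> n \<Longrightarrow> pr i j \<sqsubset> pr n n"
  using pr_mono[of i n j n] by (auto simp: lt_def pr_inj)

lemma evS_identity: "evS e E (identity n) = identity_set M (ev e E n)"
  using CompFun_apply[OF AC02_identity, of "[ev e E n]" "[]"]
  by (auto simp: identity_def identity_set lookup_def holds_is_pair ev_left ev_right lf_pr sec_pr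
      lt_def[symmetric] pr_strict simp del: sI.simps)

lemma evS_entry_products:
  assumes "evS e E X1 \<in> \<S>" "evS e E X2 \<in> \<S>"
  shows "evS e E (entry_products n i j X1 X2) = {b. b \<sqsubset> ev e E n \<and>
    pr (ev e E i) b \<in> evS e E X1 \<and> pr b (ev e E j) \<in> evS e E X2}"
  using CompFun_apply[OF AC02_entry_products, of "[ev e E n, ev e E i, ev e E j]" "[evS e E X1, evS e E X2]"] assms
  by (simp add: entry_products_def lookup_def del: sI.simps)

lemma sI_ParityF: "sI M ParityF [a] [A] = parity_str M a A"
  by simp

lemma evS_Prod2:
  assumes "evS e E X1 \<in> \<S>" "evS e E X2 \<in> \<S>"
  shows "evS e E (Prod2 n X1 X2) = prod_set M (ev e E n) (evS e E X1) (evS e E X2)"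
proof -
  let ?n = "ev e E n" and ?A = "evS e E X1" and ?B = "evS e E X2"
  define e' where "e' v = (lookup \<zero> [Suc 0] [?n])(0 := v)" for v
  define E' where "E' = lookup {} [0, Suc 0] [?A, ?B]"
  have [simp]: "e' v 0 = v" "e' v (Suc 0) = ?n" "E' 0 = ?A" "E' (Suc 0) = ?B" for v
    by (simp_all add: e'_def E'_def lookup_def)
  have ep: "evS (e' v) E' (entry_products x\<^sub>1 (left x\<^sub>0) (right x\<^sub>0) X\<^sub>0 X\<^sub>1) =
      {b. b \<sqsubset> ?n \<and> pr (lf v) b \<in> ?A \<and> pr b (sec (lf v) v) \<in> ?B}" for v
    using assms by (subst evS_entry_products) (simp_all add: ev_left ev_right)
  have "evS e E (Prod2 n X1 X2) = {v. v \<sqsubset> pr ?n ?n \<and> (\<exists>x y. v = pr x y) \<and> lf v \<sqsubset> ?n \<and>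
      sec (lf v) v \<sqsubset> ?n \<and>
      ?n \<in> parity_str M ?n {b. b \<sqsubset> ?n \<and> pr (lf v) b \<in> ?A \<and> pr b (sec (lf v) v) \<in> ?B}}"
    using CompFun_apply[OF AC02_Prod2, of "[?n]" "[?A, ?B]"] assms
    by (simp add: Prod2_def e'_def[symmetric] E'_def[symmetric] ep[unfolded One_nat_def] holds_is_pair ev_left ev_right
        sI_ParityF lt_def[symmetric] del: sI.simps) (simp add: lookup_def del: sI.simps)
  then show ?thesis unfolding prod_set
    by (auto simp: lf_pr sec_pr pr_strict)
qed

lemma holds_powseq_graph:
  assumes "range E \<subseteq> \<S>"
  shows "holds e E (powseq_graph Corrected x\<^sub>0 x\<^sub>1 X\<^sub>1 X\<^sub>0) \<longleftrightarrow> powseq_spec M (e 0) (e 1) (E 1) (E 0)"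
proof -
  have ES: "E i \<in> \<S>" for i using assms by auto
  \<comment> \<open>A row is a value of the symbol \<open>row\<close>, hence a string;
    \<open>evS_Prod2\<close> needs this for the powers.\<close>
  have rows: "row_set M i (E 0) \<in> \<S>" for i
    using sI_strs[of "CompFun 0 [1] [0] (pair x\<^sub>1 x\<^sub>0 \<^bold>\<in> X\<^sub>0) (Len X\<^sub>0)" "[i]" "[E 0]"]
      evS_row[of "\<lambda>_. i" E X\<^sub>0 x\<^sub>0] ES by (simp add: row_def del: sI.simps)
  have "(\<forall>b. b \<sqsubset> len (E 0) \<longrightarrow> b \<in> E 0 \<longrightarrow> (\<exists>x y. b = pr x y)) \<longleftrightarrow> (\<forall>p\<in>E 0. \<exists>i c. p = pr i c)"
    using L1[OF ES] by blast
  then show ?thesis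
    by (simp add: powseq_graph_def powseq_spec holds_is_pair evS_row evS_identity evS_Prod2 ES rows
        lt_def[symmetric])
qed

lemma expansion:
  assumes ax: "VparityL_axiom v \<psi>" and \<psi>: "\<And>e E. range E \<subseteq> \<S> \<Longrightarrow> sat\<^sub>0 e E \<psi>"
    and \<phi>: "\<phi> \<in> axms (VparityL_bar v)" and E: "range E \<subseteq> \<S>"
  shows "holds e E \<phi>"
proof -
  have "derives L_FAC02 (axms V0_2_bar) (\<psi> \<^bold>\<longleftrightarrow> powseq_exists v)" "\<psi> \<in> formulas L_A2"
    using ax by (auto simp: VparityL_axiom_def theorems_def V0_2_bar_def)
  moreover have "models M (nI M) (sI M) (axms V0_2_bar \<inter> formulas L_FAC02)"
    using bar_axioms by (simp add: models_def)
  ultimately have "holds e E (\<psi> \<^bold>\<longleftrightarrow> powseq_exists v)" if "range E \<subseteq> \<S>" for e E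
    using soundness[of L_FAC02 "axms V0_2_bar" "\<psi> \<^bold>\<longleftrightarrow> powseq_exists v" M "nI M" "sI M" E e] sI_strs that
    by blast
  \<comment> \<open>The expansion already satisfies the theory of AC0(2), so the provable
    equivalence holds in it. As \<open>\<psi>\<close> has no function symbols, its truth passes from
    the given model to the expansion.\<close>
  then have pe: "\<exists>Y\<in>\<S>. holds e (case_nat Y E) (powseq_graph v x\<^sub>0 x\<^sub>1 X\<^sub>1 X\<^sub>0)" if "range E \<subseteq> \<S>" for e E
    using \<psi>[OF that, of e] that sat_L_A2[OF \<open>\<psi> \<in> formulas L_A2\<close>, of M "nI M" "sI M" e E I\<^sub>0 J\<^sub>0]
    by (simp add: powseq_exists_def)
  show ?thesis
  proof (cases v)
    case Literal
    obtain Y where "holds (\<lambda>_. \<zero>) (case_nat Y E) (powseq_graph Literal x\<^sub>0 x\<^sub>1 X\<^sub>1 X\<^sub>0)"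
      using pe[OF E, of "\<lambda>_. \<zero>"] Literal by blast
    then have "len Y \<sqsubset> pr \<zero> (pr \<zero> \<zero>)" by (simp add: powseq_graph_def lt_def)
    then show ?thesis using B7[OF _ B9, of "len Y"] by (simp add: pr_eq B3 B5 zero_mul lt_def)
  next
    case Corrected
    have ex: "\<exists>Y. powseq_spec M n k X Y" if "X \<in> \<S>" for n k X
    proof -
      have r: "range (\<lambda>_. X) \<subseteq> \<S>" using that by auto
      obtain Y where Y: "Y \<in> \<S>" "holds (case_nat n (\<lambda>_. k)) (case_nat Y (\<lambda>_. X))
          (powseq_graph Corrected x\<^sub>0 x\<^sub>1 X\<^sub>1 X\<^sub>0)"
        using pe[OF r, of "case_nat n (\<lambda>_. k)"] Corrected by blast
      then show ?thesis using holds_powseq_graph[OF range_case_nat[OF r Y(1)]] by auto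
    qed
    consider "\<phi> \<in> axms V0_2_bar" | "\<phi> = PowSeqF_axiom v"
      | (Comp) z xs Xs \<chi> t where "\<phi> = CompFun_axiom z xs Xs \<chi> t" "FparityL_s (CompFun z xs Xs \<chi> t)"
      using \<phi> by (auto simp: VparityL_bar_def L_FparityL_def)
    then show ?thesis
    proof cases
      case 1
      then show ?thesis using E by (rule bar_axioms)
    next
      case 2
      have ES: "E i \<in> \<S>" for i using E by auto
      let ?Y = "powseq_str M (e 0) (e 1) (E 0)"
      have spec: "powseq_spec M (e 0) (e 1) (E 0) ?Y" by (rule powseq_str(1)[OF ex[OF ES]])
      have strs: "evS e E T \<in> \<S>" for T by (rule eval_st_strs[OF E sI_strs])
      have "row_set M (e 3) (powseq_str M (e 0) (e (Suc 0)) (E 0)) \<in> \<S>"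
        using evS_row[of e E "SFun PowSeqF [x\<^sub>0, x\<^sub>1] [X\<^sub>0]" x\<^sub>3, OF strs]
          strs[of "row x\<^sub>3 (SFun PowSeqF [x\<^sub>0, x\<^sub>1] [X\<^sub>0])"] by simp
      note strs = this strs
      show ?thesis using spec
        unfolding 2 Corrected PowSeqF_axiom_def Let_def
        by (auto simp: powseq_spec holds_is_pair evS_row evS_identity evS_Prod2 strs ES lt_def[symmetric])
    next
      case Comp
      have "goodS g" if "FparityL_s g" for g by (rule good_FparityL[OF ex that])
      then show ?thesis unfolding Comp(1) using Comp(2) E good_AC02
        by (intro CompFun_axiom_holds)
          (auto simp: L_FAC02_def elim!: FparityL_s.cases AC02_s.cases)
    qed
  qed
qed

end

section \<open>Models of the universal theories\<close>

lemma formulas_mono: "fst L \<subseteq> fst L' \<Longrightarrow> snd L \<subseteq> snd L' \<Longrightarrow> \<phi> \<in> formulas L \<Longrightarrow> \<phi> \<in> formulas L'"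
  by (auto simp: formulas_def)

lemma nterms_mono: "fst L \<subseteq> fst L' \<Longrightarrow> snd L \<subseteq> snd L' \<Longrightarrow> t \<in> nterms L \<Longrightarrow> t \<in> nterms L'"
  by (auto simp: nterms_def)

lemma L_A2_subset: "\<phi> \<in> formulas L_A2 \<Longrightarrow> \<phi> \<in> formulas L" "t \<in> nterms L_A2 \<Longrightarrow> t \<in> nterms L"
  by (auto intro: formulas_mono[of L_A2] nterms_mono[of L_A2] simp: L_A2_def)

lemma V0_2_formulas: "axms V0_2 \<subseteq> formulas L_A2"
  by (auto simp: V0_2_def basic_open_def B12_def SE_def parity_axiom_def COMP_def up_formulas)

lemma fvN_up:
  fixes t :: "('f, 'g) nterm" and T :: "('f, 'g) sterm"
  shows "fvN_nt (upN_nt t) = Suc ` fvN_nt t" and "fvN_st (upN_st T) = Suc ` fvN_st T"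
  unfolding upN_nt_def upN_st_def by (induction t and T) auto

lemma AC02_dataN: "AC02_n (MinFun z xs Xs \<phi> t) \<Longrightarrow> defining_data z xs Xs \<phi> t \<and>
    (\<forall>f\<in>nsyms \<phi>. AC02_n f) \<and> (\<forall>g\<in>ssyms \<phi>. AC02_s g)"
  by (erule AC02_n.cases) simp_all

lemma AC02_dataS: "AC02_s (CompFun z xs Xs \<phi> t) \<Longrightarrow> defining_data z xs Xs \<phi> t \<and>
    (\<forall>f\<in>nsyms \<phi>. AC02_n f) \<and> (\<forall>g\<in>ssyms \<phi>. AC02_s g)"
  by (erule AC02_s.cases) simp_all

lemma FparityL_data: "FparityL_s (CompFun z xs Xs \<phi> t) \<Longrightarrow> defining_data z xs Xs \<phi> t"
  by (erule FparityL_s.cases) (use AC02_dataS in \<open>simp_all add: L_FAC02_def\<close>)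

lemma defined_formulas:
  assumes D: "defining_data z xs Xs \<phi> t" and s: "\<forall>f\<in>nsyms \<phi>. f \<in> fst L" "\<forall>g\<in>ssyms \<phi>. g \<in> snd L"
  shows "MinFun z xs Xs \<phi> t \<in> fst L \<Longrightarrow> MinFun_axiom z xs Xs \<phi> t \<in> formulas L"
    and "CompFun z xs Xs \<phi> t \<in> snd L \<Longrightarrow> CompFun_axiom z xs Xs \<phi> t \<in> formulas L"
proof -
  have "\<phi> \<in> formulas L" using D s by (auto simp: defining_data_def formulas_def)
  moreover have "t \<in> nterms L"
    using D wf_no_syms(1)[of t] by (auto simp: defining_data_def nterms_def)
  ultimately show "MinFun z xs Xs \<phi> t \<in> fst L \<Longrightarrow> MinFun_axiom z xs Xs \<phi> t \<in> formulas L"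
    and "CompFun z xs Xs \<phi> t \<in> snd L \<Longrightarrow> CompFun_axiom z xs Xs \<phi> t \<in> formulas L"
    by (auto simp: MinFun_axiom_def CompFun_axiom_def Let_def)
qed

lemma V0_2_bar_formulas: "axms V0_2_bar \<subseteq> formulas L_FAC02"
proof
  fix \<phi> assume "\<phi> \<in> axms V0_2_bar"
  then consider "\<phi> \<in> basic_open" | "\<phi> \<in> pd_axioms \<union> SE_axioms \<union> {ParityF_axiom}"
    | (Min) z xs Xs \<chi> t where "\<phi> = MinFun_axiom z xs Xs \<chi> t" "AC02_n (MinFun z xs Xs \<chi> t)"
    | (Comp) z xs Xs \<chi> t where "\<phi> = CompFun_axiom z xs Xs \<chi> t" "AC02_s (CompFun z xs Xs \<chi> t)"
    by (auto simp: V0_2_bar_def L_FAC02_def)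
  then show "\<phi> \<in> formulas L_FAC02"
  proof cases
    case 1
    then show ?thesis by (auto simp: basic_open_def)
  next
    case 2
    have "Pd \<in> fst L_FAC02" "FSE \<in> fst L_FAC02" "ParityF \<in> snd L_FAC02"
      by (auto simp: L_FAC02_def intro: AC02_n_AC02_s.intros)
    then show ?thesis
      using 2 by (auto simp: pd_axioms_def SE_axioms_def ParityF_axiom_def Let_def)
  next
    case Min
    then show ?thesis
      using AC02_dataN[OF Min(2)] by (simp add: defined_formulas(1) L_FAC02_def)
  next
    case Comp
    then show ?thesis
      using AC02_dataS[OF Comp(2)] by (simp add: defined_formulas(2) L_FAC02_def)
  qed
qed

lemma FparityL_terms:
  "pair s u \<in> nterms L \<longleftrightarrow> s \<in> nterms L \<and> u \<in> nterms L"
  "s \<in> nterms L_FparityL \<Longrightarrow> u \<in> nterms L_FparityL \<Longrightarrow> second s u \<in> nterms L_FparityL"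
  "u \<in> nterms L_FparityL \<Longrightarrow> left u \<in> nterms L_FparityL"
  "s \<in> nterms L_FparityL \<Longrightarrow> Y \<in> sterms L_FparityL \<Longrightarrow> row s Y \<in> sterms L_FparityL"
  "s \<in> nterms L_FparityL \<Longrightarrow> identity s \<in> sterms L_FparityL"
  "s \<in> nterms L_FparityL \<Longrightarrow> X \<in> sterms L_FparityL \<Longrightarrow> Y \<in> sterms L_FparityL \<Longrightarrow>
     Prod2 s X Y \<in> sterms L_FparityL"
proof -
  have N: "AC02_n f \<Longrightarrow> f \<in> fst L_FparityL" and S: "AC02_s g \<Longrightarrow> g \<in> snd L_FparityL" for f g
    by (simp_all add: L_FparityL_def L_FAC02_def FparityL_s.intros)
  show "pair s u \<in> nterms L \<longleftrightarrow> s \<in> nterms L \<and> u \<in> nterms L" by (auto simp: pair_def)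
  show "s \<in> nterms L_FparityL \<Longrightarrow> u \<in> nterms L_FparityL \<Longrightarrow> second s u \<in> nterms L_FparityL"
    by (simp add: second_def N AC02_second del: One_nat_def)
  show "u \<in> nterms L_FparityL \<Longrightarrow> left u \<in> nterms L_FparityL"
    by (simp add: left_def N AC02_left del: One_nat_def)
  show "s \<in> nterms L_FparityL \<Longrightarrow> Y \<in> sterms L_FparityL \<Longrightarrow> row s Y \<in> sterms L_FparityL"
    by (simp add: row_def S AC02_row del: One_nat_def)
  show "s \<in> nterms L_FparityL \<Longrightarrow> identity s \<in> sterms L_FparityL"
    by (simp add: identity_def S AC02_identity del: One_nat_def)
  show "s \<in> nterms L_FparityL \<Longrightarrow> X \<in> sterms L_FparityL \<Longrightarrow> Y \<in> sterms L_FparityL \<Longrightarrow>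
     Prod2 s X Y \<in> sterms L_FparityL"
    by (simp add: Prod2_def S AC02_Prod2 del: One_nat_def)
qed

lemma PowSeqF_axiom_formulas: "PowSeqF_axiom v \<in> formulas L_FparityL"
proof -
  have "PowSeqF \<in> snd L_FparityL" by (simp add: L_FparityL_def FparityL_s.intros)
  then have "SFun PowSeqF [x\<^sub>0, x\<^sub>1] [X\<^sub>0] \<in> sterms L_FparityL" by simp
  moreover have "PowSeqF_axiom v \<in> formulas L_FparityL" if "SFun PowSeqF [x\<^sub>0, x\<^sub>1] [X\<^sub>0] \<in> sterms L_FparityL"
    using that
    by (cases v) (simp_all add: PowSeqF_axiom_def Let_def is_pair_def right_def FparityL_terms del: terms_simps(9))
  ultimately show ?thesis by blast
qed

lemma qfree_derived [simp]:
  "qfree (\<^bold>\<not> \<phi>) \<longleftrightarrow> qfree \<phi>" "qfree (\<phi> \<^bold>\<and> \<psi>) \<longleftrightarrow> qfree \<phi> \<and> qfree \<psi>"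
  "qfree (\<phi> \<^bold>\<or> \<psi>) \<longleftrightarrow> qfree \<phi> \<and> qfree \<psi>" "qfree (\<phi> \<^bold>\<longleftrightarrow> \<psi>) \<longleftrightarrow> qfree \<phi> \<and> qfree \<psi>" "qfree (s \<^bold>< t)"
  by (auto simp: Neg_def Conj_def Disj_def Iff_def Lt_def)

lemma defined_qfree:
  assumes "defining_data z xs Xs \<phi> t"
  shows "qfree (MinFun_axiom z xs Xs \<phi> t)" "qfree (CompFun_axiom z xs Xs \<phi> t)"
  using assms by (simp_all add: MinFun_axiom_def CompFun_axiom_def Let_def defining_data_def)

lemma V0_2_bar_qfree: "\<phi> \<in> axms V0_2_bar \<Longrightarrow> qfree \<phi>"
proof -
  assume "\<phi> \<in> axms V0_2_bar"
  moreover have "qfree \<phi>" if "\<phi> \<in> basic_open \<union> pd_axioms \<union> SE_axioms \<union> {ParityF_axiom}"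
    using that by (auto simp: basic_open_def pd_axioms_def SE_axioms_def ParityF_axiom_def Let_def)
  moreover have "qfree (MinFun_axiom z xs Xs \<chi> t)" if "AC02_n (MinFun z xs Xs \<chi> t)" for z xs Xs \<chi> t
    by (rule defined_qfree(1)) (simp add: AC02_dataN[OF that])
  moreover have "qfree (CompFun_axiom z xs Xs \<chi> t)" if "AC02_s (CompFun z xs Xs \<chi> t)" for z xs Xs \<chi> t
    by (rule defined_qfree(2)) (simp add: AC02_dataS[OF that])
  ultimately show "qfree \<phi>" by (auto simp: V0_2_bar_def L_FAC02_def)
qed

lemma VparityL_bar_qfree: "\<phi> \<in> axms (VparityL_bar v) \<Longrightarrow> qfree \<phi>"
proof -
  have "qfree (PowSeqF_axiom v)" by (cases v) (auto simp: PowSeqF_axiom_def Let_def is_pair_def)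
  moreover have "qfree (CompFun_axiom z xs Xs \<chi> t)" if "FparityL_s (CompFun z xs Xs \<chi> t)" for z xs Xs \<chi> t
    using FparityL_data[OF that] by (rule defined_qfree)
  ultimately show "\<phi> \<in> axms (VparityL_bar v) \<Longrightarrow> qfree \<phi>"
    using V0_2_bar_qfree by (auto simp: VparityL_bar_def L_FparityL_def)
qed

text \<open>The rule \<open>Axiom\<close> admits formulas of the language only, so restricting the
  axioms to the language changes no derivation. All axioms are open, and their free variables are
  read as universally closed.\<close>

lemma universal_VparityL_bar: "universal_theory (VparityL_bar v)"
proof -
  let ?L = "lang (VparityL_bar v)" and ?A = "axms (VparityL_bar v)"
  have 1: "derives ?L (?A \<inter> formulas ?L) \<phi>" if "derives ?L ?A \<phi>" for \<phi>
    using that by (induction rule: derives.induct) (auto intro: derives.intros)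
  have 2: "derives ?L ?A \<phi>" if "derives ?L (?A \<inter> formulas ?L) \<phi>" for \<phi>
    using that by (induction rule: derives.induct) (auto intro: derives.intros)
  show ?thesis unfolding universal_theory_def
    by (rule exI[of _ "?A \<inter> formulas ?L"])
      (use 1 2 in \<open>auto simp: theorems_def intro: universal.intros(1) VparityL_bar_qfree\<close>)
qed

section \<open>Elimination of bounded quantifiers in models of the universal theory\<close>

locale bar =
  fixes M :: "'n struct" and I :: "(nfun, 'n) nint" and J :: "(sfun, 'n) sint"
  assumes bar: "models M I J (axms V0_2_bar)" and J: "\<And>g as As. J g as As \<in> m_strs M"
    and strs_ne: "m_strs M \<noteq> {}"
begin

abbreviation "evb \<equiv> eval_nt M I J"
abbreviation "satb \<equiv> sat M I J"
abbreviation leb (infix "\<sqsubseteq>" 50) where "x \<sqsubseteq> y \<equiv> m_le M x y"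
abbreviation addb (infixl "\<oplus>" 65) where "x \<oplus> y \<equiv> m_plus M x y"
abbreviation oneb ("\<one>") where "\<one> \<equiv> m_one M"
abbreviation zerob ("\<zero>") where "\<zero> \<equiv> m_zero M"

lemma bar_sat: "\<phi> \<in> axms V0_2_bar \<Longrightarrow> range E \<subseteq> m_strs M \<Longrightarrow> satb e E \<phi>"
  using bar by (rule modelsD)

lemma basic_bar:
  assumes "\<phi> \<in> basic_open" "X \<in> m_strs M"
  shows "satb (case_nat x (\<lambda>_. y)) (\<lambda>_. X) \<phi>"
  by (rule bar_sat) (use assms in \<open>auto simp: V0_2_bar_def\<close>)

lemma basic_bar_num:
  assumes \<phi>: "\<phi> \<in> basic_open"
  shows "\<exists>E. satb (case_nat x (\<lambda>_. y)) E \<phi>"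
proof -
  obtain X where "X \<in> m_strs M" using strs_ne by auto
  then show ?thesis by (intro exI[of _ "\<lambda>_. X"] basic_bar[OF \<phi>])
qed

lemma antisym: "x \<sqsubseteq> y \<Longrightarrow> y \<sqsubseteq> x \<Longrightarrow> x = y"
  using basic_bar_num[of "x\<^sub>0 \<^bold>\<le> x\<^sub>1 \<^bold>\<and> x\<^sub>1 \<^bold>\<le> x\<^sub>0 \<^bold>\<longrightarrow> x\<^sub>0 \<^bold>=\<^sub>1 x\<^sub>1" x y] by (simp add: basic_open_def)
lemma zero_le: "\<zero> \<sqsubseteq> x"
  using basic_bar_num[of "Zero \<^bold>\<le> x\<^sub>0" x] by (simp add: basic_open_def)
lemma total: "x \<sqsubseteq> y \<or> y \<sqsubseteq> x"
  using basic_bar_num[of "x\<^sub>0 \<^bold>\<le> x\<^sub>1 \<^bold>\<or> x\<^sub>1 \<^bold>\<le> x\<^sub>0" x y] by (simp add: basic_open_def)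
lemma le_Suc: "x \<sqsubseteq> y \<longleftrightarrow> x \<sqsubseteq> y \<oplus> \<one> \<and> x \<noteq> y \<oplus> \<one>"
  using basic_bar_num[of "x\<^sub>0 \<^bold>\<le> x\<^sub>1 \<^bold>\<longleftrightarrow> x\<^sub>0 \<^bold>< x\<^sub>1 \<^bold>+ One" x y] by (simp add: basic_open_def)
lemma Suc_le: "x \<sqsubseteq> y \<Longrightarrow> x \<noteq> y \<Longrightarrow> x \<oplus> \<one> \<sqsubseteq> y"
  using total[of "x \<oplus> \<one>" y] le_Suc[of y x] antisym[of x y] by metis
lemma mem_len: "X \<in> m_strs M \<Longrightarrow> x \<oplus> \<one> = m_len M X \<Longrightarrow> x \<in> X"
  using basic_bar[of "x\<^sub>1 \<^bold>+ One \<^bold>=\<^sub>1 Len X\<^sub>0 \<^bold>\<longrightarrow> x\<^sub>1 \<^bold>\<in> X\<^sub>0" X x x] by (simp add: basic_open_def)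

lemma pred_bar: "x \<noteq> \<zero> \<Longrightarrow> \<exists>y. y \<oplus> \<one> = x"
proof -
  obtain X where "X \<in> m_strs M" using strs_ne by auto
  then have "satb (\<lambda>_. x) (\<lambda>_. X) (\<^bold>\<not> x\<^sub>0 \<^bold>=\<^sub>1 Zero \<^bold>\<longrightarrow> NFun Pd [x\<^sub>0] [] \<^bold>+ One \<^bold>=\<^sub>1 x\<^sub>0)"
    by (intro bar_sat) (auto simp: V0_2_bar_def pd_axioms_def)
  then show "x \<noteq> \<zero> \<Longrightarrow> \<exists>y. y \<oplus> \<one> = x" by auto
qed

text \<open>The quantifier turns into a search: a witness up to \<open>t\<close> exists iff the
  least one below \<open>t + 1\<close> is found, that is, iff the search does not return its
  bound.\<close>

lemma qelim_Ex:
  assumes \<phi>: "qfree \<phi>" "\<phi> \<in> formulas L_FAC02" and t: "t \<in> nterms L_A2"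
  shows "\<exists>\<chi>. qfree \<chi> \<and> \<chi> \<in> formulas L_FAC02 \<and> (\<forall>e E. range E \<subseteq> m_strs M \<longrightarrow>
    satb e E \<chi> = (\<exists>a. a \<sqsubseteq> evb e E t \<and> satb (case_nat a e) E \<phi>))"
proof -
  \<comment> \<open>The search is strict and the quantifier is not, hence the successor. The term is
    raised since inside the symbol variable 0 is the searched number.\<close>
  let ?t = "upN_nt t \<^bold>+ One"
  define xs where "xs = sorted_list_of_set (fvN \<phi> \<union> fvN_nt ?t - {0})"
  define Xs where "Xs = sorted_list_of_set (fvS \<phi> \<union> fvS_nt ?t)"
  define f where "f = MinFun 0 xs Xs \<phi> ?t"
  have xs: "set xs = fvN \<phi> \<union> fvN_nt ?t - {0}" "set Xs = fvS \<phi> \<union> fvS_nt ?t" "distinct xs" "distinct Xs"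
    by (auto simp: xs_def Xs_def finite_fv finite_fv_term)
  have tA: "?t \<in> nterms L_A2" using t by simp
  have D: "defining_data 0 xs Xs \<phi> ?t"
    unfolding defining_data_def
    using xs \<phi> tA by (auto simp: fvN_up formulas_def nterms_def L_A2_def)
  have f: "AC02_n f" unfolding f_def
    by (rule AC02_n_AC02_s.intros(4)[OF D]) (use \<phi> in \<open>auto simp: formulas_def L_FAC02_def\<close>)
  \<comment> \<open>Outside the quantifier all number variables are lower by one. The list
    \<open>xs\<close> omits 0, so \<open>i - 1\<close> is the true predecessor.\<close>
  define \<chi> where "\<chi> = (NFun f (map (\<lambda>i. NVar (i - 1)) xs) (map SVar Xs) \<^bold>< t \<^bold>+ One)"
  have "qfree \<chi>" by (simp add: \<chi>_def)
  moreover have "\<chi> \<in> formulas L_FAC02"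
    using f L_A2_subset(2)[OF t, of L_FAC02] by (auto simp: \<chi>_def f_def L_FAC02_def)
  moreover have "satb e E \<chi> = (\<exists>a. a \<sqsubseteq> evb e E t \<and> satb (case_nat a e) E \<phi>)"
    if E: "range E \<subseteq> m_strs M" for e E
  proof -
    define m where "m = I f (map (\<lambda>i. e (i - 1)) xs) (map E Xs)"
    have args: "map (case_nat a e) xs = map (\<lambda>i. e (i - 1)) xs" for a
      using xs(1) by (auto split: nat.split)
    have ax: "MinFun_axiom 0 xs Xs \<phi> ?t \<in> axms V0_2_bar"
      using f by (auto simp: V0_2_bar_def L_FAC02_def f_def)
    have m: "m \<sqsubseteq> evb e E t \<oplus> \<one>" "a = m \<Longrightarrow> a \<noteq> evb e E t \<oplus> \<one> \<Longrightarrow> satb (case_nat a e) E \<phi>"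
      "a \<sqsubseteq> m \<Longrightarrow> a \<noteq> m \<Longrightarrow> \<not> satb (case_nat a e) E \<phi>" for a
      using bar_sat[OF ax E, of "case_nat a e"]
      by (auto simp: MinFun_axiom_def Let_def comp_def args m_def f_def)
    have "satb e E \<chi> \<longleftrightarrow> m \<noteq> evb e E t \<oplus> \<one>"
      using m(1) by (simp add: \<chi>_def comp_def m_def)
    also have "\<dots> \<longleftrightarrow> (\<exists>a. a \<sqsubseteq> evb e E t \<and> satb (case_nat a e) E \<phi>)"
    proof
      assume "m \<noteq> evb e E t \<oplus> \<one>"
      then show "\<exists>a. a \<sqsubseteq> evb e E t \<and> satb (case_nat a e) E \<phi>"
        using m(1) m(2)[OF refl] le_Suc[of m "evb e E t"] by (intro exI[of _ m]) simp
    next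
      assume "\<exists>a. a \<sqsubseteq> evb e E t \<and> satb (case_nat a e) E \<phi>"
      then obtain a where a: "a \<sqsubseteq> evb e E t" "satb (case_nat a e) E \<phi>" by blast
      then show "m \<noteq> evb e E t \<oplus> \<one>" using m(3)[of a] le_Suc[of a "evb e E t"] by auto
    qed
    finally show ?thesis .
  qed
  ultimately show ?thesis by blast
qed

lemma qelim:
  assumes "Sigma0B \<phi>" "\<phi> \<in> formulas L_A2"
  shows "\<exists>\<chi>. qfree \<chi> \<and> \<chi> \<in> formulas L_FAC02 \<and>
    (\<forall>e E. range E \<subseteq> m_strs M \<longrightarrow> satb e E \<chi> = satb e E \<phi>)"
  using assms
proof (induction rule: Sigma0B.induct)
  case (1 \<phi>)
  then show ?case by (intro exI[of _ \<phi>]) (simp add: L_A2_subset)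
next
  case (2 \<phi> \<psi>)
  then obtain \<phi>' \<psi>' where "qfree \<phi>'" "\<phi>' \<in> formulas L_FAC02" "qfree \<psi>'" "\<psi>' \<in> formulas L_FAC02"
    "\<forall>e E. range E \<subseteq> m_strs M \<longrightarrow> satb e E \<phi>' = satb e E \<phi>"
    "\<forall>e E. range E \<subseteq> m_strs M \<longrightarrow> satb e E \<psi>' = satb e E \<psi>" by auto
  then show ?case by (intro exI[of _ "\<phi>' \<^bold>\<longrightarrow> \<psi>'"]) simp
next
  case (3 \<phi> t)
  then obtain \<phi>' where \<phi>': "qfree \<phi>'" "\<phi>' \<in> formulas L_FAC02"
    "\<forall>e E. range E \<subseteq> m_strs M \<longrightarrow> satb e E \<phi>' = satb e E \<phi>" by auto
  obtain \<chi> where "qfree \<chi>" "\<chi> \<in> formulas L_FAC02" "\<forall>e E. range E \<subseteq> m_strs M \<longrightarrow>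
    satb e E \<chi> = (\<exists>a. a \<sqsubseteq> evb e E t \<and> satb (case_nat a e) E (\<^bold>\<not> \<phi>'))"
    using qelim_Ex[of "\<^bold>\<not> \<phi>'" t] \<phi>'(1,2) 3 by auto
  then show ?case using \<phi>'(3) by (intro exI[of _ "\<^bold>\<not> \<chi>"]) simp
next
  case (4 \<phi> t)
  then obtain \<phi>' where \<phi>': "qfree \<phi>'" "\<phi>' \<in> formulas L_FAC02"
    "\<forall>e E. range E \<subseteq> m_strs M \<longrightarrow> satb e E \<phi>' = satb e E \<phi>" by auto
  obtain \<chi> where "qfree \<chi>" "\<chi> \<in> formulas L_FAC02" "\<forall>e E. range E \<subseteq> m_strs M \<longrightarrow>
    satb e E \<chi> = (\<exists>a. a \<sqsubseteq> evb e E t \<and> satb (case_nat a e) E \<phi>')"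
    using qelim_Ex[of \<phi>' t] \<phi>'(1,2) 4 by auto
  then show ?case using \<phi>'(3) by (intro exI[of _ \<chi>]) simp
qed

lemma COMP_bar:
  assumes "Sigma0B \<phi>" "\<phi> \<in> formulas L_A2" and E: "range E \<subseteq> m_strs M"
  shows "satb e E (COMP \<phi>)"
proof -
  obtain \<phi>' where \<phi>': "qfree \<phi>'" "\<phi>' \<in> formulas L_FAC02"
    "\<forall>e E. range E \<subseteq> m_strs M \<longrightarrow> satb e E \<phi>' = satb e E \<phi>" using qelim[OF assms(1,2)] by auto
  \<comment> \<open>Variable 1 is the bound of the comprehension and must be an argument of the
    symbol even if the formula does not mention it.\<close>
  define xs where "xs = sorted_list_of_set (insert 1 (fvN \<phi>') - {0})"
  define Xs where "Xs = sorted_list_of_set (fvS \<phi>')"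
  define g where "g = CompFun 0 xs Xs \<phi>' x\<^sub>1"
  have xs: "set xs = insert 1 (fvN \<phi>') - {0}" "set Xs = fvS \<phi>'" "distinct xs" "distinct Xs"
    by (auto simp: xs_def Xs_def finite_fv)
  have D: "defining_data 0 xs Xs \<phi>' x\<^sub>1"
    unfolding defining_data_def using xs \<phi>' by (auto simp: formulas_def)
  have g: "AC02_s g" unfolding g_def
    by (rule AC02_n_AC02_s.intros(5)[OF D]) (use \<phi>' in \<open>auto simp: formulas_def L_FAC02_def\<close>)
  then have ax: "CompFun_axiom 0 xs Xs \<phi>' x\<^sub>1 \<in> axms V0_2_bar"
    by (auto simp: V0_2_bar_def L_FAC02_def g_def)
  define A where "A = J g (map (\<lambda>i. e (i - 1)) xs) (map E Xs)"
  have args: "map (case_nat a e) xs = map (\<lambda>i. e (i - 1)) xs" for a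
    using xs(1) by (auto split: nat.split)
  have A: "z \<in> A \<longleftrightarrow> z \<sqsubseteq> e 0 \<and> z \<noteq> e 0 \<and> satb (case_nat z e) E \<phi>" for z
    using bar_sat[OF ax E, of "case_nat z e"] \<phi>'(3) E
    by (auto simp: CompFun_axiom_def comp_def args A_def g_def)
  have AS: "A \<in> m_strs M" unfolding A_def by (rule J)
  \<comment> \<open>The defining axiom speaks about elements only. The length is zero or has an
    element of \<open>A\<close> as predecessor, which lies below the bound.\<close>
  have "m_len M A \<sqsubseteq> e 0"
  proof (cases "m_len M A = \<zero>")
    case False
    then obtain y where y: "y \<oplus> \<one> = m_len M A" using pred_bar by blast
    then have "y \<in> A" by (rule mem_len[OF AS])
    then show ?thesis using A[of y] Suc_le[of y "e 0"] y by simp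
  qed (simp add: zero_le)
  then show ?thesis using AS A by (auto simp: COMP_def intro!: bexI[of _ A])
qed

lemma V0_2_bar_models: "models M I J (axms V0_2)"
  unfolding models_def
proof (intro ballI allI impI)
  fix \<phi> and e :: "nat \<Rightarrow> 'n" and E :: "nat \<Rightarrow> 'n set"
  assume "\<phi> \<in> axms V0_2" and E: "range E \<subseteq> m_strs M"
  have ES: "E i \<in> m_strs M" for i using E by auto
  consider "\<phi> \<in> basic_open" | "\<phi> = B12" | "\<phi> = SE" | "\<phi> = parity_axiom"
    | \<chi> where "\<phi> = COMP \<chi>" "Sigma0B \<chi>" "\<chi> \<in> formulas L_A2"
    using \<open>\<phi> \<in> axms V0_2\<close> by (auto simp: V0_2_def)
  then show "satb e E \<phi>"
  proof cases
    case 1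
    then show ?thesis using E by (intro bar_sat) (auto simp: V0_2_bar_def)
  next
    case 2
    \<comment> \<open>\<open>pred_bar\<close> yields an unbounded predecessor, while B12 asks for
      one below the number itself.\<close>
    have le: "y \<sqsubseteq> y \<oplus> \<one>" for y using total[of y y] le_Suc[of y y] by blast
    have "\<exists>y. y \<sqsubseteq> e 0 \<and> y \<oplus> \<one> = e 0" if nz: "e 0 \<noteq> \<zero>"
    proof -
      obtain y where y: "y \<oplus> \<one> = e 0" using pred_bar[OF nz] by blast
      show ?thesis using le[of y] unfolding y by (intro exI[of _ y]) (simp add: y)
    qed
    then show ?thesis by (simp add: 2 B12_def)
  next
    case 3
    let ?d = "I FSE [] [E 0, E 1]"
    have ax: "satb e' E \<phi>" if "\<phi> \<in> SE_axioms" for \<phi> e'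
      using that E by (intro bar_sat) (auto simp: V0_2_bar_def)
    have d: "?d \<sqsubseteq> m_len M (E 0)"
      "?d \<noteq> m_len M (E 0) \<Longrightarrow> (?d \<in> E 0) \<noteq> (?d \<in> E 1)"
      "m_len M (E 0) = m_len M (E 1) \<Longrightarrow> ?d = m_len M (E 0) \<Longrightarrow> E 0 = E 1"
      using ax[of "NFun FSE [] [X\<^sub>0, X\<^sub>1] \<^bold>\<le> Len X\<^sub>0" e]
        ax[of "NFun FSE [] [X\<^sub>0, X\<^sub>1] \<^bold>< Len X\<^sub>0 \<^bold>\<longrightarrow>
          Xor (NFun FSE [] [X\<^sub>0, X\<^sub>1] \<^bold>\<in> X\<^sub>0) (NFun FSE [] [X\<^sub>0, X\<^sub>1] \<^bold>\<in> X\<^sub>1)" e]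
        ax[of "Len X\<^sub>0 \<^bold>=\<^sub>1 Len X\<^sub>1 \<^bold>\<and> NFun FSE [] [X\<^sub>0, X\<^sub>1] \<^bold>=\<^sub>1 Len X\<^sub>0 \<^bold>\<longrightarrow> X\<^sub>0 \<^bold>=\<^sub>2 X\<^sub>1" e]
      by (simp_all add: SE_axioms_def Let_def)
    have "E 0 = E 1" if len: "m_len M (E 0) = m_len M (E 1)"
      and eq: "\<And>a. a \<sqsubseteq> m_len M (E 0) \<Longrightarrow> a \<noteq> m_len M (E 0) \<Longrightarrow> (a \<in> E 0) = (a \<in> E 1)"
    proof (cases "?d = m_len M (E 0)")
      case True
      then show ?thesis by (rule d(3)[OF len])
    next
      case False
      then show ?thesis using d(2)[OF False] eq[OF d(1) False] by blast
    qed
    then show ?thesis unfolding 3 SE_def by simp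
  next
    case 4
    let ?Z = "J ParityF [e 0] [E 0]"
    have ax: "satb (case_nat (e 0) (\<lambda>_. a)) E ParityF_axiom" for a
      using E by (intro bar_sat) (auto simp: V0_2_bar_def)
    have Z: "m_len M ?Z \<sqsubseteq> e 0 \<oplus> \<one>" "\<zero> \<notin> ?Z"
      "a \<sqsubseteq> e 0 \<Longrightarrow> a \<noteq> e 0 \<Longrightarrow> (a \<oplus> \<one> \<in> ?Z) = ((a \<in> E 0) \<noteq> (a \<in> ?Z))" for a
      using ax[of a] by (simp_all add: ParityF_axiom_def Let_def)
    show ?thesis unfolding 4 parity_axiom_def
      using Z J[of ParityF "[e 0]" "[E 0]"] by (auto intro!: bexI[of _ ?Z])
  next
    case 5
    then show ?thesis using COMP_bar E by simp
  qed
qed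

lemma powseq_exists_bar:
  assumes "models M I J {PowSeqF_axiom v}" and E: "range E \<subseteq> m_strs M"
  shows "satb e E (powseq_exists v)"
proof -
  \<comment> \<open>The arithmetic derived for models of V0(2) becomes available, in particular for
    evaluating the bound of the literal variant at zero.\<close>
  interpret v0: v0 M I J by unfold_locales (rule V0_2_bar_models strs_ne)+
  have ax: "satb e E (PowSeqF_axiom v)" if "range E \<subseteq> m_strs M" for e E
    using modelsD[OF assms(1) _ that] by simp
  show ?thesis
  proof (cases v)
    case Literal
    have "v0.lt (m_len M (J PowSeqF [m_zero M, m_zero M] [E 0])) (m_pair M (m_zero M) (m_pair M (m_zero M) (m_zero M)))"
      using ax[OF E, of "\<lambda>_. m_zero M"] Literal by (simp add: PowSeqF_axiom_def Let_def v0.lt_def)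
    then show ?thesis
      using v0.B7[OF _ v0.B9, of "m_len M (J PowSeqF [m_zero M, m_zero M] [E 0])"]
      by (simp add: v0.pr_eq v0.B3 v0.B5 v0.zero_mul v0.lt_def)
  next
    case Corrected
    let ?Y = "J PowSeqF [e 0, e 1] [E 0]"
    \<comment> \<open>The free variables \<open>b\<close> and \<open>i\<close> of the open axiom
      supply the instances of the two bounded quantifiers in the graph.\<close>
    have ax': "satb (case_nat (e 0) (case_nat (e 1) (case_nat b (\<lambda>_. i)))) E (PowSeqF_axiom v)" for b i
      by (rule ax[OF E])
    \<comment> \<open>Graph and axiom apply the same symbols to corresponding arguments, so
      unfolding makes the evaluations coincide; the values of the symbols are not computed.\<close>
    have "satb e (case_nat ?Y E) (powseq_graph Corrected x\<^sub>0 x\<^sub>1 X\<^sub>1 X\<^sub>0)"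
      using ax' unfolding Corrected
      by (auto simp: powseq_graph_def PowSeqF_axiom_def Let_def is_pair_def left_def right_def second_def
          row_def identity_def Prod2_def numeral_2_eq_2 numeral_3_eq_3)
    then show ?thesis using J Corrected by (auto simp: powseq_exists_def)
  qed
qed

end

section \<open>Extensionality of maximal consistent sets\<close>

lemma upN_Len: "upN_nt (Len T) = Len (upN_st T)"
  by (simp add: upN_nt_def upN_st_def)

context henkin
begin

lemma basic_inst:
  assumes "basic_open \<subseteq> A" "\<phi> \<in> basic_open" "s \<in> nterms L" "t \<in> nterms L" "T \<in> sterms L"
  shows "subst (case_nat s (\<lambda>_. t)) (\<lambda>_. T) \<phi> \<in> \<Gamma>"
proof (rule mem_axiom)
  show "\<phi> \<in> formulas L" using assms(2) by (auto simp: basic_open_def)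
qed (use assms in \<open>auto split: nat.split\<close>)

lemma le_subst: "eqN s s' \<Longrightarrow> eqN t t' \<Longrightarrow> (s \<^bold>\<le> t) \<in> \<Gamma> \<Longrightarrow> (s' \<^bold>\<le> t') \<in> \<Gamma>"
  using mem_subst_cong[of "case_nat s (\<lambda>_. t)" "case_nat s' (\<lambda>_. t')" SVar SVar "x\<^sub>0 \<^bold>\<le> x\<^sub>1"]
  by (auto simp: eq_refl split: nat.split)

text \<open>If the length of \<open>S\<close> is a successor \<open>t + 1\<close>, then
  \<open>t\<close> belongs to \<open>S\<close>, hence to \<open>T\<close>, and is below the length
  of \<open>T\<close>. The assumption \<open>pred\<close> abstracts from the way in which a theory
  provides predecessors: by B12 or by the symbol \<open>Pd\<close>.\<close>

lemma len_le:
  assumes basic: "basic_open \<subseteq> A"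
    and pred: "\<And>s. s \<in> nterms L \<Longrightarrow> (s \<^bold>=\<^sub>1 Zero) \<notin> \<Gamma> \<Longrightarrow> \<exists>t\<in>nterms L. (t \<^bold>+ One \<^bold>=\<^sub>1 s) \<in> \<Gamma>"
    and ST: "S \<in> sterms L" "T \<in> sterms L"
    and eq: "\<And>t. t \<in> nterms L \<Longrightarrow> (t \<^bold>\<in> S) \<in> \<Gamma> \<Longrightarrow> (t \<^bold>\<in> T) \<in> \<Gamma>"
  shows "(Len S \<^bold>\<le> Len T) \<in> \<Gamma>"
proof (cases "(Len S \<^bold>=\<^sub>1 Zero) \<in> \<Gamma>")
  case True
  have "(Zero \<^bold>\<le> Len T) \<in> \<Gamma>"
    using basic_inst[OF basic, of "Zero \<^bold>\<le> x\<^sub>0" "Len T" "Len T" T] ST by (simp add: basic_open_def)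
  moreover have "eqN Zero (Len S)" by (rule eq_sym(1)) (use True ST in \<open>simp add: eqN_def\<close>)
  ultimately show ?thesis using le_subst[of Zero "Len S" "Len T" "Len T"] eq_refl(1)[of "Len T"] ST by simp
next
  case False
  then obtain t where t: "t \<in> nterms L" "(t \<^bold>+ One \<^bold>=\<^sub>1 Len S) \<in> \<Gamma>" using pred[of "Len S"] ST by auto
  have "(t \<^bold>\<in> S) \<in> \<Gamma>"
    using basic_inst[OF basic, of "x\<^sub>1 \<^bold>+ One \<^bold>=\<^sub>1 Len X\<^sub>0 \<^bold>\<longrightarrow> x\<^sub>1 \<^bold>\<in> X\<^sub>0" t t S] ST t
    by (simp add: basic_open_def mem_Imp)
  then have "(t \<^bold>\<in> T) \<in> \<Gamma>" by (rule eq[OF t(1)])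
  then have lt: "(t \<^bold>\<le> Len T) \<in> \<Gamma>" "(t \<^bold>=\<^sub>1 Len T) \<notin> \<Gamma>"
    using basic_inst[OF basic, of "x\<^sub>1 \<^bold>\<in> X\<^sub>0 \<^bold>\<longrightarrow> x\<^sub>1 \<^bold>< Len X\<^sub>0" t t T] ST t
    by (simp_all add: basic_open_def mem_Imp mem_derived)
  let ?n = "Len T"
  have n: "?n \<in> nterms L" using ST by simp
  have "(?n \<^bold>\<le> t \<^bold>+ One) \<in> \<Gamma> \<or> (t \<^bold>+ One \<^bold>\<le> ?n) \<in> \<Gamma>"
    using basic_inst[OF basic, of "x\<^sub>0 \<^bold>\<le> x\<^sub>1 \<^bold>\<or> x\<^sub>1 \<^bold>\<le> x\<^sub>0" ?n "t \<^bold>+ One" T] n t ST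
    by (simp add: basic_open_def mem_derived)
  \<comment> \<open>In the other case of linearity, B11 would give a number at most \<open>t\<close>
    for the length of \<open>T\<close>, against \<open>t\<close> being strictly below it, unless
    equality holds.\<close>
  moreover have "(t \<^bold>+ One \<^bold>\<le> ?n) \<in> \<Gamma>" if le: "(?n \<^bold>\<le> t \<^bold>+ One) \<in> \<Gamma>"
  proof (cases "(?n \<^bold>=\<^sub>1 t \<^bold>+ One) \<in> \<Gamma>")
    case True
    then have e: "eqN ?n (t \<^bold>+ One)" using n t by (simp add: eqN_def)
    show ?thesis by (rule le_subst[OF e eq_sym(1)[OF e] le])
  next
    case False
    then have "(?n \<^bold>\<le> t) \<in> \<Gamma>"
      using basic_inst[OF basic, of "x\<^sub>0 \<^bold>\<le> x\<^sub>1 \<^bold>\<longleftrightarrow> x\<^sub>0 \<^bold>< x\<^sub>1 \<^bold>+ One" ?n t T] n t ST le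
      by (simp add: basic_open_def mem_derived)
    then have "(t \<^bold>=\<^sub>1 ?n) \<in> \<Gamma>"
      using basic_inst[OF basic, of "x\<^sub>0 \<^bold>\<le> x\<^sub>1 \<^bold>\<and> x\<^sub>1 \<^bold>\<le> x\<^sub>0 \<^bold>\<longrightarrow> x\<^sub>0 \<^bold>=\<^sub>1 x\<^sub>1" t ?n T] n t ST lt
      by (simp add: basic_open_def mem_derived mem_Imp)
    then show ?thesis using lt by blast
  qed
  ultimately have "(t \<^bold>+ One \<^bold>\<le> ?n) \<in> \<Gamma>" by blast
  moreover have "eqN (t \<^bold>+ One) (Len S)" using t ST by (simp add: eqN_def)
  ultimately show ?thesis using le_subst[of "t \<^bold>+ One" "Len S" ?n ?n] eq_refl(1)[OF n] by blast
qed

lemma len_eq: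
  assumes basic: "basic_open \<subseteq> A"
    and pred: "\<And>s. s \<in> nterms L \<Longrightarrow> (s \<^bold>=\<^sub>1 Zero) \<notin> \<Gamma> \<Longrightarrow> \<exists>t\<in>nterms L. (t \<^bold>+ One \<^bold>=\<^sub>1 s) \<in> \<Gamma>"
    and ST: "S \<in> sterms L" "T \<in> sterms L"
    and eq: "\<And>t. t \<in> nterms L \<Longrightarrow> (t \<^bold>\<in> S) \<in> \<Gamma> \<longleftrightarrow> (t \<^bold>\<in> T) \<in> \<Gamma>"
  shows "(Len S \<^bold>=\<^sub>1 Len T) \<in> \<Gamma>"
proof -
  have "(Len S \<^bold>\<le> Len T) \<in> \<Gamma>" "(Len T \<^bold>\<le> Len S) \<in> \<Gamma>"
    using len_le[OF basic pred ST] len_le[OF basic pred ST(2,1)] eq by blast+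
  then show ?thesis
    using basic_inst[OF basic, of "x\<^sub>0 \<^bold>\<le> x\<^sub>1 \<^bold>\<and> x\<^sub>1 \<^bold>\<le> x\<^sub>0 \<^bold>\<longrightarrow> x\<^sub>0 \<^bold>=\<^sub>1 x\<^sub>1" "Len S" "Len T" T] ST
    by (simp add: basic_open_def mem_derived mem_Imp)
qed

lemma ext_V0_2:
  assumes A: "axms V0_2 \<subseteq> A" and ST: "S \<in> sterms L" "T \<in> sterms L"
    and eq: "\<And>t. t \<in> nterms L \<Longrightarrow> (t \<^bold>\<in> S) \<in> \<Gamma> \<longleftrightarrow> (t \<^bold>\<in> T) \<in> \<Gamma>"
  shows "(S \<^bold>=\<^sub>2 T) \<in> \<Gamma>"
proof -
  have basic: "basic_open \<subseteq> A" and B12: "B12 \<in> A" and SE: "SE \<in> A"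
    using A by (auto simp: V0_2_def)
  have pred: "\<exists>t\<in>nterms L. (t \<^bold>+ One \<^bold>=\<^sub>1 s) \<in> \<Gamma>" if s: "s \<in> nterms L" "(s \<^bold>=\<^sub>1 Zero) \<notin> \<Gamma>" for s
  proof (rule ccontr)
    assume neg: "\<not> ?thesis"
    \<comment> \<open>Maximality handles universal formulas through their term instances. Without a
      predecessor among the terms, every instance of \<open>?\<chi>\<close> would belong to
      \<open>\<Gamma>\<close>, so its universal closure would too, against B12.\<close>
    let ?\<chi> = "\<^bold>\<not> (NVar 0 \<^bold>\<le> upN_nt s \<^bold>\<and> NVar 0 \<^bold>+ One \<^bold>=\<^sub>1 upN_nt s)"
    have \<chi>: "AllN ?\<chi> \<in> formulas L" using s by simp
    have "subst (\<lambda>_. s) SVar B12 \<in> \<Gamma>"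
      by (rule mem_axiom[OF B12]) (use s in \<open>auto simp: B12_def\<close>)
    then have "((\<^bold>\<not> s \<^bold>=\<^sub>1 Zero) \<^bold>\<longrightarrow> \<^bold>\<not> AllN ?\<chi>) \<in> \<Gamma>"
      by (simp add: B12_def ExLe_def ExN_def)
    then have "AllN ?\<chi> \<notin> \<Gamma>" using s \<chi> by (simp add: mem_Imp mem_Neg)
    moreover have "instN t ?\<chi> \<in> \<Gamma>" if "t \<in> nterms L" for t
      using neg that s by (simp add: instN_def inst_up_term mem_Neg mem_derived)
    ultimately show False using mem_AllN[OF \<chi>] by blast
  qed
  \<comment> \<open>The matrix of the bounded quantifier in \<open>SE\<close>, written out for
    \<open>S\<close> and \<open>T\<close> so that \<open>mem_AllN\<close> applies to it.\<close>
  let ?\<psi> = "NVar 0 \<^bold>\<le> upN_nt (Len S) \<^bold>\<longrightarrow> NVar 0 \<^bold>< upN_nt (Len S) \<^bold>\<longrightarrow>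
    (NVar 0 \<^bold>\<in> upN_st S \<^bold>\<longleftrightarrow> NVar 0 \<^bold>\<in> upN_st T)"
  have \<psi>: "AllN ?\<psi> \<in> formulas L" using ST by simp
  have "subst NVar (case_nat S (\<lambda>_. T)) SE \<in> \<Gamma>"
    by (rule mem_axiom[OF SE]) (use ST in \<open>auto simp: SE_def split: nat.split\<close>)
  then have "((Len S \<^bold>=\<^sub>1 Len T \<^bold>\<and> AllN ?\<psi>) \<^bold>\<longrightarrow> S \<^bold>=\<^sub>2 T) \<in> \<Gamma>"
    by (simp add: SE_def AllLt_def AllLe_def upN_Len)
  moreover have "AllN ?\<psi> \<in> \<Gamma>"
  proof -
    have "instN t ?\<psi> \<in> \<Gamma>" if "t \<in> nterms L" for t
      using that ST eq[OF that] by (simp add: instN_def inst_up_term mem_derived mem_Imp upN_Len)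
    then show ?thesis using mem_AllN[OF \<psi>] by blast
  qed
  ultimately show ?thesis
    using len_eq[OF basic pred ST eq] ST \<psi> by (simp add: mem_derived mem_Imp)
qed

text \<open>The first difference of \<open>S\<close> and \<open>T\<close> is named by a term, and on
  terms the two agree. It therefore cannot lie below the length, so it equals the length, and the
  last axiom for \<open>FSE\<close> applies.\<close>

lemma ext_V0_2_bar:
  assumes A: "axms V0_2_bar \<subseteq> A" and L: "Pd \<in> fst L" "FSE \<in> fst L"
    and ST: "S \<in> sterms L" "T \<in> sterms L"
    and eq: "\<And>t. t \<in> nterms L \<Longrightarrow> (t \<^bold>\<in> S) \<in> \<Gamma> \<longleftrightarrow> (t \<^bold>\<in> T) \<in> \<Gamma>"
  shows "(S \<^bold>=\<^sub>2 T) \<in> \<Gamma>"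
proof -
  have basic: "basic_open \<subseteq> A" and pdA: "pd_axioms \<subseteq> A" and SEA: "SE_axioms \<subseteq> A"
    using A by (auto simp: V0_2_bar_def)
  have pred: "\<exists>t\<in>nterms L. (t \<^bold>+ One \<^bold>=\<^sub>1 s) \<in> \<Gamma>" if s: "s \<in> nterms L" "(s \<^bold>=\<^sub>1 Zero) \<notin> \<Gamma>" for s
  proof -
    have "subst (\<lambda>_. s) SVar (\<^bold>\<not> x\<^sub>0 \<^bold>=\<^sub>1 Zero \<^bold>\<longrightarrow> NFun Pd [x\<^sub>0] [] \<^bold>+ One \<^bold>=\<^sub>1 x\<^sub>0) \<in> \<Gamma>"
      by (rule mem_axiom) (use s pdA L in \<open>auto simp: pd_axioms_def\<close>)
    then show ?thesis using s L by (intro bexI[of _ "NFun Pd [s] []"]) (simp_all add: mem_Imp mem_Neg)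
  qed
  let ?d = "NFun FSE [] [S, T]"
  have d: "?d \<in> nterms L" using L ST by (simp add: numeral_2_eq_2)
  have ax: "subst NVar (case_nat S (\<lambda>_. T)) \<phi> \<in> \<Gamma>" if "\<phi> \<in> SE_axioms" for \<phi>
    by (rule mem_axiom)
      (use that SEA ST L in \<open>auto simp: SE_axioms_def Let_def split: nat.split\<close>)
  have "(?d \<^bold>\<le> Len S) \<in> \<Gamma>"
    using ax[of "NFun FSE [] [X\<^sub>0, X\<^sub>1] \<^bold>\<le> Len X\<^sub>0"] by (simp add: SE_axioms_def Let_def)
  moreover have "(?d \<^bold>< Len S \<^bold>\<longrightarrow> Xor (?d \<^bold>\<in> S) (?d \<^bold>\<in> T)) \<in> \<Gamma>"
    using ax[of "NFun FSE [] [X\<^sub>0, X\<^sub>1] \<^bold>< Len X\<^sub>0 \<^bold>\<longrightarrow>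
      Xor (NFun FSE [] [X\<^sub>0, X\<^sub>1] \<^bold>\<in> X\<^sub>0) (NFun FSE [] [X\<^sub>0, X\<^sub>1] \<^bold>\<in> X\<^sub>1)"]
    by (simp add: SE_axioms_def Let_def)
  ultimately have "(?d \<^bold>=\<^sub>1 Len S) \<in> \<Gamma>"
    using d ST eq[OF d] by (auto simp: mem_Imp mem_derived mem_Neg simp del: terms_simps(7))
  moreover have "((Len S \<^bold>=\<^sub>1 Len T \<^bold>\<and> ?d \<^bold>=\<^sub>1 Len S) \<^bold>\<longrightarrow> S \<^bold>=\<^sub>2 T) \<in> \<Gamma>"
    using ax[of "Len X\<^sub>0 \<^bold>=\<^sub>1 Len X\<^sub>1 \<^bold>\<and> NFun FSE [] [X\<^sub>0, X\<^sub>1] \<^bold>=\<^sub>1 Len X\<^sub>0 \<^bold>\<longrightarrow> X\<^sub>0 \<^bold>=\<^sub>2 X\<^sub>1"]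
    by (simp add: SE_axioms_def Let_def)
  ultimately show ?thesis
    using len_eq[OF basic pred ST eq] ST d by (simp add: mem_derived mem_Imp del: terms_simps(7))
qed

end

section \<open>The main theorem\<close>

theorem mainTheorem10:
  fixes v :: variant and \<psi> :: form
  assumes "VparityL_axiom v \<psi>"
  shows "universal_theory (VparityL_bar v) \<and> conservative_extension (VparityL_bar v) (VparityL \<psi>)"
proof
  show "universal_theory (VparityL_bar v)" by (rule universal_VparityL_bar)
  have \<psi>: "\<psi> \<in> formulas L_A2" using assms by (simp add: VparityL_axiom_def)
  let ?A = "axms V0_2 \<union> {\<psi>}" and ?B = "axms (VparityL_bar v)"
  have thms: "theorems (VparityL \<psi>) = {\<phi>. derives L_A2 ?A \<phi>}"
    "theorems (VparityL_bar v) = {\<phi>. derives L_FparityL ?B \<phi>}"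
    by (simp_all add: theorems_def VparityL_def VparityL_bar_def)
  have A: "?A \<subseteq> formulas L_A2" using V0_2_formulas \<psi> by auto
  have barB: "axms V0_2_bar \<subseteq> ?B" by (auto simp: VparityL_bar_def)
  have FAC: "fst L_FAC02 \<subseteq> fst L_FparityL" "snd L_FAC02 \<subseteq> snd L_FparityL"
    by (auto simp: L_FparityL_def intro: FparityL_s.intros)
  have barF: "axms V0_2_bar \<subseteq> formulas L_FparityL"
    using V0_2_bar_formulas formulas_mono[OF FAC] by blast
  have "derives L_FparityL ?B \<phi>" if der: "derives L_A2 ?A \<phi>" for \<phi>
  proof (rule ccontr)
    assume neg: "\<not> derives L_FparityL ?B \<phi>"
    have F: "Pd \<in> fst L_FparityL" "FSE \<in> fst L_FparityL"
      using FAC(1) by (auto simp: L_FAC02_def intro: AC02_n_AC02_s.intros)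
    have \<phi>: "\<phi> \<in> formulas L_FparityL" using derives_formulas[OF der] by (rule L_A2_subset)
    have basic: "basic_open \<subseteq> ?B" using barB by (auto simp: V0_2_bar_def)
    obtain M :: "nat struct" and I J e E where M: "\<And>g as Xs. J g as Xs \<in> m_strs M"
      "models M I J (?B \<inter> formulas L_FparityL)" "range E \<subseteq> m_strs M" "\<not> sat M I J e E \<phi>"
    proof (rule completeness[OF \<phi> neg basic])
      show "(S \<^bold>=\<^sub>2 T) \<in> \<Gamma>" if "henkin L_FparityL ?B \<Gamma>" "S \<in> sterms L_FparityL" "T \<in> sterms L_FparityL"
        "\<And>t. t \<in> nterms L_FparityL \<Longrightarrow> (t \<^bold>\<in> S) \<in> \<Gamma> \<longleftrightarrow> (t \<^bold>\<in> T) \<in> \<Gamma>" for \<Gamma> S T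
        using that(4) by (rule henkin.ext_V0_2_bar[OF that(1) barB F that(2,3)])
    qed (rule that)
    have "models M I J (axms V0_2_bar)"
      using M(2) barB barF unfolding models_def by blast
    then interpret bar M I J using M(1,3) by unfold_locales auto
    have powF: "PowSeqF_axiom v \<in> formulas L_FparityL" by (rule PowSeqF_axiom_formulas)
    have "models M I J {PowSeqF_axiom v}"
      using M(2) powF by (auto simp: models_def VparityL_bar_def)
    note pe = powseq_exists_bar[OF this]
    \<comment> \<open>The provable equivalence is sound for the original interpretation of the
      symbols, so the value of the power sequence makes \<open>\<psi>\<close> true.\<close>
    have "sat M I J e E (\<psi> \<^bold>\<longleftrightarrow> powseq_exists v)" if "range E \<subseteq> m_strs M" for e E
    proof (rule soundness)
      show "derives L_FAC02 (axms V0_2_bar) (\<psi> \<^bold>\<longleftrightarrow> powseq_exists v)"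
        using assms by (simp add: VparityL_axiom_def theorems_def V0_2_bar_def)
      show "models M I J (axms V0_2_bar \<inter> formulas L_FAC02)" using bar by (auto simp: models_def)
    qed (use M that in auto)
    then have "models M I J (?A \<inter> formulas L_A2)"
      using V0_2_bar_models pe by (auto simp: models_def)
    from soundness[OF der this M(1) M(3)] M(4) show False by blast
  qed
  moreover have "derives L_A2 ?A \<phi>" if der: "derives L_FparityL ?B \<phi>" and \<phi>: "\<phi> \<in> formulas L_A2" for \<phi>
  proof (rule ccontr)
    assume neg: "\<not> derives L_A2 ?A \<phi>"
    have basic: "basic_open \<subseteq> ?A" by (auto simp: V0_2_def)
    obtain M :: "nat struct" and I J e E where M: "\<And>g as Xs. J g as Xs \<in> m_strs M"
      "models M I J (?A \<inter> formulas L_A2)" "range E \<subseteq> m_strs M" "\<not> sat M I J e E \<phi>"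
    proof (rule completeness[OF \<phi> neg basic])
      show "(S \<^bold>=\<^sub>2 T) \<in> \<Gamma>" if "henkin L_A2 ?A \<Gamma>" "S \<in> sterms L_A2" "T \<in> sterms L_A2"
        "\<And>t. t \<in> nterms L_A2 \<Longrightarrow> (t \<^bold>\<in> S) \<in> \<Gamma> \<longleftrightarrow> (t \<^bold>\<in> T) \<in> \<Gamma>" for \<Gamma> S T
        using that(4) by (rule henkin.ext_V0_2[OF that(1) Un_upper1 that(2,3)])
    qed (rule that)
    interpret v0 M I J
      using M A by unfold_locales (auto simp: models_def)
    \<comment> \<open>Only the interpretation of the symbols changes; numbers and strings of the
      countermodel stay the same.\<close>
    have "models M (nI M) (sI M) (?B \<inter> formulas L_FparityL)"
      using expansion[OF assms] M(2) \<psi> by (auto simp: models_def)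
    \<comment> \<open>Truth of \<open>\<phi>\<close> in the expansion contradicts its failure in the
      countermodel, as formulas of the basic vocabulary are evaluated alike in both.\<close>
    from soundness[OF der this sI_strs M(3)] have "holds e E \<phi>" .
    then show False using M(4) sat_L_A2[OF \<phi>] by blast
  qed
  ultimately show "conservative_extension (VparityL_bar v) (VparityL \<psi>)"
    by (auto simp: conservative_extension_def thms) (simp_all add: VparityL_def L_A2_def)
qed

end
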